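(* Let $(\underline{\mathcal{M}},\underline{\mathcal{W}},\underline{\mathcal{F}},\underline{\mathcal{C}})$ be an $\omega$-combinatorial left proper model category. Let $\mathcal{M}$ denote the full subcategory of $\underline{\mathcal{M}}$ spanned by the finitely presentable objects, and let $\mathcal{W},\mathcal{C}$ denote the classes of weak equivalences and cofibrations between objects of $\mathcal{M}$, respectively. Suppose we are given a cylinder object in $\mathcal{M}$, that is, for every object $B$ of $\mathcal{M}$ we are given a factorization in $\mathcal{M}$ of the fold map $B\sqcup B\to B$ into a cofibration followed by a weak equivalence: $$B\sqcup B\xrightarrow{(i_0,i_1)} I\otimes B\xrightarrow{p} B.$$ (No simplicial structure is assumed; $I\otimes B$ is just notation.) Assume further: 1. The category $\mathcal{M}$ has finite limits. 2. Every object of $\mathcal{M}$ is cofibrant. 3. For every morphism $f:A\to B$ in $\mathcal{M}$, the map $B\coprod_{A}(I\otimes A)\to B$ from the pushout of $B\xleftarrow{f}A\xrightarrow{i_0}I\otimes A$, induced by $\mathrm{id}_B:B\to B$ and $f\circ p: I\otimes A\to B$, is a right proper map in $(\mathcal{M},\mathcal{W})$. Then $(\mathcal{M},\mathcal{W},\mathcal{C})$ is an ind-admissible weak cofibration category, and the induced model structure on $\mathrm{Ind}(\mathcal{M})$ coincides with $(\underline{\mathcal{M}},\underline{\mathcal{W}},\underline{\mathcal{F}},\underline{\mathcal{C}})$ under the natural equivalence $\underline{\mathcal{M}}\simeq\mathrm{Ind}(\mathcal{M})$. In particular, the full subcategory of $\underline{\mathcal{M}}^{\to}$ spanned by the class of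 weak equivalences is finitely accessible.
   Context: Model categories are taken in Hovey's sense (in particular with functorial factorizations); in the quadruple, $\underline{\mathcal{W}},\underline{\mathcal{F}},\underline{\mathcal{C}}$ are the weak equivalences, fibrations and cofibrations. A model category is combinatorial if it is locally presentable and cofibrantly generated. It is $\omega$-combinatorial if it is combinatorial, its underlying category is locally finitely presentable, and both its cofibrations and its trivial cofibrations are generated by sets of morphisms having finitely presentable domains and codomains. Then $\mathcal{M}$ is essentially small, closed under finite colimits, and the natural equivalence $\mathrm{Ind}(\mathcal{M})\simeq\underline{\mathcal{M}}$ is given by taking colimits. A relative category is a pair $(\mathcal{D},\mathcal{V})$ with $\mathcal{V}\subseteq\mathcal{D}$ a subcategory (the weak equivalences) containing all isomorphisms and satisfying two out of three. A map $f:A\to B$ in $\mathcal{D}$ is right proper in $(\mathcal{D},\mathcal{V})$ if for every pullback square in $\mathcal{D}$ with $i:D\to B$ a weak equivalence and $j:C\to A$ its base change along $f$, the map $j$ is a weak equivalence. $\mathrm{Ind}(\mathcal{D})$ has as objects diagrams $I\to\mathcal{D}$ with $I$ small filtered, and $\mathrm{Hom}(X,Y)=\lim_s\mathrm{colim}_t\mathrm{Hom}_{\mathcal{D}}(X_s,Y_t)$; $\mathcal{D}$ is the full subcategory of diagrams indexed by the one-morphism category. A natural transformation between diagrams with the same index category induces a morphism in $\mathrm{Ind}(\mathcal{D})$. For a class $N$ of morphisms of $\mathcal{D}$, $Lw^{\cong}(N)$ is the class of morphisms of $\mathrm{Ind}(\mathcal{D})$ isomorphic, as objects of $\mathrm{Ind}(\mathcal{D})^{\to}$,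 to a morphism induced by a natural transformation all of whose components are in $N$. Here $\mathcal{D}^{\to}$ denotes the category of morphisms of $\mathcal{D}$. A weak cofibration category is a category $\mathcal{M}$ with subcategories $\mathcal{W},\mathcal{C}$ (weak equivalences, cofibrations) containing all isomorphisms such that: $\mathcal{M}$ has finite colimits; $\mathcal{W}$ has the two out of three property; $\mathcal{C}$ and $\mathcal{C}\cap\mathcal{W}$ are closed under cobase change; every morphism factors as a map in $\mathcal{C}$ followed by a map in $\mathcal{W}$. It is ind-admissible if $Lw^{\cong}(\mathcal{W})$ satisfies the two out of three property in $\mathrm{Ind}(\mathcal{M})$. For an (essentially) small ind-admissible weak cofibration category, the induced model structure on $\mathrm{Ind}(\mathcal{M})$ has weak equivalences $Lw^{\cong}(\mathcal{W})$, fibrations the maps with the right lifting property with respect to $\mathcal{C}\cap\mathcal{W}$, and cofibrations the maps with the left lifting property with respect to all acyclic fibrations (it is a known theorem that this is a model structure). A category is finitely accessible if it has filtered colimits and there is a small set of finitely presentable objects that generates it under filtered colimits. *)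

theory Defs
  imports Main
begin

unbundle cardinal_syntax

section \<open>Smallness\<close>

text \<open>A type \<open>'u\<close> plays the role of a Grothendieck universe: its cardinality is assumed to be
  an uncountable strongly inaccessible cardinal, and a set is small if it has fewer elements
  than \<open>'u\<close>. Every small category is isomorphic to one whose objects and morphisms are
  elements of \<open>'u\<close>, so quantifying over small index categories amounts to quantifying over
  categories on the type \<open>'u\<close>.\<close>

definition inaccessible_universe :: "'u itself \<Rightarrow> bool" where
  "inaccessible_universe _ \<longleftrightarrow>
     natLeq <o |UNIV :: 'u set| \<and>
     regularCard |UNIV :: 'u set| \<and>
     (\<forall>A :: 'u set. |A| <o |UNIV :: 'u set| \<longrightarrow> |Pow A| <o |UNIV :: 'u set| )"

definition small :: "'u itself \<Rightarrow> 'a set \<Rightarrow> bool" where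
  "small _ A \<longleftrightarrow> |A| <o |UNIV :: 'u set|"


section \<open>Categories, functors, natural transformations\<close>

record ('o, 'm) cat =
  Ob :: "'o set"
  Mor :: "'m set"
  Dom :: "'m \<Rightarrow> 'o"
  Cod :: "'m \<Rightarrow> 'o"
  Idt :: "'o \<Rightarrow> 'm"
  Cmp :: "'m \<Rightarrow> 'm \<Rightarrow> 'm"  (infixl "\<cdot>\<index>" 70)

definition Hom :: "('o, 'm) cat \<Rightarrow> 'o \<Rightarrow> 'o \<Rightarrow> 'm set" where
  "Hom C a b = {f \<in> Mor C. Dom C f = a \<and> Cod C f = b}"

definition category :: "('o, 'm) cat \<Rightarrow> bool" where
  "category C \<longleftrightarrow>
     (\<forall>f \<in> Mor C. Dom C f \<in> Ob C \<and> Cod C f \<in> Ob C) \<and>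
     (\<forall>a \<in> Ob C. Idt C a \<in> Hom C a a) \<and>
     (\<forall>f \<in> Mor C. \<forall>g \<in> Mor C. Cod C f = Dom C g \<longrightarrow> g \<cdot>\<^bsub>C\<^esub> f \<in> Hom C (Dom C f) (Cod C g)) \<and>
     (\<forall>f \<in> Mor C. f \<cdot>\<^bsub>C\<^esub> Idt C (Dom C f) = f \<and> Idt C (Cod C f) \<cdot>\<^bsub>C\<^esub> f = f) \<and>
     (\<forall>f \<in> Mor C. \<forall>g \<in> Mor C. \<forall>h \<in> Mor C. Cod C f = Dom C g \<and> Cod C g = Dom C h \<longrightarrow>
        (h \<cdot>\<^bsub>C\<^esub> g) \<cdot>\<^bsub>C\<^esub> f = h \<cdot>\<^bsub>C\<^esub> (g \<cdot>\<^bsub>C\<^esub> f))"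

definition is_iso :: "('o, 'm) cat \<Rightarrow> 'm \<Rightarrow> bool" where
  "is_iso C f \<longleftrightarrow> f \<in> Mor C \<and>
     (\<exists>g \<in> Hom C (Cod C f) (Dom C f).
        g \<cdot>\<^bsub>C\<^esub> f = Idt C (Dom C f) \<and> f \<cdot>\<^bsub>C\<^esub> g = Idt C (Cod C f))"

definition isomorphic :: "('o, 'm) cat \<Rightarrow> 'o \<Rightarrow> 'o \<Rightarrow> bool" where
  "isomorphic C a b \<longleftrightarrow> (\<exists>f \<in> Hom C a b. is_iso C f)"

definition is_retract :: "('o, 'm) cat \<Rightarrow> 'o \<Rightarrow> 'o \<Rightarrow> bool" where
  "is_retract C a b \<longleftrightarrow> (\<exists>s \<in> Hom C a b. \<exists>r \<in> Hom C b a. r \<cdot>\<^bsub>C\<^esub> s = Idt C a)"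

definition full_subcat :: "('o, 'm) cat \<Rightarrow> 'o set \<Rightarrow> ('o, 'm) cat" where
  "full_subcat C S = C\<lparr>Ob := Ob C \<inter> S, Mor := {f \<in> Mor C. Dom C f \<in> S \<and> Cod C f \<in> S}\<rparr>"

text \<open>A morphism \<open>f \<rightarrow> g\<close> of the category of morphisms is recorded as \<open>(f, g, u, v)\<close>, where \<open>u\<close>
  and \<open>v\<close> are the top and bottom of a commutative square with vertical sides \<open>f\<close> and \<open>g\<close>.\<close>

definition arrow_cat :: "('o, 'm) cat \<Rightarrow> ('m, 'm \<times> 'm \<times> 'm \<times> 'm) cat" where
  "arrow_cat C =
    \<lparr>Ob = Mor C,
     Mor = {(f, g, u, v). f \<in> Mor C \<and> g \<in> Mor C \<and>
              u \<in> Hom C (Dom C f) (Dom C g) \<and> v \<in> Hom C (Cod C f) (Cod C g) \<and>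
              g \<cdot>\<^bsub>C\<^esub> u = v \<cdot>\<^bsub>C\<^esub> f},
     Dom = (\<lambda>(f, g, u, v). f),
     Cod = (\<lambda>(f, g, u, v). g),
     Idt = (\<lambda>f. (f, f, Idt C (Dom C f), Idt C (Cod C f))),
     Cmp = (\<lambda>(f', g', u', v') (f, g, u, v). (f, g', u' \<cdot>\<^bsub>C\<^esub> u, v' \<cdot>\<^bsub>C\<^esub> v))\<rparr>"

record ('a, 'b, 'c, 'd) fctr =
  fob :: "'a \<Rightarrow> 'c"
  fmor :: "'b \<Rightarrow> 'd"

definition is_functor ::
    "('a, 'b) cat \<Rightarrow> ('c, 'd) cat \<Rightarrow> ('a, 'b, 'c, 'd) fctr \<Rightarrow> bool" where
  "is_functor A B T \<longleftrightarrow> category A \<and> category B \<and>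
     (\<forall>a \<in> Ob A. fob T a \<in> Ob B) \<and>
     (\<forall>f \<in> Mor A. fmor T f \<in> Hom B (fob T (Dom A f)) (fob T (Cod A f))) \<and>
     (\<forall>a \<in> Ob A. fmor T (Idt A a) = Idt B (fob T a)) \<and>
     (\<forall>f \<in> Mor A. \<forall>g \<in> Mor A. Cod A f = Dom A g \<longrightarrow>
        fmor T (g \<cdot>\<^bsub>A\<^esub> f) = fmor T g \<cdot>\<^bsub>B\<^esub> fmor T f)"

definition nat_trans ::
    "('a, 'b) cat \<Rightarrow> ('c, 'd) cat \<Rightarrow> ('a, 'b, 'c, 'd) fctr \<Rightarrow> ('a, 'b, 'c, 'd) fctr \<Rightarrow>
     ('a \<Rightarrow> 'd) \<Rightarrow> bool" where
  "nat_trans A B S T \<tau> \<longleftrightarrow> is_functor A B S \<and> is_functor A B T \<and>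
     (\<forall>a \<in> Ob A. \<tau> a \<in> Hom B (fob S a) (fob T a)) \<and>
     (\<forall>f \<in> Mor A. \<tau> (Cod A f) \<cdot>\<^bsub>B\<^esub> fmor S f = fmor T f \<cdot>\<^bsub>B\<^esub> \<tau> (Dom A f))"

definition naturally_isomorphic ::
    "('a, 'b) cat \<Rightarrow> ('c, 'd) cat \<Rightarrow> ('a, 'b, 'c, 'd) fctr \<Rightarrow> ('a, 'b, 'c, 'd) fctr \<Rightarrow> bool" where
  "naturally_isomorphic A B S T \<longleftrightarrow>
     (\<exists>\<tau>. nat_trans A B S T \<tau> \<and> (\<forall>a \<in> Ob A. is_iso B (\<tau> a)))"

definition id_fctr :: "('a, 'b, 'a, 'b) fctr" where
  "id_fctr = \<lparr>fob = id, fmor = id\<rparr>"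

definition comp_fctr ::
    "('c, 'd, 'e, 'f) fctr \<Rightarrow> ('a, 'b, 'c, 'd) fctr \<Rightarrow> ('a, 'b, 'e, 'f) fctr" where
  "comp_fctr T S = \<lparr>fob = fob T \<circ> fob S, fmor = fmor T \<circ> fmor S\<rparr>"

definition is_equivalence ::
    "('a, 'b) cat \<Rightarrow> ('c, 'd) cat \<Rightarrow> ('a, 'b, 'c, 'd) fctr \<Rightarrow> bool" where
  "is_equivalence A B T \<longleftrightarrow> is_functor A B T \<and>
     (\<exists>S. is_functor B A S \<and>
        naturally_isomorphic A A id_fctr (comp_fctr S T) \<and>
        naturally_isomorphic B B (comp_fctr T S) id_fctr)"

definition locally_small :: "'u itself \<Rightarrow> ('o, 'm) cat \<Rightarrow> bool" where
  "locally_small U C \<longleftrightarrow> category C \<and> (\<forall>a \<in> Ob C. \<forall>b \<in> Ob C. small U (Hom C a b))"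


section \<open>Limits and colimits\<close>

definition cocone ::
    "('i, 'j) cat \<Rightarrow> ('o, 'm) cat \<Rightarrow> ('i, 'j, 'o, 'm) fctr \<Rightarrow> 'o \<Rightarrow> ('i \<Rightarrow> 'm) \<Rightarrow> bool" where
  "cocone J C X L \<iota> \<longleftrightarrow> L \<in> Ob C \<and> (\<forall>j \<in> Ob J. \<iota> j \<in> Hom C (fob X j) L) \<and>
     (\<forall>u \<in> Mor J. \<iota> (Cod J u) \<cdot>\<^bsub>C\<^esub> fmor X u = \<iota> (Dom J u))"

definition is_colimit ::
    "('i, 'j) cat \<Rightarrow> ('o, 'm) cat \<Rightarrow> ('i, 'j, 'o, 'm) fctr \<Rightarrow> 'o \<Rightarrow> ('i \<Rightarrow> 'm) \<Rightarrow> bool" where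
  "is_colimit J C X L \<iota> \<longleftrightarrow> cocone J C X L \<iota> \<and>
     (\<forall>L' \<iota>'. cocone J C X L' \<iota>' \<longrightarrow>
        (\<exists>!h. h \<in> Hom C L L' \<and> (\<forall>j \<in> Ob J. h \<cdot>\<^bsub>C\<^esub> \<iota> j = \<iota>' j)))"

definition cone ::
    "('i, 'j) cat \<Rightarrow> ('o, 'm) cat \<Rightarrow> ('i, 'j, 'o, 'm) fctr \<Rightarrow> 'o \<Rightarrow> ('i \<Rightarrow> 'm) \<Rightarrow> bool" where
  "cone J C X L \<pi> \<longleftrightarrow> L \<in> Ob C \<and> (\<forall>j \<in> Ob J. \<pi> j \<in> Hom C L (fob X j)) \<and>
     (\<forall>u \<in> Mor J. fmor X u \<cdot>\<^bsub>C\<^esub> \<pi> (Dom J u) = \<pi> (Cod J u))"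

definition is_limit ::
    "('i, 'j) cat \<Rightarrow> ('o, 'm) cat \<Rightarrow> ('i, 'j, 'o, 'm) fctr \<Rightarrow> 'o \<Rightarrow> ('i \<Rightarrow> 'm) \<Rightarrow> bool" where
  "is_limit J C X L \<pi> \<longleftrightarrow> cone J C X L \<pi> \<and>
     (\<forall>L' \<pi>'. cone J C X L' \<pi>' \<longrightarrow>
        (\<exists>!h. h \<in> Hom C L' L \<and> (\<forall>j \<in> Ob J. \<pi> j \<cdot>\<^bsub>C\<^esub> h = \<pi>' j)))"

definition has_colimits :: "(('i, 'j) cat \<Rightarrow> bool) \<Rightarrow> ('o, 'm) cat \<Rightarrow> bool" where
  "has_colimits \<Phi> C \<longleftrightarrow> (\<forall>J X. \<Phi> J \<and> is_functor J C X \<longrightarrow> (\<exists>L \<iota>. is_colimit J C X L \<iota>))"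

definition has_limits :: "(('i, 'j) cat \<Rightarrow> bool) \<Rightarrow> ('o, 'm) cat \<Rightarrow> bool" where
  "has_limits \<Phi> C \<longleftrightarrow> (\<forall>J X. \<Phi> J \<and> is_functor J C X \<longrightarrow> (\<exists>L \<pi>. is_limit J C X L \<pi>))"

definition small_cat :: "('u, 'u) cat \<Rightarrow> bool" where
  "small_cat J \<longleftrightarrow> category J \<and> small TYPE('u) (Ob J) \<and> small TYPE('u) (Mor J)"

definition finite_cat :: "('i, 'j) cat \<Rightarrow> bool" where
  "finite_cat J \<longleftrightarrow> category J \<and> finite (Ob J) \<and> finite (Mor J)"

definition cocomplete :: "'u itself \<Rightarrow> ('o, 'm) cat \<Rightarrow> bool" where
  "cocomplete _ C \<longleftrightarrow> has_colimits (small_cat :: ('u, 'u) cat \<Rightarrow> bool) C"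

definition complete_cat :: "'u itself \<Rightarrow> ('o, 'm) cat \<Rightarrow> bool" where
  "complete_cat _ C \<longleftrightarrow> has_limits (small_cat :: ('u, 'u) cat \<Rightarrow> bool) C"

definition has_finite_colimits :: "('o, 'm) cat \<Rightarrow> bool" where
  "has_finite_colimits C \<longleftrightarrow> has_colimits (finite_cat :: (nat, nat) cat \<Rightarrow> bool) C"

definition has_finite_limits :: "('o, 'm) cat \<Rightarrow> bool" where
  "has_finite_limits C \<longleftrightarrow> has_limits (finite_cat :: (nat, nat) cat \<Rightarrow> bool) C"

definition is_initial :: "('o, 'm) cat \<Rightarrow> 'o \<Rightarrow> bool" where
  "is_initial C z \<longleftrightarrow> z \<in> Ob C \<and> (\<forall>a \<in> Ob C. \<exists>!f. f \<in> Hom C z a)"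

definition is_coproduct ::
    "('o, 'm) cat \<Rightarrow> 'o \<Rightarrow> 'o \<Rightarrow> 'o \<Rightarrow> 'm \<Rightarrow> 'm \<Rightarrow> bool" where
  "is_coproduct C a b s k l \<longleftrightarrow>
     s \<in> Ob C \<and> k \<in> Hom C a s \<and> l \<in> Hom C b s \<and>
     (\<forall>c \<in> Ob C. \<forall>f \<in> Hom C a c. \<forall>g \<in> Hom C b c.
        \<exists>!h. h \<in> Hom C s c \<and> h \<cdot>\<^bsub>C\<^esub> k = f \<and> h \<cdot>\<^bsub>C\<^esub> l = g)"

text \<open>\<open>is_pushout C f g h k\<close>: the pushout of \<open>f : A \<rightarrow> B\<close> and \<open>g : A \<rightarrow> D\<close> is given by
  \<open>h : B \<rightarrow> P\<close> (the cobase change of \<open>g\<close>) and \<open>k : D \<rightarrow> P\<close> (the cobase change of \<open>f\<close>).\<close>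

definition is_pushout :: "('o, 'm) cat \<Rightarrow> 'm \<Rightarrow> 'm \<Rightarrow> 'm \<Rightarrow> 'm \<Rightarrow> bool" where
  "is_pushout C f g h k \<longleftrightarrow>
     f \<in> Mor C \<and> g \<in> Mor C \<and> Dom C f = Dom C g \<and>
     h \<in> Hom C (Cod C f) (Cod C h) \<and> k \<in> Hom C (Cod C g) (Cod C h) \<and>
     h \<cdot>\<^bsub>C\<^esub> f = k \<cdot>\<^bsub>C\<^esub> g \<and>
     (\<forall>Q \<in> Ob C. \<forall>h' \<in> Hom C (Cod C f) Q. \<forall>k' \<in> Hom C (Cod C g) Q.
        h' \<cdot>\<^bsub>C\<^esub> f = k' \<cdot>\<^bsub>C\<^esub> g \<longrightarrow>
        (\<exists>!w. w \<in> Hom C (Cod C h) Q \<and> w \<cdot>\<^bsub>C\<^esub> h = h' \<and> w \<cdot>\<^bsub>C\<^esub> k = k'))"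

text \<open>\<open>is_pullback C f i j f'\<close>: the pullback of \<open>f : A \<rightarrow> B\<close> and \<open>i : D \<rightarrow> B\<close> is given by
  \<open>j : P \<rightarrow> A\<close> (the base change of \<open>i\<close>) and \<open>f' : P \<rightarrow> D\<close> (the base change of \<open>f\<close>).\<close>

definition is_pullback :: "('o, 'm) cat \<Rightarrow> 'm \<Rightarrow> 'm \<Rightarrow> 'm \<Rightarrow> 'm \<Rightarrow> bool" where
  "is_pullback C f i j f' \<longleftrightarrow>
     f \<in> Mor C \<and> i \<in> Mor C \<and> Cod C f = Cod C i \<and>
     j \<in> Hom C (Dom C j) (Dom C f) \<and> f' \<in> Hom C (Dom C j) (Dom C i) \<and>
     f \<cdot>\<^bsub>C\<^esub> j = i \<cdot>\<^bsub>C\<^esub> f' \<and>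
     (\<forall>Q \<in> Ob C. \<forall>x \<in> Hom C Q (Dom C f). \<forall>y \<in> Hom C Q (Dom C i).
        f \<cdot>\<^bsub>C\<^esub> x = i \<cdot>\<^bsub>C\<^esub> y \<longrightarrow>
        (\<exists>!w. w \<in> Hom C Q (Dom C j) \<and> j \<cdot>\<^bsub>C\<^esub> w = x \<and> f' \<cdot>\<^bsub>C\<^esub> w = y))"


section \<open>Filtered colimits, presentable objects, accessible categories\<close>

definition filtered :: "('i, 'j) cat \<Rightarrow> bool" where
  "filtered J \<longleftrightarrow> category J \<and> Ob J \<noteq> {} \<and>
     (\<forall>a \<in> Ob J. \<forall>b \<in> Ob J. \<exists>c \<in> Ob J. Hom J a c \<noteq> {} \<and> Hom J b c \<noteq> {}) \<and>
     (\<forall>a \<in> Ob J. \<forall>b \<in> Ob J. \<forall>u \<in> Hom J a b. \<forall>v \<in> Hom J a b.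
        \<exists>c \<in> Ob J. \<exists>w \<in> Hom J b c. w \<cdot>\<^bsub>J\<^esub> u = w \<cdot>\<^bsub>J\<^esub> v)"

definition small_filtered :: "('u, 'u) cat \<Rightarrow> bool" where
  "small_filtered J \<longleftrightarrow> small_cat J \<and> filtered J"

definition small_regular_cardinal :: "'u rel \<Rightarrow> bool" where
  "small_regular_cardinal \<kappa> \<longleftrightarrow>
     Card_order \<kappa> \<and> infinite (Field \<kappa>) \<and> regularCard \<kappa> \<and> \<kappa> <o |UNIV :: 'u set|"

definition small_kappa_filtered :: "'u rel \<Rightarrow> ('u, 'u) cat \<Rightarrow> bool" where
  "small_kappa_filtered \<kappa> J \<longleftrightarrow> small_cat J \<and>
     (\<forall>(I :: ('u, 'u) cat) X. |Mor I| <o \<kappa> \<and> is_functor I J X \<longrightarrow> (\<exists>c \<iota>. cocone I J X c \<iota>))"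

text \<open>The colimit over \<open>j\<close> in \<open>J\<close> of the sets \<open>Hom C a (X j)\<close>, as the quotient of the disjoint
  union by the equivalence relation generated by the transition maps.\<close>

definition hom_diag ::
    "('i, 'j) cat \<Rightarrow> ('o, 'm) cat \<Rightarrow> ('i, 'j, 'o, 'm) fctr \<Rightarrow> 'o \<Rightarrow> ('i \<times> 'm) set" where
  "hom_diag J C X a = (SIGMA j : Ob J. Hom C a (fob X j))"

definition hom_eqv ::
    "('i, 'j) cat \<Rightarrow> ('o, 'm) cat \<Rightarrow> ('i, 'j, 'o, 'm) fctr \<Rightarrow> 'o \<Rightarrow> ('i \<times> 'm) rel" where
  "hom_eqv J C X a =
     (let r = {((Dom J u, f), (Cod J u, fmor X u \<cdot>\<^bsub>C\<^esub> f)) | u f.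
                 u \<in> Mor J \<and> f \<in> Hom C a (fob X (Dom J u))}
      in (r \<union> r\<inverse>)\<^sup>*)"

definition hom_colim ::
    "('i, 'j) cat \<Rightarrow> ('o, 'm) cat \<Rightarrow> ('i, 'j, 'o, 'm) fctr \<Rightarrow> 'o \<Rightarrow> ('i \<times> 'm) set set" where
  "hom_colim J C X a = hom_diag J C X a // hom_eqv J C X a"

text \<open>\<open>Hom C A\<close> preserves the colimits indexed by \<open>\<Phi>\<close>: the canonical map from \<open>hom_colim J C X A\<close>
  to \<open>Hom C A L\<close>, sending the class of \<open>(j, g)\<close> to \<open>\<iota> j \<cdot> g\<close>, is a bijection.\<close>

definition presentable_wrt :: "(('i, 'j) cat \<Rightarrow> bool) \<Rightarrow> ('o, 'm) cat \<Rightarrow> 'o \<Rightarrow> bool" where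
  "presentable_wrt \<Phi> C A \<longleftrightarrow> A \<in> Ob C \<and>
     (\<forall>J X L \<iota>. \<Phi> J \<and> is_functor J C X \<and> is_colimit J C X L \<iota> \<longrightarrow>
        (\<forall>f \<in> Hom C A L. \<exists>!c. c \<in> hom_colim J C X A \<and> (\<forall>(j, g) \<in> c. \<iota> j \<cdot>\<^bsub>C\<^esub> g = f)))"

definition finitely_presentable :: "'u itself \<Rightarrow> ('o, 'm) cat \<Rightarrow> 'o \<Rightarrow> bool" where
  "finitely_presentable _ C A \<longleftrightarrow>
     presentable_wrt (small_filtered :: ('u, 'u) cat \<Rightarrow> bool) C A"

definition accessible_wrt :: "(('u, 'u) cat \<Rightarrow> bool) \<Rightarrow> ('o, 'm) cat \<Rightarrow> bool" where
  "accessible_wrt \<Phi> C \<longleftrightarrow> locally_small TYPE('u) C \<and> has_colimits \<Phi> C \<and>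
     (\<exists>G \<subseteq> Ob C. small TYPE('u) G \<and> (\<forall>A \<in> G. presentable_wrt \<Phi> C A) \<and>
        (\<forall>L \<in> Ob C. \<exists>J X \<iota>. \<Phi> J \<and> is_functor J C X \<and> (\<forall>j \<in> Ob J. fob X j \<in> G) \<and>
           is_colimit J C X L \<iota>))"

definition finitely_accessible :: "'u itself \<Rightarrow> ('o, 'm) cat \<Rightarrow> bool" where
  "finitely_accessible _ C \<longleftrightarrow> accessible_wrt (small_filtered :: ('u, 'u) cat \<Rightarrow> bool) C"

definition locally_finitely_presentable :: "'u itself \<Rightarrow> ('o, 'm) cat \<Rightarrow> bool" where
  "locally_finitely_presentable U C \<longleftrightarrow> cocomplete U C \<and> finitely_accessible U C"

definition locally_presentable :: "'u itself \<Rightarrow> ('o, 'm) cat \<Rightarrow> bool" where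
  "locally_presentable U C \<longleftrightarrow> cocomplete U C \<and>
     (\<exists>\<kappa> :: 'u rel. small_regular_cardinal \<kappa> \<and> accessible_wrt (small_kappa_filtered \<kappa>) C)"

definition fp_subcat :: "'u itself \<Rightarrow> ('o, 'm) cat \<Rightarrow> ('o, 'm) cat" where
  "fp_subcat U C = full_subcat C {A \<in> Ob C. finitely_presentable U C A}"


section \<open>Model categories\<close>

definition wide_subcat :: "('o, 'm) cat \<Rightarrow> 'm set \<Rightarrow> bool" where
  "wide_subcat C N \<longleftrightarrow> N \<subseteq> Mor C \<and> (\<forall>a \<in> Ob C. Idt C a \<in> N) \<and>
     (\<forall>f \<in> N. \<forall>g \<in> N. Cod C f = Dom C g \<longrightarrow> g \<cdot>\<^bsub>C\<^esub> f \<in> N)"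

definition two_out_of_three :: "('o, 'm) cat \<Rightarrow> 'm set \<Rightarrow> bool" where
  "two_out_of_three C N \<longleftrightarrow>
     (\<forall>f \<in> Mor C. \<forall>g \<in> Mor C. Cod C f = Dom C g \<longrightarrow>
        (f \<in> N \<and> g \<in> N \<longrightarrow> g \<cdot>\<^bsub>C\<^esub> f \<in> N) \<and>
        (f \<in> N \<and> g \<cdot>\<^bsub>C\<^esub> f \<in> N \<longrightarrow> g \<in> N) \<and>
        (g \<in> N \<and> g \<cdot>\<^bsub>C\<^esub> f \<in> N \<longrightarrow> f \<in> N))"

definition closed_under_retracts :: "('o, 'm) cat \<Rightarrow> 'm set \<Rightarrow> bool" where
  "closed_under_retracts C N \<longleftrightarrow>
     (\<forall>f \<in> Mor C. \<forall>g \<in> N. is_retract (arrow_cat C) f g \<longrightarrow> f \<in> N)"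

definition has_lift :: "('o, 'm) cat \<Rightarrow> 'm \<Rightarrow> 'm \<Rightarrow> bool" where
  "has_lift C i p \<longleftrightarrow>
     (\<forall>u \<in> Hom C (Dom C i) (Dom C p). \<forall>v \<in> Hom C (Cod C i) (Cod C p).
        p \<cdot>\<^bsub>C\<^esub> u = v \<cdot>\<^bsub>C\<^esub> i \<longrightarrow>
        (\<exists>h \<in> Hom C (Cod C i) (Dom C p). h \<cdot>\<^bsub>C\<^esub> i = u \<and> p \<cdot>\<^bsub>C\<^esub> h = v))"

definition rlp :: "('o, 'm) cat \<Rightarrow> 'm set \<Rightarrow> 'm set" where
  "rlp C N = {p \<in> Mor C. \<forall>i \<in> N. has_lift C i p}"

definition llp :: "('o, 'm) cat \<Rightarrow> 'm set \<Rightarrow> 'm set" where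
  "llp C N = {i \<in> Mor C. \<forall>p \<in> N. has_lift C i p}"

definition dom_fctr :: "('o, 'm) cat \<Rightarrow> ('m, 'm \<times> 'm \<times> 'm \<times> 'm, 'o, 'm) fctr" where
  "dom_fctr C = \<lparr>fob = Dom C, fmor = (\<lambda>(f, g, u, v). u)\<rparr>"

definition cod_fctr :: "('o, 'm) cat \<Rightarrow> ('m, 'm \<times> 'm \<times> 'm \<times> 'm, 'o, 'm) fctr" where
  "cod_fctr C = \<lparr>fob = Cod C, fmor = (\<lambda>(f, g, u, v). v)\<rparr>"

definition has_functorial_factorization :: "('o, 'm) cat \<Rightarrow> 'm set \<Rightarrow> 'm set \<Rightarrow> bool" where
  "has_functorial_factorization C L R \<longleftrightarrow>
     (\<exists>E \<alpha> \<beta>. nat_trans (arrow_cat C) C (dom_fctr C) E \<alpha> \<and>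
              nat_trans (arrow_cat C) C E (cod_fctr C) \<beta> \<and>
              (\<forall>f \<in> Mor C. \<alpha> f \<in> L \<and> \<beta> f \<in> R \<and> \<beta> f \<cdot>\<^bsub>C\<^esub> \<alpha> f = f))"

definition model_category ::
    "'u itself \<Rightarrow> ('o, 'm) cat \<Rightarrow> 'm set \<Rightarrow> 'm set \<Rightarrow> 'm set \<Rightarrow> bool" where
  "model_category U C W Fib Cof \<longleftrightarrow>
     category C \<and> complete_cat U C \<and> cocomplete U C \<and>
     wide_subcat C W \<and> wide_subcat C Fib \<and> wide_subcat C Cof \<and>
     two_out_of_three C W \<and>
     closed_under_retracts C W \<and> closed_under_retracts C Fib \<and> closed_under_retracts C Cof \<and>
     (\<forall>i \<in> Cof \<inter> W. \<forall>p \<in> Fib. has_lift C i p) \<and>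
     (\<forall>i \<in> Cof. \<forall>p \<in> Fib \<inter> W. has_lift C i p) \<and>
     has_functorial_factorization C Cof (Fib \<inter> W) \<and>
     has_functorial_factorization C (Cof \<inter> W) Fib"

definition closed_under_cobase_change :: "('o, 'm) cat \<Rightarrow> 'm set \<Rightarrow> bool" where
  "closed_under_cobase_change C N \<longleftrightarrow> (\<forall>f g h k. is_pushout C f g h k \<and> f \<in> N \<longrightarrow> k \<in> N)"

definition left_proper :: "('o, 'm) cat \<Rightarrow> 'm set \<Rightarrow> 'm set \<Rightarrow> bool" where
  "left_proper C W Cof \<longleftrightarrow>
     (\<forall>f g h k. is_pushout C f g h k \<and> f \<in> W \<and> g \<in> Cof \<longrightarrow> k \<in> W)"

definition cofibrant :: "('o, 'm) cat \<Rightarrow> 'm set \<Rightarrow> 'o \<Rightarrow> bool" where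
  "cofibrant C Cof A \<longleftrightarrow> (\<forall>z. is_initial C z \<longrightarrow> Hom C z A \<subseteq> Cof)"

text \<open>The requirement that the domains of the generating sets permit the small object argument is
  not spelled out: \<open>cofibrantly_generated\<close> is only used for locally presentable categories, where
  every object is small.\<close>

definition cofibrantly_generated ::
    "'u itself \<Rightarrow> ('o, 'm) cat \<Rightarrow> 'm set \<Rightarrow> 'm set \<Rightarrow> bool" where
  "cofibrantly_generated U C W Fib \<longleftrightarrow>
     (\<exists>I \<subseteq> Mor C. small U I \<and> Fib \<inter> W = rlp C I) \<and>
     (\<exists>J \<subseteq> Mor C. small U J \<and> Fib = rlp C J)"

definition combinatorial ::
    "'u itself \<Rightarrow> ('o, 'm) cat \<Rightarrow> 'm set \<Rightarrow> 'm set \<Rightarrow> 'm set \<Rightarrow> bool" where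
  "combinatorial U C W Fib Cof \<longleftrightarrow> model_category U C W Fib Cof \<and>
     locally_presentable U C \<and> cofibrantly_generated U C W Fib"

definition fp_generated :: "'u itself \<Rightarrow> ('o, 'm) cat \<Rightarrow> 'm set \<Rightarrow> bool" where
  "fp_generated U C N \<longleftrightarrow>
     (\<exists>I \<subseteq> Mor C. small U I \<and>
        (\<forall>i \<in> I. finitely_presentable U C (Dom C i) \<and> finitely_presentable U C (Cod C i)) \<and>
        N = llp C (rlp C I))"

definition omega_combinatorial ::
    "'u itself \<Rightarrow> ('o, 'm) cat \<Rightarrow> 'm set \<Rightarrow> 'm set \<Rightarrow> 'm set \<Rightarrow> bool" where
  "omega_combinatorial U C W Fib Cof \<longleftrightarrow> combinatorial U C W Fib Cof \<and>
     locally_finitely_presentable U C \<and> fp_generated U C Cof \<and> fp_generated U C (Cof \<inter> W)"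

definition right_proper_map :: "('o, 'm) cat \<Rightarrow> 'm set \<Rightarrow> 'm \<Rightarrow> bool" where
  "right_proper_map D V f \<longleftrightarrow> f \<in> Mor D \<and>
     (\<forall>i j f'. is_pullback D f i j f' \<and> i \<in> V \<longrightarrow> j \<in> V)"


section \<open>Ind-categories\<close>

type_synonym ('u, 'o, 'm) ind_ob = "('u, 'u) cat \<times> ('u, 'u, 'o, 'm) fctr"

text \<open>A morphism of the ind-category carries its domain, its codomain and an element of the limit
  over \<open>s\<close> of the sets \<open>hom_colim\<close>, i.e. a compatible family of equivalence classes. Families
  are empty outside the index category, so that equality of morphisms is equality in the limit.\<close>

type_synonym ('u, 'o, 'm) ind_mor =
  "('u, 'o, 'm) ind_ob \<times> ('u, 'o, 'm) ind_ob \<times> ('u \<Rightarrow> ('u \<times> 'm) set)"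

definition ind_obs :: "('o, 'm) cat \<Rightarrow> ('u, 'o, 'm) ind_ob set" where
  "ind_obs D = {(J, X). small_filtered J \<and> is_functor J D X}"

definition ind_hom ::
    "('o, 'm) cat \<Rightarrow> ('u, 'o, 'm) ind_ob \<Rightarrow> ('u, 'o, 'm) ind_ob \<Rightarrow> ('u \<Rightarrow> ('u \<times> 'm) set) set" where
  "ind_hom D = (\<lambda>(I, X) (J, Y).
     {\<phi>. (\<forall>s. s \<notin> Ob I \<longrightarrow> \<phi> s = {}) \<and>
          (\<forall>s \<in> Ob I. \<phi> s \<in> hom_colim J D Y (fob X s)) \<and>
          (\<forall>u \<in> Mor I. \<forall>(t, f) \<in> \<phi> (Cod I u). (t, f \<cdot>\<^bsub>D\<^esub> fmor X u) \<in> \<phi> (Dom I u))})"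

definition Ind :: "'u itself \<Rightarrow> ('o, 'm) cat \<Rightarrow> (('u, 'o, 'm) ind_ob, ('u, 'o, 'm) ind_mor) cat" where
  "Ind _ D =
    \<lparr>Ob = ind_obs D,
     Mor = {(P, Q, \<phi>). P \<in> ind_obs D \<and> Q \<in> ind_obs D \<and> \<phi> \<in> ind_hom D P Q},
     Dom = (\<lambda>(P, Q, \<phi>). P),
     Cod = (\<lambda>(P, Q, \<phi>). Q),
     Idt = (\<lambda>(I, X). ((I, X), (I, X),
              \<lambda>s. if s \<in> Ob I then hom_eqv I D X (fob X s) `` {(s, Idt D (fob X s))} else {})),
     Cmp = (\<lambda>(Q, (K, Z), \<psi>) ((I, X), Q', \<phi>). ((I, X), (K, Z),
              \<lambda>s. if s \<in> Ob I
                   then (\<Union>(t, f) \<in> \<phi> s. \<Union>(r, g) \<in> \<psi> t. hom_eqv K D Z (fob X s) `` {(r, g \<cdot>\<^bsub>D\<^esub> f)})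
                   else {}))\<rparr>"

definition ind_map ::
    "('o, 'm) cat \<Rightarrow> ('u, 'u) cat \<Rightarrow> ('u, 'u, 'o, 'm) fctr \<Rightarrow> ('u, 'u, 'o, 'm) fctr \<Rightarrow>
     ('u \<Rightarrow> 'm) \<Rightarrow> ('u, 'o, 'm) ind_mor" where
  "ind_map D J X Y \<tau> = ((J, X), (J, Y),
     \<lambda>s. if s \<in> Ob J then hom_eqv J D Y (fob X s) `` {(s, \<tau> s)} else {})"

definition Lw :: "'u itself \<Rightarrow> ('o, 'm) cat \<Rightarrow> 'm set \<Rightarrow> ('u, 'o, 'm) ind_mor set" where
  "Lw U D N = {\<phi> \<in> Mor (Ind U D).
     \<exists>J X Y \<tau>. small_filtered J \<and> nat_trans J D X Y \<tau> \<and> (\<forall>j \<in> Ob J. \<tau> j \<in> N) \<and>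
        isomorphic (arrow_cat (Ind U D)) \<phi> (ind_map D J X Y \<tau>)}"

text \<open>\<open>D\<close> sits inside \<open>Ind U D\<close> as the diagrams on the one-morphism category; which element of
  \<open>'u\<close> serves as its only object and morphism is immaterial.\<close>

definition one_cat :: "('u, 'u) cat" where
  "one_cat = \<lparr>Ob = {undefined}, Mor = {undefined}, Dom = id, Cod = id, Idt = id,
              Cmp = (\<lambda>_ _. undefined)\<rparr>"

definition const_fctr :: "('o, 'm) cat \<Rightarrow> 'o \<Rightarrow> ('u, 'u, 'o, 'm) fctr" where
  "const_fctr D a = \<lparr>fob = (\<lambda>_. a), fmor = (\<lambda>_. Idt D a)\<rparr>"

definition ind_embed :: "'u itself \<Rightarrow> ('o, 'm) cat \<Rightarrow> 'm \<Rightarrow> ('u, 'o, 'm) ind_mor" where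
  "ind_embed _ D f =
     ind_map D one_cat (const_fctr D (Dom D f)) (const_fctr D (Cod D f)) (\<lambda>_. f)"

text \<open>The natural functor from \<open>Ind U M\<close> to \<open>C\<close>, for a subcategory \<open>M\<close> of \<open>C\<close>: it sends a
  diagram to a colimit in \<open>C\<close>, and a morphism to the map induced on colimits.\<close>

definition is_colimit_functor ::
    "'u itself \<Rightarrow> ('o, 'm) cat \<Rightarrow> ('o, 'm) cat \<Rightarrow>
     (('u, 'o, 'm) ind_ob, ('u, 'o, 'm) ind_mor, 'o, 'm) fctr \<Rightarrow> bool" where
  "is_colimit_functor U M C T \<longleftrightarrow> is_functor (Ind U M) C T \<and>
     (\<exists>\<iota>. (\<forall>(J, X) \<in> Ob (Ind U M). is_colimit J C X (fob T (J, X)) (\<iota> (J, X))) \<and>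
          (\<forall>((I, X), Q, \<phi>) \<in> Mor (Ind U M). \<forall>s \<in> Ob I. \<forall>(t, f) \<in> \<phi> s.
             fmor T ((I, X), Q, \<phi>) \<cdot>\<^bsub>C\<^esub> \<iota> (I, X) s = \<iota> Q t \<cdot>\<^bsub>C\<^esub> f))"


section \<open>Weak cofibration categories\<close>

definition weak_cofibration_category :: "('o, 'm) cat \<Rightarrow> 'm set \<Rightarrow> 'm set \<Rightarrow> bool" where
  "weak_cofibration_category M W Cof \<longleftrightarrow> category M \<and>
     wide_subcat M W \<and> wide_subcat M Cof \<and> {f. is_iso M f} \<subseteq> W \<inter> Cof \<and>
     has_finite_colimits M \<and> two_out_of_three M W \<and>
     closed_under_cobase_change M Cof \<and> closed_under_cobase_change M (Cof \<inter> W) \<and>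
     (\<forall>f \<in> Mor M. \<exists>c \<in> Cof. \<exists>w \<in> W. Cod M c = Dom M w \<and> w \<cdot>\<^bsub>M\<^esub> c = f)"

definition ind_admissible :: "'u itself \<Rightarrow> ('o, 'm) cat \<Rightarrow> 'm set \<Rightarrow> bool" where
  "ind_admissible U M W \<longleftrightarrow> two_out_of_three (Ind U M) (Lw U M W)"

definition ind_fib :: "'u itself \<Rightarrow> ('o, 'm) cat \<Rightarrow> 'm set \<Rightarrow> 'm set \<Rightarrow> ('u, 'o, 'm) ind_mor set" where
  "ind_fib U M W Cof = rlp (Ind U M) (ind_embed U M ` (Cof \<inter> W))"

definition ind_cof :: "'u itself \<Rightarrow> ('o, 'm) cat \<Rightarrow> 'm set \<Rightarrow> 'm set \<Rightarrow> ('u, 'o, 'm) ind_mor set" where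
  "ind_cof U M W Cof = llp (Ind U M) (ind_fib U M W Cof \<inter> Lw U M W)"

definition is_fold_map :: "('o, 'm) cat \<Rightarrow> 'o \<Rightarrow> 'o \<Rightarrow> 'm \<Rightarrow> 'm \<Rightarrow> 'm \<Rightarrow> bool" where
  "is_fold_map M B s k l d \<longleftrightarrow>
     d \<in> Hom M s B \<and> d \<cdot>\<^bsub>M\<^esub> k = Idt M B \<and> d \<cdot>\<^bsub>M\<^esub> l = Idt M B"

text \<open>For each \<open>B\<close>: \<open>dbl B\<close> is the coproduct of two copies of \<open>B\<close>, with inclusions \<open>k0 B\<close> and
  \<open>k1 B\<close>, and \<open>p B \<cdot> i B\<close> is a factorization of the fold map through the cylinder \<open>cyl B\<close>. The
  maps \<open>i\<^sub>0\<close> and \<open>i\<^sub>1\<close> from \<open>B\<close> to \<open>cyl B\<close> are \<open>i B \<cdot> k0 B\<close> and \<open>i B \<cdot> k1 B\<close>.\<close>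

definition is_cylinder ::
    "('o, 'm) cat \<Rightarrow> 'm set \<Rightarrow> 'm set \<Rightarrow> ('o \<Rightarrow> 'o) \<Rightarrow> ('o \<Rightarrow> 'm) \<Rightarrow> ('o \<Rightarrow> 'm) \<Rightarrow>
     ('o \<Rightarrow> 'o) \<Rightarrow> ('o \<Rightarrow> 'm) \<Rightarrow> ('o \<Rightarrow> 'm) \<Rightarrow> bool" where
  "is_cylinder M W Cof dbl k0 k1 cyl i p \<longleftrightarrow>
     (\<forall>B \<in> Ob M. is_coproduct M B B (dbl B) (k0 B) (k1 B) \<and>
        i B \<in> Hom M (dbl B) (cyl B) \<inter> Cof \<and> p B \<in> Hom M (cyl B) B \<inter> W \<and>
        is_fold_map M B (dbl B) (k0 B) (k1 B) (p B \<cdot>\<^bsub>M\<^esub> i B))"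

end

theory Submission
  imports Defs
begin

text \<open>Call a morphism \<open>f\<close> of \<open>C\<close> dense for a class \<open>N\<close> of morphisms of \<open>M\<close> if every commutative square from a
  morphism of \<open>M\<close> to \<open>f\<close> factors through a member of \<open>N\<close>; equivalently, \<open>f\<close> is a filtered colimit of
  members of \<open>N\<close> in the category of morphisms. The small object argument with finitely presentable cells
  shows that trivial cofibrations are dense for the trivial cofibrations of \<open>M\<close>. Since the objects of \<open>M\<close>
  are cofibrant, \<open>M\<close> has mapping cylinder factorizations, and with left properness these imply that the
  weak equivalences are exactly the morphisms that are dense for the weak equivalences of \<open>M\<close>.

  Hence under the equivalence of \<open>Ind(M)\<close> with \<open>C\<close> the levelwise weak equivalences become the weak
  equivalences of \<open>C\<close>, which gives admissibility and accessibility. The fibrations agree because the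
  generating trivial cofibrations lie in \<open>M\<close>, and then the cofibrations agree by lifting.\<close>

section \<open>Small sets\<close>

text \<open>What makes density workable is that the morphisms of \<open>M\<close> are finitely
  presentable in the category of morphisms, so a square into a filtered colimit already lands in
  some stage. Density is therefore stable under filtered colimits and retracts for formal reasons,
  and closure of \<open>W\<close> under filtered colimits, which the model category axioms do not
  contain, falls out of the comparison of \<open>W\<close> with the dense morphisms. The obstacle is
  that the factorizations of the model category leave \<open>M\<close>. Inside \<open>M\<close> only
  the mapping cylinder is at hand, whose second factor is a weak equivalence but need not be a
  fibration; when a weak equivalence is approximated, this factor has to be undone by a pushout
  along a cofibration, and there left properness enters. For the converse the approximating weak
  equivalence is factored in \<open>C\<close> after all, since only lifting properties of its
  factors matter. A second obstacle is size: \<open>M\<close> is only essentially small and index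
  categories must live on \<open>'u\<close>, so colimit formulas need small sets of representatives
  and a relabelling.\<close>

lemma small_type: "small (TYPE('u)) A = small (U :: 'u itself) A"
  by (simp add: small_def)

lemma small_mono: "small U B \<Longrightarrow> A \<subseteq> B \<Longrightarrow> small U A"
  unfolding small_def using card_of_mono1 ordLeq_ordLess_trans by blast

lemma small_image: "small U A \<Longrightarrow> small U (f ` A)"
  unfolding small_def using card_of_image ordLeq_ordLess_trans by blast

lemma small_inj:
  assumes "small (U :: 'u itself) (A :: 'a set)"
  shows "\<exists>e :: 'a \<Rightarrow> 'u. inj_on e A"
  using assms unfolding small_def by (metis card_of_ordLeq ordLess_imp_ordLeq)

locale universe =
  fixes U :: "'u itself"
  assumes univ: "inaccessible_universe U"
begin

lemma infinite_univ: "infinite (UNIV :: 'u set)"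
proof -
  have "natLeq \<le>o |UNIV :: 'u set|"
    using univ unfolding inaccessible_universe_def using ordLess_imp_ordLeq by blast
  then show ?thesis
    using infinite_iff_natLeq_ordLeq by blast
qed

lemma small_finite: "finite A \<Longrightarrow> small U A"
  unfolding small_def using infinite_univ by (meson card_of_Well_order card_of_ordLeq_finite not_ordLeq_iff_ordLess)

lemma small_nat: "small U (A :: nat set)"
proof -
  have "natLeq <o |UNIV :: 'u set|"
    using univ by (simp add: inaccessible_universe_def)
  then have "|UNIV :: nat set| <o |UNIV :: 'u set|"
    using card_of_nat ordIso_ordLess_trans by blast
  then show ?thesis
    using small_mono[of U UNIV A] by (simp add: small_def)
qed

text \<open>This is the place where regularity of the universe cardinal enters.\<close>

lemma small_UN:
  assumes "small U I" "\<And>i. i \<in> I \<Longrightarrow> small U (A i)"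
  shows "small U (\<Union>i\<in>I. A i)"
proof -
  have "Cinfinite |UNIV :: 'u set|" "regularCard |UNIV :: 'u set|"
    using infinite_univ univ
    by (auto simp: cinfinite_def inaccessible_universe_def Field_card_of card_of_card_order_on)
  then show ?thesis
    using card_of_UNION_ordLess_infinite_Field_regularCard assms unfolding small_def by blast
qed

lemma small_Sigma:
  assumes "small U I" "\<And>i. i \<in> I \<Longrightarrow> small U (A i)"
  shows "small U (Sigma I A)"
proof -
  have "small U (\<Union>i\<in>I. Pair i ` A i)"
    by (rule small_UN) (auto intro: assms small_image)
  then show ?thesis
    by (rule small_mono) auto
qed

lemma small_Times: "small U A \<Longrightarrow> small U B \<Longrightarrow> small U (A \<times> B)"
  by (rule small_Sigma)

lemma small_Pow:
  assumes "small U A"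
  shows "small U (Pow A)"
proof -
  \<comment> \<open>The strong limit condition speaks of subsets of \<open>'u\<close> only, so
    \<open>A\<close> is embedded there and its power set is carried back along the inverse.\<close>
  obtain e :: "_ \<Rightarrow> 'u" where e: "inj_on e A"
    using small_inj assms by blast
  have "small U (e ` A)"
    using assms by (rule small_image)
  then have "small U (Pow (e ` A))"
    using univ unfolding inaccessible_universe_def small_def by blast
  then have "small U ((\<lambda>B. inv_into A e ` B) ` Pow (e ` A))"
    by (rule small_image)
  then show ?thesis
  proof (rule small_mono)
    show "Pow A \<subseteq> (\<lambda>B. inv_into A e ` B) ` Pow (e ` A)"
    proof
      fix B assume B: "B \<in> Pow A"
      then have "inv_into A e ` e ` B = B"
        using e by (simp add: inv_into_image_cancel)
      with B show "B \<in> (\<lambda>B. inv_into A e ` B) ` Pow (e ` A)"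
        by (metis (no_types, lifting) PowD PowI image_eqI image_mono)
    qed
  qed
qed

end

section \<open>Categories and functors\<close>

lemma Hom_iff: "f \<in> Hom C a b \<longleftrightarrow> f \<in> Mor C \<and> Dom C f = a \<and> Cod C f = b"
  by (auto simp: Hom_def)

text \<open>The category axioms as conditional rewrite rules. Associativity is oriented to the
  right, so the simplifier compares composites in right-nested normal form.\<close>

lemma
  fixes C (structure)
  assumes "category C"
  shows dom_ob [simp]: "f \<in> Mor C \<Longrightarrow> Dom C f \<in> Ob C"
    and cod_ob [simp]: "f \<in> Mor C \<Longrightarrow> Cod C f \<in> Ob C"
    and idt_mor [simp]: "a \<in> Ob C \<Longrightarrow> Idt C a \<in> Mor C"
    and dom_idt [simp]: "a \<in> Ob C \<Longrightarrow> Dom C (Idt C a) = a"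
    and cod_idt [simp]: "a \<in> Ob C \<Longrightarrow> Cod C (Idt C a) = a"
    and comp_mor [simp]: "f \<in> Mor C \<Longrightarrow> g \<in> Mor C \<Longrightarrow> Cod C f = Dom C g \<Longrightarrow> g \<cdot> f \<in> Mor C"
    and dom_comp [simp]: "f \<in> Mor C \<Longrightarrow> g \<in> Mor C \<Longrightarrow> Cod C f = Dom C g \<Longrightarrow> Dom C (g \<cdot> f) = Dom C f"
    and cod_comp [simp]: "f \<in> Mor C \<Longrightarrow> g \<in> Mor C \<Longrightarrow> Cod C f = Dom C g \<Longrightarrow> Cod C (g \<cdot> f) = Cod C g"
    and comp_idt [simp]: "f \<in> Mor C \<Longrightarrow> Dom C f = a \<Longrightarrow> f \<cdot> Idt C a = f"
    and idt_comp [simp]: "f \<in> Mor C \<Longrightarrow> Cod C f = a \<Longrightarrow> Idt C a \<cdot> f = f"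
    and comp_assoc [simp]: "f \<in> Mor C \<Longrightarrow> g \<in> Mor C \<Longrightarrow> h \<in> Mor C \<Longrightarrow> Cod C f = Dom C g \<Longrightarrow>
      Cod C g = Dom C h \<Longrightarrow> (h \<cdot> g) \<cdot> f = h \<cdot> (g \<cdot> f)"
  using assms by (auto simp: category_def Hom_iff)

text \<open>A hypothesis \<open>g \<cdot> f = h\<close> does not match inside the right-nested
  normal form \<open>g \<cdot> (f \<cdot> x)\<close>; this restatement lets it act there.\<close>

lemma comp_reassoc:
  fixes C (structure)
  assumes "g \<cdot> f = h" "category C" "f \<in> Mor C" "g \<in> Mor C" "Cod C f = Dom C g"
    "x \<in> Mor C" "Cod C x = Dom C f"
  shows "g \<cdot> (f \<cdot> x) = h \<cdot> x"
  using assms by (metis comp_assoc)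

lemma comp_Hom:
  "category C \<Longrightarrow> f \<in> Hom C a b \<Longrightarrow> g \<in> Hom C b c \<Longrightarrow> g \<cdot>\<^bsub>C\<^esub> f \<in> Hom C a c"
  by (simp add: Hom_iff)

lemma Hom_ob: "category C \<Longrightarrow> f \<in> Hom C a b \<Longrightarrow> a \<in> Ob C \<and> b \<in> Ob C"
  by (auto simp: Hom_iff)

lemma is_functor_cat: "is_functor A B T \<Longrightarrow> category A \<and> category B"
  by (simp add: is_functor_def)

lemma
  assumes "is_functor A B T"
  shows fob_ob [simp]: "a \<in> Ob A \<Longrightarrow> fob T a \<in> Ob B"
    and fmor_mor [simp]: "f \<in> Mor A \<Longrightarrow> fmor T f \<in> Mor B"
    and dom_fmor [simp]: "f \<in> Mor A \<Longrightarrow> Dom B (fmor T f) = fob T (Dom A f)"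
    and cod_fmor [simp]: "f \<in> Mor A \<Longrightarrow> Cod B (fmor T f) = fob T (Cod A f)"
    and fmor_idt [simp]: "a \<in> Ob A \<Longrightarrow> fmor T (Idt A a) = Idt B (fob T a)"
    and fmor_comp [simp]: "f \<in> Mor A \<Longrightarrow> g \<in> Mor A \<Longrightarrow> Cod A f = Dom A g \<Longrightarrow>
      fmor T (g \<cdot>\<^bsub>A\<^esub> f) = fmor T g \<cdot>\<^bsub>B\<^esub> fmor T f"
  using assms by (auto simp: is_functor_def Hom_iff)

lemma functor_comp:
  assumes "is_functor A B S" "is_functor B D T"
  shows "is_functor A D (comp_fctr T S)"
  using assms unfolding is_functor_def comp_fctr_def by (auto simp: Hom_iff)

lemma comp_fctr_simps [simp]:
  "fob (comp_fctr T S) a = fob T (fob S a)" "fmor (comp_fctr T S) f = fmor T (fmor S f)"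
  by (simp_all add: comp_fctr_def)

lemma is_isoE:
  assumes "is_iso C f"
  obtains g where "f \<in> Mor C" "g \<in> Hom C (Cod C f) (Dom C f)"
    "g \<cdot>\<^bsub>C\<^esub> f = Idt C (Dom C f)" "f \<cdot>\<^bsub>C\<^esub> g = Idt C (Cod C f)"
  using assms by (auto simp: is_iso_def)

lemma is_isoI:
  assumes "f \<in> Hom C a b" "g \<in> Hom C b a" "g \<cdot>\<^bsub>C\<^esub> f = Idt C a" "f \<cdot>\<^bsub>C\<^esub> g = Idt C b"
  shows "is_iso C f"
  using assms by (auto simp: is_iso_def Hom_iff)

lemma full_subcat_simps [simp]:
  "Ob (full_subcat C S) = Ob C \<inter> S"
  "f \<in> Mor (full_subcat C S) \<longleftrightarrow> f \<in> Mor C \<and> Dom C f \<in> S \<and> Cod C f \<in> S"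
  "Dom (full_subcat C S) = Dom C" "Cod (full_subcat C S) = Cod C"
  "Idt (full_subcat C S) = Idt C" "Cmp (full_subcat C S) = Cmp C"
  by (simp_all add: full_subcat_def)

lemma category_full_subcat [simp]: "category C \<Longrightarrow> category (full_subcat C S)"
  unfolding category_def by (auto simp: Hom_iff)

lemma Hom_full_subcat [simp]:
  "a \<in> S \<Longrightarrow> b \<in> S \<Longrightarrow> Hom (full_subcat C S) a b = Hom C a b"
  by (auto simp: Hom_iff)

lemma functor_full_subcat:
  assumes "category C"
  shows "is_functor J (full_subcat C S) X \<longleftrightarrow> is_functor J C X \<and> (\<forall>j\<in>Ob J. fob X j \<in> S)"
  using assms unfolding is_functor_def by (auto simp: Hom_iff)

section \<open>Colimits\<close>

lemma colimit_cocone: "is_colimit J C X L \<iota> \<Longrightarrow> cocone J C X L \<iota>"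
  by (simp add: is_colimit_def)

lemma cocone_ob: "cocone J C X L \<iota> \<Longrightarrow> L \<in> Ob C"
  by (simp add: cocone_def)

lemma
  assumes "cocone J C X L \<iota>"
  shows cocone_mor: "j \<in> Ob J \<Longrightarrow> \<iota> j \<in> Mor C"
    and dom_cocone: "j \<in> Ob J \<Longrightarrow> Dom C (\<iota> j) = fob X j"
    and cod_cocone: "j \<in> Ob J \<Longrightarrow> Cod C (\<iota> j) = L"
    and cocone_comm: "u \<in> Mor J \<Longrightarrow> \<iota> (Cod J u) \<cdot>\<^bsub>C\<^esub> fmor X u = \<iota> (Dom J u)"
  using assms by (auto simp: cocone_def Hom_iff)

lemmas cocone_facts = cocone_ob cocone_mor dom_cocone cod_cocone

lemma colimit_induced:
  assumes "is_colimit J C X L \<iota>" "cocone J C X Z \<zeta>"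
  obtains h where "h \<in> Hom C L Z" "\<And>j. j \<in> Ob J \<Longrightarrow> h \<cdot>\<^bsub>C\<^esub> \<iota> j = \<zeta> j"
  using assms unfolding is_colimit_def by blast

lemma cocone_comp:
  assumes "category C" "is_functor J C X" "cocone J C X L \<iota>" "h \<in> Hom C L Z"
  shows "cocone J C X Z (\<lambda>j. h \<cdot>\<^bsub>C\<^esub> \<iota> j)"
proof -
  have "category J" using is_functor_cat[OF assms(2)] by simp
  then show ?thesis
    using assms cocone_facts[OF assms(3)] cocone_comm[OF assms(3)] Hom_ob[OF assms(1,4)]
    unfolding cocone_def[of J C X Z] by (simp add: Hom_iff)
qed

lemma colimit_unique:
  fixes C (structure)
  assumes "category C" "is_functor J C X" "is_colimit J C X L \<iota>" "h \<in> Hom C L Z" "h' \<in> Hom C L Z"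
    "\<And>j. j \<in> Ob J \<Longrightarrow> h \<cdot> \<iota> j = h' \<cdot> \<iota> j"
  shows "h = h'"
proof -
  have "cocone J C X Z (\<lambda>j. h \<cdot> \<iota> j)"
    by (rule cocone_comp[OF assms(1,2) colimit_cocone[OF assms(3)] assms(4)])
  then have "\<exists>!k. k \<in> Hom C L Z \<and> (\<forall>j\<in>Ob J. k \<cdot> \<iota> j = h \<cdot> \<iota> j)"
    using assms(3) unfolding is_colimit_def by blast
  then show ?thesis
    using assms(4,5,6) by metis
qed

lemma is_colimitI:
  fixes C (structure)
  assumes "cocone J C X L \<iota>"
    and "\<And>Z \<zeta>. cocone J C X Z \<zeta> \<Longrightarrow> \<exists>h\<in>Hom C L Z. \<forall>j\<in>Ob J. h \<cdot> \<iota> j = \<zeta> j"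
    and "\<And>Z h h'. h \<in> Hom C L Z \<Longrightarrow> h' \<in> Hom C L Z \<Longrightarrow>
           (\<forall>j\<in>Ob J. h \<cdot> \<iota> j = h' \<cdot> \<iota> j) \<Longrightarrow> h = h'"
  shows "is_colimit J C X L \<iota>"
  unfolding is_colimit_def
proof (intro conjI allI impI)
  fix Z \<zeta> assume "cocone J C X Z \<zeta>"
  then obtain h where h: "h\<in>Hom C L Z" "\<forall>j\<in>Ob J. h \<cdot> \<iota> j = \<zeta> j"
    using assms(2) by blast
  then show "\<exists>!h. h \<in> Hom C L Z \<and> (\<forall>j\<in>Ob J. h \<cdot> \<iota> j = \<zeta> j)"
    using assms(3) by (intro ex1I[of _ h]) (auto simp del: Hom_iff)
qed (rule assms(1))

lemma colimit_iso:
  fixes C (structure)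
  assumes C: "category C" "is_functor J C X"
    and L: "is_colimit J C X L \<iota>" and L': "is_colimit J C X L' \<iota>'"
  obtains \<theta> \<theta>' where "\<theta> \<in> Hom C L L'" "\<theta>' \<in> Hom C L' L" "\<theta>' \<cdot> \<theta> = Idt C L" "\<theta> \<cdot> \<theta>' = Idt C L'"
    "\<And>j. j \<in> Ob J \<Longrightarrow> \<theta> \<cdot> \<iota> j = \<iota>' j" "\<And>j. j \<in> Ob J \<Longrightarrow> \<theta>' \<cdot> \<iota>' j = \<iota> j"
proof -
  note cc = colimit_cocone[OF L] colimit_cocone[OF L']
  note ob = cocone_facts[OF cc(1)] cocone_facts[OF cc(2)]
  obtain \<theta> where t: "\<theta> \<in> Hom C L L'" "\<And>j. j \<in> Ob J \<Longrightarrow> \<theta> \<cdot> \<iota> j = \<iota>' j"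
    using colimit_induced[OF L cc(2)] by blast
  obtain \<theta>' where t': "\<theta>' \<in> Hom C L' L" "\<And>j. j \<in> Ob J \<Longrightarrow> \<theta>' \<cdot> \<iota>' j = \<iota> j"
    using colimit_induced[OF L' cc(1)] by blast
  have "\<theta>' \<cdot> \<theta> = Idt C L"
    by (rule colimit_unique[OF C L, of _ L]) (use t t' ob C in \<open>auto simp: Hom_iff\<close>)
  moreover have "\<theta> \<cdot> \<theta>' = Idt C L'"
    by (rule colimit_unique[OF C L', of _ L']) (use t t' ob C in \<open>auto simp: Hom_iff\<close>)
  ultimately show thesis
    using that t t' by blast
qed

lemma colimit_transfer:
  fixes C (structure)
  assumes C: "category C" "is_functor J C X" and L: "is_colimit J C X L \<iota>"
    and t: "\<theta> \<in> Hom C L L'" "\<theta>' \<in> Hom C L' L" "\<theta>' \<cdot> \<theta> = Idt C L" "\<theta> \<cdot> \<theta>' = Idt C L'"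
  shows "is_colimit J C X L' (\<lambda>j. \<theta> \<cdot> \<iota> j)"
proof (rule is_colimitI)
  note cc = colimit_cocone[OF L]
  note ob = Hom_ob[OF C(1) t(1)] cocone_facts[OF cc]
  show "cocone J C X L' (\<lambda>j. \<theta> \<cdot> \<iota> j)"
    by (rule cocone_comp[OF C cc t(1)])
  fix Z
  {
    fix \<zeta> assume "cocone J C X Z \<zeta>"
    then obtain h where h: "h \<in> Hom C L Z" "\<And>j. j \<in> Ob J \<Longrightarrow> h \<cdot> \<iota> j = \<zeta> j"
      using colimit_induced[OF L] by blast
    have "(h \<cdot> \<theta>') \<cdot> (\<theta> \<cdot> \<iota> j) = \<zeta> j" if "j \<in> Ob J" for j
      using that h t C ob comp_reassoc[OF t(3) C(1)] by (simp add: Hom_iff)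
    then show "\<exists>h\<in>Hom C L' Z. \<forall>j\<in>Ob J. h \<cdot> (\<theta> \<cdot> \<iota> j) = \<zeta> j"
      using h t C by (intro bexI[of _ "h \<cdot> \<theta>'"]) (auto simp: Hom_iff)
  }
  fix h h' assume h: "h \<in> Hom C L' Z" "h' \<in> Hom C L' Z"
    and eq: "\<forall>j\<in>Ob J. h \<cdot> (\<theta> \<cdot> \<iota> j) = h' \<cdot> (\<theta> \<cdot> \<iota> j)"
  have "h \<cdot> \<theta> = h' \<cdot> \<theta>"
    by (rule colimit_unique[OF C L, of _ Z]) (use eq h t C ob in \<open>auto simp: Hom_iff\<close>)
  then have "h \<cdot> (\<theta> \<cdot> \<theta>') = h' \<cdot> (\<theta> \<cdot> \<theta>')"
    using h t C by (metis (no_types, lifting) Hom_iff comp_assoc)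
  then show "h = h'"
    using h t C by (simp add: Hom_iff)
qed

text \<open>Legs are total functions whose values off the index category are arbitrary, so families
  that agree on objects have to be exchanged explicitly.\<close>

lemma cocone_cong:
  assumes "category J" "\<And>j. j \<in> Ob J \<Longrightarrow> \<iota> j = \<iota>' j"
  shows "cocone J C X L \<iota> \<longleftrightarrow> cocone J C X L \<iota>'"
  using assms by (auto simp: cocone_def)

lemma colimit_cong:
  assumes "category J" "\<And>j. j \<in> Ob J \<Longrightarrow> \<iota> j = \<iota>' j"
  shows "is_colimit J C X L \<iota> \<longleftrightarrow> is_colimit J C X L \<iota>'"
proof -
  have "cocone J C X L \<iota> \<longleftrightarrow> cocone J C X L \<iota>'"
    using assms by (rule cocone_cong)
  then show ?thesis
    unfolding is_colimit_def using assms(2) by simp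
qed

lemma cocone_full_subcat:
  assumes "category C" "is_functor J C X" "\<forall>j\<in>Ob J. fob X j \<in> S" "L \<in> S"
  shows "cocone J (full_subcat C S) X L \<iota> \<longleftrightarrow> cocone J C X L \<iota>"
  using assms unfolding cocone_def by auto

lemma colimit_full_subcat:
  assumes "category C" "is_functor J C X" "\<forall>j\<in>Ob J. fob X j \<in> S" "L \<in> S" "is_colimit J C X L \<iota>"
  shows "is_colimit J (full_subcat C S) X L \<iota>"
  unfolding is_colimit_def
proof (intro conjI allI impI)
  show "cocone J (full_subcat C S) X L \<iota>"
    using assms by (simp add: cocone_full_subcat colimit_cocone)
  fix Z \<zeta> assume z: "cocone J (full_subcat C S) X Z \<zeta>"
  then have "Z \<in> S" using cocone_ob by fastforce
  then show "\<exists>!h. h \<in> Hom (full_subcat C S) L Z \<and> (\<forall>j\<in>Ob J. h \<cdot>\<^bsub>full_subcat C S\<^esub> \<iota> j = \<zeta> j)"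
    using assms z unfolding is_colimit_def by (simp add: cocone_full_subcat)
qed

text \<open>The ambient colimit that lies in \<open>S\<close> is also a colimit in the subcategory,
  hence isomorphic to the given one, and the ambient universal property is carried across that
  isomorphism.\<close>

lemma colimit_full_subcatD:
  fixes C (structure)
  assumes C: "category C" "is_functor J C X" "\<forall>j\<in>Ob J. fob X j \<in> S"
    and L: "L \<in> S" "is_colimit J C X L \<iota>" and L': "is_colimit J (full_subcat C S) X L' \<iota>'"
  shows "is_colimit J C X L' \<iota>'"
proof -
  have F: "is_functor J (full_subcat C S) X"
    using C by (simp add: functor_full_subcat)
  have L'S: "L' \<in> S" using cocone_ob[OF colimit_cocone[OF L']] by simp
  obtain \<theta> \<theta>' where t: "\<theta> \<in> Hom (full_subcat C S) L L'" "\<theta>' \<in> Hom (full_subcat C S) L' L"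
    "\<theta>' \<cdot> \<theta> = Idt C L" "\<theta> \<cdot> \<theta>' = Idt C L'"
    "\<And>j. j \<in> Ob J \<Longrightarrow> \<theta> \<cdot> \<iota> j = \<iota>' j"
    using colimit_iso[OF category_full_subcat[OF C(1)] F colimit_full_subcat[OF C L] L']
    by (metis full_subcat_simps(5,6))
  have "is_colimit J C X L' (\<lambda>j. \<theta> \<cdot> \<iota> j)"
    using colimit_transfer[OF C(1,2) L(2)] t(1-4) L'S L(1) by auto
  with colimit_cong[OF conjunct1[OF is_functor_cat[OF C(2)]] t(5)] show ?thesis
    by (rule iffD1)
qed

section \<open>Relabelling of index categories\<close>

text \<open>Small categories of arbitrary type are transported to the type \<open>'u\<close> along injections.\<close>

definition relabel_cat :: "('i \<Rightarrow> 'k) \<Rightarrow> ('j \<Rightarrow> 'l) \<Rightarrow> ('i, 'j) cat \<Rightarrow> ('k, 'l) cat" where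
  "relabel_cat e e' K =
    \<lparr>Ob = e ` Ob K, Mor = e' ` Mor K,
     Dom = (\<lambda>x. e (Dom K (inv_into (Mor K) e' x))),
     Cod = (\<lambda>x. e (Cod K (inv_into (Mor K) e' x))),
     Idt = (\<lambda>x. e' (Idt K (inv_into (Ob K) e x))),
     Cmp = (\<lambda>g f. e' (inv_into (Mor K) e' g \<cdot>\<^bsub>K\<^esub> inv_into (Mor K) e' f))\<rparr>"

definition relabel_fctr ::
    "('i \<Rightarrow> 'k) \<Rightarrow> ('j \<Rightarrow> 'l) \<Rightarrow> ('i, 'j) cat \<Rightarrow> ('i, 'j, 'o, 'm) fctr \<Rightarrow> ('k, 'l, 'o, 'm) fctr" where
  "relabel_fctr e e' K X =
    \<lparr>fob = (\<lambda>x. fob X (inv_into (Ob K) e x)), fmor = (\<lambda>x. fmor X (inv_into (Mor K) e' x))\<rparr>"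

context
  fixes K :: "('i, 'j) cat" and e :: "'i \<Rightarrow> 'k" and e' :: "'j \<Rightarrow> 'l"
  assumes K: "category K" and e: "inj_on e (Ob K)" and e': "inj_on e' (Mor K)"
begin

lemma relabel_cat_simps:
  "Ob (relabel_cat e e' K) = e ` Ob K" "Mor (relabel_cat e e' K) = e' ` Mor K"
  "f \<in> Mor K \<Longrightarrow> Dom (relabel_cat e e' K) (e' f) = e (Dom K f)"
  "f \<in> Mor K \<Longrightarrow> Cod (relabel_cat e e' K) (e' f) = e (Cod K f)"
  "a \<in> Ob K \<Longrightarrow> Idt (relabel_cat e e' K) (e a) = e' (Idt K a)"
  "f \<in> Mor K \<Longrightarrow> g \<in> Mor K \<Longrightarrow> e' g \<cdot>\<^bsub>relabel_cat e e' K\<^esub> e' f = e' (g \<cdot>\<^bsub>K\<^esub> f)"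
  using e e' by (simp_all add: relabel_cat_def)

lemma relabel_fctr_simps:
  "a \<in> Ob K \<Longrightarrow> fob (relabel_fctr e e' K X) (e a) = fob X a"
  "f \<in> Mor K \<Longrightarrow> fmor (relabel_fctr e e' K X) (e' f) = fmor X f"
  using e e' by (simp_all add: relabel_fctr_def)

lemma e_eq_iff: "a \<in> Ob K \<Longrightarrow> b \<in> Ob K \<Longrightarrow> e a = e b \<longleftrightarrow> a = b"
  using e by (simp add: inj_on_eq_iff)

lemma category_relabel: "category (relabel_cat e e' K)"
  unfolding category_def Hom_iff using K
  by (simp add: relabel_cat_simps e_eq_iff)

lemma functor_relabel:
  assumes "is_functor K C X"
  shows "is_functor (relabel_cat e e' K) C (relabel_fctr e e' K X)"
proof -
  have "category C" using is_functor_cat[OF assms] by simp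
  then show ?thesis
    unfolding is_functor_def using category_relabel assms K
    by (simp add: relabel_cat_simps relabel_fctr_simps e_eq_iff Hom_iff)
qed

lemma Hom_relabel:
  assumes "a \<in> Ob K" "b \<in> Ob K"
  shows "Hom (relabel_cat e e' K) (e a) (e b) = e' ` Hom K a b"
  using assms K by (auto simp: Hom_iff relabel_cat_simps e_eq_iff)

lemma filtered_relabel:
  assumes "filtered K"
  shows "filtered (relabel_cat e e' K)"
proof -
  have "\<exists>c\<in>Ob K. \<exists>w\<in>Hom K b c. w \<cdot>\<^bsub>K\<^esub> u = w \<cdot>\<^bsub>K\<^esub> v"
    if "a \<in> Ob K" "b \<in> Ob K" "u \<in> Hom K a b" "v \<in> Hom K a b" for a b u v
    using assms that unfolding filtered_def by blast
  then have co: "\<exists>c\<in>Ob K. \<exists>w\<in>Hom K b c. e' w \<cdot>\<^bsub>relabel_cat e e' K\<^esub> e' u = e' w \<cdot>\<^bsub>relabel_cat e e' K\<^esub> e' v"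
    if "a \<in> Ob K" "b \<in> Ob K" "u \<in> Hom K a b" "v \<in> Hom K a b" for a b u v
    using that by (simp add: Hom_iff relabel_cat_simps) metis
  have jo: "\<exists>c\<in>Ob K. Hom K a c \<noteq> {} \<and> Hom K b c \<noteq> {}" if "a \<in> Ob K" "b \<in> Ob K" for a b
    using assms that unfolding filtered_def by blast
  have "Ob K \<noteq> {}" using assms by (simp add: filtered_def)
  then show ?thesis
    unfolding filtered_def relabel_cat_simps(1)
    using category_relabel co jo by (auto simp add: Hom_relabel)
qed

lemma cocone_relabel:
  "cocone (relabel_cat e e' K) C (relabel_fctr e e' K X) L \<kappa> \<longleftrightarrow> cocone K C X L (\<kappa> \<circ> e)"
  unfolding cocone_def using K by (simp add: relabel_cat_simps relabel_fctr_simps)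

lemma colimit_relabel:
  "is_colimit (relabel_cat e e' K) C (relabel_fctr e e' K X) L \<kappa> \<longleftrightarrow> is_colimit K C X L (\<kappa> \<circ> e)"
proof -
  have "(\<forall>\<zeta>. cocone (relabel_cat e e' K) C (relabel_fctr e e' K X) Z \<zeta> \<longrightarrow>
            (\<exists>!h. h \<in> Hom C L Z \<and> (\<forall>j\<in>e ` Ob K. h \<cdot>\<^bsub>C\<^esub> \<kappa> j = \<zeta> j))) \<longleftrightarrow>
        (\<forall>\<zeta>. cocone K C X Z \<zeta> \<longrightarrow>
            (\<exists>!h. h \<in> Hom C L Z \<and> (\<forall>j\<in>Ob K. h \<cdot>\<^bsub>C\<^esub> (\<kappa> \<circ> e) j = \<zeta> j)))"
    (is "?l \<longleftrightarrow> ?r") for Z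
  proof
    assume l: ?l
    show ?r
    proof (intro allI impI)
      fix \<zeta> assume "cocone K C X Z \<zeta>"
      \<comment> \<open>Every cocone over \<open>K\<close> is the restriction along \<open>e\<close>
        of one over the relabelled category, obtained with the inverse of \<open>e\<close> on its
        image; the other direction only restricts.\<close>
      then have "cocone K C X Z ((\<zeta> \<circ> inv_into (Ob K) e) \<circ> e)"
        using K e by (simp add: cocone_def)
      then show "\<exists>!h. h \<in> Hom C L Z \<and> (\<forall>j\<in>Ob K. h \<cdot>\<^bsub>C\<^esub> (\<kappa> \<circ> e) j = \<zeta> j)"
        using l[rule_format, of "\<zeta> \<circ> inv_into (Ob K) e"] e by (simp add: cocone_relabel)
    qed
  next
    assume r: ?r
    show ?l
      using r[rule_format, of "\<zeta> \<circ> e" for \<zeta>] by (simp add: cocone_relabel)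
  qed
  then show ?thesis
    unfolding is_colimit_def by (simp add: cocone_relabel relabel_cat_simps)
qed

end

lemma relabel_small:
  fixes U :: "'u itself" and K :: "('i, 'j) cat"
  assumes K: "category K" "small U (Ob K)" "small U (Mor K)"
  obtains e :: "'i \<Rightarrow> 'u" and e' :: "'j \<Rightarrow> 'u" where "inj_on e (Ob K)" "inj_on e' (Mor K)"
    "small_cat (relabel_cat e e' K)"
proof -
  obtain e :: "'i \<Rightarrow> 'u" and e' :: "'j \<Rightarrow> 'u" where e: "inj_on e (Ob K)" "inj_on e' (Mor K)"
    using small_inj[OF K(2)] small_inj[OF K(3)] by blast
  have "small_cat (relabel_cat e e' K)"
    unfolding small_cat_def small_type[of _ U]
    using category_relabel[OF K(1) e] K by (simp add: relabel_cat_simps[OF K(1) e] small_image)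
  then show thesis using that e by blast
qed

text \<open>\<open>cocomplete\<close> quantifies over index categories whose objects and morphisms
  are elements of \<open>'u\<close>; relabelling frees it from that type.\<close>

lemma cocomplete_colimit:
  fixes U :: "'u itself"
  assumes "cocomplete U C" "is_functor K C X" "small U (Ob K)" "small U (Mor K)"
  shows "\<exists>L \<iota>. is_colimit K C X L \<iota>"
proof -
  have K: "category K" using is_functor_cat[OF assms(2)] by simp
  obtain e e' where e: "inj_on e (Ob K)" "inj_on e' (Mor K)"
    "small_cat (relabel_cat e e' K :: ('u, 'u) cat)"
    using relabel_small[OF K assms(3,4)] by blast
  obtain L \<kappa> where "is_colimit (relabel_cat e e' K) C (relabel_fctr e e' K X) L \<kappa>"
    using assms(1) functor_relabel[OF K e(1,2) assms(2)] e(3)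
    unfolding cocomplete_def has_colimits_def by metis
  then show ?thesis
    unfolding colimit_relabel[OF K e(1,2)] by (intro exI)
qed

section \<open>Filtered categories\<close>

lemma filtered_cat: "filtered J \<Longrightarrow> category J"
  by (simp add: filtered_def)

lemma filtered_join:
  assumes "filtered J" "a \<in> Ob J" "b \<in> Ob J"
  obtains c u v where "c \<in> Ob J" "u \<in> Hom J a c" "v \<in> Hom J b c"
proof -
  have "\<exists>c\<in>Ob J. Hom J a c \<noteq> {} \<and> Hom J b c \<noteq> {}"
    using assms unfolding filtered_def by blast
  then show thesis using that by blast
qed

lemma filtered_coeq:
  assumes "filtered J" "u \<in> Hom J a b" "v \<in> Hom J a b"
  obtains c w where "c \<in> Ob J" "w \<in> Hom J b c" "w \<cdot>\<^bsub>J\<^esub> u = w \<cdot>\<^bsub>J\<^esub> v"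
proof -
  have "a \<in> Ob J" "b \<in> Ob J"
    using Hom_ob[OF filtered_cat[OF assms(1)] assms(2)] by auto
  then have "\<exists>c\<in>Ob J. \<exists>w\<in>Hom J b c. w \<cdot>\<^bsub>J\<^esub> u = w \<cdot>\<^bsub>J\<^esub> v"
    using assms unfolding filtered_def by blast
  then show thesis using that by blast
qed

lemma filteredI:
  assumes "category J" "Ob J \<noteq> {}"
    and "\<And>a b. a \<in> Ob J \<Longrightarrow> b \<in> Ob J \<Longrightarrow> \<exists>c. \<exists>u v. u \<in> Hom J a c \<and> v \<in> Hom J b c"
    and "\<And>a b u v. u \<in> Hom J a b \<Longrightarrow> v \<in> Hom J a b \<Longrightarrow> \<exists>c. \<exists>w\<in>Hom J b c. w \<cdot>\<^bsub>J\<^esub> u = w \<cdot>\<^bsub>J\<^esub> v"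
  shows "filtered J"
  unfolding filtered_def
proof (intro conjI ballI assms(1,2))
  fix a b assume "a \<in> Ob J" "b \<in> Ob J"
  then obtain c u v where "u \<in> Hom J a c" "v \<in> Hom J b c" using assms(3) by blast
  then show "\<exists>c\<in>Ob J. Hom J a c \<noteq> {} \<and> Hom J b c \<noteq> {}"
    using Hom_ob[OF assms(1)] by blast
next
  fix a b u v assume "u \<in> Hom J a b" "v \<in> Hom J a b"
  then obtain c w where "w\<in>Hom J b c" "w \<cdot>\<^bsub>J\<^esub> u = w \<cdot>\<^bsub>J\<^esub> v" using assms(4) by blast
  then show "\<exists>c\<in>Ob J. \<exists>w\<in>Hom J b c. w \<cdot>\<^bsub>J\<^esub> u = w \<cdot>\<^bsub>J\<^esub> v"
    using Hom_ob[OF assms(1)] by blast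
qed

text \<open>A join of the two targets need not make the square commute; one coequalizing arrow
  repairs it.\<close>

lemma filtered_square:
  assumes J: "filtered J" and u: "u \<in> Hom J a b" and v: "v \<in> Hom J a c"
  obtains d s t where "d \<in> Ob J" "s \<in> Hom J b d" "t \<in> Hom J c d" "s \<cdot>\<^bsub>J\<^esub> u = t \<cdot>\<^bsub>J\<^esub> v"
proof -
  note C = filtered_cat[OF J]
  obtain d s t where st: "d \<in> Ob J" "s \<in> Hom J b d" "t \<in> Hom J c d"
    using filtered_join[OF J] Hom_ob[OF C u] Hom_ob[OF C v] by metis
  obtain d' w where w: "d' \<in> Ob J" "w \<in> Hom J d d'" "w \<cdot>\<^bsub>J\<^esub> (s \<cdot>\<^bsub>J\<^esub> u) = w \<cdot>\<^bsub>J\<^esub> (t \<cdot>\<^bsub>J\<^esub> v)"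
    using filtered_coeq[OF J comp_Hom[OF C u st(2)] comp_Hom[OF C v st(3)]] by blast
  show thesis
    by (rule that[OF w(1) comp_Hom[OF C st(2) w(2)] comp_Hom[OF C st(3) w(2)]])
      (use u v st w C in \<open>simp add: Hom_iff\<close>)
qed

text \<open>This elementary criterion characterizes cofinality only when \<open>E\<close> and \<open>K\<close> are filtered.\<close>

definition cofinal_fctr :: "('i, 'j) cat \<Rightarrow> ('k, 'l) cat \<Rightarrow> ('i, 'j, 'k, 'l) fctr \<Rightarrow> bool" where
  "cofinal_fctr E K F \<longleftrightarrow> is_functor E K F \<and>
    (\<forall>k\<in>Ob K. \<exists>e\<in>Ob E. Hom K k (fob F e) \<noteq> {}) \<and>
    (\<forall>e\<in>Ob E. \<forall>k\<in>Ob K. \<forall>v\<in>Hom K k (fob F e). \<forall>v'\<in>Hom K k (fob F e).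
       \<exists>e'. \<exists>c\<in>Hom E e e'. fmor F c \<cdot>\<^bsub>K\<^esub> v = fmor F c \<cdot>\<^bsub>K\<^esub> v')"

text \<open>A cocone over \<open>E\<close> extends to \<open>K\<close>: each object \<open>k\<close>
  maps to some \<open>fob F e\<close>, and the leg at \<open>e\<close> is pulled back along that
  map. Everything rests on the result not depending on the choice.\<close>

lemma cofinal_colimit:
  fixes C (structure)
  assumes E: "filtered E" and F: "cofinal_fctr E K F" and X: "is_functor K C X"
    and L: "is_colimit K C X L \<iota>"
  shows "is_colimit E C (comp_fctr X F) L (\<lambda>e. \<iota> (fob F e))"
proof (rule is_colimitI)
  have Ff: "is_functor E K F" using F by (simp add: cofinal_fctr_def)
  have cats: "category C" "category K" "category E"
    using is_functor_cat[OF X] is_functor_cat[OF Ff] by auto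
  note cc = cocone_facts[OF colimit_cocone[OF L]] cocone_comm[OF colimit_cocone[OF L]]
  have "\<iota> (fob F (Cod E u)) \<cdot> fmor X (fmor F u) = \<iota> (fob F (Dom E u))" if "u \<in> Mor E" for u
    using cc(5)[of "fmor F u"] Ff that by simp
  then show "cocone E C (comp_fctr X F) L (\<lambda>e. \<iota> (fob F e))"
    unfolding cocone_def using cc(1-4) Ff cats by (simp add: Hom_iff)
  have ex: "\<exists>e\<in>Ob E. \<exists>v. v \<in> Hom K k (fob F e)" if "k \<in> Ob K" for k
    using F that unfolding cofinal_fctr_def by blast
  fix Z
  {
    fix \<zeta> assume z: "cocone E C (comp_fctr X F) Z \<zeta>"
    note zc = cocone_facts[OF z]
    have zcom: "\<zeta> (Cod E u) \<cdot> fmor X (fmor F u) = \<zeta> (Dom E u)" if "u \<in> Mor E" for u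
      using cocone_comm[OF z that] by simp
    \<comment> \<open>Both choices are pushed to a common \<open>d\<close> in \<open>E\<close>. The
      resulting arrows from \<open>k\<close> to \<open>fob F d\<close> are parallel, and the last
      clause of \<open>cofinal_fctr\<close> coequalizes them by an arrow in the image of
      \<open>F\<close>.\<close>
    have indep: "\<zeta> e \<cdot> fmor X v = \<zeta> e' \<cdot> fmor X v'"
      if e: "e \<in> Ob E" "e' \<in> Ob E" and v: "v \<in> Hom K k (fob F e)" "v' \<in> Hom K k (fob F e')" for k e e' v v'
    proof -
      obtain d a b where d: "d \<in> Ob E" "a \<in> Hom E e d" "b \<in> Hom E e' d"
        using filtered_join[OF E e] by blast
      have "fmor F a \<cdot>\<^bsub>K\<^esub> v \<in> Hom K k (fob F d)" "fmor F b \<cdot>\<^bsub>K\<^esub> v' \<in> Hom K k (fob F d)"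
        using d v Ff cats by (auto simp: Hom_iff)
      moreover have "k \<in> Ob K" using Hom_ob[OF cats(2) v(1)] by simp
      ultimately obtain d' c where c: "c \<in> Hom E d d'"
        "fmor F c \<cdot>\<^bsub>K\<^esub> (fmor F a \<cdot>\<^bsub>K\<^esub> v) = fmor F c \<cdot>\<^bsub>K\<^esub> (fmor F b \<cdot>\<^bsub>K\<^esub> v')"
        using F d(1) unfolding cofinal_fctr_def by meson
      have "\<zeta> d' \<cdot> fmor X (fmor F c \<cdot>\<^bsub>K\<^esub> (fmor F a \<cdot>\<^bsub>K\<^esub> v)) = \<zeta> e \<cdot> fmor X v"
        using zcom[of "c \<cdot>\<^bsub>E\<^esub> a"] c(1) d v Ff cats zc X Hom_ob[OF cats(3) c(1)]
          comp_reassoc[OF zcom[of "c \<cdot>\<^bsub>E\<^esub> a"]]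
        by (simp add: Hom_iff)
      moreover have "\<zeta> d' \<cdot> fmor X (fmor F c \<cdot>\<^bsub>K\<^esub> (fmor F b \<cdot>\<^bsub>K\<^esub> v')) = \<zeta> e' \<cdot> fmor X v'"
        using zcom[of "c \<cdot>\<^bsub>E\<^esub> b"] c(1) d v Ff cats zc X Hom_ob[OF cats(3) c(1)]
          comp_reassoc[OF zcom[of "c \<cdot>\<^bsub>E\<^esub> b"]]
        by (simp add: Hom_iff)
      ultimately show ?thesis using c(2) by simp
    qed
    define e where "e k = (SOME e. e \<in> Ob E \<and> (\<exists>v. v \<in> Hom K k (fob F e)))" for k
    define v where "v k = (SOME v. v \<in> Hom K k (fob F (e k)))" for k
    have e: "e k \<in> Ob E \<and> (\<exists>v. v \<in> Hom K k (fob F (e k)))" if "k \<in> Ob K" for k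
      unfolding e_def by (rule someI_ex) (use ex[OF that] in blast)
    have v: "v k \<in> Hom K k (fob F (e k))" if "k \<in> Ob K" for k
      unfolding v_def by (rule someI_ex) (use e[OF that] in blast)
    define \<eta> where "\<eta> k = \<zeta> (e k) \<cdot> fmor X (v k)" for k
    have \<eta>: "\<eta> k = \<zeta> e' \<cdot> fmor X v'" if "e' \<in> Ob E" "v' \<in> Hom K k (fob F e')" for k e' v'
      unfolding \<eta>_def using indep e v that Hom_ob[OF cats(2) that(2)] by blast
    have "cocone K C X Z \<eta>"
      unfolding cocone_def
    proof (intro conjI ballI)
      show "Z \<in> Ob C" using zc by simp
      show "\<eta> k \<in> Hom C (fob X k) Z" if "k \<in> Ob K" for k
        unfolding \<eta>_def using that e[OF that] v[OF that] zc X cats by (auto simp: Hom_iff)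
      show "\<eta> (Cod K u) \<cdot> fmor X u = \<eta> (Dom K u)" if u: "u \<in> Mor K" for u
      proof -
        have ce: "e (Cod K u) \<in> Ob E" "v (Cod K u) \<in> Hom K (Cod K u) (fob F (e (Cod K u)))"
          using e v u cats by auto
        have "\<eta> (Dom K u) = \<zeta> (e (Cod K u)) \<cdot> fmor X (v (Cod K u) \<cdot>\<^bsub>K\<^esub> u)"
          using \<eta>[OF ce(1), of "v (Cod K u) \<cdot>\<^bsub>K\<^esub> u"] ce u cats by (simp add: Hom_iff)
        then show ?thesis
          unfolding \<eta>_def using ce u cats X zc by (simp add: Hom_iff)
      qed
    qed
    then obtain h where h: "h \<in> Hom C L Z" "\<And>k. k \<in> Ob K \<Longrightarrow> h \<cdot> \<iota> k = \<eta> k"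
      using colimit_induced[OF L] by blast
    have "h \<cdot> \<iota> (fob F e) = \<zeta> e" if "e \<in> Ob E" for e
      using h(2)[of "fob F e"] \<eta>[OF that, of "Idt K (fob F e)"] that Ff cats X zc by (simp add: Hom_iff)
    then show "\<exists>h\<in>Hom C L Z. \<forall>e\<in>Ob E. h \<cdot> \<iota> (fob F e) = \<zeta> e"
      using h by blast
  }
  fix h h' assume h: "h \<in> Hom C L Z" "h' \<in> Hom C L Z"
    and eq: "\<forall>e\<in>Ob E. h \<cdot> \<iota> (fob F e) = h' \<cdot> \<iota> (fob F e)"
  show "h = h'"
  proof (rule colimit_unique[OF cats(1) X L h])
    fix k assume k: "k \<in> Ob K"
    then obtain e v where e: "e \<in> Ob E" "v \<in> Hom K k (fob F e)" using ex by blast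
    have "\<iota> (fob F e) \<cdot> fmor X v = \<iota> k"
      using cc(5)[of v] e by (simp add: Hom_iff)
    then have "(g \<cdot> \<iota> (fob F e)) \<cdot> fmor X v = g \<cdot> \<iota> k" if "g \<in> Hom C L Z" for g
      using e that cc(1-4) X cats Ff by (simp add: Hom_iff)
    from this[OF h(1)] this[OF h(2)] eq e(1) show "h \<cdot> \<iota> k = h' \<cdot> \<iota> k"
      by metis
  qed
qed

text \<open>The counterpart of \<open>small_filtered\<close> for index categories of any type:
  coslices, slices and comma categories are not built on \<open>'u\<close>.\<close>

definition small_index :: "'u itself \<Rightarrow> ('i, 'j) cat \<Rightarrow> bool" where
  "small_index U J \<longleftrightarrow> filtered J \<and> small U (Ob J) \<and> small U (Mor J)"

lemma small_filtered_iff: "small_filtered (J :: ('u, 'u) cat) \<longleftrightarrow> small_index (U :: 'u itself) J"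
  unfolding small_filtered_def small_index_def small_cat_def small_type[of _ U] filtered_def by blast

lemma small_index_relabel:
  fixes U :: "'u itself"
  assumes "small_index U K"
  obtains e e' where "inj_on e (Ob K)" "inj_on e' (Mor K)"
    "small_filtered (relabel_cat e e' K :: ('u, 'u) cat)"
proof -
  have K: "category K" "small U (Ob K)" "small U (Mor K)" "filtered K"
    using assms unfolding small_index_def filtered_def by blast+
  obtain e e' where e: "inj_on e (Ob K)" "inj_on e' (Mor K)" "small_cat (relabel_cat e e' K :: ('u, 'u) cat)"
    using relabel_small[OF K(1-3)] by blast
  show thesis
    by (rule that[OF e(1,2)])
      (use e(3) filtered_relabel[OF K(1) e(1,2) K(4)] in \<open>simp add: small_filtered_def\<close>)
qed

lemma filtered_colimit:
  fixes U :: "'u itself"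
  assumes "has_colimits (small_filtered :: ('u, 'u) cat \<Rightarrow> bool) C" "is_functor K C X" "small_index U K"
  shows "\<exists>L \<iota>. is_colimit K C X L \<iota>"
proof -
  have K: "category K" using is_functor_cat[OF assms(2)] by simp
  obtain e e' where e: "inj_on e (Ob K)" "inj_on e' (Mor K)"
    "small_filtered (relabel_cat e e' K :: ('u, 'u) cat)"
    using small_index_relabel[OF assms(3)] by blast
  obtain L \<kappa> where "is_colimit (relabel_cat e e' K) C (relabel_fctr e e' K X) L \<kappa>"
    using assms(1) functor_relabel[OF K e(1,2) assms(2)] e(3)
    unfolding has_colimits_def by metis
  then show ?thesis
    unfolding colimit_relabel[OF K e(1,2)] by (intro exI)
qed

section \<open>Finitely presentable objects\<close>

lemma hom_diag_iff: "(j, g) \<in> hom_diag J C X a \<longleftrightarrow> j \<in> Ob J \<and> g \<in> Hom C a (fob X j)"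
  by (simp add: hom_diag_def)

lemma hom_eqv_refl: "(p, p) \<in> hom_eqv J C X a"
  by (simp add: hom_eqv_def Let_def)

lemma hom_eqv_sym: "(p, q) \<in> hom_eqv J C X a \<Longrightarrow> (q, p) \<in> hom_eqv J C X a"
  unfolding hom_eqv_def Let_def by (rule symD[OF sym_rtrancl]) (auto simp: sym_def)

lemma hom_eqv_trans:
  "(p, q) \<in> hom_eqv J C X a \<Longrightarrow> (q, r) \<in> hom_eqv J C X a \<Longrightarrow> (p, r) \<in> hom_eqv J C X a"
  unfolding hom_eqv_def Let_def by simp

lemma hom_eqv_step:
  assumes "u \<in> Mor J" "f \<in> Hom C a (fob X (Dom J u))"
  shows "((Dom J u, f), (Cod J u, fmor X u \<cdot>\<^bsub>C\<^esub> f)) \<in> hom_eqv J C X a"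
  unfolding hom_eqv_def Let_def using assms by (intro r_into_rtrancl) blast

text \<open>The relation is generated by the transition maps, so a property propagates along a
  zigzag when it survives one step in either direction.\<close>

lemma hom_eqv_induct [consumes 2, case_names refl fwd bwd]:
  assumes "(p, q) \<in> hom_eqv J C X a" "p \<in> hom_diag J C X a"
    and "P p"
    and "\<And>u f. u \<in> Mor J \<Longrightarrow> f \<in> Hom C a (fob X (Dom J u)) \<Longrightarrow> P (Dom J u, f) \<Longrightarrow>
           P (Cod J u, fmor X u \<cdot>\<^bsub>C\<^esub> f)"
    and "\<And>u f. u \<in> Mor J \<Longrightarrow> f \<in> Hom C a (fob X (Dom J u)) \<Longrightarrow> P (Cod J u, fmor X u \<cdot>\<^bsub>C\<^esub> f) \<Longrightarrow>
           P (Dom J u, f)"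
  shows "P q"
  using assms(1) unfolding hom_eqv_def Let_def
  by (induction rule: rtrancl_induct) (use assms in auto)

lemma hom_eqv_diag:
  assumes X: "is_functor J C X" and "(p, q) \<in> hom_eqv J C X a" "p \<in> hom_diag J C X a"
  shows "q \<in> hom_diag J C X a"
  using assms(2,3)
proof (induction rule: hom_eqv_induct)
  case (fwd u f)
  then show ?case
    using X is_functor_cat[OF X] by (simp add: hom_diag_iff Hom_iff)
next
  case (bwd u f)
  then show ?case
    using X is_functor_cat[OF X] by (simp add: hom_diag_iff)
qed (use assms in simp)

lemma hom_eqv_cocone:
  fixes C (structure)
  assumes X: "is_functor J C X" and L: "cocone J C X L \<iota>"
    and "(p, q) \<in> hom_eqv J C X a" "p \<in> hom_diag J C X a"
  shows "\<iota> (fst p) \<cdot> snd p = \<iota> (fst q) \<cdot> snd q"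
proof -
  have cats: "category J" "category C" using is_functor_cat[OF X] by auto
  have "\<iota> (Cod J u) \<cdot> (fmor X u \<cdot> f) = \<iota> (Dom J u) \<cdot> f"
    if "u \<in> Mor J" "f \<in> Hom C a (fob X (Dom J u))" for u f
    using comp_reassoc[OF cocone_comm[OF L that(1)]] that cats X cocone_facts[OF L] by (simp add: Hom_iff)
  with assms(3,4) show ?thesis
    by (induction rule: hom_eqv_induct) auto
qed

text \<open>Over a filtered index a zigzag collapses to a single pair of arrows into a common stage:
  a forward step is absorbed by completing a square, a backward step by composition.\<close>

lemma hom_eqv_filtered:
  fixes C (structure)
  assumes J: "filtered J" and X: "is_functor J C X"
    and "(p, q) \<in> hom_eqv J C X a" "p \<in> hom_diag J C X a"
  shows "\<exists>k. \<exists>u\<in>Hom J (fst p) k. \<exists>v\<in>Hom J (fst q) k. fmor X u \<cdot> snd p = fmor X v \<cdot> snd q"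
proof -
  have cats: "category J" "category C" using is_functor_cat[OF X] by auto
  obtain j g where p: "p = (j, g)" "j \<in> Ob J" "g \<in> Hom C a (fob X j)"
    using assms(4) by (cases p) (auto simp: hom_diag_iff)
  show ?thesis
    using assms(3,4)
  proof (induction rule: hom_eqv_induct)
    case refl
    have "Idt J j \<in> Hom J j j" using cats p by (simp add: Hom_iff)
    then show ?case using p by auto
  next
    case (fwd t f)
    then obtain k u v where uv: "u \<in> Hom J j k" "v \<in> Hom J (Dom J t) k" "fmor X u \<cdot> g = fmor X v \<cdot> f"
      using p by auto
    obtain d s s' where s: "s \<in> Hom J k d" "s' \<in> Hom J (Cod J t) d" "s \<cdot>\<^bsub>J\<^esub> v = s' \<cdot>\<^bsub>J\<^esub> t"
      using filtered_square[OF J uv(2), of t "Cod J t"] fwd(1) by (metis Hom_iff)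
    have "fmor X (s \<cdot>\<^bsub>J\<^esub> v) = fmor X (s' \<cdot>\<^bsub>J\<^esub> t)" using s(3) by simp
    then have e: "fmor X s \<cdot> fmor X v = fmor X s' \<cdot> fmor X t"
      using s(1,2) uv fwd X by (simp add: Hom_iff)
    have "fmor X (s \<cdot>\<^bsub>J\<^esub> u) \<cdot> g = fmor X s' \<cdot> (fmor X t \<cdot> f)"
      using comp_reassoc[OF e] s(1,2) uv p fwd(1,2) X cats by (simp add: Hom_iff)
    moreover have "s \<cdot>\<^bsub>J\<^esub> u \<in> Hom J j d" using comp_Hom cats s uv by metis
    ultimately show ?case using s(2) p by auto
  next
    case (bwd t f)
    then obtain k u v where uv: "u \<in> Hom J j k" "v \<in> Hom J (Cod J t) k"
      "fmor X u \<cdot> g = fmor X v \<cdot> (fmor X t \<cdot> f)"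
      using p by auto
    have "fmor X u \<cdot> g = fmor X (v \<cdot>\<^bsub>J\<^esub> t) \<cdot> f"
      using uv bwd(1,2) X cats by (simp add: Hom_iff)
    moreover have "v \<cdot>\<^bsub>J\<^esub> t \<in> Hom J (Dom J t) k" using uv bwd(1) cats by (simp add: Hom_iff)
    ultimately show ?case using uv(1) p by auto
  qed
qed

lemma hom_eqvI:
  fixes C (structure)
  assumes X: "is_functor J C X" and g: "g \<in> Hom C a (fob X j)" "g' \<in> Hom C a (fob X j')"
    and uv: "u \<in> Hom J j k" "v \<in> Hom J j' k" "fmor X u \<cdot> g = fmor X v \<cdot> g'"
  shows "((j, g), (j', g')) \<in> hom_eqv J C X a"
proof -
  have "((j, g), (k, fmor X u \<cdot> g)) \<in> hom_eqv J C X a"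
    using hom_eqv_step[of u J g C a X] g uv by (simp add: Hom_iff)
  moreover have "((j', g'), (k, fmor X v \<cdot> g')) \<in> hom_eqv J C X a"
    using hom_eqv_step[of v J g' C a X] g uv by (simp add: Hom_iff)
  ultimately show ?thesis
    using uv(3) hom_eqv_sym hom_eqv_trans by metis
qed

lemma finitely_presentable_ob: "finitely_presentable U C A \<Longrightarrow> A \<in> Ob C"
  by (simp add: finitely_presentable_def presentable_wrt_def)

text \<open>The uniqueness half of presentability: representatives with the same image in the
  colimit generate the unique class over that image, so a class is a whole fibre.\<close>

lemma finitely_presentable_class:
  fixes C (structure) and J :: "('u, 'u) cat"
  assumes A: "finitely_presentable (U :: 'u itself) C A" and J: "small_filtered J"
    and X: "is_functor J C X" and L: "is_colimit J C X L \<iota>"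
    and g: "j \<in> Ob J" "g \<in> Hom C A (fob X j)"
  shows "hom_eqv J C X A `` {(j, g)} =
    {(k, h). k \<in> Ob J \<and> h \<in> Hom C A (fob X k) \<and> \<iota> k \<cdot> h = \<iota> j \<cdot> g}"
    (is "?E (j, g) = ?R")
proof -
  have cats: "category J" "category C" using is_functor_cat[OF X] by auto
  note cc = colimit_cocone[OF L]
  have cls: "?E (k, h) \<in> hom_colim J C X A \<and> (\<forall>(k', h')\<in>?E (k, h). \<iota> k' \<cdot> h' = \<iota> k \<cdot> h)"
    if "k \<in> Ob J" "h \<in> Hom C A (fob X k)" for k h
    using that hom_eqv_cocone[OF X cc, of "(k, h)" _ A] unfolding hom_colim_def
    by (fastforce intro: quotientI simp: hom_diag_iff)
  have "\<iota> j \<cdot> g \<in> Hom C A L"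
    using g cocone_facts[OF cc] cats by (simp add: Hom_iff)
  then have un: "\<exists>!c. c \<in> hom_colim J C X A \<and> (\<forall>(k, h)\<in>c. \<iota> k \<cdot> h = \<iota> j \<cdot> g)"
    using A J X L unfolding finitely_presentable_def presentable_wrt_def by blast
  show ?thesis
  proof (intro set_eqI iffI)
    fix q assume q: "q \<in> ?E (j, g)"
    then have "q \<in> hom_diag J C X A"
      using hom_eqv_diag[OF X, of "(j, g)" q A] g by (simp add: hom_diag_iff)
    then show "q \<in> ?R"
      using cls[OF g] q by (cases q) (auto simp: hom_diag_iff)
  next
    fix q assume "q \<in> ?R"
    then obtain k h where q: "q = (k, h)" "k \<in> Ob J" "h \<in> Hom C A (fob X k)" "\<iota> k \<cdot> h = \<iota> j \<cdot> g"
      by blast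
    have "?E (k, h) = ?E (j, g)"
      using un cls[OF g] cls[OF q(2,3)] unfolding q(4) by blast
    then show "q \<in> ?E (j, g)"
      using q(1) hom_eqv_refl by (metis Image_singleton_iff)
  qed
qed

lemma finitely_presentable_factor':
  fixes J :: "('u, 'u) cat"
  assumes A: "finitely_presentable (U :: 'u itself) C A" and J: "small_filtered J"
    and X: "is_functor J C X" and L: "is_colimit J C X L \<iota>" and f: "f \<in> Hom C A L"
  shows "\<exists>j\<in>Ob J. \<exists>g\<in>Hom C A (fob X j). \<iota> j \<cdot>\<^bsub>C\<^esub> g = f"
proof -
  obtain c where c: "c \<in> hom_colim J C X A" "\<forall>(j, g)\<in>c. \<iota> j \<cdot>\<^bsub>C\<^esub> g = f"
    using A J X L f unfolding finitely_presentable_def presentable_wrt_def by blast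
  then obtain j g where "(j, g) \<in> hom_diag J C X A" "c = hom_eqv J C X A `` {(j, g)}"
    unfolding hom_colim_def by (metis quotientE surj_pair)
  then show ?thesis
    using c(2) hom_eqv_refl by (fastforce simp: hom_diag_iff)
qed

lemma finitely_presentable_equalize':
  fixes C (structure) and J :: "('u, 'u) cat"
  assumes A: "finitely_presentable (U :: 'u itself) C A" and J: "small_filtered J"
    and X: "is_functor J C X" and L: "is_colimit J C X L \<iota>"
    and g: "j \<in> Ob J" "g \<in> Hom C A (fob X j)" "g' \<in> Hom C A (fob X j)" "\<iota> j \<cdot> g = \<iota> j \<cdot> g'"
  shows "\<exists>k. \<exists>u\<in>Hom J j k. fmor X u \<cdot> g = fmor X u \<cdot> g'"
proof -
  have cats: "category J" "category C" using is_functor_cat[OF X] by auto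
  have fJ: "filtered J" using J by (simp add: small_filtered_def)
  have "((j, g), (j, g')) \<in> hom_eqv J C X A"
    using finitely_presentable_class[OF A J X L g(1,2)] g by auto
  then obtain k u v where uv: "u \<in> Hom J j k" "v \<in> Hom J j k" "fmor X u \<cdot> g = fmor X v \<cdot> g'"
    using hom_eqv_filtered[OF fJ X, of "(j, g)" "(j, g')" A] g by (auto simp: hom_diag_iff)
  \<comment> \<open>Equivalence only yields two possibly different arrows \<open>u\<close> and
    \<open>v\<close> into the stage \<open>k\<close>; after coequalizing them a single transition
    map does the work.\<close>
  obtain d w where w: "w \<in> Hom J k d" "w \<cdot>\<^bsub>J\<^esub> u = w \<cdot>\<^bsub>J\<^esub> v"
    using filtered_coeq[OF fJ uv(1,2)] by blast
  have "fmor X (w \<cdot>\<^bsub>J\<^esub> u) = fmor X (w \<cdot>\<^bsub>J\<^esub> v)" using w by simp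
  then have e: "fmor X w \<cdot> fmor X u = fmor X w \<cdot> fmor X v"
    using w(1) uv X by (simp add: Hom_iff)
  have "fmor X (w \<cdot>\<^bsub>J\<^esub> u) \<cdot> g = fmor X (w \<cdot>\<^bsub>J\<^esub> u) \<cdot> g'"
    using comp_reassoc[OF e] uv w(1) X g cats by (simp add: Hom_iff)
  moreover have "w \<cdot>\<^bsub>J\<^esub> u \<in> Hom J j d" using uv w cats by (simp add: Hom_iff)
  ultimately show ?thesis by blast
qed

text \<open>Relabelling extends the factorization property from index categories on
  \<open>'u\<close> to small filtered ones of any type.\<close>

lemma finitely_presentable_factor:
  assumes A: "finitely_presentable U C A" and J: "small_index U J"
    and X: "is_functor J C X" and L: "is_colimit J C X L \<iota>" and f: "f \<in> Hom C A L"
  obtains j g where "j \<in> Ob J" "g \<in> Hom C A (fob X j)" "\<iota> j \<cdot>\<^bsub>C\<^esub> g = f"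
proof -
  have K: "category J" using is_functor_cat[OF X] by simp
  obtain e e' where e: "inj_on e (Ob J)" "inj_on e' (Mor J)" "small_filtered (relabel_cat e e' J :: ('a, 'a) cat)"
    using small_index_relabel[OF J] by blast
  have "is_colimit J C X L ((\<iota> \<circ> inv_into (Ob J) e) \<circ> e)"
    by (rule iffD1[OF colimit_cong[OF K] L]) (use e in simp)
  from finitely_presentable_factor'[OF A e(3) functor_relabel[OF K e(1,2) X]
      this[folded colimit_relabel[OF K e(1,2)]] f]
  show thesis
    using that e by (auto simp: relabel_cat_simps[OF K e(1,2)] relabel_fctr_simps[OF K e(1,2)])
qed

lemma finitely_presentable_equalize:
  fixes C (structure)
  assumes A: "finitely_presentable U C A" and J: "small_index U J"
    and X: "is_functor J C X" and L: "is_colimit J C X L \<iota>"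
    and g: "j \<in> Ob J" "g \<in> Hom C A (fob X j)" "g' \<in> Hom C A (fob X j)" "\<iota> j \<cdot> g = \<iota> j \<cdot> g'"
  obtains k u where "u \<in> Hom J j k" "fmor X u \<cdot> g = fmor X u \<cdot> g'"
proof -
  have K: "category J" using is_functor_cat[OF X] by simp
  obtain e e' where e: "inj_on e (Ob J)" "inj_on e' (Mor J)" "small_filtered (relabel_cat e e' J :: ('a, 'a) cat)"
    using small_index_relabel[OF J] by blast
  have L': "is_colimit J C X L ((\<iota> \<circ> inv_into (Ob J) e) \<circ> e)"
    by (rule iffD1[OF colimit_cong[OF K] L]) (use e in simp)
  have "\<exists>k. \<exists>u\<in>Hom (relabel_cat e e' J) (e j) k.
      fmor (relabel_fctr e e' J X) u \<cdot> g = fmor (relabel_fctr e e' J X) u \<cdot> g'"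
    by (rule finitely_presentable_equalize'[OF A e(3) functor_relabel[OF K e(1,2) X]
      L'[folded colimit_relabel[OF K e(1,2)]]])
      (use g e in \<open>simp_all add: relabel_cat_simps[OF K e(1,2)] relabel_fctr_simps[OF K e(1,2)]\<close>)
  then obtain u where u: "u \<in> Mor J" "Dom J u = j" "fmor X u \<cdot> g = fmor X u \<cdot> g'"
    using g(1) K by (auto simp: Hom_iff relabel_cat_simps[OF K e(1,2)] relabel_fctr_simps[OF K e(1,2)] e_eq_iff[OF K e(1,2)])
  then show thesis using that[of u "Cod J u"] by (simp add: Hom_iff)
qed

text \<open>The usual elementary criterion. Existence of a factorization provides a class over
  \<open>f\<close>; the equalizing condition makes any two representatives over \<open>f\<close>
  equivalent, hence the class unique.\<close>

lemma finitely_presentableI: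
  fixes C (structure) and U :: "'u itself"
  assumes ob: "A \<in> Ob C"
    and fac: "\<And>(J :: ('u, 'u) cat) X L \<iota> f. small_index U J \<Longrightarrow> is_functor J C X \<Longrightarrow> is_colimit J C X L \<iota> \<Longrightarrow>
       f \<in> Hom C A L \<Longrightarrow> \<exists>j\<in>Ob J. \<exists>g\<in>Hom C A (fob X j). \<iota> j \<cdot> g = f"
    and eq: "\<And>(J :: ('u, 'u) cat) X L \<iota> j g g'. small_index U J \<Longrightarrow> is_functor J C X \<Longrightarrow> is_colimit J C X L \<iota> \<Longrightarrow>
       j \<in> Ob J \<Longrightarrow> g \<in> Hom C A (fob X j) \<Longrightarrow> g' \<in> Hom C A (fob X j) \<Longrightarrow> \<iota> j \<cdot> g = \<iota> j \<cdot> g' \<Longrightarrow>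
       \<exists>k. \<exists>u\<in>Hom J j k. fmor X u \<cdot> g = fmor X u \<cdot> g'"
  shows "finitely_presentable U C A"
  unfolding finitely_presentable_def presentable_wrt_def
proof (intro conjI allI impI ballI ob; elim conjE)
  fix J :: "('u, 'u) cat" and X L \<iota> f
  assume J: "small_filtered J" and X: "is_functor J C X" and L: "is_colimit J C X L \<iota>" and f: "f \<in> Hom C A L"
  have si: "small_index U J" using J unfolding small_filtered_iff[of J U] .
  have fJ: "filtered J" using J by (simp add: small_filtered_def)
  have cats: "category J" "category C" using is_functor_cat[OF X] by auto
  note cc = colimit_cocone[OF L]
  note cf = cocone_facts[OF cc]
  have eqv: "((j, g), (j', g')) \<in> hom_eqv J C X A"
    if g: "j \<in> Ob J" "g \<in> Hom C A (fob X j)" "j' \<in> Ob J" "g' \<in> Hom C A (fob X j')" "\<iota> j \<cdot> g = \<iota> j' \<cdot> g'"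
    for j j' g g'
  proof -
    obtain k u v where uv: "k \<in> Ob J" "u \<in> Hom J j k" "v \<in> Hom J j' k"
      using filtered_join[OF fJ g(1,3)] by blast
    have c1: "\<iota> k \<cdot> (fmor X u \<cdot> g) = \<iota> j \<cdot> g"
      using comp_reassoc[OF cocone_comm[OF cc, of u]] uv g X cats cf by (simp add: Hom_iff)
    have c2: "\<iota> k \<cdot> (fmor X v \<cdot> g') = \<iota> j' \<cdot> g'"
      using comp_reassoc[OF cocone_comm[OF cc, of v]] uv g X cats cf by (simp add: Hom_iff)
    have m: "fmor X u \<cdot> g \<in> Hom C A (fob X k)" "fmor X v \<cdot> g' \<in> Hom C A (fob X k)"
      using uv g X cats by (simp_all add: Hom_iff)
    obtain d w where w: "w \<in> Hom J k d"
      "fmor X w \<cdot> (fmor X u \<cdot> g) = fmor X w \<cdot> (fmor X v \<cdot> g')"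
      using eq[OF si X L uv(1) m] c1 c2 g(5) by auto
    show ?thesis
      by (rule hom_eqvI[OF X g(2,4) comp_Hom[OF cats(1) uv(2) w(1)] comp_Hom[OF cats(1) uv(3) w(1)]])
        (use w uv g X cats in \<open>simp add: Hom_iff\<close>)
  qed
  obtain j g where g: "j \<in> Ob J" "g \<in> Hom C A (fob X j)" "\<iota> j \<cdot> g = f"
    using fac[OF si X L f] by blast
  let ?c = "hom_eqv J C X A `` {(j, g)}"
  show "\<exists>!c. c \<in> hom_colim J C X A \<and> (\<forall>(j, g)\<in>c. \<iota> j \<cdot> g = f)"
  proof (rule ex1I[of _ ?c])
    show "?c \<in> hom_colim J C X A \<and> (\<forall>(j, g)\<in>?c. \<iota> j \<cdot> g = f)"
      using g hom_eqv_cocone[OF X cc, of "(j, g)" _ A] unfolding hom_colim_def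
      by (fastforce intro: quotientI simp: hom_diag_iff)
  next
    fix c assume c: "c \<in> hom_colim J C X A \<and> (\<forall>(j, g)\<in>c. \<iota> j \<cdot> g = f)"
    then obtain k h where k: "(k, h) \<in> hom_diag J C X A" "c = hom_eqv J C X A `` {(k, h)}"
      unfolding hom_colim_def by (metis quotientE surj_pair)
    then have "\<iota> k \<cdot> h = f" using c hom_eqv_refl by fastforce
    then have e: "((k, h), (j, g)) \<in> hom_eqv J C X A"
      using eqv k(1) g by (simp add: hom_diag_iff)
    show "c = ?c"
      unfolding k(2) using hom_eqv_trans[OF e] hom_eqv_trans[OF hom_eqv_sym[OF e]] by auto
  qed
qed

section \<open>Finite colimits of finitely presentable objects\<close>

lemma filtered_upper_bound:
  assumes J: "filtered J" and "finite S" "S \<subseteq> Ob J"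
  shows "\<exists>c\<in>Ob J. \<forall>s\<in>S. Hom J s c \<noteq> {}"
  using assms(2,3)
proof (induction rule: finite_induct)
  case empty
  show ?case using J by (auto simp: filtered_def)
next
  case (insert x S)
  then obtain c where c: "c \<in> Ob J" "\<forall>s\<in>S. Hom J s c \<noteq> {}" by auto
  obtain d u v where d: "d \<in> Ob J" "u \<in> Hom J c d" "v \<in> Hom J x d"
    using filtered_join[OF J c(1), of x] insert by blast
  have "Hom J s d \<noteq> {}" if "s \<in> S" for s
    using c(2) that comp_Hom[OF filtered_cat[OF J] _ d(2)] by blast
  then show ?case using d by auto
qed

text \<open>A condition that persists along later arrows can be arranged for finitely many indices
  at once, by completing the individual arrows out of \<open>j\<close> to commutative
  squares.\<close>

lemma filtered_finite_property:
  assumes J: "filtered J" and "j \<in> Ob J" and "finite S"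
    and ex: "\<And>m. m \<in> S \<Longrightarrow> \<exists>c. \<exists>u\<in>Hom J j c. E m u"
    and stable: "\<And>m c u d v. m \<in> S \<Longrightarrow> u \<in> Hom J j c \<Longrightarrow> E m u \<Longrightarrow> v \<in> Hom J c d \<Longrightarrow> E m (v \<cdot>\<^bsub>J\<^esub> u)"
  shows "\<exists>c. \<exists>u\<in>Hom J j c. \<forall>m\<in>S. E m u"
  using assms(3-5)
proof (induction rule: finite_induct)
  case empty
  have "Idt J j \<in> Hom J j j" using filtered_cat[OF J] assms(2) by (simp add: Hom_iff)
  then show ?case by auto
next
  case (insert x S)
  have "\<exists>c. \<exists>u\<in>Hom J j c. \<forall>m\<in>S. E m u"
    using insert.prems by (intro insert.IH) (meson insertI2)+
  then obtain c u where c: "u \<in> Hom J j c" "\<forall>m\<in>S. E m u" by blast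
  obtain c' u' where c': "u' \<in> Hom J j c'" "E x u'" using insert.prems(1)[of x] by auto
  obtain d s t where d: "s \<in> Hom J c d" "t \<in> Hom J c' d" "s \<cdot>\<^bsub>J\<^esub> u = t \<cdot>\<^bsub>J\<^esub> u'"
    using filtered_square[OF J c(1) c'(1)] by blast
  have "E x (s \<cdot>\<^bsub>J\<^esub> u)" unfolding d(3) using insert.prems(2) c' d by blast
  moreover have "E m (s \<cdot>\<^bsub>J\<^esub> u)" if "m \<in> S" for m using insert.prems(2) c d that by blast
  ultimately show ?case
    using comp_Hom[OF filtered_cat[OF J] c(1) d(1)] by (intro exI[of _ d] bexI[of _ "s \<cdot>\<^bsub>J\<^esub> u"]) auto
qed

text \<open>Finiteness enters twice. Finitely many legs factor through a common stage, and finitely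
  many compatibility equations, true in the colimit, hold together at one later stage, where the
  legs form a cocone. Uniqueness is likewise arranged for all legs at once.\<close>

lemma finitely_presentable_finite_colimit:
  fixes C (structure) and U :: "'u itself"
  assumes K: "finite_cat K" and D: "is_functor K C D" and c: "is_colimit K C D c \<kappa>"
    and fp: "\<And>k. k \<in> Ob K \<Longrightarrow> finitely_presentable U C (fob D k)"
  shows "finitely_presentable U C c"
proof (rule finitely_presentableI)
  have fin: "finite (Ob K)" "finite (Mor K)" using K by (auto simp: finite_cat_def)
  have cats: "category K" "category C" using is_functor_cat[OF D] by auto
  note cc = colimit_cocone[OF c]
  note cf = cocone_facts[OF cc]
  show "c \<in> Ob C" by (rule cf(1))
  fix J :: "('u, 'u) cat" and X L \<iota>
  assume J: "small_index U J" and X: "is_functor J C X" and L: "is_colimit J C X L \<iota>"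
  have fJ: "filtered J" using J by (simp add: small_index_def)
  note cJ = filtered_cat[OF fJ]
  note lf = cocone_facts[OF colimit_cocone[OF L]] and lcom = cocone_comm[OF colimit_cocone[OF L]]
  {
    fix f assume f: "f \<in> Hom C c L"
    have "\<exists>j g. j \<in> Ob J \<and> g \<in> Hom C (fob D k) (fob X j) \<and> \<iota> j \<cdot> g = f \<cdot> \<kappa> k" if k: "k \<in> Ob K" for k
    proof -
      have "f \<cdot> \<kappa> k \<in> Hom C (fob D k) L" using f cf k cats by (simp add: Hom_iff)
      then show ?thesis using finitely_presentable_factor[OF fp[OF k] J X L] by metis
    qed
    then obtain j g where jg: "\<And>k. k \<in> Ob K \<Longrightarrow> j k \<in> Ob J"
      "\<And>k. k \<in> Ob K \<Longrightarrow> g k \<in> Hom C (fob D k) (fob X (j k))"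
      "\<And>k. k \<in> Ob K \<Longrightarrow> \<iota> (j k) \<cdot> g k = f \<cdot> \<kappa> k"
      by metis
    obtain z where z: "z \<in> Ob J" "\<And>k. k \<in> Ob K \<Longrightarrow> Hom J (j k) z \<noteq> {}"
      using filtered_upper_bound[OF fJ, of "j ` Ob K"] fin(1) jg(1) by (metis (no_types, lifting) finite_imageI image_eqI image_subsetI)
    then have "\<forall>k\<in>Ob K. \<exists>w. w \<in> Hom J (j k) z" by blast
    from bchoice[OF this] obtain w where w: "\<And>k. k \<in> Ob K \<Longrightarrow> w k \<in> Hom J (j k) z" by blast
    define g' where "g' k = fmor X (w k) \<cdot> g k" for k
    have g': "g' k \<in> Hom C (fob D k) (fob X z)" "\<iota> z \<cdot> g' k = f \<cdot> \<kappa> k" if "k \<in> Ob K" for k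
    proof -
      show "g' k \<in> Hom C (fob D k) (fob X z)"
        unfolding g'_def using jg(1,2)[OF that] w[OF that] X cats by (simp add: Hom_iff)
      have "\<iota> z \<cdot> fmor X (w k) = \<iota> (j k)" using lcom[of "w k"] w[OF that] by (simp add: Hom_iff)
      from comp_reassoc[OF this cats(2), of "g k"] show "\<iota> z \<cdot> g' k = f \<cdot> \<kappa> k"
        unfolding g'_def using jg[OF that] w[OF that] X cats lf z by (simp add: Hom_iff)
    qed
    have "\<exists>d. \<exists>u\<in>Hom J z d. \<forall>m\<in>Mor K. fmor X u \<cdot> (g' (Cod K m) \<cdot> fmor D m) = fmor X u \<cdot> g' (Dom K m)"
    proof (rule filtered_finite_property[OF fJ z(1) fin(2)])
      fix m assume m: "m \<in> Mor K"
      then have d: "Dom K m \<in> Ob K" "Cod K m \<in> Ob K" using cats by auto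
      have h: "g' (Cod K m) \<cdot> fmor D m \<in> Hom C (fob D (Dom K m)) (fob X z)"
        using g'(1)[OF d(2)] D m cats by (simp add: Hom_iff)
      have e: "\<iota> z \<cdot> (g' (Cod K m) \<cdot> fmor D m) = \<iota> z \<cdot> g' (Dom K m)"
        using comp_reassoc[OF g'(2)[OF d(2)] cats(2), of "fmor D m"] g'[OF d(1)] g'(1)[OF d(2)] D m cats lf z d cf
          f cocone_comm[OF cc m] by (simp add: Hom_iff)
      show "\<exists>d. \<exists>u\<in>Hom J z d. fmor X u \<cdot> (g' (Cod K m) \<cdot> fmor D m) = fmor X u \<cdot> g' (Dom K m)"
        using finitely_presentable_equalize[OF fp[OF d(1)] J X L z(1) h g'(1)[OF d(1)] e] by metis
    next
      fix m d u e v
      assume m: "m \<in> Mor K" and u: "u \<in> Hom J z d" and v: "v \<in> Hom J d e"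
        and eq: "fmor X u \<cdot> (g' (Cod K m) \<cdot> fmor D m) = fmor X u \<cdot> g' (Dom K m)"
      have d: "Dom K m \<in> Ob K" "Cod K m \<in> Ob K" using m cats by auto
      show "fmor X (v \<cdot>\<^bsub>J\<^esub> u) \<cdot> (g' (Cod K m) \<cdot> fmor D m) = fmor X (v \<cdot>\<^bsub>J\<^esub> u) \<cdot> g' (Dom K m)"
        using u v m d g'(1)[OF d(1)] g'(1)[OF d(2)] X D cats eq by (simp add: Hom_iff)
    qed
    then obtain d u where u: "u \<in> Hom J z d"
      "\<And>m. m \<in> Mor K \<Longrightarrow> fmor X u \<cdot> (g' (Cod K m) \<cdot> fmor D m) = fmor X u \<cdot> g' (Dom K m)"
      by blast
    have d: "d \<in> Ob J" using Hom_ob[OF cJ u(1)] by simp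
    have "cocone K C D (fob X d) (\<lambda>k. fmor X u \<cdot> g' k)"
      unfolding cocone_def
    proof (intro conjI ballI)
      show "fob X d \<in> Ob C" using d X by simp
      show "fmor X u \<cdot> g' k \<in> Hom C (fob D k) (fob X d)" if "k \<in> Ob K" for k
        using g'(1)[OF that] u(1) X cats by (simp add: Hom_iff)
      show "(fmor X u \<cdot> g' (Cod K m)) \<cdot> fmor D m = fmor X u \<cdot> g' (Dom K m)" if "m \<in> Mor K" for m
        using u(2)[OF that] u(1) g'(1)[of "Cod K m"] D X cats that by (simp add: Hom_iff)
    qed
    then obtain h where h: "h \<in> Hom C c (fob X d)" "\<And>k. k \<in> Ob K \<Longrightarrow> h \<cdot> \<kappa> k = fmor X u \<cdot> g' k"
      using colimit_induced[OF c] by blast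
    have "\<iota> d \<cdot> h = f"
    proof (rule colimit_unique[OF cats(2) D c _ f])
      show "\<iota> d \<cdot> h \<in> Hom C c L" using h(1) lf d cats by (simp add: Hom_iff)
      fix k assume k: "k \<in> Ob K"
      have "\<iota> d \<cdot> fmor X u = \<iota> z" using lcom[of u] u(1) by (simp add: Hom_iff)
      from comp_reassoc[OF this cats(2), of "g' k"] show "(\<iota> d \<cdot> h) \<cdot> \<kappa> k = f \<cdot> \<kappa> k"
        using h(1) h(2)[OF k] g'[OF k] u(1) X cats lf cf d z k by (simp add: Hom_iff)
    qed
    then show "\<exists>j\<in>Ob J. \<exists>g\<in>Hom C c (fob X j). \<iota> j \<cdot> g = f" using h(1) d by blast
  }
  fix j g g' assume j: "j \<in> Ob J" and g: "g \<in> Hom C c (fob X j)" "g' \<in> Hom C c (fob X j)"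
    and eq: "\<iota> j \<cdot> g = \<iota> j \<cdot> g'"
  have "\<exists>d. \<exists>u\<in>Hom J j d. \<forall>k\<in>Ob K. fmor X u \<cdot> (g \<cdot> \<kappa> k) = fmor X u \<cdot> (g' \<cdot> \<kappa> k)"
  proof (rule filtered_finite_property[OF fJ j fin(1)])
    fix k assume k: "k \<in> Ob K"
    have h: "g \<cdot> \<kappa> k \<in> Hom C (fob D k) (fob X j)" "g' \<cdot> \<kappa> k \<in> Hom C (fob D k) (fob X j)"
      using g cf k cats by (simp_all add: Hom_iff)
    have "\<iota> j \<cdot> (g \<cdot> \<kappa> k) = \<iota> j \<cdot> (g' \<cdot> \<kappa> k)"
      using comp_reassoc[OF eq cats(2), of "\<kappa> k"] g cf k cats lf j by (simp add: Hom_iff)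
    then show "\<exists>d. \<exists>u\<in>Hom J j d. fmor X u \<cdot> (g \<cdot> \<kappa> k) = fmor X u \<cdot> (g' \<cdot> \<kappa> k)"
      using finitely_presentable_equalize[OF fp[OF k] J X L j h] by metis
  next
    fix k d u e v
    assume k: "k \<in> Ob K" and u: "u \<in> Hom J j d" and v: "v \<in> Hom J d e"
      and eq: "fmor X u \<cdot> (g \<cdot> \<kappa> k) = fmor X u \<cdot> (g' \<cdot> \<kappa> k)"
    show "fmor X (v \<cdot>\<^bsub>J\<^esub> u) \<cdot> (g \<cdot> \<kappa> k) = fmor X (v \<cdot>\<^bsub>J\<^esub> u) \<cdot> (g' \<cdot> \<kappa> k)"
      using u v k g cf X cats eq by (simp add: Hom_iff)
  qed
  then obtain d u where u: "u \<in> Hom J j d"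
    "\<And>k. k \<in> Ob K \<Longrightarrow> fmor X u \<cdot> (g \<cdot> \<kappa> k) = fmor X u \<cdot> (g' \<cdot> \<kappa> k)" by blast
  have "fmor X u \<cdot> g = fmor X u \<cdot> g'"
    by (rule colimit_unique[OF cats(2) D c, of _ "fob X d"]) (use u g X cats cf in \<open>simp_all add: Hom_iff\<close>)
  then show "\<exists>k. \<exists>u\<in>Hom J j k. fmor X u \<cdot> g = fmor X u \<cdot> g'" using u(1) by blast
qed

section \<open>Coslices and posets\<close>

text \<open>A morphism is stored as a composable pair, its source \<open>u\<close> and the arrow
  \<open>v\<close> that follows. The target is the composite and need not be recorded.\<close>

definition coslice :: "('i, 'j) cat \<Rightarrow> 'i \<Rightarrow> ('j, 'j \<times> 'j) cat" where
  "coslice J a =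
    \<lparr>Ob = {u \<in> Mor J. Dom J u = a},
     Mor = {(u, v). u \<in> Mor J \<and> v \<in> Mor J \<and> Dom J u = a \<and> Cod J u = Dom J v},
     Dom = fst, Cod = (\<lambda>(u, v). v \<cdot>\<^bsub>J\<^esub> u), Idt = (\<lambda>u. (u, Idt J (Cod J u))),
     Cmp = (\<lambda>(u', v') (u, v). (u, v' \<cdot>\<^bsub>J\<^esub> v))\<rparr>"

definition coslice_fctr :: "('i, 'j) cat \<Rightarrow> ('j, 'j \<times> 'j, 'i, 'j) fctr" where
  "coslice_fctr J = \<lparr>fob = Cod J, fmor = snd\<rparr>"

lemma coslice_simps:
  "u \<in> Ob (coslice J a) \<longleftrightarrow> u \<in> Mor J \<and> Dom J u = a"
  "(u, v) \<in> Mor (coslice J a) \<longleftrightarrow> u \<in> Mor J \<and> v \<in> Mor J \<and> Dom J u = a \<and> Cod J u = Dom J v"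
  "Dom (coslice J a) (u, v) = u" "Cod (coslice J a) (u, v) = v \<cdot>\<^bsub>J\<^esub> u"
  "Idt (coslice J a) u = (u, Idt J (Cod J u))"
  "(u', v') \<cdot>\<^bsub>coslice J a\<^esub> (u, v) = (u, v' \<cdot>\<^bsub>J\<^esub> v)"
  "fob (coslice_fctr J) = Cod J" "fmor (coslice_fctr J) = snd"
  by (simp_all add: coslice_def coslice_fctr_def)

lemma category_coslice:
  assumes "category J"
  shows "category (coslice J a)"
  unfolding category_def using assms
  by (simp add: coslice_simps split_paired_all Ball_def Hom_iff) (metis cod_comp comp_assoc)

lemma functor_coslice:
  assumes "category J"
  shows "is_functor (coslice J a) J (coslice_fctr J)"
  unfolding is_functor_def using assms category_coslice[OF assms]
  by (simp add: coslice_simps split_paired_all Ball_def Hom_iff)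

lemma filtered_coslice:
  assumes J: "filtered J" and a: "a \<in> Ob J"
  shows "filtered (coslice J a)"
proof (rule filteredI)
  note cJ = filtered_cat[OF J]
  show "category (coslice J a)" using cJ by (rule category_coslice)
  have "Idt J a \<in> Ob (coslice J a)" using cJ a by (simp add: coslice_simps)
  then show "Ob (coslice J a) \<noteq> {}" by blast
  show "\<exists>w s t. s \<in> Hom (coslice J a) u w \<and> t \<in> Hom (coslice J a) v w"
    if "u \<in> Ob (coslice J a)" "v \<in> Ob (coslice J a)" for u v
  proof -
    have uv: "u \<in> Hom J a (Cod J u)" "v \<in> Hom J a (Cod J v)" using that by (auto simp: coslice_simps Hom_iff)
    obtain d s t where d: "s \<in> Hom J (Cod J u) d" "t \<in> Hom J (Cod J v) d" "s \<cdot>\<^bsub>J\<^esub> u = t \<cdot>\<^bsub>J\<^esub> v"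
      using filtered_square[OF J uv] by blast
    have "(u, s) \<in> Hom (coslice J a) u (s \<cdot>\<^bsub>J\<^esub> u)" "(v, t) \<in> Hom (coslice J a) v (s \<cdot>\<^bsub>J\<^esub> u)"
      using d uv by (auto simp: Hom_iff coslice_simps)
    then show ?thesis by blast
  qed
  show "\<exists>w. \<exists>t\<in>Hom (coslice J a) v w. t \<cdot>\<^bsub>coslice J a\<^esub> p = t \<cdot>\<^bsub>coslice J a\<^esub> q"
    if pq: "p \<in> Hom (coslice J a) u v" "q \<in> Hom (coslice J a) u v" for u v p q
  proof -
    obtain s s' where s: "p = (u, s)" "q = (u, s')" using pq by (cases p; cases q) (auto simp: Hom_iff coslice_simps)
    have st: "s \<in> Hom J (Cod J u) (Cod J v)" "s' \<in> Hom J (Cod J u) (Cod J v)" and v: "v \<in> Mor J" "Dom J v = a"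
    proof -
      have "u \<in> Mor J" "Dom J u = a" "s \<in> Mor J" "s' \<in> Mor J" "Cod J u = Dom J s" "Cod J u = Dom J s'"
        "s \<cdot>\<^bsub>J\<^esub> u = v" "s' \<cdot>\<^bsub>J\<^esub> u = v"
        using pq unfolding s by (simp_all add: Hom_iff coslice_simps)
      moreover from this have "Cod J v = Cod J s" "Cod J v = Cod J s'" "v \<in> Mor J" "Dom J v = a"
        using cod_comp[OF cJ, of u s] cod_comp[OF cJ, of u s'] comp_mor[OF cJ, of u s] dom_comp[OF cJ, of u s]
        by simp_all
      ultimately show "s \<in> Hom J (Cod J u) (Cod J v)" "s' \<in> Hom J (Cod J u) (Cod J v)" "v \<in> Mor J" "Dom J v = a"
        by (simp_all add: Hom_iff)
    qed
    obtain d w where w: "w \<in> Hom J (Cod J v) d" "w \<cdot>\<^bsub>J\<^esub> s = w \<cdot>\<^bsub>J\<^esub> s'"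
      using filtered_coeq[OF J st] by blast
    have "(v, w) \<in> Hom (coslice J a) v (w \<cdot>\<^bsub>J\<^esub> v)" using w(1) v by (auto simp: Hom_iff coslice_simps)
    moreover have "(v, w) \<cdot>\<^bsub>coslice J a\<^esub> p = (v, w) \<cdot>\<^bsub>coslice J a\<^esub> q" using w s by (simp add: coslice_simps)
    ultimately show ?thesis by blast
  qed
qed

lemma (in universe) small_coslice:
  assumes "small_index U J" "a \<in> Ob J"
  shows "small_index U (coslice J a)"
proof -
  have J: "filtered J" "small U (Mor J)" using assms by (auto simp: small_index_def)
  have "small U (Ob (coslice J a))" "small U (Mor (coslice J a))"
    by (rule small_mono[OF J(2)], auto simp: coslice_simps)
      (rule small_mono[OF small_Times[OF J(2) J(2)]], auto simp: coslice_simps)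
  then show ?thesis using filtered_coslice[OF J(1) assms(2)] by (simp add: small_index_def)
qed

text \<open>Keeping only the stages together with an arrow from \<open>a\<close> leaves a filtered
  colimit unchanged. This lets a presentation begin at a stage through which a given map
  factors.\<close>

lemma cofinal_coslice:
  assumes J: "filtered J" and a: "a \<in> Ob J"
  shows "cofinal_fctr (coslice J a) J (coslice_fctr J)"
  unfolding cofinal_fctr_def
proof (intro conjI ballI)
  note cJ = filtered_cat[OF J]
  show "is_functor (coslice J a) J (coslice_fctr J)" using cJ by (rule functor_coslice)
  show "\<exists>e\<in>Ob (coslice J a). Hom J k (fob (coslice_fctr J) e) \<noteq> {}" if k: "k \<in> Ob J" for k
  proof -
    obtain c u v where "u \<in> Hom J k c" "v \<in> Hom J a c" using filtered_join[OF J k a] by blast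
    then show ?thesis by (auto simp: coslice_simps Hom_iff intro!: bexI[of _ v])
  qed
  fix e k v v' assume e: "e \<in> Ob (coslice J a)" and
    v: "v \<in> Hom J k (fob (coslice_fctr J) e)" "v' \<in> Hom J k (fob (coslice_fctr J) e)"
  obtain d w where w: "w \<in> Hom J (Cod J e) d" "w \<cdot>\<^bsub>J\<^esub> v = w \<cdot>\<^bsub>J\<^esub> v'"
    by (rule filtered_coeq[OF J v[unfolded coslice_simps]])
  have "(e, w) \<in> Hom (coslice J a) e (w \<cdot>\<^bsub>J\<^esub> e)" using w e by (auto simp: Hom_iff coslice_simps)
  moreover have "fmor (coslice_fctr J) (e, w) \<cdot>\<^bsub>J\<^esub> v = fmor (coslice_fctr J) (e, w) \<cdot>\<^bsub>J\<^esub> v'"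
    using w by (simp add: coslice_simps)
  ultimately show "\<exists>e'. \<exists>c\<in>Hom (coslice J a) e e'.
      fmor (coslice_fctr J) c \<cdot>\<^bsub>J\<^esub> v = fmor (coslice_fctr J) c \<cdot>\<^bsub>J\<^esub> v'"
    by blast
qed

definition poset_cat :: "'a set \<Rightarrow> ('a \<Rightarrow> 'a \<Rightarrow> bool) \<Rightarrow> ('a, 'a \<times> 'a) cat" where
  "poset_cat P le =
    \<lparr>Ob = P, Mor = {(a, b). a \<in> P \<and> b \<in> P \<and> le a b}, Dom = fst, Cod = snd,
     Idt = (\<lambda>a. (a, a)), Cmp = (\<lambda>(b', c) (a, b). (a, c))\<rparr>"

lemma poset_cat_simps [simp]:
  "Ob (poset_cat P le) = P"
  "(a, b) \<in> Mor (poset_cat P le) \<longleftrightarrow> a \<in> P \<and> b \<in> P \<and> le a b"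
  "Dom (poset_cat P le) = fst" "Cod (poset_cat P le) = snd"
  "Idt (poset_cat P le) a = (a, a)" "(b', c) \<cdot>\<^bsub>poset_cat P le\<^esub> (a, b) = (a, c)"
  by (simp_all add: poset_cat_def)

lemma category_poset:
  assumes "\<And>a. a \<in> P \<Longrightarrow> le a a" "\<And>a b c. le a b \<Longrightarrow> le b c \<Longrightarrow> le a c"
  shows "category (poset_cat P le)"
  unfolding category_def using assms by (auto simp: Hom_iff)

lemma filtered_poset:
  assumes "\<And>a. a \<in> P \<Longrightarrow> le a a" "\<And>a b c. le a b \<Longrightarrow> le b c \<Longrightarrow> le a c"
    "P \<noteq> {}" "\<And>a b. a \<in> P \<Longrightarrow> b \<in> P \<Longrightarrow> \<exists>c\<in>P. le a c \<and> le b c"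
  shows "filtered (poset_cat P le)"
proof (rule filteredI)
  show "category (poset_cat P le)" using assms(1,2) by (rule category_poset)
  show "Ob (poset_cat P le) \<noteq> {}" using assms(3) by simp
  fix a b assume "a \<in> Ob (poset_cat P le)" "b \<in> Ob (poset_cat P le)"
  then obtain c where "c \<in> P" "le a c" "le b c" "a \<in> P" "b \<in> P" using assms(4)[of a b] by auto
  then have "(a, c) \<in> Hom (poset_cat P le) a c" "(b, c) \<in> Hom (poset_cat P le) b c"
    by (auto simp: Hom_iff)
  then show "\<exists>c u v. u \<in> Hom (poset_cat P le) a c \<and> v \<in> Hom (poset_cat P le) b c" by blast
next
  fix a b u v assume uv: "u \<in> Hom (poset_cat P le) a b" "v \<in> Hom (poset_cat P le) a b"
  then have "u = v" by (cases u; cases v) (auto simp: Hom_iff)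
  moreover have "(b, b) \<in> Hom (poset_cat P le) b b"
    using uv assms(1) by (cases u) (auto simp: Hom_iff)
  ultimately show "\<exists>c. \<exists>w\<in>Hom (poset_cat P le) b c. w \<cdot>\<^bsub>poset_cat P le\<^esub> u = w \<cdot>\<^bsub>poset_cat P le\<^esub> v"
    by blast
qed

section \<open>Pushouts and initial objects as colimits\<close>

text \<open>The walking span with apex 0 and feet 1 and 2. Morphisms 0, 1, 2 are the identities and
  3, 4 the legs to 1 and 2, which explains the threshold 2 and the shift \<open>m - 2\<close>.
  Natural numbers are used because finite colimits are tested on them.\<close>

definition span_cat :: "(nat, nat) cat" where
  "span_cat =
    \<lparr>Ob = {0, 1, 2}, Mor = {0, 1, 2, 3, 4}, Dom = (\<lambda>m. if m \<le> 2 then m else 0),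
     Cod = (\<lambda>m. if m \<le> 2 then m else m - 2), Idt = (\<lambda>a. a),
     Cmp = (\<lambda>g f. if g \<le> 2 then f else g)\<rparr>"

definition span_fctr :: "('o, 'm) cat \<Rightarrow> 'm \<Rightarrow> 'm \<Rightarrow> (nat, nat, 'o, 'm) fctr" where
  "span_fctr C f g =
    (let ob = (\<lambda>n. if n = 0 then Dom C f else if n = 1 then Cod C f else Cod C g)
     in \<lparr>fob = ob, fmor = (\<lambda>m. if m \<le> 2 then Idt C (ob m) else if m = 3 then f else g)\<rparr>)"

lemma finite_span: "finite_cat span_cat"
  by (auto simp: finite_cat_def category_def span_cat_def Hom_iff)

lemma span_simps:
  "Ob span_cat = {0, 1, 2}" "Mor span_cat = {0, 1, 2, 3, 4}"
  "Dom span_cat 0 = 0" "Dom span_cat (Suc 0) = Suc 0" "Dom span_cat 2 = 2" "Dom span_cat 3 = 0" "Dom span_cat 4 = 0"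
  "Cod span_cat 0 = 0" "Cod span_cat (Suc 0) = Suc 0" "Cod span_cat 2 = 2" "Cod span_cat 3 = Suc 0" "Cod span_cat 4 = 2"
  "fob (span_fctr C f g) 0 = Dom C f" "fob (span_fctr C f g) (Suc 0) = Cod C f" "fob (span_fctr C f g) 2 = Cod C g"
  "fmor (span_fctr C f g) 0 = Idt C (Dom C f)" "fmor (span_fctr C f g) (Suc 0) = Idt C (Cod C f)"
  "fmor (span_fctr C f g) 2 = Idt C (Cod C g)"
  "fmor (span_fctr C f g) 3 = f" "fmor (span_fctr C f g) 4 = g"
  by (auto simp: span_cat_def span_fctr_def Let_def)

lemma functor_span:
  assumes C: "category C" and f: "f \<in> Mor C" "g \<in> Mor C" "Dom C f = Dom C g"
  shows "is_functor span_cat C (span_fctr C f g)"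
proof -
  have "category span_cat" using finite_span by (simp add: finite_cat_def)
  then show ?thesis
    unfolding is_functor_def using assms
    by (auto simp: span_cat_def span_fctr_def Hom_iff Let_def)
qed

lemma cocone_span:
  assumes C: "category C" and f: "f \<in> Mor C" "g \<in> Mor C" "Dom C f = Dom C g"
  shows "cocone span_cat C (span_fctr C f g) Q \<iota> \<longleftrightarrow>
    \<iota> 1 \<in> Hom C (Cod C f) Q \<and> \<iota> 2 \<in> Hom C (Cod C g) Q \<and> \<iota> 1 \<cdot>\<^bsub>C\<^esub> f = \<iota> 2 \<cdot>\<^bsub>C\<^esub> g \<and> \<iota> 0 = \<iota> 1 \<cdot>\<^bsub>C\<^esub> f"
  unfolding cocone_def span_simps using assms
  by (auto simp: span_simps Hom_iff)

lemma pushout_univ: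
  fixes C (structure)
  assumes "is_pushout C f g h k" "Q \<in> Ob C" "h' \<in> Hom C (Cod C f) Q" "k' \<in> Hom C (Cod C g) Q" "h' \<cdot> f = k' \<cdot> g"
  shows "\<exists>!w. w \<in> Hom C (Cod C h) Q \<and> w \<cdot> h = h' \<and> w \<cdot> k = k'"
  using assms by (simp add: is_pushout_def)

text \<open>Gives pushouts access to the results on finite colimits, notably existence and finite
  presentability. The leg at the apex carries no information: it has to be the composite
  \<open>h \<cdot> f\<close>.\<close>

lemma pushout_iff_colimit:
  fixes C (structure)
  assumes C: "category C" and f: "f \<in> Mor C" "g \<in> Mor C" "Dom C f = Dom C g"
  shows "is_pushout C f g h k \<longleftrightarrow>
    is_colimit span_cat C (span_fctr C f g) (Cod C h) (\<lambda>n. if n = 0 then h \<cdot> f else if n = 1 then h else k)"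
    (is "_ \<longleftrightarrow> is_colimit _ _ _ _ ?\<iota>")
proof
  assume p: "is_pushout C f g h k"
  then have hk: "h \<in> Hom C (Cod C f) (Cod C h)" "k \<in> Hom C (Cod C g) (Cod C h)" "h \<cdot> f = k \<cdot> g"
    by (simp_all add: is_pushout_def)
  have aux: "w \<cdot> (h \<cdot> f) = (w \<cdot> h) \<cdot> f" if "w \<in> Hom C (Cod C h) Q" for w Q
    using that hk f C by (simp add: Hom_iff)
  show "is_colimit span_cat C (span_fctr C f g) (Cod C h) ?\<iota>"
    unfolding is_colimit_def
  proof (intro conjI allI impI)
    show "cocone span_cat C (span_fctr C f g) (Cod C h) ?\<iota>"
      using hk by (simp add: cocone_span[OF C f])
    fix Q \<zeta> assume "cocone span_cat C (span_fctr C f g) Q \<zeta>"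
    then have z: "\<zeta> 1 \<in> Hom C (Cod C f) Q" "\<zeta> 2 \<in> Hom C (Cod C g) Q" "\<zeta> 1 \<cdot> f = \<zeta> 2 \<cdot> g" "\<zeta> 0 = \<zeta> 1 \<cdot> f"
      by (simp_all add: cocone_span[OF C f])
    then have "\<exists>!w. w \<in> Hom C (Cod C h) Q \<and> w \<cdot> h = \<zeta> 1 \<and> w \<cdot> k = \<zeta> 2"
      using pushout_univ[OF p _ z(1,2,3)] Hom_ob[OF C z(1)] by simp
    moreover have "(w \<in> Hom C (Cod C h) Q \<and> (\<forall>j\<in>Ob span_cat. w \<cdot> ?\<iota> j = \<zeta> j)) \<longleftrightarrow>
        w \<in> Hom C (Cod C h) Q \<and> w \<cdot> h = \<zeta> 1 \<and> w \<cdot> k = \<zeta> 2" for w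
      unfolding span_simps using z(4) aux[of w Q] by (auto simp del: comp_assoc)
    ultimately show "\<exists>!w. w \<in> Hom C (Cod C h) Q \<and> (\<forall>j\<in>Ob span_cat. w \<cdot> ?\<iota> j = \<zeta> j)"
      by simp
  qed
next
  assume c: "is_colimit span_cat C (span_fctr C f g) (Cod C h) ?\<iota>"
  then have hk: "h \<in> Hom C (Cod C f) (Cod C h)" "k \<in> Hom C (Cod C g) (Cod C h)" "h \<cdot> f = k \<cdot> g"
    using cocone_span[OF C f, of "Cod C h" ?\<iota>] colimit_cocone[OF c] by simp_all
  have aux: "w \<cdot> (h \<cdot> f) = (w \<cdot> h) \<cdot> f" if "w \<in> Hom C (Cod C h) Q" for w Q
    using that hk f C by (simp add: Hom_iff)
  show "is_pushout C f g h k"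
    unfolding is_pushout_def
  proof (intro conjI ballI impI f hk)
    fix Q h' k' assume Q: "Q \<in> Ob C" "h' \<in> Hom C (Cod C f) Q" "k' \<in> Hom C (Cod C g) Q" "h' \<cdot> f = k' \<cdot> g"
    let ?z = "\<lambda>n::nat. if n = 0 then h' \<cdot> f else if n = 1 then h' else k'"
    have "cocone span_cat C (span_fctr C f g) Q ?z"
      using Q by (simp add: cocone_span[OF C f])
    then have "\<exists>!w. w \<in> Hom C (Cod C h) Q \<and> (\<forall>j\<in>Ob span_cat. w \<cdot> ?\<iota> j = ?z j)"
      using c by (simp add: is_colimit_def)
    moreover have "(w \<in> Hom C (Cod C h) Q \<and> (\<forall>j\<in>Ob span_cat. w \<cdot> ?\<iota> j = ?z j)) \<longleftrightarrow>
        w \<in> Hom C (Cod C h) Q \<and> w \<cdot> h = h' \<and> w \<cdot> k = k'" for w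
      unfolding span_simps using aux[of w Q] by (auto simp del: comp_assoc)
    ultimately show "\<exists>!w. w \<in> Hom C (Cod C h) Q \<and> w \<cdot> h = h' \<and> w \<cdot> k = k'"
      by simp
  qed
qed

lemma pushout_facts:
  assumes "is_pushout C f g h k"
  shows "f \<in> Mor C" "g \<in> Mor C" "Dom C f = Dom C g" "h \<in> Mor C" "k \<in> Mor C"
    "Dom C h = Cod C f" "Dom C k = Cod C g" "Cod C k = Cod C h" "h \<cdot>\<^bsub>C\<^esub> f = k \<cdot>\<^bsub>C\<^esub> g"
  using assms by (simp_all add: is_pushout_def Hom_iff)

lemma pushout_induced:
  fixes C (structure)
  assumes "category C" "is_pushout C f g h k" "h' \<in> Hom C (Cod C f) Q" "k' \<in> Hom C (Cod C g) Q" "h' \<cdot> f = k' \<cdot> g"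
  obtains w where "w \<in> Hom C (Cod C h) Q" "w \<cdot> h = h'" "w \<cdot> k = k'"
proof -
  have "Q \<in> Ob C" using Hom_ob[OF assms(1,3)] by simp
  from pushout_univ[OF assms(2) this assms(3-5)] show thesis using that by blast
qed

lemma pushout_unique:
  fixes C (structure)
  assumes C: "category C" and p: "is_pushout C f g h k" and w: "w \<in> Hom C (Cod C h) Q" "w' \<in> Hom C (Cod C h) Q"
    and eq: "w \<cdot> h = w' \<cdot> h" "w \<cdot> k = w' \<cdot> k"
  shows "w = w'"
proof -
  note pf = pushout_facts[OF p]
  have Q: "Q \<in> Ob C" using Hom_ob[OF C w(1)] by simp
  have h: "w \<cdot> h \<in> Hom C (Cod C f) Q" "w \<cdot> k \<in> Hom C (Cod C g) Q"
    using w pf C by (simp_all add: Hom_iff)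
  have e: "(w \<cdot> h) \<cdot> f = (w \<cdot> k) \<cdot> g"
    using w pf C by (simp add: Hom_iff)
  have "\<exists>!v. v \<in> Hom C (Cod C h) Q \<and> v \<cdot> h = w \<cdot> h \<and> v \<cdot> k = w \<cdot> k"
    by (rule pushout_univ[OF p Q h e])
  then show ?thesis using w eq by metis
qed

lemma pushout_swap:
  fixes C (structure)
  assumes "is_pushout C f g h k"
  shows "is_pushout C g f k h"
proof -
  note pf = pushout_facts[OF assms]
  have "\<exists>!w. w \<in> Hom C (Cod C k) Q \<and> w \<cdot> k = k' \<and> w \<cdot> h = h'"
    if "Q \<in> Ob C" "k' \<in> Hom C (Cod C g) Q" "h' \<in> Hom C (Cod C f) Q" "k' \<cdot> g = h' \<cdot> f" for Q h' k'
    using pushout_univ[OF assms that(1,3,2) that(4)[symmetric]] pf(8) by (simp only: conj_commute)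
  note u = this
  show ?thesis
    unfolding is_pushout_def
  proof (intro conjI ballI impI)
    fix Q k' h' assume "Q \<in> Ob C" "k' \<in> Hom C (Cod C g) Q" "h' \<in> Hom C (Cod C f) Q" "k' \<cdot> g = h' \<cdot> f"
    then show "\<exists>!w. w \<in> Hom C (Cod C k) Q \<and> w \<cdot> k = k' \<and> w \<cdot> h = h'" by (rule u)
  qed (use pf in \<open>simp_all add: Hom_iff\<close>)
qed

definition empty_cat :: "(nat, nat) cat" where
  "empty_cat = \<lparr>Ob = {}, Mor = {}, Dom = id, Cod = id, Idt = id, Cmp = (\<lambda>f g. f)\<rparr>"

lemma finite_empty: "finite_cat empty_cat"
  by (simp add: finite_cat_def category_def empty_cat_def)

lemma functor_empty: "category C \<Longrightarrow> is_functor empty_cat C X"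
proof -
  assume C: "category C"
  have "category empty_cat" using finite_empty by (simp add: finite_cat_def)
  moreover have "Ob empty_cat = {}" "Mor empty_cat = {}" by (simp_all add: empty_cat_def)
  ultimately show ?thesis
    unfolding is_functor_def using C by simp
qed

lemma colimit_empty: "is_colimit empty_cat C X L \<iota> \<longleftrightarrow> is_initial C L"
  by (auto simp: is_colimit_def cocone_def is_initial_def empty_cat_def)

lemma colimit_fctr_cong:
  assumes "\<And>j. j \<in> Ob J \<Longrightarrow> fob X j = fob Y j" "\<And>u. u \<in> Mor J \<Longrightarrow> fmor X u = fmor Y u"
  shows "is_colimit J C X L \<iota> \<longleftrightarrow> is_colimit J C Y L \<iota>"
proof -
  have "cocone J C X Z \<zeta> \<longleftrightarrow> cocone J C Y Z \<zeta>" for Z \<zeta>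
    unfolding cocone_def using assms by simp
  then show ?thesis unfolding is_colimit_def by simp
qed

section \<open>The category of morphisms\<close>

lemma arrow_cat_simps:
  "Ob (arrow_cat C) = Mor C"
  "(f, g, u, v) \<in> Mor (arrow_cat C) \<longleftrightarrow> f \<in> Mor C \<and> g \<in> Mor C \<and>
     u \<in> Hom C (Dom C f) (Dom C g) \<and> v \<in> Hom C (Cod C f) (Cod C g) \<and> g \<cdot>\<^bsub>C\<^esub> u = v \<cdot>\<^bsub>C\<^esub> f"
  "Dom (arrow_cat C) (f, g, u, v) = f" "Cod (arrow_cat C) (f, g, u, v) = g"
  "Idt (arrow_cat C) f = (f, f, Idt C (Dom C f), Idt C (Cod C f))"
  "(f', g', u', v') \<cdot>\<^bsub>arrow_cat C\<^esub> (f, g, u, v) = (f, g', u' \<cdot>\<^bsub>C\<^esub> u, v' \<cdot>\<^bsub>C\<^esub> v)"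
  by (simp_all add: arrow_cat_def)

lemma category_arrow [simp]:
  fixes C (structure)
  assumes "category C"
  shows "category (arrow_cat C)"
proof -
  have "g' \<cdot> (u' \<cdot> u) = v' \<cdot> (v \<cdot> f)"
    if "f \<in> Mor C" "g \<in> Mor C" "g' \<in> Mor C" "u \<in> Hom C (Dom C f) (Dom C g)" "v \<in> Hom C (Cod C f) (Cod C g)"
      "g \<cdot> u = v \<cdot> f" "u' \<in> Hom C (Dom C g) (Dom C g')" "v' \<in> Hom C (Cod C g) (Cod C g')"
      "g' \<cdot> u' = v' \<cdot> g" for f g g' u v u' v'
    using that comp_reassoc[OF that(9) assms, of u] assms by (simp add: Hom_iff)
  note sq = this[unfolded Hom_iff]
  show ?thesis
    unfolding category_def Ball_def split_paired_all split_paired_All arrow_cat_simps Hom_iff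
    using assms by (simp add: Hom_iff) (metis sq)
qed

lemma Hom_arrow:
  "t \<in> Hom (arrow_cat C) f g \<longleftrightarrow> (\<exists>u v. t = (f, g, u, v) \<and> f \<in> Mor C \<and> g \<in> Mor C \<and>
     u \<in> Hom C (Dom C f) (Dom C g) \<and> v \<in> Hom C (Cod C f) (Cod C g) \<and> g \<cdot>\<^bsub>C\<^esub> u = v \<cdot>\<^bsub>C\<^esub> f)"
  by (cases t) (auto simp: Hom_def arrow_cat_simps)

lemma Hom_arrowE:
  assumes "t \<in> Hom (arrow_cat C) f g"
  obtains u v where "t = (f, g, u, v)" "f \<in> Mor C" "g \<in> Mor C"
     "u \<in> Hom C (Dom C f) (Dom C g)" "v \<in> Hom C (Cod C f) (Cod C g)" "g \<cdot>\<^bsub>C\<^esub> u = v \<cdot>\<^bsub>C\<^esub> f"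
  using assms by (auto simp: Hom_arrow)

lemma Hom_arrow_iff:
  "(f', g', u, v) \<in> Hom (arrow_cat C) f g \<longleftrightarrow> f' = f \<and> g' = g \<and> f \<in> Mor C \<and> g \<in> Mor C \<and>
     u \<in> Hom C (Dom C f) (Dom C g) \<and> v \<in> Hom C (Cod C f) (Cod C g) \<and> g \<cdot>\<^bsub>C\<^esub> u = v \<cdot>\<^bsub>C\<^esub> f"
  by (auto simp: Hom_arrow)

definition top_side :: "'m \<times> 'm \<times> 'm \<times> 'm \<Rightarrow> 'm" where "top_side t = fst (snd (snd t))"
definition bot_side :: "'m \<times> 'm \<times> 'm \<times> 'm \<Rightarrow> 'm" where "bot_side t = snd (snd (snd t))"

lemma side_simps [simp]: "top_side (f, g, u, v) = u" "bot_side (f, g, u, v) = v"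
  by (simp_all add: top_side_def bot_side_def)

lemma arrow_eta: "fst t = f \<Longrightarrow> fst (snd t) = g \<Longrightarrow> t = (f, g, top_side t, bot_side t)"
  by (cases t) simp

lemma arrow_fctr_simps [simp]:
  "fob (dom_fctr C) = Dom C" "fob (cod_fctr C) = Cod C"
  "fmor (dom_fctr C) = top_side" "fmor (cod_fctr C) = bot_side"
  by (auto simp: dom_fctr_def cod_fctr_def fun_eq_iff)

lemma functor_dom: "category C \<Longrightarrow> is_functor (arrow_cat C) C (dom_fctr C)"
  and functor_cod: "category C \<Longrightarrow> is_functor (arrow_cat C) C (cod_fctr C)"
  unfolding is_functor_def Ball_def split_paired_all split_paired_All arrow_cat_simps Hom_iff
  by (simp_all add: arrow_cat_simps)

lemma arrow_fmor:
  assumes Z: "is_functor J (arrow_cat C) Z" and u: "u \<in> Mor J"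
  obtains s t where "fmor Z u = (fob Z (Dom J u), fob Z (Cod J u), s, t)"
    "s \<in> Hom C (Dom C (fob Z (Dom J u))) (Dom C (fob Z (Cod J u)))"
    "t \<in> Hom C (Cod C (fob Z (Dom J u))) (Cod C (fob Z (Cod J u)))"
    "fob Z (Cod J u) \<cdot>\<^bsub>C\<^esub> s = t \<cdot>\<^bsub>C\<^esub> fob Z (Dom J u)"
proof -
  have "fmor Z u \<in> Hom (arrow_cat C) (fob Z (Dom J u)) (fob Z (Cod J u))"
    using Z u by (simp add: Hom_def)
  then show thesis using that by (auto simp: Hom_arrow)
qed

lemma arrow_cocone:
  fixes C (structure)
  assumes C: "category C" and Z: "is_functor J (arrow_cat C) Z"
  shows "cocone J (arrow_cat C) Z f \<kappa> \<longleftrightarrow>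
    f \<in> Mor C \<and> cocone J C (comp_fctr (dom_fctr C) Z) (Dom C f) (\<lambda>j. top_side (\<kappa> j)) \<and>
    cocone J C (comp_fctr (cod_fctr C) Z) (Cod C f) (\<lambda>j. bot_side (\<kappa> j)) \<and>
    (\<forall>j\<in>Ob J. fst (\<kappa> j) = fob Z j \<and> fst (snd (\<kappa> j)) = f \<and>
       f \<cdot> top_side (\<kappa> j) = bot_side (\<kappa> j) \<cdot> fob Z j)"
proof -
  have J: "category J" using is_functor_cat[OF Z] by simp
  have Zm: "fob Z j \<in> Mor C" if "j \<in> Ob J" for j using fob_ob[OF Z that] by (simp add: arrow_cat_simps)
  let ?e = "\<forall>j\<in>Ob J. fst (\<kappa> j) = fob Z j \<and> fst (snd (\<kappa> j)) = f"
  have nat: "\<kappa> (Cod J u) \<cdot>\<^bsub>arrow_cat C\<^esub> fmor Z u = \<kappa> (Dom J u) \<longleftrightarrow>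
     top_side (\<kappa> (Cod J u)) \<cdot> top_side (fmor Z u) = top_side (\<kappa> (Dom J u)) \<and>
     bot_side (\<kappa> (Cod J u)) \<cdot> bot_side (fmor Z u) = bot_side (\<kappa> (Dom J u))"
    if u: "u \<in> Mor J" and k: ?e for u
  proof -
    obtain s t where st: "fmor Z u = (fob Z (Dom J u), fob Z (Cod J u), s, t)"
      using arrow_fmor[OF Z u] by metis
    have d: "Dom J u \<in> Ob J" "Cod J u \<in> Ob J" using J u by auto
    obtain x y x' y' where "\<kappa> (Dom J u) = (fob Z (Dom J u), f, x, y)" "\<kappa> (Cod J u) = (fob Z (Cod J u), f, x', y')"
      using k d by (metis arrow_eta)
    then show ?thesis unfolding st by (simp add: arrow_cat_simps)
  qed
  have hom: "\<kappa> j \<in> Hom (arrow_cat C) (fob Z j) f \<longleftrightarrow> f \<in> Mor C \<and>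
      top_side (\<kappa> j) \<in> Hom C (Dom C (fob Z j)) (Dom C f) \<and> bot_side (\<kappa> j) \<in> Hom C (Cod C (fob Z j)) (Cod C f) \<and>
      fst (\<kappa> j) = fob Z j \<and> fst (snd (\<kappa> j)) = f \<and> f \<cdot> top_side (\<kappa> j) = bot_side (\<kappa> j) \<cdot> fob Z j"
    if "j \<in> Ob J" for j
    using Zm[OF that] by (cases "\<kappa> j") (auto simp: Hom_arrow_iff)
  show ?thesis
  proof (cases ?e)
    case True
    show ?thesis
      unfolding cocone_def comp_fctr_simps arrow_fctr_simps
      using hom nat[OF _ True] C by (simp add: arrow_cat_simps) (auto simp: Hom_iff)
  next
    case False
    then show ?thesis unfolding cocone_def using hom by blast
  qed
qed

text \<open>Colimits of morphisms are computed on sources and targets separately: the two induced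
  maps form a square because its commutation can be tested on the legs of \<open>L\<close>.\<close>

lemma arrow_colimitI:
  fixes C (structure)
  assumes C: "category C" and Z: "is_functor J (arrow_cat C) Z"
    and L: "is_colimit J C (comp_fctr (dom_fctr C) Z) L \<iota>"
    and L': "is_colimit J C (comp_fctr (cod_fctr C) Z) L' \<iota>'"
    and f: "f \<in> Hom C L L'" "\<And>j. j \<in> Ob J \<Longrightarrow> f \<cdot> \<iota> j = \<iota>' j \<cdot> fob Z j"
  shows "is_colimit J (arrow_cat C) Z f (\<lambda>j. (fob Z j, f, \<iota> j, \<iota>' j))"
proof (rule is_colimitI)
  have J: "category J" using is_functor_cat[OF Z] by simp
  have Zm: "fob Z j \<in> Mor C" if "j \<in> Ob J" for j using fob_ob[OF Z that] by (simp add: arrow_cat_simps)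
  note F = functor_comp[OF Z functor_dom[OF C]] functor_comp[OF Z functor_cod[OF C]]
  note cc = colimit_cocone[OF L] colimit_cocone[OF L']
  note lf = cocone_facts[OF cc(1)] cocone_facts[OF cc(2)]
  have fm: "f \<in> Mor C" "Dom C f = L" "Cod C f = L'" using f(1) by (auto simp: Hom_iff)
  show "cocone J (arrow_cat C) Z f (\<lambda>j. (fob Z j, f, \<iota> j, \<iota>' j))"
    using cc f fm by (simp add: arrow_cocone[OF C Z])
  fix g
  {
    fix \<zeta> assume "cocone J (arrow_cat C) Z g \<zeta>"
    then have g: "g \<in> Mor C" and z: "cocone J C (comp_fctr (dom_fctr C) Z) (Dom C g) (\<lambda>j. top_side (\<zeta> j))"
      "cocone J C (comp_fctr (cod_fctr C) Z) (Cod C g) (\<lambda>j. bot_side (\<zeta> j))"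
      and z': "\<And>j. j \<in> Ob J \<Longrightarrow> fst (\<zeta> j) = fob Z j \<and> fst (snd (\<zeta> j)) = g"
       "\<And>j. j \<in> Ob J \<Longrightarrow> g \<cdot> top_side (\<zeta> j) = bot_side (\<zeta> j) \<cdot> fob Z j"
      by (auto simp: arrow_cocone[OF C Z])
    obtain u where u: "u \<in> Hom C L (Dom C g)" "\<And>j. j \<in> Ob J \<Longrightarrow> u \<cdot> \<iota> j = top_side (\<zeta> j)"
      using colimit_induced[OF L z(1)] by blast
    obtain v where v: "v \<in> Hom C L' (Cod C g)" "\<And>j. j \<in> Ob J \<Longrightarrow> v \<cdot> \<iota>' j = bot_side (\<zeta> j)"
      using colimit_induced[OF L' z(2)] by blast
    have "g \<cdot> u = v \<cdot> f"
    proof (rule colimit_unique[OF C F(1) L])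
      show "g \<cdot> u \<in> Hom C L (Cod C g)" "v \<cdot> f \<in> Hom C L (Cod C g)"
        using u(1) v(1) f(1) g C by (simp_all add: Hom_iff)
      fix j assume j: "j \<in> Ob J"
      have "v \<cdot> (f \<cdot> \<iota> j) = bot_side (\<zeta> j) \<cdot> fob Z j"
        unfolding f(2)[OF j] using comp_reassoc[OF v(2)[OF j] C] v(1) lf j Zm[OF j] by (simp add: Hom_iff)
      then show "(g \<cdot> u) \<cdot> \<iota> j = (v \<cdot> f) \<cdot> \<iota> j"
        using u(1) u(2)[OF j] v(1) f(1) g C lf j z'(2)[OF j] by (simp add: Hom_iff)
    qed
    then have "(f, g, u, v) \<in> Hom (arrow_cat C) f g"
      using u(1) v(1) fm g by (simp add: Hom_arrow_iff)
    moreover have "(f, g, u, v) \<cdot>\<^bsub>arrow_cat C\<^esub> (fob Z j, f, \<iota> j, \<iota>' j) = \<zeta> j" if "j \<in> Ob J" for j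
      using z'(1)[OF that] u(2)[OF that] v(2)[OF that] arrow_eta[of "\<zeta> j"] by (metis arrow_cat_simps(6))
    ultimately show "\<exists>h\<in>Hom (arrow_cat C) f g. \<forall>j\<in>Ob J. h \<cdot>\<^bsub>arrow_cat C\<^esub> (fob Z j, f, \<iota> j, \<iota>' j) = \<zeta> j"
      by blast
  }
  fix h h' assume h: "h \<in> Hom (arrow_cat C) f g" "h' \<in> Hom (arrow_cat C) f g"
    and eq: "\<forall>j\<in>Ob J. h \<cdot>\<^bsub>arrow_cat C\<^esub> (fob Z j, f, \<iota> j, \<iota>' j) = h' \<cdot>\<^bsub>arrow_cat C\<^esub> (fob Z j, f, \<iota> j, \<iota>' j)"
  obtain u v where h1: "h = (f, g, u, v)" "u \<in> Hom C L (Dom C g)" "v \<in> Hom C L' (Cod C g)"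
    using h(1) fm by (auto simp: Hom_arrow)
  obtain u' v' where h2: "h' = (f, g, u', v')" "u' \<in> Hom C L (Dom C g)" "v' \<in> Hom C L' (Cod C g)"
    using h(2) fm by (auto simp: Hom_arrow)
  have e: "u \<cdot> \<iota> j = u' \<cdot> \<iota> j" "v \<cdot> \<iota>' j = v' \<cdot> \<iota>' j" if "j \<in> Ob J" for j
    using eq[rule_format, OF that] unfolding h1(1) h2(1) by (simp_all add: arrow_cat_simps)
  have "u = u'" by (rule colimit_unique[OF C F(1) L h1(2) h2(2) e(1)])
  moreover have "v = v'" by (rule colimit_unique[OF C F(2) L' h1(3) h2(3) e(2)])
  ultimately show "h = h'" using h1 h2 by simp
qed

lemma arrow_colimit_ex:
  fixes C (structure)
  assumes C: "category C" and Z: "is_functor J (arrow_cat C) Z"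
    and L: "is_colimit J C (comp_fctr (dom_fctr C) Z) L \<iota>"
    and L': "is_colimit J C (comp_fctr (cod_fctr C) Z) L' \<iota>'"
  obtains f where "f \<in> Hom C L L'" "\<And>j. j \<in> Ob J \<Longrightarrow> f \<cdot> \<iota> j = \<iota>' j \<cdot> fob Z j"
    "is_colimit J (arrow_cat C) Z f (\<lambda>j. (fob Z j, f, \<iota> j, \<iota>' j))"
proof -
  have J: "category J" using is_functor_cat[OF Z] by simp
  have Zm: "fob Z j \<in> Mor C" if "j \<in> Ob J" for j using fob_ob[OF Z that] by (simp add: arrow_cat_simps)
  note cc = colimit_cocone[OF L']
  note lf = cocone_facts[OF cc]
  have "cocone J C (comp_fctr (dom_fctr C) Z) L' (\<lambda>j. \<iota>' j \<cdot> fob Z j)"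
    unfolding cocone_def
  proof (intro conjI ballI)
    show "L' \<in> Ob C" by (rule lf(1))
    show "\<iota>' j \<cdot> fob Z j \<in> Hom C (fob (comp_fctr (dom_fctr C) Z) j) L'" if "j \<in> Ob J" for j
      using that lf Zm C by (simp add: Hom_iff)
    fix u assume u: "u \<in> Mor J"
    obtain s t where st: "fmor Z u = (fob Z (Dom J u), fob Z (Cod J u), s, t)"
      "s \<in> Hom C (Dom C (fob Z (Dom J u))) (Dom C (fob Z (Cod J u)))"
      "t \<in> Hom C (Cod C (fob Z (Dom J u))) (Cod C (fob Z (Cod J u)))"
      "fob Z (Cod J u) \<cdot> s = t \<cdot> fob Z (Dom J u)" by (rule arrow_fmor[OF Z u])
    have d: "Dom J u \<in> Ob J" "Cod J u \<in> Ob J" using J u by auto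
    have "\<iota>' (Cod J u) \<cdot> t = \<iota>' (Dom J u)" using cocone_comm[OF cc u] st(1) by simp
    from comp_reassoc[OF this C, of "fob Z (Dom J u)"]
    show "(\<iota>' (Cod J u) \<cdot> fob Z (Cod J u)) \<cdot> fmor (comp_fctr (dom_fctr C) Z) u = \<iota>' (Dom J u) \<cdot> fob Z (Dom J u)"
      using st d Zm lf C by (simp add: Hom_iff)
  qed
  then obtain f where f: "f \<in> Hom C L L'" "\<And>j. j \<in> Ob J \<Longrightarrow> f \<cdot> \<iota> j = \<iota>' j \<cdot> fob Z j"
    using colimit_induced[OF L] by blast
  show thesis using that[OF f arrow_colimitI[OF C Z L L' f]] .
qed

text \<open>Once sources and targets have colimits, the pointwise colimit exists. Any other colimit
  in the category of morphisms is isomorphic to it, and an isomorphism of morphisms is one on both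
  sides.\<close>

lemma arrow_colimitD:
  fixes C (structure)
  assumes C: "category C" and Z: "is_functor J (arrow_cat C) Z"
    and L: "is_colimit J C (comp_fctr (dom_fctr C) Z) L \<iota>"
    and L': "is_colimit J C (comp_fctr (cod_fctr C) Z) L' \<iota>'"
    and f: "is_colimit J (arrow_cat C) Z f \<kappa>"
  shows "is_colimit J C (comp_fctr (dom_fctr C) Z) (Dom C f) (\<lambda>j. top_side (\<kappa> j))"
    "is_colimit J C (comp_fctr (cod_fctr C) Z) (Cod C f) (\<lambda>j. bot_side (\<kappa> j))"
proof -
  have J: "category J" using is_functor_cat[OF Z] by simp
  note F = functor_comp[OF Z functor_dom[OF C]] functor_comp[OF Z functor_cod[OF C]]
  obtain g where g: "g \<in> Hom C L L'" "\<And>j. j \<in> Ob J \<Longrightarrow> g \<cdot> \<iota> j = \<iota>' j \<cdot> fob Z j"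
    "is_colimit J (arrow_cat C) Z g (\<lambda>j. (fob Z j, g, \<iota> j, \<iota>' j))"
    using arrow_colimit_ex[OF C Z L L'] by blast
  obtain \<theta> \<theta>' where t: "\<theta> \<in> Hom (arrow_cat C) g f" "\<theta>' \<in> Hom (arrow_cat C) f g"
    "\<theta>' \<cdot>\<^bsub>arrow_cat C\<^esub> \<theta> = Idt (arrow_cat C) g" "\<theta> \<cdot>\<^bsub>arrow_cat C\<^esub> \<theta>' = Idt (arrow_cat C) f"
    "\<And>j. j \<in> Ob J \<Longrightarrow> \<theta> \<cdot>\<^bsub>arrow_cat C\<^esub> (fob Z j, g, \<iota> j, \<iota>' j) = \<kappa> j"
    using colimit_iso[OF category_arrow[OF C] Z g(3) f] by metis
  have gm: "Dom C g = L" "Cod C g = L'" using g(1) by (auto simp: Hom_iff)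
  obtain s t where s: "\<theta> = (g, f, s, t)" "s \<in> Hom C L (Dom C f)" "t \<in> Hom C L' (Cod C f)"
    using t(1) gm by (auto simp: Hom_arrow)
  obtain s' t' where s': "\<theta>' = (f, g, s', t')" "s' \<in> Hom C (Dom C f) L" "t' \<in> Hom C (Cod C f) L'"
    using t(2) gm by (auto simp: Hom_arrow)
  have inv: "s' \<cdot> s = Idt C L" "s \<cdot> s' = Idt C (Dom C f)" "t' \<cdot> t = Idt C L'" "t \<cdot> t' = Idt C (Cod C f)"
    using t(3,4) gm unfolding s(1) s'(1) by (simp_all add: arrow_cat_simps)
  have k: "s \<cdot> \<iota> j = top_side (\<kappa> j)" "t \<cdot> \<iota>' j = bot_side (\<kappa> j)" if "j \<in> Ob J" for j
    unfolding t(5)[OF that, symmetric] s(1) by (simp_all add: arrow_cat_simps)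
  show "is_colimit J C (comp_fctr (dom_fctr C) Z) (Dom C f) (\<lambda>j. top_side (\<kappa> j))"
    by (rule iffD1[OF colimit_cong[OF J k(1)] colimit_transfer[OF C F(1) L s(2) s'(2) inv(1,2)]])
  show "is_colimit J C (comp_fctr (cod_fctr C) Z) (Cod C f) (\<lambda>j. bot_side (\<kappa> j))"
    by (rule iffD1[OF colimit_cong[OF J k(2)] colimit_transfer[OF C F(2) L' s(3) s'(3) inv(3,4)]])
qed

text \<open>A square from \<open>a\<close> into a colimit is factored on its two sides at possibly
  different stages and moved to a common one. There it need not commute, but the two composites out
  of \<open>Dom C a\<close> agree in the colimit of targets, hence at a later stage.\<close>

lemma arrow_fp:
  fixes C (structure) and U :: "'u itself"
  assumes C: "category C" and fc: "has_colimits (small_filtered :: ('u, 'u) cat \<Rightarrow> bool) C"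
    and a: "a \<in> Mor C" "finitely_presentable U C (Dom C a)" "finitely_presentable U C (Cod C a)"
  shows "finitely_presentable U (arrow_cat C) a"
proof (rule finitely_presentableI)
  show "a \<in> Ob (arrow_cat C)" using a by (simp add: arrow_cat_simps)
  fix J :: "('u, 'u) cat" and Z f \<kappa>
  assume J: "small_index U J" and Z: "is_functor J (arrow_cat C) Z" and f: "is_colimit J (arrow_cat C) Z f \<kappa>"
  note F = functor_comp[OF Z functor_dom[OF C]] functor_comp[OF Z functor_cod[OF C]]
  have fJ: "filtered J" using J by (simp add: small_index_def)
  note cJ = filtered_cat[OF fJ]
  let ?X = "comp_fctr (dom_fctr C) Z" and ?Y = "comp_fctr (cod_fctr C) Z"
  obtain L \<iota> where L: "is_colimit J C ?X L \<iota>" using filtered_colimit[OF fc F(1) J] by blast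
  obtain L' \<iota>' where L': "is_colimit J C ?Y L' \<iota>'" using filtered_colimit[OF fc F(2) J] by blast
  note X = arrow_colimitD(1)[OF C Z L L' f] and Y = arrow_colimitD(2)[OF C Z L L' f]
  note xf = cocone_facts[OF colimit_cocone[OF X]] and yf = cocone_facts[OF colimit_cocone[OF Y]]
  have Zm: "fob Z j \<in> Mor C" if "j \<in> Ob J" for j using fob_ob[OF Z that] by (simp add: arrow_cat_simps)
  have "\<And>j. j \<in> Ob J \<Longrightarrow> fst (\<kappa> j) = fob Z j \<and> fst (snd (\<kappa> j)) = f" and kap1: "f \<in> Mor C"
    "\<And>j. j \<in> Ob J \<Longrightarrow> f \<cdot> top_side (\<kappa> j) = bot_side (\<kappa> j) \<cdot> fob Z j"
    using colimit_cocone[OF f] unfolding arrow_cocone[OF C Z] by blast+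
  then have kap: "f \<in> Mor C" "\<And>j. j \<in> Ob J \<Longrightarrow> \<kappa> j = (fob Z j, f, top_side (\<kappa> j), bot_side (\<kappa> j))"
    "\<And>j. j \<in> Ob J \<Longrightarrow> f \<cdot> top_side (\<kappa> j) = bot_side (\<kappa> j) \<cdot> fob Z j"
    using arrow_eta by metis+
  {
    fix t assume "t \<in> Hom (arrow_cat C) a f"
    then obtain u v where t: "t = (a, f, u, v)" "u \<in> Hom C (Dom C a) (Dom C f)" "v \<in> Hom C (Cod C a) (Cod C f)"
      "f \<cdot> u = v \<cdot> a" by (auto simp: Hom_arrow)
    obtain i g where g: "i \<in> Ob J" "g \<in> Hom C (Dom C a) (fob ?X i)" "top_side (\<kappa> i) \<cdot> g = u"
      using finitely_presentable_factor[OF a(2) J F(1) X t(2)] by blast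
    obtain i' h where h: "i' \<in> Ob J" "h \<in> Hom C (Cod C a) (fob ?Y i')" "bot_side (\<kappa> i') \<cdot> h = v"
      using finitely_presentable_factor[OF a(3) J F(2) Y t(3)] by blast
    obtain k p q where k: "k \<in> Ob J" "p \<in> Hom J i k" "q \<in> Hom J i' k"
      using filtered_join[OF fJ g(1) h(1)] by blast
    define g' where "g' = fmor ?X p \<cdot> g"
    define h' where "h' = fmor ?Y q \<cdot> h"
    have tm: "fmor ?X p \<in> Hom C (fob ?X i) (fob ?X k)" "fmor ?Y q \<in> Hom C (fob ?Y i') (fob ?Y k)"
      using k by (simp_all add: Hom_def dom_fmor[OF F(1)] cod_fmor[OF F(1)] fmor_mor[OF F(1)]
         dom_fmor[OF F(2)] cod_fmor[OF F(2)] fmor_mor[OF F(2)] del: comp_fctr_simps)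
    have g': "g' \<in> Hom C (Dom C a) (fob ?X k)" and h': "h' \<in> Hom C (Cod C a) (fob ?Y k)"
      unfolding g'_def h'_def using comp_Hom[OF C g(2) tm(1)] comp_Hom[OF C h(2) tm(2)] .
    have gu: "top_side (\<kappa> k) \<cdot> g' = u"
      unfolding g'_def using comp_reassoc[OF cocone_comm[OF colimit_cocone[OF X], of p] C, of g] g k tm xf
      by (simp add: Hom_iff)
    have hv: "bot_side (\<kappa> k) \<cdot> h' = v"
      unfolding h'_def using comp_reassoc[OF cocone_comm[OF colimit_cocone[OF Y], of q] C, of h] h k tm yf
      by (simp add: Hom_iff)
    have m: "fob Z k \<cdot> g' \<in> Hom C (Dom C a) (fob ?Y k)" "h' \<cdot> a \<in> Hom C (Dom C a) (fob ?Y k)"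
      using g' h' Zm[OF k(1)] a(1) C by (simp_all add: Hom_iff)
    have "bot_side (\<kappa> k) \<cdot> (fob Z k \<cdot> g') = f \<cdot> u"
      using comp_reassoc[OF kap(3)[OF k(1)] C, of g'] gu kap(1) g' Zm[OF k(1)] xf yf k(1) C by (simp add: Hom_iff)
    moreover have "bot_side (\<kappa> k) \<cdot> (h' \<cdot> a) = v \<cdot> a"
      using comp_reassoc[OF hv C, of a] h' a(1) yf k(1) by (simp add: Hom_iff)
    ultimately have "bot_side (\<kappa> k) \<cdot> (fob Z k \<cdot> g') = bot_side (\<kappa> k) \<cdot> (h' \<cdot> a)" using t(4) by simp
    then obtain l w where w: "w \<in> Hom J k l"
      "fmor ?Y w \<cdot> (fob Z k \<cdot> g') = fmor ?Y w \<cdot> (h' \<cdot> a)"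
      using finitely_presentable_equalize[OF a(2) J F(2) Y k(1) m] by blast
    have wm: "w \<in> Mor J" "Dom J w = k" "Cod J w = l" "l \<in> Ob J" using w(1) cJ by (auto simp: Hom_iff)
    obtain x y where xy: "fmor Z w = (fob Z k, fob Z l, x, y)"
      "x \<in> Hom C (Dom C (fob Z k)) (Dom C (fob Z l))" "y \<in> Hom C (Cod C (fob Z k)) (Cod C (fob Z l))"
      "fob Z l \<cdot> x = y \<cdot> fob Z k" using arrow_fmor[OF Z wm(1)] wm by metis
    have "fob Z l \<cdot> (x \<cdot> g') = (y \<cdot> h') \<cdot> a"
      using comp_reassoc[OF xy(4) C, of g'] w(2) xy g' h' Zm[OF k(1)] Zm[OF wm(4)] a(1) C
      by (simp add: Hom_iff)
    then have t1: "(a, fob Z l, x \<cdot> g', y \<cdot> h') \<in> Hom (arrow_cat C) a (fob Z l)"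
      unfolding Hom_arrow_iff using xy g' h' Zm[OF wm(4)] a(1) C by (simp add: Hom_iff)
    have "top_side (\<kappa> l) \<cdot> x = top_side (\<kappa> k)" "bot_side (\<kappa> l) \<cdot> y = bot_side (\<kappa> k)"
      using cocone_comm[OF colimit_cocone[OF X] wm(1)] cocone_comm[OF colimit_cocone[OF Y] wm(1)] wm xy by simp_all
    from comp_reassoc[OF this(1) C, of g'] comp_reassoc[OF this(2) C, of h']
    have "top_side (\<kappa> l) \<cdot> (x \<cdot> g') = u" "bot_side (\<kappa> l) \<cdot> (y \<cdot> h') = v"
      using gu hv xy g' h' xf yf wm(4) by (simp_all add: Hom_iff)
    then have "\<kappa> l \<cdot>\<^bsub>arrow_cat C\<^esub> (a, fob Z l, x \<cdot> g', y \<cdot> h') = t"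
      unfolding t(1) by (subst kap(2)[OF wm(4)]) (simp add: arrow_cat_simps)
    then show "\<exists>j\<in>Ob J. \<exists>g\<in>Hom (arrow_cat C) a (fob Z j). \<kappa> j \<cdot>\<^bsub>arrow_cat C\<^esub> g = t"
      using t1 wm(4) by blast
  }
  fix j g g' assume j: "j \<in> Ob J" and g: "g \<in> Hom (arrow_cat C) a (fob Z j)" "g' \<in> Hom (arrow_cat C) a (fob Z j)"
    and eq: "\<kappa> j \<cdot>\<^bsub>arrow_cat C\<^esub> g = \<kappa> j \<cdot>\<^bsub>arrow_cat C\<^esub> g'"
  obtain u v where u: "g = (a, fob Z j, u, v)" "u \<in> Hom C (Dom C a) (fob ?X j)" "v \<in> Hom C (Cod C a) (fob ?Y j)"
    using g(1) by (auto simp: Hom_arrow)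
  obtain u' v' where u': "g' = (a, fob Z j, u', v')" "u' \<in> Hom C (Dom C a) (fob ?X j)" "v' \<in> Hom C (Cod C a) (fob ?Y j)"
    using g(2) by (auto simp: Hom_arrow)
  have e: "top_side (\<kappa> j) \<cdot> u = top_side (\<kappa> j) \<cdot> u'" "bot_side (\<kappa> j) \<cdot> v = bot_side (\<kappa> j) \<cdot> v'"
    using eq kap(2)[OF j] unfolding u(1) u'(1) by (metis arrow_cat_simps(6) prod.inject)+
  obtain k p where p: "p \<in> Hom J j k" "fmor ?X p \<cdot> u = fmor ?X p \<cdot> u'"
    using finitely_presentable_equalize[OF a(2) J F(1) X j u(2) u'(2) e(1)] by blast
  obtain k' q where q: "q \<in> Hom J j k'" "fmor ?Y q \<cdot> v = fmor ?Y q \<cdot> v'"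
    using finitely_presentable_equalize[OF a(3) J F(2) Y j u(3) u'(3) e(2)] by blast
  obtain d s t where d: "s \<in> Hom J k d" "t \<in> Hom J k' d" "s \<cdot>\<^bsub>J\<^esub> p = t \<cdot>\<^bsub>J\<^esub> q"
    using filtered_square[OF fJ p(1) q(1)] by blast
  let ?w = "s \<cdot>\<^bsub>J\<^esub> p"
  have w: "?w \<in> Hom J j d" using comp_Hom[OF cJ p(1) d(1)] .
  have "fmor ?X ?w \<cdot> u = fmor ?X ?w \<cdot> u'"
    using fmor_comp[OF F(1), of p s] p d(1) u(2) u'(2) C
      fmor_mor[OF F(1), of p] dom_fmor[OF F(1), of p] cod_fmor[OF F(1), of p]
      fmor_mor[OF F(1), of s] dom_fmor[OF F(1), of s]
    by (simp add: Hom_iff del: comp_fctr_simps)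
  moreover have "fmor ?Y ?w \<cdot> v = fmor ?Y ?w \<cdot> v'"
    unfolding d(3)
    using fmor_comp[OF F(2), of q t] q d(2) u(3) u'(3) C
      fmor_mor[OF F(2), of q] dom_fmor[OF F(2), of q] cod_fmor[OF F(2), of q]
      fmor_mor[OF F(2), of t] dom_fmor[OF F(2), of t]
    by (simp add: Hom_iff del: comp_fctr_simps)
  moreover obtain x y where "fmor Z ?w = (fob Z j, fob Z d, x, y)"
    using arrow_fmor[OF Z, of ?w] w by (metis Hom_iff)
  ultimately have "fmor Z ?w \<cdot>\<^bsub>arrow_cat C\<^esub> g = fmor Z ?w \<cdot>\<^bsub>arrow_cat C\<^esub> g'"
    unfolding u(1) u'(1) by (simp add: arrow_cat_simps)
  then show "\<exists>k. \<exists>u\<in>Hom J j k. fmor Z u \<cdot>\<^bsub>arrow_cat C\<^esub> g = fmor Z u \<cdot>\<^bsub>arrow_cat C\<^esub> g'" using w by blast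
qed

section \<open>Objects approximated by a class of finitely presentable objects\<close>

text \<open>Formulated for any category \<open>D\<close> with a class \<open>P\<close> of test
  objects: the formal closure properties use nothing about squares. \<open>dense\<close> is the
  instance where \<open>D\<close> is the category of morphisms.\<close>

definition factors_through :: "('o, 'm) cat \<Rightarrow> 'o set \<Rightarrow> 'o set \<Rightarrow> 'o \<Rightarrow> bool" where
  "factors_through D P N f \<longleftrightarrow> f \<in> Ob D \<and>
    (\<forall>a\<in>P. \<forall>t\<in>Hom D a f. \<exists>n\<in>N. \<exists>r\<in>Hom D a n. \<exists>s\<in>Hom D n f. s \<cdot>\<^bsub>D\<^esub> r = t)"

lemma factors_throughE:
  assumes "factors_through D P N f" "a \<in> P" "t \<in> Hom D a f"
  obtains n r s where "n \<in> N" "r \<in> Hom D a n" "s \<in> Hom D n f" "s \<cdot>\<^bsub>D\<^esub> r = t"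
  using assms unfolding factors_through_def by blast

lemma factors_through_retract:
  assumes D: "category D" and g: "factors_through D P N g" and f: "is_retract D f g"
  shows "factors_through D P N f"
proof -
  obtain s r where sr: "s \<in> Hom D f g" "r \<in> Hom D g f" "r \<cdot>\<^bsub>D\<^esub> s = Idt D f"
    using f by (auto simp: is_retract_def)
  show ?thesis
    unfolding factors_through_def
  proof (intro conjI ballI)
    show "f \<in> Ob D" using Hom_ob[OF D sr(1)] by simp
    fix a t assume a: "a \<in> P" "t \<in> Hom D a f"
    obtain n x y where n: "n \<in> N" "x \<in> Hom D a n" "y \<in> Hom D n g" "y \<cdot>\<^bsub>D\<^esub> x = s \<cdot>\<^bsub>D\<^esub> t"
      using factors_throughE[OF g a(1) comp_Hom[OF D a(2) sr(1)]] by blast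
    have "(r \<cdot>\<^bsub>D\<^esub> y) \<cdot>\<^bsub>D\<^esub> x = t"
      using n(2-4) sr(1,2) a(2) D comp_reassoc[OF sr(3) D, of t] by (simp add: Hom_iff)
    then show "\<exists>n\<in>N. \<exists>r\<in>Hom D a n. \<exists>s\<in>Hom D n f. s \<cdot>\<^bsub>D\<^esub> r = t"
      using n(1,2) comp_Hom[OF D n(3) sr(2)] by blast
  qed
qed

text \<open>An approximation through \<open>n\<close> can be routed through any object of which
  \<open>n\<close> is a retract. This is used to pass to a small set of representatives.\<close>

lemma factors_through_mono:
  assumes D: "category D" and f: "factors_through D P N f"
    and N: "\<And>n. n \<in> N \<Longrightarrow> \<exists>m\<in>N'. is_retract D n m"
  shows "factors_through D P N' f"
  unfolding factors_through_def
proof (intro conjI ballI)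
  show "f \<in> Ob D" using f by (simp add: factors_through_def)
  fix a t assume a: "a \<in> P" "t \<in> Hom D a f"
  obtain n x y where n: "n \<in> N" "x \<in> Hom D a n" "y \<in> Hom D n f" "y \<cdot>\<^bsub>D\<^esub> x = t"
    using factors_throughE[OF f a] by blast
  obtain m s r where m: "m \<in> N'" "s \<in> Hom D n m" "r \<in> Hom D m n" "r \<cdot>\<^bsub>D\<^esub> s = Idt D n"
    using N[OF n(1)] by (auto simp: is_retract_def)
  have "(y \<cdot>\<^bsub>D\<^esub> r) \<cdot>\<^bsub>D\<^esub> (s \<cdot>\<^bsub>D\<^esub> x) = t"
    using n(2-4) m(2,3) D comp_reassoc[OF m(4) D, of x] by (simp add: Hom_iff)
  then show "\<exists>n\<in>N'. \<exists>r\<in>Hom D a n. \<exists>s\<in>Hom D n f. s \<cdot>\<^bsub>D\<^esub> r = t"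
    using m(1) comp_Hom[OF D n(2) m(2)] comp_Hom[OF D m(3) n(3)] by blast
qed

text \<open>A test map into the colimit comes from a stage, by finite presentability, and can be
  approximated there.\<close>

lemma factors_through_colimit:
  assumes D: "category D" and P: "\<And>a. a \<in> P \<Longrightarrow> finitely_presentable U D a"
    and J: "small_index U J" and Z: "is_functor J D Z" and f: "is_colimit J D Z f \<kappa>"
    and N: "\<And>j. j \<in> Ob J \<Longrightarrow> factors_through D P N (fob Z j)"
  shows "factors_through D P N f"
  unfolding factors_through_def
proof (intro conjI ballI)
  note kf = cocone_facts[OF colimit_cocone[OF f]]
  show "f \<in> Ob D" by (rule kf(1))
  fix a t assume a: "a \<in> P" "t \<in> Hom D a f"
  obtain j g where g: "j \<in> Ob J" "g \<in> Hom D a (fob Z j)" "\<kappa> j \<cdot>\<^bsub>D\<^esub> g = t"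
    using finitely_presentable_factor[OF P[OF a(1)] J Z f a(2)] by blast
  obtain n x y where n: "n \<in> N" "x \<in> Hom D a n" "y \<in> Hom D n (fob Z j)" "y \<cdot>\<^bsub>D\<^esub> x = g"
    using factors_throughE[OF N[OF g(1)] a(1) g(2)] by blast
  have k: "\<kappa> j \<in> Hom D (fob Z j) f" using kf g(1) by (simp add: Hom_iff)
  have "(\<kappa> j \<cdot>\<^bsub>D\<^esub> y) \<cdot>\<^bsub>D\<^esub> x = t" using n(2-4) k g D by (simp add: Hom_iff)
  then show "\<exists>n\<in>N. \<exists>r\<in>Hom D a n. \<exists>s\<in>Hom D n f. s \<cdot>\<^bsub>D\<^esub> r = t"
    using n(1,2) comp_Hom[OF D n(3) k] by blast
qed

text \<open>The comma category of the full subcategory on \<open>N\<close> over \<open>f\<close>. A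
  morphism is stored as \<open>(s, t)\<close> with target \<open>t\<close>; its source is the
  composite, so the triangle commutes by construction.\<close>

definition slice_over :: "('o, 'm) cat \<Rightarrow> 'o set \<Rightarrow> 'o \<Rightarrow> ('m, 'm \<times> 'm) cat" where
  "slice_over D N f =
    \<lparr>Ob = {t \<in> Mor D. Dom D t \<in> N \<and> Cod D t = f},
     Mor = {(s, t). s \<in> Mor D \<and> t \<in> Mor D \<and> Dom D s \<in> N \<and> Dom D t \<in> N \<and> Cod D s = Dom D t \<and> Cod D t = f},
     Dom = (\<lambda>(s, t). t \<cdot>\<^bsub>D\<^esub> s), Cod = snd, Idt = (\<lambda>t. (Idt D (Dom D t), t)),
     Cmp = (\<lambda>(s', t') (s, t). (s' \<cdot>\<^bsub>D\<^esub> s, t'))\<rparr>"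

definition slice_fctr :: "('o, 'm) cat \<Rightarrow> ('m, 'm \<times> 'm, 'o, 'm) fctr" where
  "slice_fctr D = \<lparr>fob = Dom D, fmor = fst\<rparr>"

lemma slice_simps:
  "t \<in> Ob (slice_over D N f) \<longleftrightarrow> t \<in> Mor D \<and> Dom D t \<in> N \<and> Cod D t = f"
  "(s, t) \<in> Mor (slice_over D N f) \<longleftrightarrow>
     s \<in> Mor D \<and> t \<in> Mor D \<and> Dom D s \<in> N \<and> Dom D t \<in> N \<and> Cod D s = Dom D t \<and> Cod D t = f"
  "Dom (slice_over D N f) (s, t) = t \<cdot>\<^bsub>D\<^esub> s" "Cod (slice_over D N f) (s, t) = t"
  "Idt (slice_over D N f) t = (Idt D (Dom D t), t)"
  "(s', t') \<cdot>\<^bsub>slice_over D N f\<^esub> (s, t) = (s' \<cdot>\<^bsub>D\<^esub> s, t')"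
  "fob (slice_fctr D) = Dom D" "fmor (slice_fctr D) = fst"
  by (simp_all add: slice_over_def slice_fctr_def)

lemma category_slice:
  assumes "category D"
  shows "category (slice_over D N f)"
  unfolding category_def Ball_def split_paired_all split_paired_All Hom_iff slice_simps using assms
  by auto

lemma functor_slice:
  assumes "category D"
  shows "is_functor (slice_over D N f) D (slice_fctr D)"
  unfolding is_functor_def Ball_def split_paired_all split_paired_All Hom_iff slice_simps
  using assms category_slice[OF assms] by (simp add: slice_simps)

lemma Hom_slice:
  assumes "category D"
  shows "p \<in> Hom (slice_over D N f) t t' \<longleftrightarrow> (\<exists>s. p = (s, t') \<and> t \<in> Ob (slice_over D N f) \<and>
    t' \<in> Ob (slice_over D N f) \<and> s \<in> Hom D (Dom D t) (Dom D t') \<and> t' \<cdot>\<^bsub>D\<^esub> s = t)"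
proof (cases p)
  case (Pair s w)
  show ?thesis (is "?l \<longleftrightarrow> ?r")
  proof
    assume ?l
    then have *: "s \<in> Mor D \<and> w \<in> Mor D \<and> Dom D s \<in> N \<and> Dom D w \<in> N \<and> Cod D s = Dom D w \<and> Cod D w = f"
      "w \<cdot>\<^bsub>D\<^esub> s = t" "w = t'"
      unfolding Pair Hom_iff slice_simps by blast+
    then have "t \<in> Mor D" "Dom D t = Dom D s" "Cod D t = f"
      using comp_mor[OF assms, of s w] dom_comp[OF assms, of s w] cod_comp[OF assms, of s w] by simp_all
    with * show ?r unfolding Pair Hom_iff slice_simps by simp
  next
    assume ?r
    then have *: "s \<in> Mor D" "Dom D s = Dom D t" "Cod D s = Dom D t'" "t \<in> Mor D" "Dom D t \<in> N"
      "t' \<in> Mor D" "Dom D t' \<in> N" "Cod D t' = f" "t' \<cdot>\<^bsub>D\<^esub> s = t" "w = t'"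
      unfolding Pair Hom_iff slice_simps by blast+
    then show ?l unfolding Pair Hom_iff slice_simps by simp
  qed
qed

text \<open>If every map from a finitely presentable object to \<open>f\<close> factors through \<open>N\<close>, then \<open>f\<close> is the
  filtered colimit of the objects of \<open>N\<close> over it.\<close>

locale approximated = universe U for U :: "'u itself" +
  fixes D :: "('o, 'm) cat" (structure) and P N :: "'o set" and f :: 'o and J :: "('i, 'j) cat" and Z \<kappa>
  assumes D: "category D" and N: "N \<subseteq> P" and P: "\<And>a. a \<in> P \<Longrightarrow> finitely_presentable U D a"
    and J: "small_index U J" and Z: "is_functor J D Z" and f: "is_colimit J D Z f \<kappa>"
    and ZP: "\<And>j. j \<in> Ob J \<Longrightarrow> fob Z j \<in> P"
    and fac: "factors_through D P N f"
begin

abbreviation "E \<equiv> slice_over D N f"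

lemma fJ: "filtered J" using J by (simp add: small_index_def)

lemma \<kappa>_Hom: "j \<in> Ob J \<Longrightarrow> \<kappa> j \<in> Hom D (fob Z j) f"
  using cocone_facts[OF colimit_cocone[OF f]] by (simp add: Hom_iff)

lemma factor_P:
  assumes "a \<in> P" "t \<in> Hom D a f"
  obtains j g where "j \<in> Ob J" "g \<in> Hom D a (fob Z j)" "\<kappa> j \<cdot> g = t"
  using finitely_presentable_factor[OF P[OF assms(1)] J Z f assms(2)] by blast

lemma factor_N:
  assumes "a \<in> P" "t \<in> Hom D a f"
  obtains s r where "s \<in> Ob E" "r \<in> Hom D a (Dom D s)" "s \<cdot> r = t"
proof -
  obtain n r s where "n \<in> N" "r \<in> Hom D a n" "s \<in> Hom D n f" "s \<cdot> r = t"
    using factors_throughE[OF fac assms] by blast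
  then show thesis using that[of s r] by (auto simp: slice_simps Hom_iff)
qed

lemma \<kappa>_comm:
  assumes "u \<in> Hom J j k"
  shows "\<kappa> k \<cdot> fmor Z u = \<kappa> j" "fmor Z u \<in> Hom D (fob Z j) (fob Z k)"
  using cocone_comm[OF colimit_cocone[OF f], of u] assms Z by (auto simp: Hom_iff)

text \<open>The refinement is not found inside \<open>N\<close> directly: the object is moved to a
  stage of the presentation \<open>Z\<close>, where finite presentability of \<open>a\<close>
  equalizes the two maps, and from there back into \<open>N\<close>.\<close>

lemma slice_refine:
  assumes a: "a \<in> P" and t: "t \<in> Ob E" and g: "g \<in> Hom D a (Dom D t)" "g' \<in> Hom D a (Dom D t)"
    and eq: "t \<cdot> g = t \<cdot> g'"
  obtains t' s where "t' \<in> Ob E" "s \<in> Hom D (Dom D t) (Dom D t')" "t' \<cdot> s = t" "s \<cdot> g = s \<cdot> g'"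
proof -
  have tm: "t \<in> Hom D (Dom D t) f" and nP: "Dom D t \<in> P" using t N by (auto simp: slice_simps Hom_iff)
  obtain j x where x: "j \<in> Ob J" "x \<in> Hom D (Dom D t) (fob Z j)" "\<kappa> j \<cdot> x = t"
    using factor_P[OF nP tm] by blast
  have "\<kappa> j \<cdot> (x \<cdot> g) = \<kappa> j \<cdot> (x \<cdot> g')"
    using comp_reassoc[OF x(3) D, of g] comp_reassoc[OF x(3) D, of g'] eq g x(2) \<kappa>_Hom[OF x(1)]
    by (simp add: Hom_iff)
  then obtain k u where u: "u \<in> Hom J j k" "fmor Z u \<cdot> (x \<cdot> g) = fmor Z u \<cdot> (x \<cdot> g')"
    using finitely_presentable_equalize[OF P[OF a] J Z f x(1) comp_Hom[OF D g(1) x(2)] comp_Hom[OF D g(2) x(2)]]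
    by blast
  have k: "k \<in> Ob J" using Hom_ob[OF filtered_cat[OF fJ] u(1)] by simp
  obtain t' r where t': "t' \<in> Ob E" "r \<in> Hom D (fob Z k) (Dom D t')" "t' \<cdot> r = \<kappa> k"
    using factor_N[OF ZP[OF k] \<kappa>_Hom[OF k]] by blast
  note uu = \<kappa>_comm[OF u(1)]
  have t'm: "t' \<in> Mor D" using t'(1) by (simp add: slice_simps)
  show thesis
  proof (rule that[OF t'(1)])
    show "r \<cdot> (fmor Z u \<cdot> x) \<in> Hom D (Dom D t) (Dom D t')"
      using comp_Hom[OF D comp_Hom[OF D x(2) uu(2)] t'(2)] .
    show "t' \<cdot> (r \<cdot> (fmor Z u \<cdot> x)) = t"
      using comp_reassoc[OF t'(3) D, of "fmor Z u \<cdot> x"] comp_reassoc[OF uu(1) D, of x] x t'(2) t'm uu(2) \<kappa>_Hom[OF k] D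
      by (simp add: Hom_iff)
    show "(r \<cdot> (fmor Z u \<cdot> x)) \<cdot> g = (r \<cdot> (fmor Z u \<cdot> x)) \<cdot> g'"
      using u(2) uu(2) x(2) g t'(2) D by (simp add: Hom_iff)
  qed
qed

text \<open>Joins are borrowed from \<open>J\<close>: both objects map to a common stage
  \<open>k\<close>, whose leg to \<open>f\<close> then factors through \<open>N\<close>.\<close>

lemma slice_join:
  assumes t: "t \<in> Ob E" and t': "t' \<in> Ob E"
  obtains w s s' where "w \<in> Ob E" "s \<in> Hom D (Dom D t) (Dom D w)" "w \<cdot> s = t"
    "s' \<in> Hom D (Dom D t') (Dom D w)" "w \<cdot> s' = t'"
proof -
  have tm: "t \<in> Hom D (Dom D t) f" "Dom D t \<in> P" "t' \<in> Hom D (Dom D t') f" "Dom D t' \<in> P"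
    using t t' N by (auto simp: slice_simps Hom_iff)
  obtain j x where x: "j \<in> Ob J" "x \<in> Hom D (Dom D t) (fob Z j)" "\<kappa> j \<cdot> x = t"
    using factor_P[OF tm(2,1)] by blast
  obtain j' x' where x': "j' \<in> Ob J" "x' \<in> Hom D (Dom D t') (fob Z j')" "\<kappa> j' \<cdot> x' = t'"
    using factor_P[OF tm(4,3)] by blast
  obtain k u v where k: "k \<in> Ob J" "u \<in> Hom J j k" "v \<in> Hom J j' k"
    using filtered_join[OF fJ x(1) x'(1)] by blast
  obtain w r where w: "w \<in> Ob E" "r \<in> Hom D (fob Z k) (Dom D w)" "w \<cdot> r = \<kappa> k"
    using factor_N[OF ZP[OF k(1)] \<kappa>_Hom[OF k(1)]] by blast
  have wm: "w \<in> Mor D" using w(1) by (simp add: slice_simps)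
  have *: "w \<cdot> (r \<cdot> (fmor Z u \<cdot> x)) = \<kappa> j \<cdot> x" if "u \<in> Hom J j k" "x \<in> Hom D n (fob Z j)" for u j x n
    using comp_reassoc[OF w(3) D, of "fmor Z u \<cdot> x"] comp_reassoc[OF \<kappa>_comm(1)[OF that(1)] D, of x]
      \<kappa>_comm(2)[OF that(1)] that(2) w(2) wm \<kappa>_Hom[OF k(1)] D by (simp add: Hom_iff)
  show thesis
  proof (rule that[OF w(1)])
    show "r \<cdot> (fmor Z u \<cdot> x) \<in> Hom D (Dom D t) (Dom D w)"
      using comp_Hom[OF D comp_Hom[OF D x(2) \<kappa>_comm(2)[OF k(2)]] w(2)] .
    show "r \<cdot> (fmor Z v \<cdot> x') \<in> Hom D (Dom D t') (Dom D w)"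
      using comp_Hom[OF D comp_Hom[OF D x'(2) \<kappa>_comm(2)[OF k(3)]] w(2)] .
  qed (use *[OF k(2) x(2)] *[OF k(3) x'(2)] x(3) x'(3) in simp_all)
qed

lemma filtered_slice: "filtered E"
proof (rule filteredI)
  show "category E" using D by (rule category_slice)
  obtain j where j: "j \<in> Ob J" using fJ by (auto simp: filtered_def)
  show "Ob E \<noteq> {}" using factor_N[OF ZP[OF j] \<kappa>_Hom[OF j]] by blast
  fix t t' assume t: "t \<in> Ob E" "t' \<in> Ob E"
  obtain w s s' where w: "w \<in> Ob E" "s \<in> Hom D (Dom D t) (Dom D w)" "w \<cdot> s = t"
    "s' \<in> Hom D (Dom D t') (Dom D w)" "w \<cdot> s' = t'"
    using slice_join[OF t] by blast
  then have "(s, w) \<in> Hom E t w" "(s', w) \<in> Hom E t' w" unfolding Hom_slice[OF D] using t by auto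
  then show "\<exists>c u v. u \<in> Hom E t c \<and> v \<in> Hom E t' c" by blast
next
  fix t t' p q assume pq: "p \<in> Hom E t t'" "q \<in> Hom E t t'"
  obtain g where g: "p = (g, t')" "t \<in> Ob E" "t' \<in> Ob E" "g \<in> Hom D (Dom D t) (Dom D t')" "t' \<cdot> g = t"
    using pq(1) unfolding Hom_slice[OF D] by blast
  obtain g' where g': "q = (g', t')" "g' \<in> Hom D (Dom D t) (Dom D t')" "t' \<cdot> g' = t"
    using pq(2) unfolding Hom_slice[OF D] by blast
  have a: "Dom D t \<in> P" using g(2) N by (auto simp: slice_simps)
  obtain w s where w: "w \<in> Ob E" "s \<in> Hom D (Dom D t') (Dom D w)" "w \<cdot> s = t'" "s \<cdot> g = s \<cdot> g'"
    using slice_refine[OF a g(3,4) g'(2)] g(5) g'(3) by auto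
  have "(s, w) \<in> Hom E t' w" unfolding Hom_slice[OF D] using w g by auto
  moreover have "(s, w) \<cdot>\<^bsub>E\<^esub> p = (s, w) \<cdot>\<^bsub>E\<^esub> q" using w(4) g(1) g'(1) by (simp add: slice_simps)
  ultimately show "\<exists>c. \<exists>w\<in>Hom E t' c. w \<cdot>\<^bsub>E\<^esub> p = w \<cdot>\<^bsub>E\<^esub> q" by blast
qed

text \<open>Cocones on the slice and on the presentation \<open>Z\<close> determine each other: a
  leg of \<open>Z\<close> factors through a member of \<open>N\<close> over \<open>f\<close>, and a
  map to \<open>f\<close> from a member of \<open>N\<close> factors through a stage of
  \<open>Z\<close>.\<close>

lemma colimit_slice: "is_colimit E D (slice_fctr D) f (\<lambda>t. t)"
proof (rule is_colimitI)
  have fo: "f \<in> Ob D" using cocone_ob[OF colimit_cocone[OF f]] .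
  show "cocone E D (slice_fctr D) f (\<lambda>t. t)"
    unfolding cocone_def Ball_def split_paired_All slice_simps using fo D by (simp add: Hom_iff)
  fix W
  {
    fix \<zeta> assume z: "cocone E D (slice_fctr D) W \<zeta>"
    have zH: "\<zeta> t \<in> Hom D (Dom D t) W" if "t \<in> Ob E" for t
      using cocone_facts[OF z] that by (simp add: Hom_iff slice_simps)
    have zc: "\<zeta> t' \<cdot> s = \<zeta> t" if "t \<in> Ob E" "t' \<in> Ob E" "s \<in> Hom D (Dom D t) (Dom D t')" "t' \<cdot> s = t" for s t t'
      using cocone_comm[OF z, of "(s, t')"] that by (simp add: slice_simps Hom_iff)
    \<comment> \<open>The factorization of a stage through \<open>N\<close> is chosen, not
      canonical; joining and refining in the slice shows that the induced map depends only on the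
      composite to \<open>f\<close>.\<close>
    have indep: "\<zeta> t \<cdot> g = \<zeta> t' \<cdot> g'"
      if a: "a \<in> P" and t: "t \<in> Ob E" "t' \<in> Ob E" and g: "g \<in> Hom D a (Dom D t)" "g' \<in> Hom D a (Dom D t')"
        and eq: "t \<cdot> g = t' \<cdot> g'" for a t t' g g'
    proof -
      obtain w s s' where w: "w \<in> Ob E" "s \<in> Hom D (Dom D t) (Dom D w)" "w \<cdot> s = t"
        "s' \<in> Hom D (Dom D t') (Dom D w)" "w \<cdot> s' = t'"
        using slice_join[OF t] by blast
      have wm: "w \<in> Mor D" using w(1) by (simp add: slice_simps)
      have "w \<cdot> (s \<cdot> g) = w \<cdot> (s' \<cdot> g')"
        using comp_reassoc[OF w(3) D, of g] comp_reassoc[OF w(5) D, of g'] eq w(2,4) wm g by (simp add: Hom_iff)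
      then obtain x r where x: "x \<in> Ob E" "r \<in> Hom D (Dom D w) (Dom D x)" "x \<cdot> r = w"
        "r \<cdot> (s \<cdot> g) = r \<cdot> (s' \<cdot> g')"
        using slice_refine[OF a w(1) comp_Hom[OF D g(1) w(2)] comp_Hom[OF D g(2) w(4)]] by blast
      have "\<zeta> x \<cdot> (r \<cdot> (s \<cdot> g)) = \<zeta> t \<cdot> g"
        using comp_reassoc[OF zc[OF w(1) x(1-3)] D, of "s \<cdot> g"] comp_reassoc[OF zc[OF t(1) w(1-3)] D, of g]
          zH[OF x(1)] zH[OF w(1)] x(2) w(2) g D by (simp add: Hom_iff)
      moreover have "\<zeta> x \<cdot> (r \<cdot> (s' \<cdot> g')) = \<zeta> t' \<cdot> g'"
        using comp_reassoc[OF zc[OF w(1) x(1-3)] D, of "s' \<cdot> g'"] comp_reassoc[OF zc[OF t(2) w(1,4,5)] D, of g']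
          zH[OF x(1)] zH[OF w(1)] x(2) w(4) g D by (simp add: Hom_iff)
      ultimately show ?thesis using x(4) by simp
    qed
    have "\<exists>s r. s \<in> Ob E \<and> r \<in> Hom D (fob Z j) (Dom D s) \<and> s \<cdot> r = \<kappa> j" if "j \<in> Ob J" for j
      using factor_N[OF ZP[OF that] \<kappa>_Hom[OF that]] by metis
    then obtain s r where sr: "\<And>j. j \<in> Ob J \<Longrightarrow> s j \<in> Ob E" "\<And>j. j \<in> Ob J \<Longrightarrow> r j \<in> Hom D (fob Z j) (Dom D (s j))"
      "\<And>j. j \<in> Ob J \<Longrightarrow> s j \<cdot> r j = \<kappa> j" by metis
    define \<eta> where "\<eta> j = \<zeta> (s j) \<cdot> r j" for j
    have sm: "s j \<in> Mor D" if "j \<in> Ob J" for j using sr(1)[OF that] by (simp add: slice_simps)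
    have "cocone J D Z W \<eta>"
      unfolding cocone_def
    proof (intro conjI ballI)
      show "W \<in> Ob D" using cocone_ob[OF z] .
      show "\<eta> j \<in> Hom D (fob Z j) W" if "j \<in> Ob J" for j
        unfolding \<eta>_def using comp_Hom[OF D sr(2)[OF that] zH[OF sr(1)[OF that]]] .
      fix u assume u: "u \<in> Mor J"
      let ?j = "Dom J u" and ?k = "Cod J u"
      have uH: "u \<in> Hom J ?j ?k" using u by (simp add: Hom_iff)
      have j: "?j \<in> Ob J" "?k \<in> Ob J" using u filtered_cat[OF fJ] by auto
      note uk = \<kappa>_comm[OF uH]
      have "s ?k \<cdot> (r ?k \<cdot> fmor Z u) = s ?j \<cdot> r ?j"
        using comp_reassoc[OF sr(3)[OF j(2)] D, of "fmor Z u"] uk sr(2)[OF j(2)] sm[OF j(2)] sr(3)[OF j(1)]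
        by (simp add: Hom_iff)
      from indep[OF ZP[OF j(1)] sr(1)[OF j(2)] sr(1)[OF j(1)] comp_Hom[OF D uk(2) sr(2)[OF j(2)]] sr(2)[OF j(1)] this]
      show "\<eta> ?k \<cdot> fmor Z u = \<eta> ?j"
        unfolding \<eta>_def using uk(2) sr(2)[OF j(2)] zH[OF sr(1)[OF j(2)]] D by (simp add: Hom_iff)
    qed
    then obtain h where h: "h \<in> Hom D f W" "\<And>j. j \<in> Ob J \<Longrightarrow> h \<cdot> \<kappa> j = \<eta> j"
      using colimit_induced[OF f] by blast
    have "h \<cdot> t = \<zeta> t" if t: "t \<in> Ob E" for t
    proof -
      have tm: "t \<in> Hom D (Dom D t) f" "Dom D t \<in> P" "t \<in> Mor D"
        using t N by (auto simp: slice_simps Hom_iff)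
      obtain j g where g: "j \<in> Ob J" "g \<in> Hom D (Dom D t) (fob Z j)" "\<kappa> j \<cdot> g = t"
        using factor_P[OF tm(2,1)] by blast
      have i: "Idt D (Dom D t) \<in> Hom D (Dom D t) (Dom D t)" using tm(3) D by (simp add: Hom_iff)
      have "s j \<cdot> (r j \<cdot> g) = t \<cdot> Idt D (Dom D t)"
        using comp_reassoc[OF sr(3)[OF g(1)] D, of g] g sr(2)[OF g(1)] sm[OF g(1)] tm(3) D by (simp add: Hom_iff)
      from indep[OF tm(2) sr(1)[OF g(1)] t comp_Hom[OF D g(2) sr(2)[OF g(1)]] i this]
      have "\<eta> j \<cdot> g = \<zeta> t"
        unfolding \<eta>_def using g(2) sr(2)[OF g(1)] zH[OF sr(1)[OF g(1)]] zH[OF t] D by (simp add: Hom_iff)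
      then show ?thesis
        using comp_reassoc[OF h(2)[OF g(1)] D, of g] g h(1) \<kappa>_Hom[OF g(1)] by (simp add: Hom_iff)
    qed
    then show "\<exists>h\<in>Hom D f W. \<forall>t\<in>Ob E. h \<cdot> t = \<zeta> t" using h(1) by blast
  }
  fix h h' assume h: "h \<in> Hom D f W" "h' \<in> Hom D f W" and eq: "\<forall>t\<in>Ob E. h \<cdot> t = h' \<cdot> t"
  show "h = h'"
  proof (rule colimit_unique[OF D Z f h])
    fix j assume j: "j \<in> Ob J"
    obtain s r where s: "s \<in> Ob E" "r \<in> Hom D (fob Z j) (Dom D s)" "s \<cdot> r = \<kappa> j"
      using factor_N[OF ZP[OF j] \<kappa>_Hom[OF j]] by blast
    have sm: "s \<in> Mor D" "Cod D s = f" using s(1) by (auto simp: slice_simps)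
    have "(g \<cdot> s) \<cdot> r = g \<cdot> \<kappa> j" if "g \<in> Hom D f W" for g
      using that s sm D by (simp add: Hom_iff)
    from this[OF h(1)] this[OF h(2)] eq s(1) show "h \<cdot> \<kappa> j = h' \<cdot> \<kappa> j" by metis
  qed
qed

lemma small_slice:
  assumes sN: "small U N" and hom: "\<And>a b. a \<in> Ob D \<Longrightarrow> b \<in> Ob D \<Longrightarrow> small U (Hom D a b)"
  shows "small_index U E"
proof -
  have No: "n \<in> Ob D" if "n \<in> N" for n
    by (rule finitely_presentable_ob[OF P]) (use that N in auto)
  have fo: "f \<in> Ob D" using cocone_ob[OF colimit_cocone[OF f]] .
  have s1: "small U (\<Union>n\<in>N. Hom D n f)"
    using sN hom No fo by (intro small_UN) auto
  have "small U (\<Union>n\<in>N. \<Union>m\<in>N. Hom D n m)"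
    using sN hom No by (intro small_UN) auto
  from small_Times[OF this s1] have s2: "small U ((\<Union>n\<in>N. \<Union>m\<in>N. Hom D n m) \<times> (\<Union>n\<in>N. Hom D n f))" .
  have "small U (Ob E)" by (rule small_mono[OF s1]) (simp add: slice_over_def Hom_def, blast)
  moreover have "small U (Mor E)" by (rule small_mono[OF s2]) (simp add: slice_over_def Hom_def, blast)
  ultimately show ?thesis using filtered_slice by (simp add: small_index_def)
qed

end

section \<open>Presentations of morphisms\<close>

text \<open>Given filtered presentations of the source and of the target of \<open>f\<close>, the comma category of
  compatible maps between their stages presents \<open>f\<close> itself.\<close>

locale presented_arrow = universe U for U :: "'u itself" +
  fixes C :: "('o, 'm) cat" (structure) and f :: 'm and I :: "('u, 'u) cat" and X \<iota> and K :: "('u, 'u) cat" and Y \<kappa>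
  assumes C: "category C" and f: "f \<in> Mor C" and lsmall: "\<And>a b. a \<in> Ob C \<Longrightarrow> b \<in> Ob C \<Longrightarrow> small U (Hom C a b)"
    and I: "small_index U I" and X: "is_functor I C X" and Xc: "is_colimit I C X (Dom C f) \<iota>"
    and Xfp: "\<And>i. i \<in> Ob I \<Longrightarrow> finitely_presentable U C (fob X i)"
    and K: "small_index U K" and Y: "is_functor K C Y" and Yc: "is_colimit K C Y (Cod C f) \<kappa>"
begin

definition comma_ob :: "('u \<times> 'u \<times> 'm) set" where
  "comma_ob = {(i, k, g). i \<in> Ob I \<and> k \<in> Ob K \<and> g \<in> Hom C (fob X i) (fob Y k) \<and> \<kappa> k \<cdot> g = f \<cdot> \<iota> i}"

text \<open>Both endpoints are stored: \<open>u\<close> and \<open>v\<close> alone do not determine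
  the stage maps \<open>g\<close> and \<open>g'\<close> between which they form a square.\<close>

definition comma :: "('u \<times> 'u \<times> 'm, ('u \<times> 'u \<times> 'm) \<times> ('u \<times> 'u \<times> 'm) \<times> 'u \<times> 'u) cat" where
  "comma =
    \<lparr>Ob = comma_ob,
     Mor = {((i, k, g), (i', k', g'), u, v). (i, k, g) \<in> comma_ob \<and> (i', k', g') \<in> comma_ob \<and>
        u \<in> Hom I i i' \<and> v \<in> Hom K k k' \<and> g' \<cdot> fmor X u = fmor Y v \<cdot> g},
     Dom = fst, Cod = (\<lambda>t. fst (snd t)),
     Idt = (\<lambda>a. (a, a, Idt I (fst a), Idt K (fst (snd a)))),
     Cmp = (\<lambda>(a', b', u', v') (a, b, u, v). (a, b', u' \<cdot>\<^bsub>I\<^esub> u, v' \<cdot>\<^bsub>K\<^esub> v))\<rparr>"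

lemma comma_simps:
  "Ob comma = comma_ob"
  "((i, k, g), (i', k', g'), u, v) \<in> Mor comma \<longleftrightarrow> (i, k, g) \<in> comma_ob \<and> (i', k', g') \<in> comma_ob \<and>
        u \<in> Hom I i i' \<and> v \<in> Hom K k k' \<and> g' \<cdot> fmor X u = fmor Y v \<cdot> g"
  "Dom comma (a, b, u, v) = a" "Cod comma (a, b, u, v) = b"
  "Idt comma (i, k, g) = ((i, k, g), (i, k, g), Idt I i, Idt K k)"
  "(a', b', u', v') \<cdot>\<^bsub>comma\<^esub> (a, b, u, v) = (a, b', u' \<cdot>\<^bsub>I\<^esub> u, v' \<cdot>\<^bsub>K\<^esub> v)"
  by (simp_all add: comma_def)

lemma cats: "category I" "category K" "filtered I" "filtered K"
  using I K by (auto simp: small_index_def filtered_def)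

lemma comma_obD:
  assumes "(i, k, g) \<in> comma_ob"
  shows "i \<in> Ob I" "k \<in> Ob K" "g \<in> Mor C" "Dom C g = fob X i" "Cod C g = fob Y k" "\<kappa> k \<cdot> g = f \<cdot> \<iota> i"
  using assms by (auto simp: comma_ob_def Hom_iff)

lemmas xf = cocone_facts[OF colimit_cocone[OF Xc]]
lemmas yf = cocone_facts[OF colimit_cocone[OF Yc]]

lemma \<iota>_comm: "u \<in> Hom I i i' \<Longrightarrow> \<iota> i' \<cdot> fmor X u = \<iota> i"
  using cocone_comm[OF colimit_cocone[OF Xc], of u] by (simp add: Hom_iff)

lemma \<kappa>_comm: "u \<in> Hom K k k' \<Longrightarrow> \<kappa> k' \<cdot> fmor Y u = \<kappa> k"
  using cocone_comm[OF colimit_cocone[OF Yc], of u] by (simp add: Hom_iff)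

lemma fmorX: "u \<in> Hom I i i' \<Longrightarrow> fmor X u \<in> Hom C (fob X i) (fob X i')"
  and fmorY: "v \<in> Hom K k k' \<Longrightarrow> fmor Y v \<in> Hom C (fob Y k) (fob Y k')"
  using X Y by (auto simp: Hom_iff)

lemma square_comp:
  assumes "g' \<cdot> fmor X u = fmor Y v \<cdot> g" "g'' \<cdot> fmor X u' = fmor Y v' \<cdot> g'"
    "(i, k, g) \<in> comma_ob" "(i', k', g') \<in> comma_ob" "(i'', k'', g'') \<in> comma_ob"
    "u \<in> Hom I i i'" "v \<in> Hom K k k'" "u' \<in> Hom I i' i''" "v' \<in> Hom K k' k''"
  shows "g'' \<cdot> fmor X (u' \<cdot>\<^bsub>I\<^esub> u) = fmor Y (v' \<cdot>\<^bsub>K\<^esub> v) \<cdot> g"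
proof -
  note d = comma_obD[OF assms(3)] comma_obD[OF assms(4)] comma_obD[OF assms(5)]
  show ?thesis
    using assms(1,6-9) d C X Y cats comp_reassoc[OF assms(2) C, of "fmor X u"] by (simp add: Hom_iff)
qed

lemma category_comma: "category comma"
proof -
  have "g \<cdot> fmor X (Idt I i) = fmor Y (Idt K k) \<cdot> g" if "(i, k, g) \<in> comma_ob" for i k g
    using comma_obD[OF that] X Y C by simp
  moreover have "Idt I i \<in> Hom I i i" "Idt K k \<in> Hom K k k" if "(i, k, g) \<in> comma_ob" for i k g
    using comma_obD[OF that] cats by (auto simp: Hom_iff)
  ultimately show ?thesis
    unfolding category_def Ball_def split_paired_all split_paired_All comma_simps Hom_def[of comma]
    using cats square_comp
    by (simp add: comma_simps) (auto simp: comp_Hom[OF cats(1)] comp_Hom[OF cats(2)] Hom_iff)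
qed

definition comma_left :: "('u \<times> 'u \<times> 'm, ('u \<times> 'u \<times> 'm) \<times> ('u \<times> 'u \<times> 'm) \<times> 'u \<times> 'u, 'u, 'u) fctr" where
  "comma_left = \<lparr>fob = fst, fmor = (\<lambda>(a, b, u, v). u)\<rparr>"

definition comma_right :: "('u \<times> 'u \<times> 'm, ('u \<times> 'u \<times> 'm) \<times> ('u \<times> 'u \<times> 'm) \<times> 'u \<times> 'u, 'u, 'u) fctr" where
  "comma_right = \<lparr>fob = (\<lambda>a. fst (snd a)), fmor = (\<lambda>(a, b, u, v). v)\<rparr>"

definition comma_arrow ::
    "('u \<times> 'u \<times> 'm, ('u \<times> 'u \<times> 'm) \<times> ('u \<times> 'u \<times> 'm) \<times> 'u \<times> 'u, 'm, 'm \<times> 'm \<times> 'm \<times> 'm) fctr" where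
  "comma_arrow = \<lparr>fob = (\<lambda>a. snd (snd a)), fmor = (\<lambda>(a, b, u, v). (snd (snd a), snd (snd b), fmor X u, fmor Y v))\<rparr>"

lemma comma_fctr_simps:
  "fob comma_left (i, k, g) = i" "fmor comma_left (a, b, u, v) = u"
  "fob comma_right (i, k, g) = k" "fmor comma_right (a, b, u, v) = v"
  "fob comma_arrow (i, k, g) = g"
  "fmor comma_arrow ((i, k, g), (i', k', g'), u, v) = (g, g', fmor X u, fmor Y v)"
  by (simp_all add: comma_left_def comma_right_def comma_arrow_def)

lemma functor_comma_left: "is_functor comma I comma_left"
  and functor_comma_right: "is_functor comma K comma_right"
  unfolding is_functor_def Ball_def split_paired_all split_paired_All comma_simps comma_fctr_simps
  using category_comma cats by (auto dest: comma_obD)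

lemma functor_comma_arrow: "is_functor comma (arrow_cat C) comma_arrow"
proof -
  have "fmor X u \<in> Hom C (Dom C g) (Dom C g')" "fmor Y v \<in> Hom C (Cod C g) (Cod C g')"
    if "(i, k, g) \<in> comma_ob" "(i', k', g') \<in> comma_ob" "u \<in> Hom I i i'" "v \<in> Hom K k k'" for i k g i' k' g' u v
    using fmorX[OF that(3)] fmorY[OF that(4)] comma_obD[OF that(1)] comma_obD[OF that(2)] by auto
  moreover have "fmor X (Idt I i) = Idt C (Dom C g)" "fmor Y (Idt K k) = Idt C (Cod C g)" if "(i, k, g) \<in> comma_ob" for i k g
    using comma_obD[OF that] X Y by simp_all
  moreover have "fmor X (u' \<cdot>\<^bsub>I\<^esub> u) = fmor X u' \<cdot> fmor X u" if "u \<in> Hom I a b" "u' \<in> Hom I b c" for u u' a b c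
    using that X by (simp add: Hom_iff)
  moreover have "fmor Y (u' \<cdot>\<^bsub>K\<^esub> u) = fmor Y u' \<cdot> fmor Y u" if "u \<in> Hom K a b" "u' \<in> Hom K b c" for u u' a b c
    using that Y by (simp add: Hom_iff)
  ultimately show ?thesis
    unfolding is_functor_def Ball_def split_paired_all split_paired_All comma_simps comma_fctr_simps arrow_cat_simps
      Hom_arrow_iff
    using category_comma C X Y by (auto dest: comma_obD)
qed

lemma comma_lift:
  assumes "i \<in> Ob I"
  obtains k g where "(i, k, g) \<in> comma_ob"
proof -
  have "f \<cdot> \<iota> i \<in> Hom C (fob X i) (Cod C f)" using xf assms f C by (simp add: Hom_iff)
  then obtain k g where "k \<in> Ob K" "g \<in> Hom C (fob X i) (fob Y k)" "\<kappa> k \<cdot> g = f \<cdot> \<iota> i"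
    using finitely_presentable_factor[OF Xfp[OF assms] K Y Yc] by metis
  then show thesis using that assms by (auto simp: comma_ob_def)
qed

lemma comma_push:
  assumes a: "(i, k, g) \<in> comma_ob" and v: "v \<in> Hom K k k'"
  shows "(i, k', fmor Y v \<cdot> g) \<in> comma_ob"
    "((i, k, g), (i, k', fmor Y v \<cdot> g), Idt I i, v) \<in> Mor comma"
proof -
  note d = comma_obD[OF a]
  have k': "k' \<in> Ob K" using Hom_ob[OF cats(2) v] by simp
  show *: "(i, k', fmor Y v \<cdot> g) \<in> comma_ob"
    using d k' fmorY[OF v] comp_reassoc[OF \<kappa>_comm[OF v] C, of g] yf C unfolding comma_ob_def
    by (simp add: Hom_iff)
  show "((i, k, g), (i, k', fmor Y v \<cdot> g), Idt I i, v) \<in> Mor comma"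
    unfolding comma_simps using a * v d cats fmorY[OF v] X C by (simp add: Hom_iff)
qed

text \<open>Both ways around the square agree after composing into \<open>Cod C f\<close>, by the
  condition in \<open>comma_ob\<close>; finite presentability of \<open>fob X i\<close> makes them
  agree at a later stage of \<open>Y\<close>.\<close>

lemma comma_align:
  assumes a: "(i, k, g) \<in> comma_ob" and b: "(i', k', g') \<in> comma_ob" and u: "u \<in> Hom I i i'" and v: "v \<in> Hom K k k'"
  obtains k'' w where "w \<in> Hom K k' k''"
    "((i, k, g), (i', k'', fmor Y w \<cdot> g'), u, w \<cdot>\<^bsub>K\<^esub> v) \<in> Mor comma"
proof -
  note d = comma_obD[OF a] comma_obD[OF b]
  note fu = fmorX[OF u] and fv = fmorY[OF v]
  have h: "g' \<cdot> fmor X u \<in> Hom C (fob X i) (fob Y k')" "fmor Y v \<cdot> g \<in> Hom C (fob X i) (fob Y k')"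
    using d fu fv C by (simp_all add: Hom_iff)
  have "\<kappa> k' \<cdot> (g' \<cdot> fmor X u) = f \<cdot> \<iota> i"
    using comp_reassoc[OF d(12) C, of "fmor X u"] \<iota>_comm[OF u] d fu f xf yf C by (simp add: Hom_iff)
  moreover have "\<kappa> k' \<cdot> (fmor Y v \<cdot> g) = f \<cdot> \<iota> i"
    using comp_reassoc[OF \<kappa>_comm[OF v] C, of g] d fv yf by (simp add: Hom_iff)
  ultimately have e: "\<kappa> k' \<cdot> (g' \<cdot> fmor X u) = \<kappa> k' \<cdot> (fmor Y v \<cdot> g)" by simp
  obtain k'' w where w: "w \<in> Hom K k' k''"
    "fmor Y w \<cdot> (g' \<cdot> fmor X u) = fmor Y w \<cdot> (fmor Y v \<cdot> g)"
    using finitely_presentable_equalize[OF Xfp[OF d(1)] K Y Yc d(8) h e] by blast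
  have "((i, k, g), (i', k'', fmor Y w \<cdot> g'), u, w \<cdot>\<^bsub>K\<^esub> v) \<in> Mor comma"
    unfolding comma_simps using a comma_push(1)[OF b w(1)] u comp_Hom[OF cats(2) v w(1)] w fmorY[OF w(1)] fu fv d Y v C cats
    by (simp add: Hom_iff)
  then show thesis using that w(1) by blast
qed

lemma Hom_comma: "(a, b, u, v) \<in> Mor comma \<Longrightarrow> (a, b, u, v) \<in> Hom comma a b"
  by (simp add: Hom_def comma_simps)

lemma filtered_comma: "filtered comma"
proof (rule filteredI)
  show "category comma" by (rule category_comma)
  obtain i where "i \<in> Ob I" using cats(3) by (auto simp: filtered_def)
  then show "Ob comma \<noteq> {}" using comma_lift by (metis comma_simps(1) empty_iff)
  fix a b assume ab: "a \<in> Ob comma" "b \<in> Ob comma"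
  obtain i k g i' k' g' where a: "a = (i, k, g)" "(i, k, g) \<in> comma_ob" and b: "b = (i', k', g')" "(i', k', g') \<in> comma_ob"
    using ab by (metis comma_simps(1) prod_cases3)
  note d = comma_obD[OF a(2)] comma_obD[OF b(2)]
  obtain l u u' where l: "l \<in> Ob I" "u \<in> Hom I i l" "u' \<in> Hom I i' l"
    using filtered_join[OF cats(3) d(1) d(7)] by blast
  \<comment> \<open>The joint stage on the source side is fixed first, since every stage of
    \<open>X\<close> carries some stage map; the target stage is then enlarged until both given
    stage maps fit.\<close>
  obtain m h where h: "(l, m, h) \<in> comma_ob" using comma_lift[OF l(1)] by blast
  obtain m1 v v1 where m1: "m1 \<in> Ob K" "v \<in> Hom K k m1" "v1 \<in> Hom K k' m1"
    using filtered_join[OF cats(4) d(2) d(8)] by blast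
  obtain m2 x y where m2: "m2 \<in> Ob K" "x \<in> Hom K m1 m2" "y \<in> Hom K m m2"
    using filtered_join[OF cats(4) m1(1) comma_obD(2)[OF h]] by blast
  have h2: "(l, m2, fmor Y y \<cdot> h) \<in> comma_ob" using comma_push(1)[OF h m2(3)] .
  obtain m3 w where w: "w \<in> Hom K m2 m3"
     "((i, k, g), (l, m3, fmor Y w \<cdot> (fmor Y y \<cdot> h)), u, w \<cdot>\<^bsub>K\<^esub> (x \<cdot>\<^bsub>K\<^esub> v)) \<in> Mor comma"
    using comma_align[OF a(2) h2 l(2) comp_Hom[OF cats(2) m1(2) m2(2)]] by blast
  let ?h = "fmor Y w \<cdot> (fmor Y y \<cdot> h)"
  have h3: "(l, m3, ?h) \<in> comma_ob" using comma_push(1)[OF h2 w(1)] .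
  \<comment> \<open>The second arrow is aligned after the first. Enlarging the target once more does
    not spoil the first arrow, which is composed with the push along \<open>w'\<close>.\<close>
  obtain m4 w' where w': "w' \<in> Hom K m3 m4"
     "((i', k', g'), (l, m4, fmor Y w' \<cdot> ?h), u', w' \<cdot>\<^bsub>K\<^esub> (w \<cdot>\<^bsub>K\<^esub> (x \<cdot>\<^bsub>K\<^esub> v1))) \<in> Mor comma"
    using comma_align[OF b(2) h3 l(3) comp_Hom[OF cats(2) comp_Hom[OF cats(2) m1(3) m2(2)] w(1)]] by blast
  have "((l, m3, ?h), (l, m4, fmor Y w' \<cdot> ?h), Idt I l, w') \<in> Mor comma"
    using comma_push(2)[OF h3 w'(1)] .
  from comp_Hom[OF category_comma Hom_comma[OF w(2)] Hom_comma[OF this]] Hom_comma[OF w'(2)]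
  show "\<exists>c u v. u \<in> Hom comma a c \<and> v \<in> Hom comma b c" unfolding a(1) b(1) by blast
next
  fix a b p q assume pq: "p \<in> Hom comma a b" "q \<in> Hom comma a b"
  have ab: "a \<in> comma_ob" "b \<in> comma_ob" using Hom_ob[OF category_comma pq(1)] by (auto simp: comma_simps)
  obtain i k g i' k' g' where a: "a = (i, k, g)" and b: "b = (i', k', g')" by (metis prod_cases3)
  obtain u v where p: "p = (a, b, u, v)" "u \<in> Hom I i i'" "v \<in> Hom K k k'"
    using pq(1) a b by (cases p) (auto simp: Hom_def[of comma] comma_simps)
  obtain u' v' where q: "q = (a, b, u', v')" "u' \<in> Hom I i i'" "v' \<in> Hom K k k'"
    using pq(2) a b by (cases q) (auto simp: Hom_def[of comma] comma_simps)
  note d = comma_obD[OF ab(2)[unfolded b]]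
  obtain l s where s: "l \<in> Ob I" "s \<in> Hom I i' l" "s \<cdot>\<^bsub>I\<^esub> u = s \<cdot>\<^bsub>I\<^esub> u'"
    using filtered_coeq[OF cats(3) p(2) q(2)] by blast
  obtain m t where t: "m \<in> Ob K" "t \<in> Hom K k' m" "t \<cdot>\<^bsub>K\<^esub> v = t \<cdot>\<^bsub>K\<^esub> v'"
    using filtered_coeq[OF cats(4) p(3) q(3)] by blast
  obtain m1 h where h: "(l, m1, h) \<in> comma_ob" using comma_lift[OF s(1)] by blast
  obtain m2 x y where m2: "m2 \<in> Ob K" "x \<in> Hom K m m2" "y \<in> Hom K m1 m2"
    using filtered_join[OF cats(4) t(1) comma_obD(2)[OF h]] by blast
  have h2: "(l, m2, fmor Y y \<cdot> h) \<in> comma_ob" using comma_push(1)[OF h m2(3)] .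
  obtain m3 w where w: "w \<in> Hom K m2 m3"
     "(b, (l, m3, fmor Y w \<cdot> (fmor Y y \<cdot> h)), s, w \<cdot>\<^bsub>K\<^esub> (x \<cdot>\<^bsub>K\<^esub> t)) \<in> Mor comma"
    using comma_align[OF ab(2)[unfolded b] h2 s(2) comp_Hom[OF cats(2) t(2) m2(2)]] b by blast
  have "(w \<cdot>\<^bsub>K\<^esub> (x \<cdot>\<^bsub>K\<^esub> t)) \<cdot>\<^bsub>K\<^esub> v = (w \<cdot>\<^bsub>K\<^esub> (x \<cdot>\<^bsub>K\<^esub> t)) \<cdot>\<^bsub>K\<^esub> v'"
    using t(2,3) m2(2) w(1) p(3) q(3) cats by (simp add: Hom_iff)
  then have "(b, (l, m3, fmor Y w \<cdot> (fmor Y y \<cdot> h)), s, w \<cdot>\<^bsub>K\<^esub> (x \<cdot>\<^bsub>K\<^esub> t)) \<cdot>\<^bsub>comma\<^esub> p =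
     (b, (l, m3, fmor Y w \<cdot> (fmor Y y \<cdot> h)), s, w \<cdot>\<^bsub>K\<^esub> (x \<cdot>\<^bsub>K\<^esub> t)) \<cdot>\<^bsub>comma\<^esub> q"
    unfolding p(1) q(1) comma_simps using s(3) by simp
  then show "\<exists>c. \<exists>w\<in>Hom comma b c. w \<cdot>\<^bsub>comma\<^esub> p = w \<cdot>\<^bsub>comma\<^esub> q"
    using Hom_comma[OF w(2)] by blast
qed

text \<open>Stage maps exist over every object of \<open>I\<close>, and an arrow of \<open>I\<close>
  becomes an arrow of the comma category once the target stage is enlarged.\<close>

lemma cofinal_left: "cofinal_fctr comma I comma_left"
  unfolding cofinal_fctr_def
proof (intro conjI ballI functor_comma_left)
  fix i assume i: "i \<in> Ob I"
  obtain k g where "(i, k, g) \<in> comma_ob" using comma_lift[OF i] by blast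
  moreover have "Idt I i \<in> Hom I i i" using i cats by (simp add: Hom_iff)
  ultimately show "\<exists>e\<in>Ob comma. Hom I i (fob comma_left e) \<noteq> {}"
    by (intro bexI[of _ "(i, k, g)"]) (auto simp: comma_simps comma_fctr_simps)
next
  fix e i u u' assume e: "e \<in> Ob comma" and u: "u \<in> Hom I i (fob comma_left e)" "u' \<in> Hom I i (fob comma_left e)"
  obtain j k g where e': "e = (j, k, g)" "(j, k, g) \<in> comma_ob" using e by (metis comma_simps(1) prod_cases3)
  obtain l s where s: "l \<in> Ob I" "s \<in> Hom I j l" "s \<cdot>\<^bsub>I\<^esub> u = s \<cdot>\<^bsub>I\<^esub> u'"
    using filtered_coeq[OF cats(3) u] unfolding e'(1) comma_fctr_simps by blast
  obtain m h where h: "(l, m, h) \<in> comma_ob" using comma_lift[OF s(1)] by blast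
  obtain m2 x y where m2: "m2 \<in> Ob K" "x \<in> Hom K k m2" "y \<in> Hom K m m2"
    using filtered_join[OF cats(4) comma_obD(2)[OF e'(2)] comma_obD(2)[OF h]] by blast
  obtain m3 w where w: "((j, k, g), (l, m3, fmor Y w \<cdot> (fmor Y y \<cdot> h)), s, w \<cdot>\<^bsub>K\<^esub> x) \<in> Mor comma"
    using comma_align[OF e'(2) comma_push(1)[OF h m2(3)] s(2) m2(2)] by blast
  then show "\<exists>e'. \<exists>c\<in>Hom comma e e'. fmor comma_left c \<cdot>\<^bsub>I\<^esub> u = fmor comma_left c \<cdot>\<^bsub>I\<^esub> u'"
    using Hom_comma[OF w] s(3) e'(1) by (metis comma_fctr_simps(2))
qed

lemma cofinal_right: "cofinal_fctr comma K comma_right"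
  unfolding cofinal_fctr_def
proof (intro conjI ballI functor_comma_right)
  fix k assume k: "k \<in> Ob K"
  obtain i where i: "i \<in> Ob I" using cats(3) by (auto simp: filtered_def)
  obtain m g where g: "(i, m, g) \<in> comma_ob" using comma_lift[OF i] by blast
  obtain m2 x y where m2: "m2 \<in> Ob K" "x \<in> Hom K k m2" "y \<in> Hom K m m2"
    using filtered_join[OF cats(4) k comma_obD(2)[OF g]] by blast
  show "\<exists>e\<in>Ob comma. Hom K k (fob comma_right e) \<noteq> {}"
    using comma_push(1)[OF g m2(3)] m2(2)
    by (intro bexI[of _ "(i, m2, fmor Y y \<cdot> g)"]) (auto simp: comma_simps comma_fctr_simps)
next
  fix e k v v' assume e: "e \<in> Ob comma" and v: "v \<in> Hom K k (fob comma_right e)" "v' \<in> Hom K k (fob comma_right e)"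
  obtain i m g where e': "e = (i, m, g)" "(i, m, g) \<in> comma_ob" using e by (metis comma_simps(1) prod_cases3)
  obtain l s where s: "l \<in> Ob K" "s \<in> Hom K m l" "s \<cdot>\<^bsub>K\<^esub> v = s \<cdot>\<^bsub>K\<^esub> v'"
    using filtered_coeq[OF cats(4) v] unfolding e'(1) comma_fctr_simps by blast
  show "\<exists>e'. \<exists>c\<in>Hom comma e e'. fmor comma_right c \<cdot>\<^bsub>K\<^esub> v = fmor comma_right c \<cdot>\<^bsub>K\<^esub> v'"
    using Hom_comma[OF comma_push(2)[OF e'(2) s(2)]] s(3) e'(1) by (metis comma_fctr_simps(4))
qed

text \<open>By cofinality of the two projections the sources of the stage maps have colimit
  \<open>Dom C f\<close> and the targets \<open>Cod C f\<close>; compatibility of the legs with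
  \<open>f\<close> is the condition in \<open>comma_ob\<close>.\<close>

lemma colimit_comma:
  "is_colimit comma (arrow_cat C) comma_arrow f (\<lambda>(i, k, g). (g, f, \<iota> i, \<kappa> k))"
proof -
  have X': "is_colimit comma C (comp_fctr (dom_fctr C) comma_arrow) (Dom C f) (\<lambda>a. \<iota> (fob comma_left a))"
    by (rule iffD1[OF colimit_fctr_cong cofinal_colimit[OF filtered_comma cofinal_left X Xc]])
      (auto simp: comma_simps comma_fctr_simps dest: comma_obD)
  have Y': "is_colimit comma C (comp_fctr (cod_fctr C) comma_arrow) (Cod C f) (\<lambda>a. \<kappa> (fob comma_right a))"
    by (rule iffD1[OF colimit_fctr_cong cofinal_colimit[OF filtered_comma cofinal_right Y Yc]])
      (auto simp: comma_simps comma_fctr_simps dest: comma_obD)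
  have "is_colimit comma (arrow_cat C) comma_arrow f
      (\<lambda>a. (fob comma_arrow a, f, \<iota> (fob comma_left a), \<kappa> (fob comma_right a)))"
    by (rule arrow_colimitI[OF C functor_comma_arrow X' Y'])
      (use f in \<open>auto simp: Hom_iff comma_simps comma_fctr_simps dest: comma_obD\<close>)
  then show ?thesis
    by (rule iffD1[OF colimit_cong[OF category_comma], rotated]) (auto simp: comma_fctr_simps comma_simps)
qed

lemma small_comma: "small_index U comma"
proof -
  have s: "small U (Ob I)" "small U (Mor I)" "small U (Ob K)" "small U (Mor K)"
    using I K by (auto simp: small_index_def)
  have "small U (\<Union>i\<in>Ob I. \<Union>k\<in>Ob K. Hom C (fob X i) (fob Y k))"
    using s lsmall X Y by (intro small_UN) auto
  from small_Times[OF s(1) small_Times[OF s(3) this]] have o: "small U comma_ob"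
    by (rule small_mono) (auto simp: comma_ob_def)
  have m: "small U (Mor comma)"
    by (rule small_mono[OF small_Times[OF o small_Times[OF o small_Times[OF s(2) s(4)]]]])
      (auto simp: comma_simps Hom_iff)
  show ?thesis unfolding small_index_def comma_simps using filtered_comma o m by simp
qed

end

section \<open>Locally finitely presentable categories\<close>

locale lfp_category = universe U for U :: "'u itself" +
  fixes C :: "('o, 'm) cat" (structure)
  assumes C: "category C" and cocomp: "cocomplete U C" and acc: "finitely_accessible U C"
begin

abbreviation "M \<equiv> fp_subcat U C"
abbreviation "D \<equiv> arrow_cat C"
abbreviation fp :: "'o \<Rightarrow> bool" where "fp \<equiv> finitely_presentable U C"

lemma D: "category D" using C by simp

lemma fp_ob: "fp A \<Longrightarrow> A \<in> Ob C"
  by (rule finitely_presentable_ob)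

lemma M_simps:
  "A \<in> Ob M \<longleftrightarrow> fp A" "f \<in> Mor M \<longleftrightarrow> f \<in> Mor C \<and> fp (Dom C f) \<and> fp (Cod C f)"
  "Dom M = Dom C" "Cod M = Cod C" "Idt M = Idt C" "Cmp M = Cmp C"
  using fp_ob C by (auto simp: fp_subcat_def)

lemma category_M: "category M"
  using C by (simp add: fp_subcat_def)

lemma Hom_M: "f \<in> Hom M a b \<longleftrightarrow> f \<in> Hom C a b \<and> fp a \<and> fp b"
  by (auto simp: Hom_iff M_simps)

lemma functor_M: "is_functor J M X \<longleftrightarrow> is_functor J C X \<and> (\<forall>j\<in>Ob J. fp (fob X j))"
  unfolding fp_subcat_def functor_full_subcat[OF C] using fp_ob by blast

lemma lsmall: "a \<in> Ob C \<Longrightarrow> b \<in> Ob C \<Longrightarrow> small U (Hom C a b)"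
  using acc unfolding finitely_accessible_def accessible_wrt_def locally_small_def small_type[of _ U] by blast

lemma filtered_colims: "has_colimits (small_filtered :: ('u, 'u) cat \<Rightarrow> bool) C"
  using acc unfolding finitely_accessible_def accessible_wrt_def by blast

lemma generators:
  obtains G where "small U G" "\<And>A. A \<in> G \<Longrightarrow> fp A"
    "\<And>L. L \<in> Ob C \<Longrightarrow> \<exists>(J :: ('u, 'u) cat) X \<iota>. small_index U J \<and> is_functor J C X \<and> (\<forall>j\<in>Ob J. fob X j \<in> G) \<and> is_colimit J C X L \<iota>"
proof -
  have "\<exists>G\<subseteq>Ob C. small TYPE('u) G \<and> (\<forall>A\<in>G. presentable_wrt (small_filtered :: ('u, 'u) cat \<Rightarrow> bool) C A) \<and>
        (\<forall>L \<in> Ob C. \<exists>(J :: ('u, 'u) cat) X \<iota>. small_filtered J \<and> is_functor J C X \<and> (\<forall>j \<in> Ob J. fob X j \<in> G) \<and>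
           is_colimit J C X L \<iota>)"
    using acc unfolding finitely_accessible_def accessible_wrt_def by blast
  then show thesis
    using that unfolding small_type[of _ U] small_filtered_iff[of _ U] finitely_presentable_def by metis
qed

lemma presentation:
  assumes "L \<in> Ob C"
  obtains J :: "('u, 'u) cat" and X \<iota> where "small_index U J" "is_functor J C X"
    "\<And>j. j \<in> Ob J \<Longrightarrow> fp (fob X j)" "is_colimit J C X L \<iota>"
proof -
  obtain G where G: "\<And>A. A \<in> G \<Longrightarrow> fp A"
    "\<And>L. L \<in> Ob C \<Longrightarrow> \<exists>(J :: ('u, 'u) cat) X \<iota>. small_index U J \<and> is_functor J C X \<and> (\<forall>j\<in>Ob J. fob X j \<in> G) \<and> is_colimit J C X L \<iota>"
    using generators by metis
  show thesis using G(2)[OF assms] G(1) that by blast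
qed

lemma finite_colimit_ex:
  assumes "finite_cat K" "is_functor K C X"
  shows "\<exists>L \<iota>. is_colimit K C X L \<iota>"
  by (rule cocomplete_colimit[OF cocomp assms(2) small_finite small_finite])
    (use assms(1) in \<open>auto simp: finite_cat_def\<close>)

lemma finite_colimit_fp:
  assumes "finite_cat K" "is_functor K M X"
  obtains L \<iota> where "fp L" "is_colimit K C X L \<iota>"
proof -
  have X: "is_functor K C X" "\<And>k. k \<in> Ob K \<Longrightarrow> fp (fob X k)" using assms(2) by (auto simp: functor_M)
  obtain L \<iota> where "is_colimit K C X L \<iota>" using finite_colimit_ex[OF assms(1) X(1)] by blast
  then show thesis using that finitely_presentable_finite_colimit[OF assms(1) X(1) _ X(2)] by blast
qed

text \<open>A finite colimit of finitely presentable objects taken in \<open>C\<close> already lies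
  in \<open>M\<close>, so one computed in \<open>M\<close> can only be isomorphic to it. Cobase
  changes in \<open>M\<close> may thus be studied in \<open>C\<close>.\<close>

lemma finite_colimit_M:
  assumes "finite_cat K" "is_functor K M X" "is_colimit K M X L \<iota>"
  shows "is_colimit K C X L \<iota>"
proof -
  have X: "is_functor K C X" "\<forall>k\<in>Ob K. fob X k \<in> {A \<in> Ob C. fp A}"
    using assms(2) fp_ob by (auto simp: functor_M)
  obtain L' \<iota>' where "fp L'" "is_colimit K C X L' \<iota>'" by (rule finite_colimit_fp[OF assms(1,2)])
  then show ?thesis
    using colimit_full_subcatD[OF C X _ _ assms(3)[unfolded fp_subcat_def]] fp_ob by blast
qed

lemma finite_colimits_M: "has_finite_colimits M"
  unfolding has_finite_colimits_def has_colimits_def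
proof (intro allI impI; elim conjE)
  fix K :: "(nat, nat) cat" and X
  assume K: "finite_cat K" "is_functor K M X"
  then have X: "is_functor K C X" "\<forall>k\<in>Ob K. fob X k \<in> {A \<in> Ob C. fp A}"
    using fp_ob by (auto simp: functor_M)
  obtain L \<iota> where "fp L" "is_colimit K C X L \<iota>" by (rule finite_colimit_fp[OF K])
  then have "is_colimit K M X L \<iota>"
    unfolding fp_subcat_def using colimit_full_subcat[OF C X] fp_ob by blast
  then show "\<exists>L \<iota>. is_colimit K M X L \<iota>" by blast
qed

lemma pushout_ex:
  assumes "f \<in> Mor C" "g \<in> Mor C" "Dom C f = Dom C g"
  obtains h k where "is_pushout C f g h k" "fp (Cod C f) \<Longrightarrow> fp (Cod C g) \<Longrightarrow> fp (Dom C f) \<Longrightarrow> fp (Cod C h)"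
proof -
  let ?S = "span_fctr C f g"
  note F = functor_span[OF C assms]
  obtain L \<iota> where L: "is_colimit span_cat C ?S L \<iota>" using finite_colimit_ex[OF finite_span F] by blast
  have cc: "\<iota> 1 \<in> Hom C (Cod C f) L" "\<iota> 0 = \<iota> 1 \<cdot> f"
    using colimit_cocone[OF L] unfolding cocone_span[OF C assms] by auto
  have "category span_cat" using finite_span by (simp add: finite_cat_def)
  have "is_colimit span_cat C ?S L (\<lambda>n. if n = 0 then \<iota> 1 \<cdot> f else if n = 1 then \<iota> 1 else \<iota> 2)"
    by (rule iffD1[OF colimit_cong[OF \<open>category span_cat\<close>] L]) (use cc(2) in \<open>auto simp: span_simps\<close>)
  moreover have "Cod C (\<iota> 1) = L" using cc(1) by (simp add: Hom_iff)
  ultimately have "is_pushout C f g (\<iota> 1) (\<iota> 2)"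
    unfolding pushout_iff_colimit[OF C assms] by simp
  moreover have "fp L" if "fp (Cod C f)" "fp (Cod C g)" "fp (Dom C f)"
    by (rule finitely_presentable_finite_colimit[OF finite_span F L]) (use that in \<open>auto simp: span_simps\<close>)
  ultimately show thesis using that cc(1) by (auto simp: Hom_iff)
qed

lemma pushout_M:
  assumes p: "is_pushout M f g h k"
  shows "is_pushout C f g h k"
proof -
  note pf = pushout_facts[OF p]
  have m: "f \<in> Mor C" "g \<in> Mor C" "Dom C f = Dom C g" using pf by (auto simp: M_simps)
  have e: "span_fctr M f g = span_fctr C f g" unfolding span_fctr_def M_simps ..
  have F: "is_functor span_cat M (span_fctr C f g)"
    using functor_span[OF category_M pf(1-3)] e by simp
  show ?thesis
    using finite_colimit_M[OF finite_span F] p e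
    unfolding pushout_iff_colimit[OF C m] pushout_iff_colimit[OF category_M pf(1-3)] M_simps by simp
qed

lemma pushout_fp:
  assumes p: "is_pushout C f g h k" and fp: "fp (Dom C f)" "fp (Cod C f)" "fp (Cod C g)"
  shows "fp (Cod C h)"
proof -
  note pf = pushout_facts[OF p]
  show ?thesis
    by (rule finitely_presentable_finite_colimit[OF finite_span functor_span[OF C pf(1-3)]
       p[unfolded pushout_iff_colimit[OF C pf(1-3)]]]) (use fp pf in \<open>auto simp: span_simps\<close>)
qed

lemma initial_ex:
  obtains z where "is_initial C z" "fp z"
proof -
  have F: "is_functor empty_cat M X" for X :: "(nat, nat, 'o, 'm) fctr" using functor_empty[OF category_M] .
  show thesis using finite_colimit_fp[OF finite_empty F] that unfolding colimit_empty by blast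
qed

text \<open>A finitely presentable object is a retract of a generator, and up to isomorphism such a retract is
  determined by an idempotent.\<close>

lemma essentially_small:
  obtains G where "small U G" "\<And>A. A \<in> G \<Longrightarrow> fp A"
    "\<And>A. fp A \<Longrightarrow> \<exists>B\<in>G. \<exists>s\<in>Hom C A B. \<exists>r\<in>Hom C B A. r \<cdot> s = Idt C A \<and> s \<cdot> r = Idt C B"
proof -
  obtain G where G: "small U G" "\<And>A. A \<in> G \<Longrightarrow> fp A"
    "\<And>L. L \<in> Ob C \<Longrightarrow> \<exists>(J :: ('u, 'u) cat) X \<iota>. small_index U J \<and> is_functor J C X \<and> (\<forall>j\<in>Ob J. fob X j \<in> G) \<and> is_colimit J C X L \<iota>"
    using generators by metis
  define S where "S = (\<Union>g\<in>G. Hom C g g)"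
  have sS: "small U S"
    unfolding S_def using G(1) lsmall fp_ob[OF G(2)] by (intro small_UN) auto
  \<comment> \<open>\<open>split e A\<close> says that the idempotent \<open>e\<close> splits
    through \<open>A\<close>. One finitely presentable object is then selected for each endomorphism
    of a generator that splits, so the selection is no larger than the set of these
    endomorphisms.\<close>
  define split where "split e A \<longleftrightarrow> fp A \<and> (\<exists>g s r. s \<in> Hom C A g \<and> r \<in> Hom C g A \<and> r \<cdot> s = Idt C A \<and> s \<cdot> r = e)" for e A
  define \<rho> where "\<rho> e = (SOME A. split e A)" for e
  define S' where "S' = {e \<in> S. \<exists>A. split e A}"
  have \<rho>: "split e (\<rho> e)" if "e \<in> S'" for e
    unfolding \<rho>_def by (rule someI_ex) (use that in \<open>simp add: S'_def\<close>)
  show thesis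
  proof (rule that[of "\<rho> ` S'"])
    show "small U (\<rho> ` S')" using small_image small_mono[OF sS, of S'] by (auto simp: S'_def)
    show "fp A" if "A \<in> \<rho> ` S'" for A using \<rho> that by (auto simp: split_def)
    fix A assume A: "fp A"
    obtain J :: "('u, 'u) cat" and X \<iota> where J: "small_index U J" "is_functor J C X" "\<forall>j\<in>Ob J. fob X j \<in> G" "is_colimit J C X A \<iota>"
      using G(3)[OF fp_ob[OF A]] by blast
    have "Idt C A \<in> Hom C A A" using fp_ob[OF A] C by (simp add: Hom_iff)
    then obtain j s where s: "j \<in> Ob J" "s \<in> Hom C A (fob X j)" "\<iota> j \<cdot> s = Idt C A"
      using finitely_presentable_factor[OF A J(1,2,4)] by metis
    let ?r = "\<iota> j"
    have r: "?r \<in> Hom C (fob X j) A" using cocone_facts[OF colimit_cocone[OF J(4)]] s(1) by (simp add: Hom_iff)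
    let ?e = "s \<cdot> ?r"
    have "split ?e A" unfolding split_def using A s r by blast
    moreover have "?e \<in> S" unfolding S_def using J(3) s(1) comp_Hom[OF C r s(2)] by blast
    ultimately have eS: "?e \<in> S'" by (auto simp: S'_def)
    obtain g s' r' where B: "s' \<in> Hom C (\<rho> ?e) g" "r' \<in> Hom C g (\<rho> ?e)" "r' \<cdot> s' = Idt C (\<rho> ?e)" "s' \<cdot> r' = ?e"
      using \<rho>[OF eS] by (auto simp: split_def)
    \<comment> \<open>A morphism determines its codomain, so the selected splitting concerns the
      same generator as the given one.\<close>
    have g: "g = fob X j"
    proof -
      have "Cod C (s' \<cdot> r') = g" "Cod C ?e = fob X j" using B(1,2) s(2) r C by (simp_all add: Hom_iff)
      then show ?thesis using B(4) by simp
    qed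
    \<comment> \<open>Two splittings of one idempotent are isomorphic by crossing their sections and
      retractions. The computation is stated with free variables so that it serves for both
      composites.\<close>
    have "(r \<cdot> s') \<cdot> (r' \<cdot> t) = Idt C a"
      if "s' \<cdot> r' = t \<cdot> r" "r \<cdot> t = Idt C a" "s' \<in> Hom C b g" "r' \<in> Hom C g b" "t \<in> Hom C a g" "r \<in> Hom C g a"
      for r s' r' t a b
    proof -
      have "a \<in> Ob C" using Hom_ob[OF C that(5)] by simp
      then show ?thesis
        using comp_reassoc[OF that(1) C, of t] that(2-) C by (simp add: Hom_iff)
    qed
    from this[of s' r' s ?r A "\<rho> ?e"] this[of s ?r s' r' "\<rho> ?e" A] B s r g
    have "(?r \<cdot> s') \<cdot> (r' \<cdot> s) = Idt C A" "(r' \<cdot> s) \<cdot> (?r \<cdot> s') = Idt C (\<rho> ?e)" by simp_all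
    moreover have "r' \<cdot> s \<in> Hom C A (\<rho> ?e)" "?r \<cdot> s' \<in> Hom C (\<rho> ?e) A"
      using B(1,2) s(2) r g C by (simp_all add: Hom_iff)
    ultimately show "\<exists>B\<in>\<rho> ` S'. \<exists>s\<in>Hom C A B. \<exists>r\<in>Hom C B A. r \<cdot> s = Idt C A \<and> s \<cdot> r = Idt C B"
      using eS by blast
  qed
qed

section \<open>Morphisms approximated by a class of morphisms of \<open>M\<close>\<close>

abbreviation dense :: "'m set \<Rightarrow> 'm \<Rightarrow> bool" where
  "dense \<equiv> factors_through D (Mor M)"

lemma fp_arrow: "a \<in> Mor M \<Longrightarrow> finitely_presentable U D a"
  using arrow_fp[OF C filtered_colims] by (simp add: M_simps)

lemma dense_mor: "dense N f \<Longrightarrow> f \<in> Mor C"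
  by (simp add: factors_through_def arrow_cat_simps)

lemma denseE:
  assumes "dense N f" "c \<in> Mor M" "u \<in> Hom C (Dom C c) (Dom C f)" "v \<in> Hom C (Cod C c) (Cod C f)" "f \<cdot> u = v \<cdot> c"
  obtains n a b x y where "n \<in> N" "n \<in> Mor C" "a \<in> Hom C (Dom C c) (Dom C n)" "b \<in> Hom C (Cod C c) (Cod C n)" "n \<cdot> a = b \<cdot> c"
    "x \<in> Hom C (Dom C n) (Dom C f)" "y \<in> Hom C (Cod C n) (Cod C f)" "f \<cdot> x = y \<cdot> n"
    "x \<cdot> a = u" "y \<cdot> b = v"
proof -
  have "(c, f, u, v) \<in> Hom D c f"
    unfolding Hom_arrow_iff using assms dense_mor by (simp add: M_simps)
  from factors_throughE[OF assms(1,2) this]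
  obtain n r s where n: "n \<in> N" "r \<in> Hom D c n" "s \<in> Hom D n f" "s \<cdot>\<^bsub>D\<^esub> r = (c, f, u, v)" by blast
  obtain a b where r: "r = (c, n, a, b)" "a \<in> Hom C (Dom C c) (Dom C n)" "b \<in> Hom C (Cod C c) (Cod C n)" "n \<cdot> a = b \<cdot> c"
    "n \<in> Mor C" using n(2) by (auto simp: Hom_arrow)
  obtain x y where s: "s = (n, f, x, y)" "x \<in> Hom C (Dom C n) (Dom C f)" "y \<in> Hom C (Cod C n) (Cod C f)" "f \<cdot> x = y \<cdot> n"
    using n(3) by (auto simp: Hom_arrow)
  show thesis using that[OF n(1) r(5) r(2-4) s(2-4)] n(4) unfolding r(1) s(1) by (simp add: arrow_cat_simps)
qed

lemma denseI:
  assumes "f \<in> Mor C"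
    "\<And>c u v. c \<in> Mor M \<Longrightarrow> u \<in> Hom C (Dom C c) (Dom C f) \<Longrightarrow> v \<in> Hom C (Cod C c) (Cod C f) \<Longrightarrow> f \<cdot> u = v \<cdot> c \<Longrightarrow>
      \<exists>n a b x y. n \<in> N \<and> n \<in> Mor C \<and> a \<in> Hom C (Dom C c) (Dom C n) \<and> b \<in> Hom C (Cod C c) (Cod C n) \<and> n \<cdot> a = b \<cdot> c \<and>
        x \<in> Hom C (Dom C n) (Dom C f) \<and> y \<in> Hom C (Cod C n) (Cod C f) \<and> f \<cdot> x = y \<cdot> n \<and> x \<cdot> a = u \<and> y \<cdot> b = v"
  shows "dense N f"
  unfolding factors_through_def
proof (intro conjI ballI)
  show "f \<in> Ob D" using assms(1) by (simp add: arrow_cat_simps)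
  fix c t assume c: "c \<in> Mor M" and t: "t \<in> Hom D c f"
  obtain u v where uv: "t = (c, f, u, v)" "u \<in> Hom C (Dom C c) (Dom C f)" "v \<in> Hom C (Cod C c) (Cod C f)" "f \<cdot> u = v \<cdot> c"
    using t by (auto simp: Hom_arrow)
  obtain n a b x y where n: "n \<in> N" "n \<in> Mor C" "a \<in> Hom C (Dom C c) (Dom C n)" "b \<in> Hom C (Cod C c) (Cod C n)" "n \<cdot> a = b \<cdot> c"
    "x \<in> Hom C (Dom C n) (Dom C f)" "y \<in> Hom C (Cod C n) (Cod C f)" "f \<cdot> x = y \<cdot> n" "x \<cdot> a = u" "y \<cdot> b = v"
    using assms(2)[OF c uv(2-4)] by blast
  have "(c, n, a, b) \<in> Hom D c n" "(n, f, x, y) \<in> Hom D n f"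
    unfolding Hom_arrow_iff using n assms(1) c by (simp_all add: M_simps)
  moreover have "(n, f, x, y) \<cdot>\<^bsub>D\<^esub> (c, n, a, b) = t" using n uv(1) by (simp add: arrow_cat_simps)
  ultimately show "\<exists>n\<in>N. \<exists>r\<in>Hom D c n. \<exists>s\<in>Hom D n f. s \<cdot>\<^bsub>D\<^esub> r = t" using n(1) by blast
qed

lemma dense_self:
  assumes "n \<in> N" "n \<in> Mor C"
  shows "dense N n"
  unfolding factors_through_def
proof (intro conjI ballI)
  show n: "n \<in> Ob D" using assms by (simp add: arrow_cat_simps)
  fix a t assume t: "t \<in> Hom D a n"
  have "Idt D n \<in> Hom D n n" "Idt D n \<cdot>\<^bsub>D\<^esub> t = t" using n t D by (simp_all add: Hom_iff)
  then show "\<exists>m\<in>N. \<exists>r\<in>Hom D a m. \<exists>s\<in>Hom D m n. s \<cdot>\<^bsub>D\<^esub> r = t" using assms(1) t by blast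
qed

lemma arrow_presentation:
  assumes f: "f \<in> Mor C"
  obtains E :: "('u \<times> 'u \<times> 'm, ('u \<times> 'u \<times> 'm) \<times> ('u \<times> 'u \<times> 'm) \<times> 'u \<times> 'u) cat" and Z \<kappa>
  where "small_index U E" "is_functor E D Z" "is_colimit E D Z f \<kappa>" "\<And>e. e \<in> Ob E \<Longrightarrow> fob Z e \<in> Mor M"
proof -
  obtain I :: "('u, 'u) cat" and X \<iota> where hI: "small_index U I" "is_functor I C X"
    "\<And>j. j \<in> Ob I \<Longrightarrow> fp (fob X j)" "is_colimit I C X (Dom C f) \<iota>"
    using presentation[of "Dom C f"] f C by auto
  obtain K :: "('u, 'u) cat" and Y \<kappa> where hK: "small_index U K" "is_functor K C Y"
    "\<And>j. j \<in> Ob K \<Longrightarrow> fp (fob Y j)" "is_colimit K C Y (Cod C f) \<kappa>"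
    using presentation[of "Cod C f"] f C by auto
  interpret presented_arrow U C f I X \<iota> K Y \<kappa>
    by unfold_locales (use C f lsmall hI hK in auto)
  show thesis
  proof (rule that[OF small_comma functor_comma_arrow colimit_comma])
    fix e assume "e \<in> Ob comma"
    then obtain i k g where e: "e = (i, k, g)" "(i, k, g) \<in> comma_ob" by (metis comma_simps(1) prod_cases3)
    from comma_obD[OF e(2)] show "fob comma_arrow e \<in> Mor M"
      unfolding e(1) comma_fctr_simps M_simps using hI(3) hK(3) comma_obD(1,2)[OF e(2)] by simp
  qed
qed

lemma small_Hom_arrow:
  assumes "a \<in> Ob D" "b \<in> Ob D"
  shows "small U (Hom D a b)"
proof -
  have ab: "a \<in> Mor C" "b \<in> Mor C" using assms by (simp_all add: arrow_cat_simps)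
  have "small U (Hom C (Dom C a) (Dom C b) \<times> Hom C (Cod C a) (Cod C b))"
    using ab C by (intro small_Times lsmall) auto
  then have "small U ((\<lambda>(u, v). (a, b, u, v)) ` (Hom C (Dom C a) (Dom C b) \<times> Hom C (Cod C a) (Cod C b)))"
    by (rule small_image)
  then show ?thesis by (rule small_mono) (auto simp: Hom_arrow)
qed

text \<open>The morphisms of \<open>M\<close> need not form a small set, whereas index categories
  must be small. Closure under isomorphism allows the endpoints to be moved into the small set
  \<open>G\<close>, and density is insensitive to this replacement.\<close>

lemma representatives:
  assumes N: "N \<subseteq> Mor M"
    and iso: "\<And>n m. n \<in> N \<Longrightarrow> m \<in> Mor M \<Longrightarrow> isomorphic D n m \<Longrightarrow> m \<in> N"
  obtains N' where "N' \<subseteq> N" "small U N'" "\<And>f. dense N f \<Longrightarrow> dense N' f"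
proof -
  obtain G where G: "small U G" "\<And>A. A \<in> G \<Longrightarrow> fp A"
    "\<And>A. fp A \<Longrightarrow> \<exists>B\<in>G. \<exists>s\<in>Hom C A B. \<exists>r\<in>Hom C B A. r \<cdot> s = Idt C A \<and> s \<cdot> r = Idt C B"
    using essentially_small by metis
  define N' where "N' = {n \<in> N. Dom C n \<in> G \<and> Cod C n \<in> G}"
  have "small U (\<Union>a\<in>G. \<Union>b\<in>G. Hom C a b)"
    using G(1) lsmall fp_ob[OF G(2)] by (intro small_UN) auto
  then have "small U N'"
    by (rule small_mono) (use N in \<open>auto simp: N'_def Hom_iff M_simps\<close>)
  moreover have "\<exists>m\<in>N'. is_retract D n m" if n: "n \<in> N" for n
  proof -
    have nM: "n \<in> Mor C" "fp (Dom C n)" "fp (Cod C n)" using n N by (auto simp: M_simps)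
    obtain A s r where A: "A \<in> G" "s \<in> Hom C (Dom C n) A" "r \<in> Hom C A (Dom C n)" "r \<cdot> s = Idt C (Dom C n)" "s \<cdot> r = Idt C A"
      using G(3)[OF nM(2)] by blast
    obtain B s' r' where B: "B \<in> G" "s' \<in> Hom C (Cod C n) B" "r' \<in> Hom C B (Cod C n)" "r' \<cdot> s' = Idt C (Cod C n)" "s' \<cdot> r' = Idt C B"
      using G(3)[OF nM(3)] by blast
    \<comment> \<open>The representative is \<open>n\<close> conjugated by isomorphisms of its
      endpoints with objects of \<open>G\<close>.\<close>
    define m where "m = s' \<cdot> (n \<cdot> r)"
    have m: "m \<in> Mor M" "Dom C m = A" "Cod C m = B"
      unfolding m_def M_simps using A(2,3) B(2,3) nM C G(2)[OF A(1)] G(2)[OF B(1)] by (simp_all add: Hom_iff)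
    have sq: "m \<cdot> s = s' \<cdot> n" "n \<cdot> r = r' \<cdot> m"
      unfolding m_def using A(2-4) B(2-4) nM C comp_reassoc[OF B(4) C, of "n \<cdot> r"] by (simp_all add: Hom_iff)
    have t: "(n, m, s, s') \<in> Hom D n m" "(m, n, r, r') \<in> Hom D m n"
      unfolding Hom_arrow_iff using sq m nM A(2,3) B(2,3) by (simp_all add: M_simps)
    have inv: "(m, n, r, r') \<cdot>\<^bsub>D\<^esub> (n, m, s, s') = Idt D n" "(n, m, s, s') \<cdot>\<^bsub>D\<^esub> (m, n, r, r') = Idt D m"
      using A(4,5) B(4,5) m by (simp_all add: arrow_cat_simps)
    have "isomorphic D n m" unfolding isomorphic_def using is_isoI[OF t inv] t(1) by blast
    then have "m \<in> N'" using iso[OF n m(1)] m A(1) B(1) by (simp add: N'_def)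
    moreover have "is_retract D n m" unfolding is_retract_def using t inv(1) by blast
    ultimately show ?thesis by blast
  qed
  ultimately show thesis
    using that[of N'] factors_through_mono[OF D, of "Mor M" N] by (auto simp: N'_def)
qed

text \<open>A small \<open>N\<close> makes its slice over \<open>f\<close> a small filtered
  category, so density of \<open>f\<close> becomes an actual filtered colimit of members of
  \<open>N\<close>. The passage back is \<open>dense_filtered_colimit\<close>.\<close>

lemma dense_colimit:
  assumes "dense N f" "N \<subseteq> Mor M" "small U N"
  obtains E :: "('u, 'u) cat" and Z \<kappa> where "small_index U E" "is_functor E D Z"
    "is_colimit E D Z f \<kappa>" "\<And>e. e \<in> Ob E \<Longrightarrow> fob Z e \<in> N"
proof -
  obtain E :: "('u \<times> 'u \<times> 'm, ('u \<times> 'u \<times> 'm) \<times> ('u \<times> 'u \<times> 'm) \<times> 'u \<times> 'u) cat" and Z \<kappa>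
    where E: "small_index U E" "is_functor E D Z" "is_colimit E D Z f \<kappa>" "\<And>e. e \<in> Ob E \<Longrightarrow> fob Z e \<in> Mor M"
    using arrow_presentation[OF dense_mor[OF assms(1)]] by blast
  interpret A: approximated U D "Mor M" N f E Z \<kappa>
    by unfold_locales (use D assms E fp_arrow in auto)
  let ?E = "slice_over D N f"
  have cE: "category ?E" using D by (rule category_slice)
  have s: "small_index U ?E" using A.small_slice[OF assms(3) small_Hom_arrow] .
  obtain e e' where e: "inj_on e (Ob ?E)" "inj_on e' (Mor ?E)" "small_filtered (relabel_cat e e' ?E :: ('u, 'u) cat)"
    using small_index_relabel[OF s] by blast
  let ?Z = "relabel_fctr e e' ?E (slice_fctr D)"
  have "is_colimit ?E D (slice_fctr D) f ((\<lambda>x. inv_into (Ob ?E) e x) \<circ> e)"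
    by (rule iffD1[OF colimit_cong[OF cE] A.colimit_slice]) (use e(1) in simp)
  then have "is_colimit (relabel_cat e e' ?E) D ?Z f (\<lambda>x. inv_into (Ob ?E) e x)"
    unfolding colimit_relabel[OF cE e(1,2)] .
  moreover have "fob ?Z x \<in> N" if "x \<in> Ob (relabel_cat e e' ?E)" for x
    using that by (auto simp: relabel_cat_simps[OF cE e(1,2)] relabel_fctr_simps[OF cE e(1,2)] slice_simps)
  ultimately show thesis
    using that e(3)[unfolded small_filtered_iff[of _ U]] functor_relabel[OF cE e(1,2) functor_slice[OF D]] by blast
qed

lemma dense_filtered_colimit:
  assumes "small_index U J" "is_functor J D Z" "is_colimit J D Z f \<kappa>" "\<And>j. j \<in> Ob J \<Longrightarrow> dense N (fob Z j)"
  shows "dense N f"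
  by (rule factors_through_colimit[OF D fp_arrow assms])

end

section \<open>The small object argument\<close>

definition konst :: "('o, 'm) cat \<Rightarrow> 'o \<Rightarrow> ('i, 'j, 'o, 'm) fctr" where
  "konst C X = \<lparr>fob = (\<lambda>_. X), fmor = (\<lambda>_. Idt C X)\<rparr>"

lemma konst_simps [simp]: "fob (konst C X) j = X" "fmor (konst C X) u = Idt C X"
  by (simp_all add: konst_def)

lemma functor_konst: "category C \<Longrightarrow> category J \<Longrightarrow> X \<in> Ob C \<Longrightarrow> is_functor J C (konst C X)"
  unfolding is_functor_def by (simp add: Hom_iff)

text \<open>Filteredness is used as connectedness: all legs of a cocone on a constant diagram
  coincide.\<close>

lemma colimit_konst:
  fixes C (structure)
  assumes J: "filtered J" and C: "category C" and X: "X \<in> Ob C"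
  shows "is_colimit J C (konst C X) X (\<lambda>_. Idt C X)"
proof (rule is_colimitI)
  show "cocone J C (konst C X) X (\<lambda>_. Idt C X)"
    unfolding cocone_def using X C by (simp add: Hom_iff)
  obtain j0 where j0: "j0 \<in> Ob J" using J by (auto simp: filtered_def)
  fix Z
  {
    fix \<zeta> assume z: "cocone J C (konst C X) Z \<zeta>"
    note zf = cocone_facts[OF z]
    have step: "\<zeta> k = \<zeta> j" if "u \<in> Hom J j k" for u j k
    proof -
      have "k \<in> Ob J" using Hom_ob[OF filtered_cat[OF J] that] by simp
      then show ?thesis using cocone_comm[OF z, of u] that zf C by (simp add: Hom_iff)
    qed
    have "\<zeta> j = \<zeta> j0" if "j \<in> Ob J" for j
      using filtered_join[OF J that j0] step by metis
    moreover have "\<zeta> j0 \<cdot> Idt C X = \<zeta> j0" using zf j0 C by simp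
    ultimately have "\<forall>j\<in>Ob J. \<zeta> j0 \<cdot> Idt C X = \<zeta> j" by metis
    then show "\<exists>h\<in>Hom C X Z. \<forall>j\<in>Ob J. h \<cdot> Idt C X = \<zeta> j"
      using zf j0 by (intro bexI[of _ "\<zeta> j0"]) (simp_all add: Hom_iff)
  }
  fix h h' assume h: "h \<in> Hom C X Z" "h' \<in> Hom C X Z" "\<forall>j\<in>Ob J. h \<cdot> Idt C X = h' \<cdot> Idt C X"
  from h(3) j0 have "h \<cdot> Idt C X = h' \<cdot> Idt C X" by blast
  with h(1,2) C show "h = h'" by (simp add: Hom_iff)
qed

text \<open>The closure properties that cell attachments need at the finite level. Only pushouts
  along maps of \<open>M\<close> are demanded; pushouts along arbitrary maps are recovered up to
  density.\<close>

locale cell_class = lfp_category U C for U :: "'u itself" and C :: "('o, 'm) cat" (structure) +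
  fixes N :: "'m set"
  assumes N: "N \<subseteq> Mor M"
    and N_pushout: "\<And>f g h k. is_pushout C f g h k \<Longrightarrow> f \<in> N \<Longrightarrow> g \<in> Mor M \<Longrightarrow> k \<in> N"
    and N_comp: "\<And>f g. f \<in> N \<Longrightarrow> g \<in> N \<Longrightarrow> Cod C f = Dom C g \<Longrightarrow> g \<cdot> f \<in> N"
    and N_idt: "\<And>A. fp A \<Longrightarrow> Idt C A \<in> N"
begin

lemma N_M: "n \<in> N \<Longrightarrow> n \<in> Mor C \<and> fp (Dom C n) \<and> fp (Cod C n)"
  using N by (auto simp: M_simps)

text \<open>A square into an identity factors through the identity of the target of
  \<open>c\<close>, with the lower side \<open>v\<close> serving as both sides of the second
  square.\<close>

lemma dense_idt:
  assumes "X \<in> Ob C"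
  shows "dense N (Idt C X)"
proof (rule denseI)
  show "Idt C X \<in> Mor C" using assms C by simp
  fix c u v assume c: "c \<in> Mor M" "u \<in> Hom C (Dom C c) (Dom C (Idt C X))" "v \<in> Hom C (Cod C c) (Cod C (Idt C X))"
    "Idt C X \<cdot> u = v \<cdot> c"
  have cM: "c \<in> Mor C" "fp (Cod C c)" "Cod C c \<in> Ob C" using c(1) C by (auto simp: M_simps)
  show "\<exists>n a b x y. n \<in> N \<and> n \<in> Mor C \<and> a \<in> Hom C (Dom C c) (Dom C n) \<and> b \<in> Hom C (Cod C c) (Cod C n) \<and> n \<cdot> a = b \<cdot> c \<and>
        x \<in> Hom C (Dom C n) (Dom C (Idt C X)) \<and> y \<in> Hom C (Cod C n) (Cod C (Idt C X)) \<and> Idt C X \<cdot> x = y \<cdot> n \<and> x \<cdot> a = u \<and> y \<cdot> b = v"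
    by (rule exI[of _ "Idt C (Cod C c)"], rule exI[of _ c], rule exI[of _ "Idt C (Cod C c)"], rule exI[of _ v], rule exI[of _ v])
      (use c cM N_idt assms C in \<open>simp add: Hom_iff\<close>)
qed

text \<open>The second factor is approximated first, by \<open>t\<close>. The map \<open>a\<close>
  this produces is a morphism of \<open>M\<close> and serves as the test for the first factor,
  giving \<open>t'\<close>. Pushing \<open>t\<close> out along \<open>b1\<close> makes the two
  approximations composable, and the composite stays in \<open>N\<close>.\<close>

lemma dense_comp:
  assumes i: "dense N i" and j: "dense N j" and ij: "Cod C i = Dom C j"
  shows "dense N (j \<cdot> i)"
proof (rule denseI)
  note m = dense_mor[OF i] dense_mor[OF j]
  show "j \<cdot> i \<in> Mor C" using m ij C by simp
  fix c u v assume c: "c \<in> Mor M" and u: "u \<in> Hom C (Dom C c) (Dom C (j \<cdot> i))"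
    and v: "v \<in> Hom C (Cod C c) (Cod C (j \<cdot> i))" and eq: "(j \<cdot> i) \<cdot> u = v \<cdot> c"
  have cM: "c \<in> Mor C" "fp (Dom C c)" "fp (Cod C c)" using c by (auto simp: M_simps)
  have u': "u \<in> Hom C (Dom C c) (Dom C i)" and v': "v \<in> Hom C (Cod C c) (Cod C j)"
    using u v m ij C by simp_all
  have iu: "i \<cdot> u \<in> Hom C (Dom C c) (Dom C j)" "j \<cdot> (i \<cdot> u) = v \<cdot> c"
    using u' eq m ij C by (simp_all add: Hom_iff)
  obtain t a b r s where t: "t \<in> N" "t \<in> Mor C" "a \<in> Hom C (Dom C c) (Dom C t)" "b \<in> Hom C (Cod C c) (Cod C t)"
    "t \<cdot> a = b \<cdot> c" "r \<in> Hom C (Dom C t) (Dom C j)" "s \<in> Hom C (Cod C t) (Cod C j)" "j \<cdot> r = s \<cdot> t"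
    "r \<cdot> a = i \<cdot> u" "s \<cdot> b = v"
    using denseE[OF j c iu(1) v' iu(2)] by metis
  have am: "a \<in> Mor C" "Dom C a = Dom C c" "Cod C a = Dom C t" using t(3) by (auto simp: Hom_iff)
  have aM: "a \<in> Mor M" using am N_M[OF t(1)] cM by (simp add: M_simps)
  obtain t' a1 b1 u2 v2 where t': "t' \<in> N" "t' \<in> Mor C" "a1 \<in> Hom C (Dom C c) (Dom C t')" "b1 \<in> Hom C (Dom C t) (Cod C t')"
    "t' \<cdot> a1 = b1 \<cdot> a" "u2 \<in> Hom C (Dom C t') (Dom C i)" "v2 \<in> Hom C (Cod C t') (Cod C i)" "i \<cdot> u2 = v2 \<cdot> t'"
    "u2 \<cdot> a1 = u" "v2 \<cdot> b1 = r"
    using denseE[OF i aM, of u r] u' t(6,9) ij unfolding am(2,3) by metis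
  have b1: "b1 \<in> Mor C" "Dom C b1 = Dom C t" "Cod C b1 = Cod C t'" using t'(4) by (auto simp: Hom_iff)
  obtain l m where p: "is_pushout C t b1 l m" using pushout_ex[OF t(2) b1(1)] b1(2) by metis
  note pf = pushout_facts[OF p]
  have mN: "m \<in> N" using N_pushout[OF p t(1)] b1 N_M[OF t(1)] N_M[OF t'(1)] by (simp add: M_simps)
  have "j \<cdot> v2 \<in> Hom C (Cod C b1) (Cod C j)" using t'(7) b1(3) ij m C by (simp add: Hom_iff)
  moreover have "s \<cdot> t = (j \<cdot> v2) \<cdot> b1"
    using t(8) t'(10) t'(7) b1 ij m C by (simp add: Hom_iff)
  ultimately obtain w where w: "w \<in> Hom C (Cod C l) (Cod C j)" "w \<cdot> l = s" "w \<cdot> m = j \<cdot> v2"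
    using pushout_induced[OF C p t(7)] by metis
  have n: "m \<cdot> t' \<in> N" "m \<cdot> t' \<in> Mor C" "Dom C (m \<cdot> t') = Dom C t'" "Cod C (m \<cdot> t') = Cod C l"
    using N_comp[OF t'(1) mN] t'(2) pf b1(3) C by simp_all
  have e1: "(m \<cdot> t') \<cdot> a1 = (l \<cdot> b) \<cdot> c"
    using comp_reassoc[OF pf(9) C, of a] t'(2,3,5) t(3-5) pf b1(1,3) am cM C by (simp add: Hom_iff)
  have e2: "(j \<cdot> i) \<cdot> u2 = w \<cdot> (m \<cdot> t')"
    using comp_reassoc[OF w(3) C, of t'] t'(2,6-8) w(1) pf b1(1,3) m ij C by (simp add: Hom_iff)
  have e3: "w \<cdot> (l \<cdot> b) = v"
    using comp_reassoc[OF w(2) C, of b] w(1) t(4,10) pf by (simp add: Hom_iff)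
  show "\<exists>n a b x y. n \<in> N \<and> n \<in> Mor C \<and> a \<in> Hom C (Dom C c) (Dom C n) \<and> b \<in> Hom C (Cod C c) (Cod C n) \<and> n \<cdot> a = b \<cdot> c \<and>
        x \<in> Hom C (Dom C n) (Dom C (j \<cdot> i)) \<and> y \<in> Hom C (Cod C n) (Cod C (j \<cdot> i)) \<and> (j \<cdot> i) \<cdot> x = y \<cdot> n \<and> x \<cdot> a = u \<and> y \<cdot> b = v"
    by (rule exI[of _ "m \<cdot> t'"], rule exI[of _ a1], rule exI[of _ "l \<cdot> b"], rule exI[of _ u2], rule exI[of _ w],
        intro conjI n(1,2) e1 e2 e3 t'(9))
      (use n t'(3,6) t(4) w(1) pf m ij C in \<open>simp_all add: Hom_iff\<close>)
qed

text \<open>Seen in the category of morphisms, the maps \<open>h j\<close> form a diagram whose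
  sources are constantly \<open>X\<close>. Its colimit keeps the source \<open>X\<close>, as the
  index is connected, and density passes to filtered colimits.\<close>

lemma dense_under_colimit:
  assumes J: "small_index U J" and E: "is_functor J C E" and L: "is_colimit J C E L \<iota>" and X: "X \<in> Ob C"
    and h: "\<And>j. j \<in> Ob J \<Longrightarrow> h j \<in> Hom C X (fob E j)" "\<And>j. j \<in> Ob J \<Longrightarrow> dense N (h j)"
    and nat: "\<And>u. u \<in> Mor J \<Longrightarrow> fmor E u \<cdot> h (Dom J u) = h (Cod J u)"
    and j: "j \<in> Ob J"
  shows "dense N (\<iota> j \<cdot> h j)"
proof -
  have fJ: "filtered J" using J by (simp add: small_index_def)
  note cJ = filtered_cat[OF fJ]
  note lf = cocone_facts[OF colimit_cocone[OF L]] and lc = cocone_comm[OF colimit_cocone[OF L]]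
  have hm: "h k \<in> Mor C" "Dom C (h k) = X" "Cod C (h k) = fob E k" if "k \<in> Ob J" for k
    using h(1)[OF that] by (auto simp: Hom_iff)
  let ?e = "\<iota> j \<cdot> h j"
  have eH: "?e \<in> Hom C X L" using hm[OF j] lf j C by (simp add: Hom_iff)
  have step: "\<iota> l \<cdot> h l = \<iota> k \<cdot> h k" if u: "u \<in> Hom J k l" for u k l
  proof -
    have kl: "k \<in> Ob J" "l \<in> Ob J" using Hom_ob[OF cJ u] by auto
    have um: "u \<in> Mor J" "Dom J u = k" "Cod J u = l" using u by (auto simp: Hom_iff)
    show ?thesis
      using comp_reassoc[OF lc[OF um(1)] C, of "h k"] nat[OF um(1)] um hm kl lf E by simp
  qed
  have const: "\<iota> k \<cdot> h k = ?e" if "k \<in> Ob J" for k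
    using filtered_join[OF fJ that j] step by metis
  define Z where "Z = \<lparr>fob = h, fmor = (\<lambda>u. (h (Dom J u), h (Cod J u), Idt C X, fmor E u))\<rparr>"
  have Zs: "fob Z = h" "fmor Z u = (h (Dom J u), h (Cod J u), Idt C X, fmor E u)" for u
    by (simp_all add: Z_def)
  have Z: "is_functor J D Z"
    unfolding is_functor_def Zs Hom_arrow_iff arrow_cat_simps
    using cJ D hm nat E X C by (simp add: Hom_iff)
  have dZ: "is_colimit J C (comp_fctr (dom_fctr C) Z) X (\<lambda>_. Idt C X)"
    by (rule iffD1[OF colimit_fctr_cong colimit_konst[OF fJ C X]]) (simp_all add: Zs hm)
  have cZ: "is_colimit J C (comp_fctr (cod_fctr C) Z) L \<iota>"
    by (rule iffD1[OF colimit_fctr_cong L]) (simp_all add: Zs hm)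
  have "is_colimit J D Z ?e (\<lambda>j. (fob Z j, ?e, Idt C X, \<iota> j))"
  proof (rule arrow_colimitI[OF C Z dZ cZ eH])
    fix k assume k: "k \<in> Ob J"
    have "?e \<cdot> Idt C X = ?e" using eH C by (simp only: Hom_iff comp_idt)
    then show "?e \<cdot> Idt C X = \<iota> k \<cdot> fob Z k" unfolding Zs const[OF k] .
  qed
  then show ?thesis
    by (rule dense_filtered_colimit[OF J Z]) (use h(2) in \<open>simp add: Zs\<close>)
qed

text \<open>The cobase change of \<open>f \<in> N\<close> along a map to an arbitrary object \<open>X\<close> is the filtered colimit of
  its cobase changes to the stages of a presentation of \<open>X\<close>.\<close>

lemma dense_pushout:
  assumes p: "is_pushout C f x h k" and f: "f \<in> N"
  shows "dense N k"
proof -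
  note pf = pushout_facts[OF p]
  let ?A = "Dom C f" and ?B = "Cod C f" and ?X = "Cod C x" and ?L = "Cod C h"
  have fM: "f \<in> Mor C" "fp ?A" "fp ?B" using N_M[OF f] by auto
  obtain J0 :: "('u, 'u) cat" and X0 \<iota>0 where J0: "small_index U J0" "is_functor J0 C X0"
    "\<And>j. j \<in> Ob J0 \<Longrightarrow> fp (fob X0 j)" "is_colimit J0 C X0 ?X \<iota>0"
    using presentation[of ?X] pf C by auto
  have xH: "x \<in> Hom C ?A ?X" using pf by (simp add: Hom_iff)
  \<comment> \<open>The source of \<open>f\<close> is finitely presentable, so \<open>x\<close>
    factors through a stage \<open>j0\<close>. In the coslice under \<open>j0\<close> every stage
    receives a map from that source, along which \<open>f\<close> can be pushed out inside
    \<open>M\<close>.\<close>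
  obtain j0 g0 where g0: "j0 \<in> Ob J0" "g0 \<in> Hom C ?A (fob X0 j0)" "\<iota>0 j0 \<cdot> g0 = x"
    using finitely_presentable_factor[OF fM(2) J0(1,2,4) xH] by blast
  have fJ0: "filtered J0" using J0(1) by (simp add: small_index_def)
  note cJ0 = filtered_cat[OF fJ0]
  let ?J = "coslice J0 j0" and ?X' = "comp_fctr X0 (coslice_fctr J0)"
  have J: "small_index U ?J" by (rule small_coslice[OF J0(1) g0(1)])
  have fJ: "filtered ?J" using J by (simp add: small_index_def)
  note cJ = filtered_cat[OF fJ]
  have X': "is_functor ?J C ?X'" by (rule functor_comp[OF functor_coslice[OF cJ0] J0(2)])
  have X'c: "is_colimit ?J C ?X' ?X (\<lambda>w. \<iota>0 (fob (coslice_fctr J0) w))"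
    by (rule cofinal_colimit[OF fJ cofinal_coslice[OF fJ0 g0(1)] J0(2,4)])
  define \<iota> where "\<iota> w = \<iota>0 (Cod J0 w)" for w
  define g where "g w = fmor X0 w \<cdot> g0" for w
  have Jo: "w \<in> Ob ?J \<longleftrightarrow> w \<in> Mor J0 \<and> Dom J0 w = j0" for w by (simp add: coslice_simps)
  note i0 = cocone_facts[OF colimit_cocone[OF J0(4)]]
  have \<iota>H: "\<iota> w \<in> Mor C" "Dom C (\<iota> w) = fob X0 (Cod J0 w)" "Cod C (\<iota> w) = ?X" if "w \<in> Ob ?J" for w
    unfolding \<iota>_def using that i0 cJ0 by (simp_all add: Jo)
  have gH: "g w \<in> Mor C" "Dom C (g w) = ?A" "Cod C (g w) = fob X0 (Cod J0 w)" if "w \<in> Ob ?J" for w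
    unfolding g_def using that g0(2) J0(2) C by (simp_all add: Jo Hom_iff)
  have \<iota>g: "\<iota> w \<cdot> g w = x" if "w \<in> Ob ?J" for w
    unfolding \<iota>_def g_def using comp_reassoc[OF cocone_comm[OF colimit_cocone[OF J0(4)], of w] C, of g0]
      that g0(2,3) i0 J0(2) cJ0 by (simp add: Jo Hom_iff)
  have fpX: "fp (fob X0 (Cod J0 w))" if "w \<in> Ob ?J" for w
    using that J0(3) cJ0 by (simp add: Jo)
  have "\<exists>h k. is_pushout C f (g w) h k" if "w \<in> Ob ?J" for w
    using pushout_ex[OF fM(1) gH(1)[OF that]] gH(2)[OF that] by metis
  then obtain H K where HK: "\<And>w. w \<in> Ob ?J \<Longrightarrow> is_pushout C f (g w) (H w) (K w)" by metis
  note hk = pushout_facts(1,2,4-9)[OF HK]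
  have KN: "K w \<in> N" if "w \<in> Ob ?J" for w
    using N_pushout[OF HK[OF that] f] gH[OF that] fM fpX[OF that] by (simp add: M_simps)
  have Mo: "(w, t) \<in> Mor ?J \<longleftrightarrow> w \<in> Ob ?J \<and> t \<in> Mor J0 \<and> Cod J0 w = Dom J0 t" for w t by (auto simp: coslice_simps)
  have cod: "t \<cdot>\<^bsub>J0\<^esub> w \<in> Ob ?J" if "(w, t) \<in> Mor ?J" for w t using that cJ0 by (simp add: Mo Jo)
  have Xt: "fmor X0 t \<in> Hom C (Cod C (g w)) (Cod C (g (t \<cdot>\<^bsub>J0\<^esub> w)))" if "(w, t) \<in> Mor ?J" for w t
    using that gH(3)[OF cod[OF that]] gH(3)[of w] J0(2) cJ0 by (auto simp: Mo Jo Hom_iff)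
  have Xg: "fmor X0 t \<cdot> g w = g (t \<cdot>\<^bsub>J0\<^esub> w)" if "(w, t) \<in> Mor ?J" for w t
    unfolding g_def using that g0(2) J0(2) cJ0 C by (simp add: Mo Jo Hom_iff)
  have exP: "\<exists>P. P \<in> Hom C (Cod C (H w)) (Cod C (H (t \<cdot>\<^bsub>J0\<^esub> w))) \<and> P \<cdot> H w = H (t \<cdot>\<^bsub>J0\<^esub> w) \<and>
      P \<cdot> K w = K (t \<cdot>\<^bsub>J0\<^esub> w) \<cdot> fmor X0 t" if m: "(w, t) \<in> Mor ?J" for w t
  proof -
    have w: "w \<in> Ob ?J" using m by (simp add: Mo)
    note c = cod[OF m]
    have "H (t \<cdot>\<^bsub>J0\<^esub> w) \<in> Hom C (Cod C f) (Cod C (H (t \<cdot>\<^bsub>J0\<^esub> w)))" using hk[OF c] by (simp add: Hom_iff)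
    moreover have "K (t \<cdot>\<^bsub>J0\<^esub> w) \<cdot> fmor X0 t \<in> Hom C (Cod C (g w)) (Cod C (H (t \<cdot>\<^bsub>J0\<^esub> w)))"
      using hk[OF c] Xt[OF m] C by (simp add: Hom_iff)
    moreover have "H (t \<cdot>\<^bsub>J0\<^esub> w) \<cdot> f = (K (t \<cdot>\<^bsub>J0\<^esub> w) \<cdot> fmor X0 t) \<cdot> g w"
      using hk[OF c] Xt[OF m] Xg[OF m] gH[OF w] C by (simp add: Hom_iff)
    ultimately show ?thesis using pushout_induced[OF C HK[OF w]] by metis
  qed
  \<comment> \<open>Transition maps between the pushouts are merely chosen, but the universal
    property makes them unique; functoriality of the diagram \<open>Z\<close> follows from
    this.\<close>
  define P where "P w t = (SOME P. P \<in> Hom C (Cod C (H w)) (Cod C (H (t \<cdot>\<^bsub>J0\<^esub> w))) \<and> P \<cdot> H w = H (t \<cdot>\<^bsub>J0\<^esub> w) \<and>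
      P \<cdot> K w = K (t \<cdot>\<^bsub>J0\<^esub> w) \<cdot> fmor X0 t)" for w t
  have P: "P w t \<in> Mor C" "Dom C (P w t) = Cod C (H w)" "Cod C (P w t) = Cod C (H (t \<cdot>\<^bsub>J0\<^esub> w))"
    "P w t \<cdot> H w = H (t \<cdot>\<^bsub>J0\<^esub> w)" "P w t \<cdot> K w = K (t \<cdot>\<^bsub>J0\<^esub> w) \<cdot> fmor X0 t"
    if "(w, t) \<in> Mor ?J" for w t
    using someI_ex[OF exP[OF that]] unfolding P_def[symmetric] by (auto simp: Hom_iff)
  have Puniq: "Q = P w t" if m: "(w, t) \<in> Mor ?J" and "Q \<in> Hom C (Cod C (H w)) (Cod C (H (t \<cdot>\<^bsub>J0\<^esub> w)))"
    "Q \<cdot> H w = H (t \<cdot>\<^bsub>J0\<^esub> w)" "Q \<cdot> K w = K (t \<cdot>\<^bsub>J0\<^esub> w) \<cdot> fmor X0 t" for w t Q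
  proof -
    have w: "w \<in> Ob ?J" using m by (simp add: Mo)
    have "P w t \<in> Hom C (Cod C (H w)) (Cod C (H (t \<cdot>\<^bsub>J0\<^esub> w)))" using P[OF m] by (simp add: Hom_iff)
    from pushout_unique[OF C HK[OF w] that(2) this] that(3,4) P(4,5)[OF m] show ?thesis by simp
  qed
  define Z :: "('u, 'u \<times> 'u, 'm, 'm \<times> 'm \<times> 'm \<times> 'm) fctr"
    where "Z = \<lparr>fob = K, fmor = (\<lambda>(w, t). (K w, K (t \<cdot>\<^bsub>J0\<^esub> w), fmor X0 t, P w t))\<rparr>"
  have Zs: "fob Z = K" "fmor Z (w, t) = (K w, K (t \<cdot>\<^bsub>J0\<^esub> w), fmor X0 t, P w t)" for w t
    by (simp_all add: Z_def)
  have Pid: "P w (Idt J0 (Cod J0 w)) = Idt C (Cod C (H w))" if w: "w \<in> Ob ?J" for w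
  proof (rule Puniq[symmetric])
    have e: "Idt J0 (Cod J0 w) \<cdot>\<^bsub>J0\<^esub> w = w" and o: "Cod J0 w \<in> Ob J0" using w cJ0 by (auto simp: Jo)
    show "(w, Idt J0 (Cod J0 w)) \<in> Mor ?J" using w cJ0 by (simp add: Mo Jo)
    have "Cod C (H w) \<in> Ob C" using hk[OF w] C by simp
    then show "Idt C (Cod C (H w)) \<in> Hom C (Cod C (H w)) (Cod C (H (Idt J0 (Cod J0 w) \<cdot>\<^bsub>J0\<^esub> w)))"
      "Idt C (Cod C (H w)) \<cdot> H w = H (Idt J0 (Cod J0 w) \<cdot>\<^bsub>J0\<^esub> w)"
      "Idt C (Cod C (H w)) \<cdot> K w = K (Idt J0 (Cod J0 w) \<cdot>\<^bsub>J0\<^esub> w) \<cdot> fmor X0 (Idt J0 (Cod J0 w))"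
      unfolding e using hk[OF w] gH(3)[OF w] J0(2) o C by (simp_all add: Hom_iff)
  qed
  have Pcomp: "P w (t' \<cdot>\<^bsub>J0\<^esub> t) = P (t \<cdot>\<^bsub>J0\<^esub> w) t' \<cdot> P w t"
    if m: "(w, t) \<in> Mor ?J" and m': "(t \<cdot>\<^bsub>J0\<^esub> w, t') \<in> Mor ?J" for w t t'
  proof (rule Puniq[symmetric])
    have w: "w \<in> Ob ?J" using m by (simp add: Mo)
    have mm: "w \<in> Mor J0" "t \<in> Mor J0" "t' \<in> Mor J0" "Cod J0 w = Dom J0 t" "Cod J0 t = Dom J0 t'" "Dom J0 w = j0"
      using m m' cJ0 by (auto simp: Mo Jo)
    have e: "(t' \<cdot>\<^bsub>J0\<^esub> t) \<cdot>\<^bsub>J0\<^esub> w = t' \<cdot>\<^bsub>J0\<^esub> (t \<cdot>\<^bsub>J0\<^esub> w)" using mm cJ0 by simp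
    show "(w, t' \<cdot>\<^bsub>J0\<^esub> t) \<in> Mor ?J" using mm cJ0 w by (simp add: Mo)
    note d = P[OF m] P[OF m'] hk[OF w] hk[OF cod[OF m]] hk[OF cod[OF m']]
    show "P (t \<cdot>\<^bsub>J0\<^esub> w) t' \<cdot> P w t \<in> Hom C (Cod C (H w)) (Cod C (H ((t' \<cdot>\<^bsub>J0\<^esub> t) \<cdot>\<^bsub>J0\<^esub> w)))"
      unfolding e using d C by (simp add: Hom_iff)
    show "(P (t \<cdot>\<^bsub>J0\<^esub> w) t' \<cdot> P w t) \<cdot> H w = H ((t' \<cdot>\<^bsub>J0\<^esub> t) \<cdot>\<^bsub>J0\<^esub> w)"
      unfolding e using d C by simp
    have "(P (t \<cdot>\<^bsub>J0\<^esub> w) t' \<cdot> P w t) \<cdot> K w = P (t \<cdot>\<^bsub>J0\<^esub> w) t' \<cdot> (K (t \<cdot>\<^bsub>J0\<^esub> w) \<cdot> fmor X0 t)"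
      using d C by simp
    also have "\<dots> = (K (t' \<cdot>\<^bsub>J0\<^esub> (t \<cdot>\<^bsub>J0\<^esub> w)) \<cdot> fmor X0 t') \<cdot> fmor X0 t"
      by (rule comp_reassoc[OF P(5)[OF m'] C]) (use d mm J0(2) gH[OF cod[OF m]] cJ0 in simp_all)
    also have "\<dots> = K ((t' \<cdot>\<^bsub>J0\<^esub> t) \<cdot>\<^bsub>J0\<^esub> w) \<cdot> fmor X0 (t' \<cdot>\<^bsub>J0\<^esub> t)"
      unfolding e using d mm J0(2) gH[OF cod[OF m']] cJ0 C by simp
    finally show "(P (t \<cdot>\<^bsub>J0\<^esub> w) t' \<cdot> P w t) \<cdot> K w = K ((t' \<cdot>\<^bsub>J0\<^esub> t) \<cdot>\<^bsub>J0\<^esub> w) \<cdot> fmor X0 (t' \<cdot>\<^bsub>J0\<^esub> t)" .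
  qed
  have Z: "is_functor ?J D Z"
    unfolding is_functor_def
  proof (intro conjI ballI impI cJ D)
    show "fob Z a \<in> Ob D" if "a \<in> Ob ?J" for a using hk[OF that] by (simp add: Zs arrow_cat_simps)
    show "fmor Z m \<in> Hom D (fob Z (Dom ?J m)) (fob Z (Cod ?J m))" if "m \<in> Mor ?J" for m
    proof (cases m)
      case (Pair w t)
      then have m: "(w, t) \<in> Mor ?J" using that by simp
      then have w: "w \<in> Ob ?J" by (simp add: Mo)
      show ?thesis
        unfolding Pair Zs coslice_simps Hom_arrow_iff
        using P[OF m] hk[OF w] hk[OF cod[OF m]] Xt[OF m] by (simp add: Hom_iff)
    qed
    show "fmor Z (Idt ?J a) = Idt D (fob Z a)" if "a \<in> Ob ?J" for a
      unfolding Zs coslice_simps arrow_cat_simps using Pid[OF that] that hk[OF that] gH(3)[OF that] J0(2) cJ0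
      by (simp add: Jo)
    show "fmor Z (m' \<cdot>\<^bsub>?J\<^esub> m) = fmor Z m' \<cdot>\<^bsub>D\<^esub> fmor Z m"
      if "m \<in> Mor ?J" "m' \<in> Mor ?J" "Cod ?J m = Dom ?J m'" for m m'
    proof -
      obtain w t w' t' where mm: "m = (w, t)" "m' = (w', t')" by (cases m; cases m') blast
      have w': "w' = t \<cdot>\<^bsub>J0\<^esub> w" using that(3) by (simp add: mm coslice_simps)
      have m1: "(w, t) \<in> Mor ?J" "(t \<cdot>\<^bsub>J0\<^esub> w, t') \<in> Mor ?J" using that by (simp_all add: mm w')
      then have jm: "w \<in> Mor J0" "t \<in> Mor J0" "t' \<in> Mor J0" "Cod J0 w = Dom J0 t" "Cod J0 t = Dom J0 t'"
        using cJ0 by (auto simp: Mo Jo)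
      show ?thesis
        unfolding mm w' Zs coslice_simps arrow_cat_simps Pcomp[OF m1] using jm cJ0 J0(2) by simp
    qed
  qed
  have dZ: "is_colimit ?J C (comp_fctr (dom_fctr C) Z) ?X \<iota>"
  proof (rule iffD1[OF colimit_fctr_cong])
    show "is_colimit ?J C ?X' ?X \<iota>" using X'c unfolding \<iota>_def coslice_simps .
    show "fob ?X' j = fob (comp_fctr (dom_fctr C) Z) j" if "j \<in> Ob ?J" for j
      using hk[OF that] gH(3)[OF that] by (simp add: Zs coslice_simps)
    show "fmor ?X' u = fmor (comp_fctr (dom_fctr C) Z) u" if "u \<in> Mor ?J" for u
      by (cases u) (simp add: Zs coslice_simps)
  qed
  have xH: "x \<in> Mor C" "Cod C x = ?X" "k \<in> Hom C ?X ?L" using pf by (simp_all add: Hom_iff)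
  have "\<exists>r. r \<in> Hom C (Cod C (H w)) ?L \<and> r \<cdot> H w = h \<and> r \<cdot> K w = k \<cdot> \<iota> w" if w: "w \<in> Ob ?J" for w
  proof -
    have "h \<in> Hom C (Cod C f) ?L" "k \<cdot> \<iota> w \<in> Hom C (Cod C (g w)) ?L"
      "h \<cdot> f = (k \<cdot> \<iota> w) \<cdot> g w"
      using pf \<iota>H[OF w] gH[OF w] \<iota>g[OF w] C by (simp_all add: Hom_iff)
    then show ?thesis using pushout_induced[OF C HK[OF w]] by metis
  qed
  then obtain \<mu> where lam: "\<And>w. w \<in> Ob ?J \<Longrightarrow> \<mu> w \<in> Hom C (Cod C (H w)) ?L"
    "\<And>w. w \<in> Ob ?J \<Longrightarrow> \<mu> w \<cdot> H w = h" "\<And>w. w \<in> Ob ?J \<Longrightarrow> \<mu> w \<cdot> K w = k \<cdot> \<iota> w" by metis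
  have \<iota>X: "\<iota> (t \<cdot>\<^bsub>J0\<^esub> w) \<cdot> fmor X0 t = \<iota> w" if "(w, t) \<in> Mor ?J" for w t
    using cocone_comm[OF colimit_cocone[OF J0(4)], of t] that cJ0 unfolding \<iota>_def by (simp add: Mo Jo)
  \<comment> \<open>Pushouts commute with the filtered colimit over the coslice; this is verified
    from the two universal properties.\<close>
  have cZ: "is_colimit ?J C (comp_fctr (cod_fctr C) Z) ?L \<mu>"
  proof (rule is_colimitI)
    have Lo: "?L \<in> Ob C" using pf C by simp
    show "cocone ?J C (comp_fctr (cod_fctr C) Z) ?L \<mu>"
      unfolding cocone_def
    proof (intro conjI ballI Lo)
      show "\<mu> w \<in> Hom C (fob (comp_fctr (cod_fctr C) Z) w) ?L" if "w \<in> Ob ?J" for w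
        using lam(1)[OF that] hk[OF that] by (simp add: Zs)
      show "\<mu> (Cod ?J m) \<cdot> fmor (comp_fctr (cod_fctr C) Z) m = \<mu> (Dom ?J m)" if "m \<in> Mor ?J" for m
      proof (cases m)
        case (Pair w t)
        then have m: "(w, t) \<in> Mor ?J" using that by simp
        then have w: "w \<in> Ob ?J" by (simp add: Mo)
        note c = cod[OF m]
        have l: "\<mu> w \<in> Mor C" "\<mu> (t \<cdot>\<^bsub>J0\<^esub> w) \<in> Mor C" "Dom C (\<mu> (t \<cdot>\<^bsub>J0\<^esub> w)) = Cod C (H (t \<cdot>\<^bsub>J0\<^esub> w))"
          "Cod C (\<mu> (t \<cdot>\<^bsub>J0\<^esub> w)) = ?L"
          using lam(1)[OF w] lam(1)[OF c] by (auto simp: Hom_iff)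
        note d = P[OF m] hk[OF w] hk[OF c] Xt[OF m] l
        have "\<mu> (t \<cdot>\<^bsub>J0\<^esub> w) \<cdot> P w t = \<mu> w"
        proof (rule pushout_unique[OF C HK[OF w] _ lam(1)[OF w]])
          show "\<mu> (t \<cdot>\<^bsub>J0\<^esub> w) \<cdot> P w t \<in> Hom C (Cod C (H w)) ?L" using d C by (simp add: Hom_iff)
          show "(\<mu> (t \<cdot>\<^bsub>J0\<^esub> w) \<cdot> P w t) \<cdot> H w = \<mu> w \<cdot> H w"
            using d C lam(2)[OF w] lam(2)[OF c] by simp
          have "(\<mu> (t \<cdot>\<^bsub>J0\<^esub> w) \<cdot> P w t) \<cdot> K w = \<mu> (t \<cdot>\<^bsub>J0\<^esub> w) \<cdot> (K (t \<cdot>\<^bsub>J0\<^esub> w) \<cdot> fmor X0 t)"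
            using d C by simp
          also have "\<dots> = (k \<cdot> \<iota> (t \<cdot>\<^bsub>J0\<^esub> w)) \<cdot> fmor X0 t"
            by (rule comp_reassoc[OF lam(3)[OF c] C]) (use d in \<open>simp_all add: Hom_iff\<close>)
          also have "\<dots> = k \<cdot> \<iota> w"
            using \<iota>H[OF c] \<iota>X[OF m] d pf gH(3)[OF c] C by (simp add: Hom_iff)
          finally show "(\<mu> (t \<cdot>\<^bsub>J0\<^esub> w) \<cdot> P w t) \<cdot> K w = \<mu> w \<cdot> K w" unfolding lam(3)[OF w] .
        qed
        then show ?thesis by (simp add: Pair Zs coslice_simps)
      qed
    qed
    fix Q
    {
      fix \<zeta> assume z: "cocone ?J C (comp_fctr (cod_fctr C) Z) Q \<zeta>"
      have zm: "\<zeta> w \<in> Mor C" "Dom C (\<zeta> w) = Cod C (H w)" "Cod C (\<zeta> w) = Q" if "w \<in> Ob ?J" for w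
        using cocone_facts[OF z] that hk[OF that] by (simp_all add: Zs)
      have zc: "\<zeta> (t \<cdot>\<^bsub>J0\<^esub> w) \<cdot> P w t = \<zeta> w" if "(w, t) \<in> Mor ?J" for w t
        using cocone_comm[OF z that] by (simp add: Zs coslice_simps)
      \<comment> \<open>The restriction of the cocone to \<open>Cod C f\<close> is the same at every
        stage, because the coslice is connected; hence it gives one map out of
        \<open>Cod C f\<close>.\<close>
      define b where "b w = \<zeta> w \<cdot> H w" for w
      have bstep: "b (t \<cdot>\<^bsub>J0\<^esub> w) = b w" if m: "(w, t) \<in> Mor ?J" for w t
      proof -
        have w: "w \<in> Ob ?J" using m by (simp add: Mo)
        show ?thesis
          unfolding b_def using comp_reassoc[OF zc[OF m] C, of "H w"] P[OF m] hk[OF w] zm[OF cod[OF m]] by simp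
      qed
      have bc: "b w = b w'" if ww: "w \<in> Ob ?J" "w' \<in> Ob ?J" for w w'
      proof -
        obtain v p q where "p \<in> Hom ?J w v" "q \<in> Hom ?J w' v" using filtered_join[OF fJ ww] by blast
        moreover obtain p1 p2 q1 q2 where "p = (p1, p2)" "q = (q1, q2)" by (cases p; cases q) blast
        ultimately have "(w, p2) \<in> Mor ?J" "(w', q2) \<in> Mor ?J" "p2 \<cdot>\<^bsub>J0\<^esub> w = v" "q2 \<cdot>\<^bsub>J0\<^esub> w' = v"
          by (auto simp: Hom_def coslice_simps)
        then show ?thesis using bstep by metis
      qed
      have "cocone ?J C (comp_fctr (dom_fctr C) Z) Q (\<lambda>w. \<zeta> w \<cdot> K w)"
        unfolding cocone_def
      proof (intro conjI ballI)
        show "Q \<in> Ob C" using cocone_ob[OF z] .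
        show "\<zeta> w \<cdot> K w \<in> Hom C (fob (comp_fctr (dom_fctr C) Z) w) Q" if "w \<in> Ob ?J" for w
          using zm[OF that] hk[OF that] C by (simp add: Zs Hom_iff)
        show "(\<zeta> (Cod ?J m) \<cdot> K (Cod ?J m)) \<cdot> fmor (comp_fctr (dom_fctr C) Z) m = \<zeta> (Dom ?J m) \<cdot> K (Dom ?J m)"
          if "m \<in> Mor ?J" for m
        proof (cases m)
          case (Pair w t)
          then have m: "(w, t) \<in> Mor ?J" using that by simp
          then have w: "w \<in> Ob ?J" by (simp add: Mo)
          note d = P[OF m] hk[OF w] hk[OF cod[OF m]] Xt[OF m] zm[OF w] zm[OF cod[OF m]]
          have "\<zeta> (t \<cdot>\<^bsub>J0\<^esub> w) \<cdot> (K (t \<cdot>\<^bsub>J0\<^esub> w) \<cdot> fmor X0 t) = \<zeta> w \<cdot> K w"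
            unfolding P(5)[OF m, symmetric] by (rule comp_reassoc[OF zc[OF m] C]) (use d in simp_all)
          then show ?thesis using d C by (simp add: Pair Zs coslice_simps Hom_iff)
        qed
      qed
      then obtain x' where x': "x' \<in> Hom C ?X Q" "\<And>w. w \<in> Ob ?J \<Longrightarrow> x' \<cdot> \<iota> w = \<zeta> w \<cdot> K w"
        using colimit_induced[OF dZ] by blast
      obtain w0 where w0: "w0 \<in> Ob ?J" using fJ by (auto simp: filtered_def)
      have bH: "b w0 \<in> Hom C ?B Q" unfolding b_def using zm[OF w0] hk[OF w0] C by (simp add: Hom_iff)
      have "x' \<cdot> (\<iota> w0 \<cdot> g w0) = (\<zeta> w0 \<cdot> K w0) \<cdot> g w0"
        by (rule comp_reassoc[OF x'(2)[OF w0] C]) (use x'(1) \<iota>H[OF w0] gH[OF w0] in \<open>simp_all add: Hom_iff\<close>)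
      then have "b w0 \<cdot> f = x' \<cdot> x"
        unfolding b_def \<iota>g[OF w0] using zm[OF w0] hk[OF w0] C by simp
      then obtain q where q: "q \<in> Hom C ?L Q" "q \<cdot> h = b w0" "q \<cdot> k = x'"
        using pushout_induced[OF C p bH, of x'] x'(1) by metis
      have "q \<cdot> \<mu> w = \<zeta> w" if w: "w \<in> Ob ?J" for w
      proof (rule pushout_unique[OF C HK[OF w]])
        have l: "\<mu> w \<in> Mor C" "Dom C (\<mu> w) = Cod C (H w)" "Cod C (\<mu> w) = ?L" using lam(1)[OF w] by (auto simp: Hom_iff)
        note d = l q(1) hk[OF w] zm[OF w] pf \<iota>H[OF w] gH(3)[OF w]
        show "q \<cdot> \<mu> w \<in> Hom C (Cod C (H w)) Q" "\<zeta> w \<in> Hom C (Cod C (H w)) Q" using d C by (simp_all add: Hom_iff)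
        show "(q \<cdot> \<mu> w) \<cdot> H w = \<zeta> w \<cdot> H w"
          using d lam(2)[OF w] q(2) bc[OF w w0] C by (simp add: Hom_iff b_def)
        show "(q \<cdot> \<mu> w) \<cdot> K w = \<zeta> w \<cdot> K w"
          using d lam(3)[OF w] comp_reassoc[OF q(3) C, of "\<iota> w"] x'(2)[OF w] C by (simp add: Hom_iff)
      qed
      then show "\<exists>q\<in>Hom C ?L Q. \<forall>w\<in>Ob ?J. q \<cdot> \<mu> w = \<zeta> w" using q(1) by blast
    }
    fix q q' assume q: "q \<in> Hom C ?L Q" "q' \<in> Hom C ?L Q" and eq: "\<forall>w\<in>Ob ?J. q \<cdot> \<mu> w = q' \<cdot> \<mu> w"
    have lm: "\<mu> w \<in> Mor C" "Dom C (\<mu> w) = Cod C (H w)" "Cod C (\<mu> w) = ?L" if "w \<in> Ob ?J" for w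
      using lam(1)[OF that] by (auto simp: Hom_iff)
    have r: "(q \<cdot> \<mu> w) \<cdot> H w = q \<cdot> h" "(q \<cdot> \<mu> w) \<cdot> K w = (q \<cdot> k) \<cdot> \<iota> w"
      if "w \<in> Ob ?J" "q \<in> Hom C ?L Q" for w q
      using that(2) lm[OF that(1)] hk[OF that(1)] lam(2,3)[OF that(1)] pf \<iota>H[OF that(1)] C by (simp_all add: Hom_iff)
    obtain w0 where w0: "w0 \<in> Ob ?J" using fJ by (auto simp: filtered_def)
    show "q = q'"
    proof (rule pushout_unique[OF C p q])
      show "q \<cdot> h = q' \<cdot> h" using r(1)[OF w0 q(1)] r(1)[OF w0 q(2)] eq w0 by metis
      have F: "is_functor ?J C (comp_fctr (dom_fctr C) Z)" using functor_comp[OF Z functor_dom[OF C]] .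
      show "q \<cdot> k = q' \<cdot> k"
      proof (rule colimit_unique[OF C F dZ])
        show "q \<cdot> k \<in> Hom C ?X Q" "q' \<cdot> k \<in> Hom C ?X Q" using q pf C by (simp_all add: Hom_iff)
        show "(q \<cdot> k) \<cdot> \<iota> w = (q' \<cdot> k) \<cdot> \<iota> w" if "w \<in> Ob ?J" for w
          using r(2)[OF that q(1)] r(2)[OF that q(2)] eq that by metis
      qed
    qed
  qed
  have "is_colimit ?J D Z k (\<lambda>j. (fob Z j, k, \<iota> j, \<mu> j))"
    by (rule arrow_colimitI[OF C Z dZ cZ xH(3)]) (use lam(3) in \<open>simp add: Zs\<close>)
  then show ?thesis
    by (rule dense_filtered_colimit[OF J Z]) (use KN dense_self N_M in \<open>simp add: Zs\<close>)
qed

end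

section \<open>Attaching cells and iterating the attachment\<close>

context cell_class
begin

text \<open>Attaching the cells \<open>s = (j, u, v)\<close> of a set \<open>F\<close> to \<open>X\<close> along the maps \<open>u\<close>.\<close>

definition attaching :: "'o \<Rightarrow> ('m \<times> 'm \<times> 'm) set \<Rightarrow> 'o \<Rightarrow> 'm \<Rightarrow> ('m \<times> 'm \<times> 'm \<Rightarrow> 'm) \<Rightarrow> bool" where
  "attaching X F L h k \<longleftrightarrow> L \<in> Ob C \<and> h \<in> Hom C X L \<and>
    (\<forall>s\<in>F. k s \<in> Hom C (Cod C (fst s)) L \<and> k s \<cdot> fst s = h \<cdot> fst (snd s)) \<and>
    (\<forall>Z x b. x \<in> Hom C X Z \<and>
       (\<forall>s\<in>F. b s \<in> Hom C (Cod C (fst s)) Z \<and> b s \<cdot> fst s = x \<cdot> fst (snd s)) \<longrightarrow>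
       (\<exists>w\<in>Hom C L Z. w \<cdot> h = x \<and> (\<forall>s\<in>F. w \<cdot> k s = b s))) \<and>
    (\<forall>Z w w'. w \<in> Hom C L Z \<and> w' \<in> Hom C L Z \<and> w \<cdot> h = w' \<cdot> h \<and>
       (\<forall>s\<in>F. w \<cdot> k s = w' \<cdot> k s) \<longrightarrow> w = w')"

lemma attachingD:
  assumes "attaching X F L h k"
  shows "L \<in> Ob C" "h \<in> Hom C X L" "\<And>s. s \<in> F \<Longrightarrow> k s \<in> Hom C (Cod C (fst s)) L"
    "\<And>s. s \<in> F \<Longrightarrow> k s \<cdot> fst s = h \<cdot> fst (snd s)"
  using assms by (auto simp: attaching_def)

lemma attaching_induced:
  assumes "attaching X F L h k" "x \<in> Hom C X Z" "\<And>s. s \<in> F \<Longrightarrow> b s \<in> Hom C (Cod C (fst s)) Z"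
    "\<And>s. s \<in> F \<Longrightarrow> b s \<cdot> fst s = x \<cdot> fst (snd s)"
  obtains w where "w \<in> Hom C L Z" "w \<cdot> h = x" "\<And>s. s \<in> F \<Longrightarrow> w \<cdot> k s = b s"
proof -
  have "\<exists>w\<in>Hom C L Z. w \<cdot> h = x \<and> (\<forall>s\<in>F. w \<cdot> k s = b s)"
  proof -
    have "\<forall>Z x b. x \<in> Hom C X Z \<and>
       (\<forall>s\<in>F. b s \<in> Hom C (Cod C (fst s)) Z \<and> b s \<cdot> fst s = x \<cdot> fst (snd s)) \<longrightarrow>
       (\<exists>w\<in>Hom C L Z. w \<cdot> h = x \<and> (\<forall>s\<in>F. w \<cdot> k s = b s))"
      using assms(1) unfolding attaching_def by (elim conjE)
    from this[THEN spec, THEN spec, THEN spec, of x Z b, THEN mp] show ?thesis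
      using assms(2-4) by blast
  qed
  then show thesis using that by blast
qed

lemma attaching_unique:
  assumes "attaching X F L h k" "w \<in> Hom C L Z" "w' \<in> Hom C L Z" "w \<cdot> h = w' \<cdot> h"
    "\<And>s. s \<in> F \<Longrightarrow> w \<cdot> k s = w' \<cdot> k s"
  shows "w = w'"
proof -
  have "\<forall>Z w w'. w \<in> Hom C L Z \<and> w' \<in> Hom C L Z \<and> w \<cdot> h = w' \<cdot> h \<and>
       (\<forall>s\<in>F. w \<cdot> k s = w' \<cdot> k s) \<longrightarrow> w = w'"
    using assms(1) unfolding attaching_def by (elim conjE)
  from this[THEN spec, THEN spec, THEN spec, of w Z w', THEN mp] show ?thesis
    using assms(2-5) by blast
qed

text \<open>For finitely many cells iterated pushouts suffice, with no coproduct of cells, and the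
  inclusion is a composite of dense maps. Arbitrary small sets of cells are then filtered colimits
  of finite ones.\<close>

lemma attaching_ex:
  assumes X: "X \<in> Ob C" and "finite F" and "\<And>s. s \<in> F \<Longrightarrow> fst s \<in> N \<and> fst (snd s) \<in> Hom C (Dom C (fst s)) X"
  shows "\<exists>L h k. attaching X F L h k \<and> dense N h"
  using assms(2,3)
proof (induction rule: finite_induct)
  case empty
  have "attaching X {} X (Idt C X) k" for k
    unfolding attaching_def
  proof (intro conjI ballI allI impI)
    fix Z x and b :: "'m \<times> 'm \<times> 'm \<Rightarrow> 'm"
    assume "x \<in> Hom C X Z \<and> (\<forall>s\<in>{}. b s \<in> Hom C (Cod C (fst s)) Z \<and> b s \<cdot> fst s = x \<cdot> fst (snd s))"
    then show "\<exists>w\<in>Hom C X Z. w \<cdot> Idt C X = x \<and> (\<forall>s\<in>{}. w \<cdot> k s = b s)"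
      using C by (intro bexI[of _ x]) (simp_all add: Hom_iff)
  next
    fix Z w w'
    assume "w \<in> Hom C X Z \<and> w' \<in> Hom C X Z \<and> w \<cdot> Idt C X = w' \<cdot> Idt C X \<and>
       (\<forall>s\<in>{}. w \<cdot> k s = w' \<cdot> k s)"
    then show "w = w'" using comp_idt[OF C] by (metis Hom_iff)
  qed (use X C in \<open>simp_all add: Hom_iff\<close>)
  then show ?case using dense_idt[OF X] by blast
next
  case (insert s F)
  obtain L h k where a: "attaching X F L h k" "dense N h" using insert by auto
  note ad = attachingD[OF a(1)]
  let ?j = "fst s" and ?u = "fst (snd s)"
  have s: "?j \<in> N" "?u \<in> Hom C (Dom C ?j) X" using insert.prems by auto
  have jm: "?j \<in> Mor C" using N_M[OF s(1)] by simp
  have hu: "h \<cdot> ?u \<in> Hom C (Dom C ?j) L" using comp_Hom[OF C s(2) ad(2)] .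
  then have hu': "h \<cdot> ?u \<in> Mor C" "Dom C ?j = Dom C (h \<cdot> ?u)" "Cod C (h \<cdot> ?u) = L"
    by (auto simp: Hom_iff)
  obtain p q where pq: "is_pushout C ?j (h \<cdot> ?u) p q" using pushout_ex[OF jm hu'(1,2)] by metis
  note pf = pushout_facts(1,2,4-9)[OF pq]
  let ?L = "Cod C p"
  have q: "q \<in> Hom C L ?L" "p \<in> Hom C (Cod C ?j) ?L" using pf hu'(3) by (simp_all add: Hom_iff)
  have dq: "dense N (q \<cdot> h)"
    using dense_comp[OF a(2) dense_pushout[OF pq s(1)]] ad(2) q(1) by (simp add: Hom_iff)
  define k' where "k' t = (if t = s then p else q \<cdot> k t)" for t
  have k's: "k' s = p" "\<And>t. t \<in> F \<Longrightarrow> k' t = q \<cdot> k t" using insert.hyps by (auto simp: k'_def)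
  have "attaching X (insert s F) ?L (q \<cdot> h) k'"
    unfolding attaching_def
  proof (intro conjI ballI allI impI)
    show "?L \<in> Ob C" using Hom_ob[OF C q(1)] by simp
    show "q \<cdot> h \<in> Hom C X ?L" using comp_Hom[OF C ad(2) q(1)] .
  next
    fix t assume t: "t \<in> insert s F"
    show "k' t \<in> Hom C (Cod C (fst t)) ?L"
    proof (cases "t = s")
      case True then show ?thesis using k's(1) q(2) by simp
    next
      case False
      then have tF: "t \<in> F" using t by simp
      show ?thesis unfolding k's(2)[OF tF] using comp_Hom[OF C ad(3)[OF tF] q(1)] .
    qed
    show "k' t \<cdot> fst t = (q \<cdot> h) \<cdot> fst (snd t)"
    proof (cases "t = s")
      case True then show ?thesis using k's(1) pf(8) q(1) ad(2) s(2) C by (simp add: Hom_iff)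
    next
      case False
      then have tF: "t \<in> F" using t by simp
      have tN: "fst t \<in> Mor C" "fst (snd t) \<in> Hom C (Dom C (fst t)) X" using insert.prems[of t] N_M tF by auto
      show ?thesis unfolding k's(2)[OF tF] using ad(3,4)[OF tF] ad(2) q(1) tN C by (simp add: Hom_iff)
    qed
  next
    fix Z x b
    assume "x \<in> Hom C X Z \<and> (\<forall>s\<in>insert s F. b s \<in> Hom C (Cod C (fst s)) Z \<and> b s \<cdot> fst s = x \<cdot> fst (snd s))"
    then have x: "x \<in> Hom C X Z" and b: "\<And>t. t \<in> F \<Longrightarrow> b t \<in> Hom C (Cod C (fst t)) Z"
      "\<And>t. t \<in> F \<Longrightarrow> b t \<cdot> fst t = x \<cdot> fst (snd t)"
      and bs: "b s \<in> Hom C (Cod C ?j) Z" "b s \<cdot> ?j = x \<cdot> ?u" by auto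
    obtain w where w: "w \<in> Hom C L Z" "w \<cdot> h = x" "\<And>t. t \<in> F \<Longrightarrow> w \<cdot> k t = b t"
      using attaching_induced[OF a(1) x b] by blast
    have "b s \<cdot> ?j = w \<cdot> (h \<cdot> ?u)"
      using comp_reassoc[OF w(2) C, of ?u] bs(2) ad(2) s(2) w(1) by (simp add: Hom_iff)
    then obtain w' where w': "w' \<in> Hom C ?L Z" "w' \<cdot> p = b s" "w' \<cdot> q = w"
      using pushout_induced[OF C pq bs(1)] w(1) hu'(3) by metis
    have "w' \<cdot> (q \<cdot> h) = x"
      using comp_reassoc[OF w'(3) C, of h] w'(1) q(1) ad(2) w(2) by (simp add: Hom_iff)
    moreover have "w' \<cdot> k' t = b t" if "t \<in> insert s F" for t
    proof (cases "t = s")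
      case True then show ?thesis using k's(1) w'(2) by simp
    next
      case False
      then have tF: "t \<in> F" using that by simp
      show ?thesis
        unfolding k's(2)[OF tF] using comp_reassoc[OF w'(3) C, of "k t"] w'(1) q(1) ad(3)[OF tF] w(3)[OF tF]
        by (simp add: Hom_iff)
    qed
    ultimately show "\<exists>w\<in>Hom C ?L Z. w \<cdot> (q \<cdot> h) = x \<and> (\<forall>s\<in>insert s F. w \<cdot> k' s = b s)"
      using w'(1) by blast
  next
    fix Z w w'
    assume "w \<in> Hom C ?L Z \<and> w' \<in> Hom C ?L Z \<and> w \<cdot> (q \<cdot> h) = w' \<cdot> (q \<cdot> h) \<and>
       (\<forall>s\<in>insert s F. w \<cdot> k' s = w' \<cdot> k' s)"
    then have w: "w \<in> Hom C ?L Z" "w' \<in> Hom C ?L Z" "w \<cdot> (q \<cdot> h) = w' \<cdot> (q \<cdot> h)"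
      and e: "\<And>t. t \<in> F \<Longrightarrow> w \<cdot> (q \<cdot> k t) = w' \<cdot> (q \<cdot> k t)" "w \<cdot> p = w' \<cdot> p"
      using k's by auto
    have "w \<cdot> q = w' \<cdot> q"
    proof (rule attaching_unique[OF a(1)])
      show "w \<cdot> q \<in> Hom C L Z" "w' \<cdot> q \<in> Hom C L Z" using comp_Hom[OF C q(1)] w(1,2) by auto
      show "(w \<cdot> q) \<cdot> h = (w' \<cdot> q) \<cdot> h" using w q(1) ad(2) C by (simp add: Hom_iff)
      show "(w \<cdot> q) \<cdot> k t = (w' \<cdot> q) \<cdot> k t" if "t \<in> F" for t
        using w(1,2) q(1) ad(3)[OF that] e(1)[OF that] C by (simp add: Hom_iff)
    qed
    then show "w = w'" using pushout_unique[OF C pq w(1,2) e(2)] by simp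
  qed
  then show ?case using dq by blast
qed

text \<open>All lifting problems are attached at once, as a filtered colimit over their finite
  subsets. This is one stage of the small object argument, and its form as a filtered colimit keeps
  the inclusion dense.\<close>

lemma attach_all:
  assumes f: "f \<in> Mor C" and J0: "J0 \<subseteq> N" "small U J0"
  shows "\<exists>e f'. dense N e \<and> e \<in> Hom C (Dom C f) (Dom C f') \<and> f' \<in> Mor C \<and> f' \<cdot> e = f \<and>
    (\<forall>j\<in>J0. \<forall>u\<in>Hom C (Dom C j) (Dom C f). \<forall>v\<in>Hom C (Cod C j) (Cod C f). f \<cdot> u = v \<cdot> j \<longrightarrow>
       (\<exists>w\<in>Hom C (Cod C j) (Dom C f'). w \<cdot> j = e \<cdot> u \<and> f' \<cdot> w = v))"
proof -
  let ?X = "Dom C f" and ?Y = "Cod C f"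
  have X: "?X \<in> Ob C" "?Y \<in> Ob C" using f C by auto
  define S where "S = {(j, u, v). j \<in> J0 \<and> u \<in> Hom C (Dom C j) ?X \<and> v \<in> Hom C (Cod C j) ?Y \<and> f \<cdot> u = v \<cdot> j}"
  define P where "P = {F. finite F \<and> F \<subseteq> S}"
  have jm: "j \<in> Mor C" if "j \<in> J0" for j using that J0 N_M by blast
  have "small U (SIGMA j : J0. Hom C (Dom C j) ?X \<times> Hom C (Cod C j) ?Y)"
    using J0(2) jm X C by (intro small_Sigma small_Times lsmall) auto
  then have "small U S" by (rule small_mono) (auto simp: S_def)
  then have sP: "small U P" by (rule small_mono[OF small_Pow]) (auto simp: P_def)
  have Sd: "fst s \<in> J0" "fst (snd s) \<in> Hom C (Dom C (fst s)) ?X" "snd (snd s) \<in> Hom C (Cod C (fst s)) ?Y"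
    "f \<cdot> fst (snd s) = snd (snd s) \<cdot> fst s" if "s \<in> S" for s
    using that by (auto simp: S_def)
  have "\<exists>L h k. attaching ?X F L h k \<and> dense N h" if "F \<in> P" for F
  proof -
    have "finite F" "F \<subseteq> S" using that by (simp_all add: P_def)
    moreover have "fst s \<in> N \<and> fst (snd s) \<in> Hom C (Dom C (fst s)) ?X" if "s \<in> S" for s
      using Sd(1,2)[OF that] J0 by blast
    ultimately show ?thesis using attaching_ex[OF X(1), of F] by blast
  qed
  then obtain L h k where a: "\<And>F. F \<in> P \<Longrightarrow> attaching ?X F (L F) (h F) (k F)" "\<And>F. F \<in> P \<Longrightarrow> dense N (h F)"
    by metis
  note ad = attachingD[OF a(1)]
  have exw: "\<exists>w. w \<in> Hom C (L F) (L G) \<and> w \<cdot> h F = h G \<and> (\<forall>s\<in>F. w \<cdot> k F s = k G s)"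
    if FG: "F \<in> P" "G \<in> P" "F \<subseteq> G" for F G
  proof -
    have "k G s \<in> Hom C (Cod C (fst s)) (L G)" "k G s \<cdot> fst s = h G \<cdot> fst (snd s)" if "s \<in> F" for s
      using ad(3,4)[OF FG(2) subsetD[OF FG(3) that]] .
    from attaching_induced[OF a(1)[OF FG(1)] ad(2)[OF FG(2)] this] show ?thesis by metis
  qed
  \<comment> \<open>The map induced by enlarging a set of cells is unique, so the attachments form a
    diagram on the poset of finite subsets although each of them was chosen independently.\<close>
  define tr where "tr F G = (SOME w. w \<in> Hom C (L F) (L G) \<and> w \<cdot> h F = h G \<and> (\<forall>s\<in>F. w \<cdot> k F s = k G s))" for F G
  have tr: "tr F G \<in> Hom C (L F) (L G)" "tr F G \<cdot> h F = h G" "\<And>s. s \<in> F \<Longrightarrow> tr F G \<cdot> k F s = k G s"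
    if FG: "F \<in> P" "G \<in> P" "F \<subseteq> G" for F G
    using someI_ex[OF exw[OF FG]] unfolding tr_def[symmetric] by auto
  let ?J = "poset_cat P (\<subseteq>)"
  have cJ: "category ?J" by (rule category_poset) auto
  have fJ: "filtered ?J"
  proof (rule filtered_poset)
    show "P \<noteq> {}" by (auto simp: P_def)
    show "\<exists>c\<in>P. a \<subseteq> c \<and> b \<subseteq> c" if "a \<in> P" "b \<in> P" for a b
      using that by (intro bexI[of _ "a \<union> b"]) (auto simp: P_def)
  qed auto
  have sJ: "small_index U ?J"
    unfolding small_index_def using fJ sP small_mono[OF small_Times[OF sP sP], of "Mor ?J"]
    by (auto simp: poset_cat_def)
  define E where "E = \<lparr>fob = L, fmor = (\<lambda>(F, G). tr F G)\<rparr>"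
  have Es: "fob E = L" "fmor E (F, G) = tr F G" for F G by (simp_all add: E_def)
  have E: "is_functor ?J C E"
    unfolding is_functor_def
  proof (intro conjI ballI impI cJ C)
    show "fob E F \<in> Ob C" if "F \<in> Ob ?J" for F using ad(1) that by (simp add: Es)
    show "fmor E m \<in> Hom C (fob E (Dom ?J m)) (fob E (Cod ?J m))" if "m \<in> Mor ?J" for m
      using tr(1) that by (cases m) (simp add: Es)
    show "fmor E (Idt ?J F) = Idt C (fob E F)" if F: "F \<in> Ob ?J" for F
    proof -
      have FP: "F \<in> P" using F by simp
      have "tr F F = Idt C (L F)"
        by (rule attaching_unique[OF a(1)[OF FP] tr(1)[OF FP FP subset_refl]])
          (use tr(2,3)[OF FP FP subset_refl] ad[OF FP] C in \<open>auto simp: Hom_iff\<close>)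
      then show ?thesis by (simp add: Es)
    qed
    show "fmor E (n \<cdot>\<^bsub>?J\<^esub> m) = fmor E n \<cdot> fmor E m" if m: "m \<in> Mor ?J" "n \<in> Mor ?J" "Cod ?J m = Dom ?J n" for m n
    proof -
      obtain F G H where mn: "m = (F, G)" "n = (G, H)" and P: "F \<in> P" "G \<in> P" "H \<in> P" "F \<subseteq> G" "G \<subseteq> H"
        using m by (cases m; cases n) auto
      note t1 = tr[OF P(1,2,4)] and t2 = tr[OF P(2,3,5)] and t3 = tr[OF P(1,3) order_trans[OF P(4,5)]]
      have "tr F H = tr G H \<cdot> tr F G"
      proof (rule attaching_unique[OF a(1)[OF P(1)] t3(1)])
        show "tr G H \<cdot> tr F G \<in> Hom C (L F) (L H)" using comp_Hom[OF C t1(1) t2(1)] .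
        show "tr F H \<cdot> h F = (tr G H \<cdot> tr F G) \<cdot> h F"
          using t1(1,2) t2(1,2) t3(2) ad(2)[OF P(1)] C by (simp add: Hom_iff)
        show "tr F H \<cdot> k F s = (tr G H \<cdot> tr F G) \<cdot> k F s" if s: "s \<in> F" for s
        proof -
          have "s \<in> G" using s P(4) by blast
          then show ?thesis
            using t1(1) t1(3)[OF s] t2(1) t2(3) t3(3)[OF s] ad(3)[OF P(1) s] C by (simp add: Hom_iff)
        qed
      qed
      then show ?thesis by (simp add: mn Es)
    qed
  qed
  obtain L' \<iota> where L': "is_colimit ?J C E L' \<iota>" using filtered_colimit[OF filtered_colims E sJ] by blast
  note lf = cocone_facts[OF colimit_cocone[OF L']] and lc = cocone_comm[OF colimit_cocone[OF L']]
  have \<iota>H: "\<iota> F \<in> Hom C (L F) L'" if "F \<in> P" for F using lf that by (simp add: Hom_iff Es)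
  have \<iota>tr: "\<iota> G \<cdot> tr F G = \<iota> F" if "F \<in> P" "G \<in> P" "F \<subseteq> G" for F G
    using lc[of "(F, G)"] that by (simp add: Es)
  have e0: "{} \<in> P" by (simp add: P_def)
  let ?e = "\<iota> {} \<cdot> h {}"
  have eh: "\<iota> F \<cdot> h F = ?e" if F: "F \<in> P" for F
    using comp_reassoc[OF \<iota>tr[OF e0 F] C, of "h {}"] tr(1,2)[OF e0 F] \<iota>H[OF F] ad(2)[OF e0] by (simp add: Hom_iff)
  have de: "dense N ?e"
    by (rule dense_under_colimit[OF sJ E L' X(1)]) (use ad(2) a(2) tr(2) e0 in \<open>auto simp: Es\<close>)
  have eH: "?e \<in> Hom C ?X L'" using comp_Hom[OF C ad(2)[OF e0] \<iota>H[OF e0]] .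
  have fH: "f \<in> Hom C ?X ?Y" using f by (simp add: Hom_iff)
  have "\<exists>y. y \<in> Hom C (L F) ?Y \<and> y \<cdot> h F = f \<and> (\<forall>s\<in>F. y \<cdot> k F s = snd (snd s))" if F: "F \<in> P" for F
  proof -
    have "s \<in> S" if "s \<in> F" for s using F that by (auto simp: P_def)
    then have "snd (snd s) \<in> Hom C (Cod C (fst s)) ?Y" "snd (snd s) \<cdot> fst s = f \<cdot> fst (snd s)" if "s \<in> F" for s
      using Sd(3,4) that by auto
    from attaching_induced[OF a(1)[OF F] fH this] show ?thesis by metis
  qed
  then obtain y where y: "\<And>F. F \<in> P \<Longrightarrow> y F \<in> Hom C (L F) ?Y" "\<And>F. F \<in> P \<Longrightarrow> y F \<cdot> h F = f"
    "\<And>F s. F \<in> P \<Longrightarrow> s \<in> F \<Longrightarrow> y F \<cdot> k F s = snd (snd s)" by metis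
  have "cocone ?J C E ?Y y"
    unfolding cocone_def
  proof (intro conjI ballI)
    show "?Y \<in> Ob C" by (rule X(2))
    show "y F \<in> Hom C (fob E F) ?Y" if "F \<in> Ob ?J" for F using y(1) that by (simp add: Es)
    show "y (Cod ?J m) \<cdot> fmor E m = y (Dom ?J m)" if m: "m \<in> Mor ?J" for m
    proof -
      obtain F G where mm: "m = (F, G)" and P: "F \<in> P" "G \<in> P" "F \<subseteq> G" using m by (cases m) auto
      note t = tr[OF P]
      have "y G \<cdot> tr F G = y F"
      proof (rule attaching_unique[OF a(1)[OF P(1)] _ y(1)[OF P(1)]])
        show "y G \<cdot> tr F G \<in> Hom C (L F) ?Y" using comp_Hom[OF C t(1) y(1)[OF P(2)]] .
        show "(y G \<cdot> tr F G) \<cdot> h F = y F \<cdot> h F"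
          using t(1,2) y(1,2)[OF P(2)] y(2)[OF P(1)] ad(2)[OF P(1)] C by (simp add: Hom_iff)
        show "(y G \<cdot> tr F G) \<cdot> k F s = y F \<cdot> k F s" if s: "s \<in> F" for s
        proof -
          have "s \<in> G" using s P(3) by blast
          then show ?thesis
            using t(1) t(3)[OF s] y(1)[OF P(2)] y(3)[OF P(2)] y(3)[OF P(1) s] ad(3)[OF P(1) s] C by (simp add: Hom_iff)
        qed
      qed
      then show ?thesis by (simp add: mm Es)
    qed
  qed
  then obtain f' where f': "f' \<in> Hom C L' ?Y" "\<And>F. F \<in> P \<Longrightarrow> f' \<cdot> \<iota> F = y F"
    using colimit_induced[OF L'] by (metis poset_cat_simps(1))
  have fm: "f' \<in> Mor C" "Dom C f' = L'" using f'(1) by (auto simp: Hom_iff)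
  have f'e: "f' \<cdot> ?e = f"
    using comp_reassoc[OF f'(2)[OF e0] C, of "h {}"] \<iota>H[OF e0] ad(2)[OF e0] fm y(2)[OF e0] by (simp add: Hom_iff)
  have lift: "\<exists>w\<in>Hom C (Cod C j) (Dom C f'). w \<cdot> j = ?e \<cdot> u \<and> f' \<cdot> w = v"
    if j: "j \<in> J0" "u \<in> Hom C (Dom C j) ?X" "v \<in> Hom C (Cod C j) ?Y" "f \<cdot> u = v \<cdot> j" for j u v
  proof -
    let ?s = "(j, u, v)"
    \<comment> \<open>A given lifting problem is solved at the singleton stage that contains just
      its own cell.\<close>
    have sP: "{?s} \<in> P" using j by (simp add: P_def S_def)
    have sF: "?s \<in> {?s}" by simp
    note d = ad(3,4)[OF sP sF, simplified] \<iota>H[OF sP] ad(2)[OF sP] j(1,2) jm[OF j(1)] fm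
    have "(\<iota> {?s} \<cdot> k {?s} ?s) \<cdot> j = ?e \<cdot> u"
      unfolding eh[OF sP, symmetric] using d C by (simp add: Hom_iff)
    moreover have "f' \<cdot> (\<iota> {?s} \<cdot> k {?s} ?s) = v"
      using comp_reassoc[OF f'(2)[OF sP] C, of "k {?s} ?s"] d y(3)[OF sP sF] by (simp add: Hom_iff)
    moreover have "\<iota> {?s} \<cdot> k {?s} ?s \<in> Hom C (Cod C j) (Dom C f')"
      using d C by (simp add: Hom_iff)
    ultimately show ?thesis by blast
  qed
  show ?thesis
    by (rule exI[of _ ?e], rule exI[of _ f']) (use de eH fm f'e lift in auto)
qed

text \<open>Iterating countably often suffices, as the sources of the attached cells are finitely presentable.\<close>

lemma small_object_argument:
  assumes f: "f \<in> Mor C" and J0: "J0 \<subseteq> N" "small U J0"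
  obtains i p where "dense N i" "p \<in> rlp C J0" "Cod C i = Dom C p" "p \<cdot> i = f"
proof -
  \<comment> \<open>The implication inside the quantifiers makes the choice total, so that the next
    map can be iterated as a function.\<close>
  have "\<exists>e f'. f \<in> Mor C \<longrightarrow> dense N e \<and> e \<in> Hom C (Dom C f) (Dom C f') \<and> f' \<in> Mor C \<and> f' \<cdot> e = f \<and>
    (\<forall>j\<in>J0. \<forall>u\<in>Hom C (Dom C j) (Dom C f). \<forall>v\<in>Hom C (Cod C j) (Cod C f). f \<cdot> u = v \<cdot> j \<longrightarrow>
       (\<exists>w\<in>Hom C (Cod C j) (Dom C f'). w \<cdot> j = e \<cdot> u \<and> f' \<cdot> w = v))" for f
    using attach_all[OF _ J0, of f] by (cases "f \<in> Mor C") auto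
  then obtain ee nx where step: "\<And>f. f \<in> Mor C \<Longrightarrow> dense N (ee f) \<and> ee f \<in> Hom C (Dom C f) (Dom C (nx f)) \<and> nx f \<in> Mor C \<and> nx f \<cdot> ee f = f \<and>
    (\<forall>j\<in>J0. \<forall>u\<in>Hom C (Dom C j) (Dom C f). \<forall>v\<in>Hom C (Cod C j) (Cod C f). f \<cdot> u = v \<cdot> j \<longrightarrow>
       (\<exists>w\<in>Hom C (Cod C j) (Dom C (nx f)). w \<cdot> j = ee f \<cdot> u \<and> nx f \<cdot> w = v))"
    by metis
  define F where "F n = (nx ^^ n) f" for n
  define e where "e n = ee (F n)" for n
  define X where "X n = Dom C (F n)" for n
  have F0: "F 0 = f" and FS: "F (Suc n) = nx (F n)" for n by (simp_all add: F_def)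
  have Fm: "F n \<in> Mor C" for n by (induction n) (use f step in \<open>auto simp: F0 FS\<close>)
  note st = step[OF Fm, folded FS e_def X_def]
  have eH: "e n \<in> Mor C" "Dom C (e n) = X n" "Cod C (e n) = X (Suc n)" for n
    using st[of n] unfolding FS[symmetric] X_def by (auto simp: Hom_iff)
  have Fe: "F (Suc n) \<cdot> e n = F n" for n using st[of n] by simp
  have FX: "Dom C (F n) = X n" for n by (simp add: X_def)
  have FY: "Cod C (F n) = Cod C f" for n
  proof (induction n)
    case (Suc n)
    have "Cod C (F (Suc n) \<cdot> e n) = Cod C (F (Suc n))" using Fm eH FX C by simp
    then show ?case using Suc Fe by simp
  qed (simp add: F0)
  have Xo: "X n \<in> Ob C" for n using Fm C by (simp add: X_def)
  \<comment> \<open>Composite of the steps from stage \<open>m\<close> to stage \<open>n\<close>.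
    The identity is the default for \<open>n < m\<close>, which makes the recursion start at
    \<open>n = m\<close> with the identity as well.\<close>
  define ch where "ch m n = rec_nat (Idt C (X m)) (\<lambda>n c. if n < m then Idt C (X m) else e n \<cdot> c) n" for m n
  have chS: "ch m (Suc n) = (if n < m then Idt C (X m) else e n \<cdot> ch m n)" for m n by (simp add: ch_def)
  have chI: "ch n n = Idt C (X n)" for n by (cases n) (simp_all add: ch_def)
  have chH: "ch m n \<in> Mor C \<and> Dom C (ch m n) = X m \<and> Cod C (ch m n) = X n" if "m \<le> n" for m n
    using that
  proof (induction n)
    case 0 then show ?case using chI[of 0] Xo C by simp
  next
    case (Suc n)
    show ?case
    proof (cases "m = Suc n")
      case True then show ?thesis using chI[of "Suc n"] Xo C by simp
    next
      case False
      then show ?thesis using Suc eH C by (simp add: chS)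
    qed
  qed
  have ch_comp: "ch n q \<cdot> ch m n = ch m q" if "m \<le> n" "n \<le> q" for m n q
    using that(2)
  proof (induction q)
    case 0 then show ?case using chI[of 0] chH[of m 0] that C by simp
  next
    case (Suc q)
    show ?case
    proof (cases "n = Suc q")
      case True then show ?thesis using chI[of n] chH[OF that(1)] C by simp
    next
      case False
      then have nq: "n \<le> q" using Suc.prems by simp
      then show ?thesis using Suc.IH eH chH[OF that(1)] chH[OF nq] that(1) C by (simp add: chS)
    qed
  qed
  let ?J = "poset_cat (UNIV :: nat set) (\<le>)"
  have cJ: "category ?J" by (rule category_poset) auto
  have fJ: "filtered ?J"
    by (rule filtered_poset) (auto intro: max.cobounded1 max.cobounded2)
  have "small U (UNIV :: nat set)" by (rule small_nat)
  then have sJ: "small_index U ?J"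
    unfolding small_index_def using fJ small_mono[OF small_Times, of UNIV UNIV "Mor ?J"] by auto
  define E where "E = \<lparr>fob = X, fmor = (\<lambda>(m, n). ch m n)\<rparr>"
  have Es: "fob E = X" "fmor E (m, n) = ch m n" for m n by (simp_all add: E_def)
  have E: "is_functor ?J C E"
    unfolding is_functor_def
  proof (intro conjI ballI impI cJ C)
    show "fob E n \<in> Ob C" for n by (simp add: Es Xo)
    show "fmor E m \<in> Hom C (fob E (Dom ?J m)) (fob E (Cod ?J m))" if "m \<in> Mor ?J" for m
      using chH that by (cases m) (simp add: Es Hom_iff)
    show "fmor E (Idt ?J n) = Idt C (fob E n)" for n by (simp add: Es chI)
    show "fmor E (n \<cdot>\<^bsub>?J\<^esub> m) = fmor E n \<cdot> fmor E m" if "m \<in> Mor ?J" "n \<in> Mor ?J" "Cod ?J m = Dom ?J n" for m n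
      using that ch_comp by (cases m; cases n) (simp add: Es)
  qed
  obtain L \<iota> where L: "is_colimit ?J C E L \<iota>" using filtered_colimit[OF filtered_colims E sJ] by blast
  note lf = cocone_facts[OF colimit_cocone[OF L]] and lc = cocone_comm[OF colimit_cocone[OF L]]
  have \<iota>H: "\<iota> n \<in> Mor C" "Dom C (\<iota> n) = X n" "Cod C (\<iota> n) = L" for n using lf by (simp_all add: Es)
  have \<iota>ch: "\<iota> n \<cdot> ch m n = \<iota> m" if "m \<le> n" for m n using lc[of "(m, n)"] that by (simp add: Es)
  have "cocone ?J C E (Cod C f) F"
    unfolding cocone_def
  proof (intro conjI ballI)
    show "Cod C f \<in> Ob C" using f C by simp
    show "F n \<in> Hom C (fob E n) (Cod C f)" for n using Fm FX FY by (simp add: Es Hom_iff)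
    have "F n \<cdot> ch m n = F m" if "m \<le> n" for m n
      using that
    proof (induction n)
      case 0 then show ?case using chI[of 0] Fm FX C by simp
    next
      case (Suc n)
      show ?case
      proof (cases "m = Suc n")
        case True then show ?thesis using chI[of "Suc n"] Fm FX C by simp
      next
        case False
        then show ?thesis using Suc comp_reassoc[OF Fe[of n] C, of "ch m n"] eH chH[of m n] Fm FX by (simp add: chS)
      qed
    qed
    then show "F (Cod ?J m) \<cdot> fmor E m = F (Dom ?J m)" if "m \<in> Mor ?J" for m
      using that by (cases m) (simp add: Es)
  qed
  then obtain p where p: "p \<in> Hom C L (Cod C f)" "\<And>n. p \<cdot> \<iota> n = F n"
    using colimit_induced[OF L] by (metis UNIV_I poset_cat_simps(1))
  have pm: "p \<in> Mor C" "Dom C p = L" "Cod C p = Cod C f" using p(1) by (auto simp: Hom_iff)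
  have dch: "dense N (ch 0 n)" for n
  proof (induction n)
    case 0 then show ?case using chI[of 0] dense_idt[OF Xo] by simp
  next
    case (Suc n)
    have "dense N (e n)" using st[of n] by simp
    from dense_comp[OF Suc this] show ?case using chH[of 0 n] eH by (simp add: chS)
  qed
  have "dense N (\<iota> 0 \<cdot> ch 0 0)"
  proof (rule dense_under_colimit[OF sJ E L Xo[of 0], where h = "ch 0" and j = 0])
    show "ch 0 n \<in> Hom C (X 0) (fob E n)" for n using chH[of 0 n] by (simp add: Es Hom_iff)
    show "dense N (ch 0 n)" for n by (rule dch)
    show "fmor E u \<cdot> ch 0 (Dom ?J u) = ch 0 (Cod ?J u)" if "u \<in> Mor ?J" for u
      using that ch_comp[of 0] by (cases u) (simp add: Es)
  qed simp
  then have di: "dense N (\<iota> 0)" using chI[of 0] \<iota>H C by simp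
  have "has_lift C j p" if j: "j \<in> J0" for j
    unfolding has_lift_def
  proof (intro ballI impI)
    fix u v assume u: "u \<in> Hom C (Dom C j) (Dom C p)" and v: "v \<in> Hom C (Cod C j) (Cod C p)" and eq: "p \<cdot> u = v \<cdot> j"
    have jN: "j \<in> Mor C" "fp (Dom C j)" using N_M J0(1) j by auto
    have uL: "u \<in> Hom C (Dom C j) L" using u pm by simp
    \<comment> \<open>The lifting problem now lives at stage \<open>n\<close>, and stage
      \<open>Suc n\<close> was built to solve it.\<close>
    obtain n g where g: "g \<in> Hom C (Dom C j) (X n)" "\<iota> n \<cdot> g = u"
      using finitely_presentable_factor[OF jN(2) sJ E L uL] by (metis Es(1))
    have "F n \<cdot> g = v \<cdot> j"
      using comp_reassoc[OF p(2)[of n] C, of g] g \<iota>H pm eq by (simp add: Hom_iff)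
    moreover have "v \<in> Hom C (Cod C j) (Cod C (F n))" "g \<in> Hom C (Dom C j) (Dom C (F n))" using v FY FX pm g by simp_all
    ultimately obtain w where w: "w \<in> Hom C (Cod C j) (X (Suc n))" "w \<cdot> j = e n \<cdot> g" "F (Suc n) \<cdot> w = v"
      using st[of n] j by (metis FX)
    have ie: "\<iota> (Suc n) \<cdot> e n = \<iota> n"
      using \<iota>ch[of n "Suc n"] eH[of n] chI[of n] C by (simp add: chS)
    have "(\<iota> (Suc n) \<cdot> w) \<cdot> j = u"
      using w(1,2) g jN eH \<iota>H comp_reassoc[OF ie C, of g] C by (simp add: Hom_iff)
    moreover have "p \<cdot> (\<iota> (Suc n) \<cdot> w) = v"
      using comp_reassoc[OF p(2)[of "Suc n"] C, of w] w(1,3) \<iota>H pm by (simp add: Hom_iff)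
    moreover have "\<iota> (Suc n) \<cdot> w \<in> Hom C (Cod C j) (Dom C p)" using w(1) \<iota>H pm C by (simp add: Hom_iff)
    ultimately show "\<exists>h\<in>Hom C (Cod C j) (Dom C p). h \<cdot> j = u \<and> p \<cdot> h = v" by blast
  qed
  then have "p \<in> rlp C J0" using pm by (simp add: rlp_def)
  then show thesis using that[OF di] \<iota>H pm p(2)[of 0] F0 by simp
qed

end

section \<open>Lifting properties\<close>

lemma has_liftE:
  fixes C (structure)
  assumes "has_lift C i p" "u \<in> Hom C (Dom C i) (Dom C p)" "v \<in> Hom C (Cod C i) (Cod C p)" "p \<cdot> u = v \<cdot> i"
  obtains h where "h \<in> Hom C (Cod C i) (Dom C p)" "h \<cdot> i = u" "p \<cdot> h = v"
  using assms unfolding has_lift_def by blast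

lemma rlp_antimono: "I \<subseteq> J \<Longrightarrow> rlp C J \<subseteq> rlp C I"
  unfolding rlp_def by blast

lemma rlp_llp_rlp:
  assumes "I \<subseteq> Mor C"
  shows "rlp C (llp C (rlp C I)) = rlp C I" "I \<subseteq> llp C (rlp C I)"
proof -
  show "I \<subseteq> llp C (rlp C I)" using assms unfolding llp_def rlp_def by blast
  then show "rlp C (llp C (rlp C I)) = rlp C I"
    using rlp_antimono[of I "llp C (rlp C I)" C] unfolding llp_def rlp_def by blast
qed

text \<open>The retract argument with fixed target: a lift of \<open>\<alpha>\<close> against
  \<open>p\<close> is a retraction of \<open>\<alpha>\<close> over that target.\<close>

lemma retract_of_right:
  fixes C (structure)
  assumes C: "category C" and a: "\<alpha> \<in> Mor C" "\<beta> \<in> Mor C" "Cod C \<alpha> = Dom C \<beta>" "\<beta> \<cdot> \<alpha> = p" and l: "has_lift C \<alpha> p"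
  shows "is_retract (arrow_cat C) p \<beta>"
proof -
  have pm: "p \<in> Mor C" "Dom C p = Dom C \<alpha>" "Cod C p = Cod C \<beta>" using a C by auto
  have o: "Dom C \<alpha> \<in> Ob C" "Cod C \<beta> \<in> Ob C" using a C by auto
  have "Idt C (Dom C p) \<in> Hom C (Dom C \<alpha>) (Dom C p)" "\<beta> \<in> Hom C (Cod C \<alpha>) (Cod C p)"
    "p \<cdot> Idt C (Dom C p) = \<beta> \<cdot> \<alpha>"
    using pm a(1-3) o C by (simp_all add: Hom_iff) (simp_all add: a(4) pm)
  then obtain h where h: "h \<in> Hom C (Cod C \<alpha>) (Dom C p)" "h \<cdot> \<alpha> = Idt C (Dom C p)" "p \<cdot> h = \<beta>"
    using has_liftE[OF l] by metis
  have "(p, \<beta>, \<alpha>, Idt C (Cod C p)) \<in> Hom (arrow_cat C) p \<beta>" "(\<beta>, p, h, Idt C (Cod C p)) \<in> Hom (arrow_cat C) \<beta> p"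
    unfolding Hom_arrow_iff using a pm h o C by (simp_all add: Hom_iff)
  moreover have "(\<beta>, p, h, Idt C (Cod C p)) \<cdot>\<^bsub>arrow_cat C\<^esub> (p, \<beta>, \<alpha>, Idt C (Cod C p)) = Idt (arrow_cat C) p"
    unfolding arrow_cat_simps using h(2) pm o C by simp
  ultimately show ?thesis unfolding is_retract_def by blast
qed

text \<open>The dual retract argument, with fixed source: the lift is a section of
  \<open>\<beta>\<close> under that source.\<close>

lemma retract_of_left:
  fixes C (structure)
  assumes C: "category C" and a: "\<alpha> \<in> Mor C" "\<beta> \<in> Mor C" "Cod C \<alpha> = Dom C \<beta>" "\<beta> \<cdot> \<alpha> = i" and l: "has_lift C i \<beta>"
  shows "is_retract (arrow_cat C) i \<alpha>"
proof -
  have im: "i \<in> Mor C" "Dom C i = Dom C \<alpha>" "Cod C i = Cod C \<beta>" using a C by auto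
  have o: "Dom C \<alpha> \<in> Ob C" "Cod C \<beta> \<in> Ob C" using a C by auto
  have "\<alpha> \<in> Hom C (Dom C i) (Dom C \<beta>)" "Idt C (Cod C i) \<in> Hom C (Cod C i) (Cod C \<beta>)"
    "\<beta> \<cdot> \<alpha> = Idt C (Cod C i) \<cdot> i"
    using im a(1-3) o C by (simp_all add: Hom_iff) (simp_all add: a(4) im)
  then obtain h where h: "h \<in> Hom C (Cod C i) (Dom C \<beta>)" "h \<cdot> i = \<alpha>" "\<beta> \<cdot> h = Idt C (Cod C i)"
    using has_liftE[OF l] by metis
  have "(i, \<alpha>, Idt C (Dom C i), h) \<in> Hom (arrow_cat C) i \<alpha>" "(\<alpha>, i, Idt C (Dom C i), \<beta>) \<in> Hom (arrow_cat C) \<alpha> i"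
    unfolding Hom_arrow_iff using a im h o C by (simp_all add: Hom_iff)
  moreover have "(\<alpha>, i, Idt C (Dom C i), \<beta>) \<cdot>\<^bsub>arrow_cat C\<^esub> (i, \<alpha>, Idt C (Dom C i), h) = Idt (arrow_cat C) i"
    unfolding arrow_cat_simps using h(3) im o C by simp
  ultimately show ?thesis unfolding is_retract_def by blast
qed

text \<open>Through this, closure under retracts puts the isomorphisms into every class of a model
  structure, since identities belong to each.\<close>

lemma iso_retract_idt:
  assumes C: "category C" and f: "is_iso C f"
  shows "is_retract (arrow_cat C) f (Idt C (Dom C f))"
proof -
  obtain g where g: "f \<in> Mor C" "g \<in> Hom C (Cod C f) (Dom C f)" "g \<cdot>\<^bsub>C\<^esub> f = Idt C (Dom C f)" "f \<cdot>\<^bsub>C\<^esub> g = Idt C (Cod C f)"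
    using f by (rule is_isoE)
  let ?i = "Idt C (Dom C f)"
  have o: "Dom C f \<in> Ob C" using g(1) C by simp
  have "(f, ?i, ?i, g) \<in> Hom (arrow_cat C) f ?i" "(?i, f, ?i, f) \<in> Hom (arrow_cat C) ?i f"
    unfolding Hom_arrow_iff using g o C by (simp_all add: Hom_iff)
  moreover have "(?i, f, ?i, f) \<cdot>\<^bsub>arrow_cat C\<^esub> (f, ?i, ?i, g) = Idt (arrow_cat C) f"
    unfolding arrow_cat_simps using g(4) o C by simp
  ultimately show ?thesis unfolding is_retract_def by blast
qed

text \<open>The lift is induced on the pushout by a lift for \<open>f\<close> and the given upper
  side.\<close>

lemma llp_pushout:
  fixes C (structure)
  assumes C: "category C" and p: "is_pushout C f g h k" and f: "f \<in> llp C S" and S: "S \<subseteq> Mor C"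
  shows "k \<in> llp C S"
proof -
  note pf = pushout_facts(1,2,4-9)[OF p]
  have "has_lift C k q" if q: "q \<in> S" for q
    unfolding has_lift_def
  proof (intro ballI impI)
    fix u v assume u: "u \<in> Hom C (Dom C k) (Dom C q)" and v: "v \<in> Hom C (Cod C k) (Cod C q)" and eq: "q \<cdot> u = v \<cdot> k"
    have qm: "q \<in> Mor C" using q S by blast
    have dg: "Dom C f = Dom C g" using pushout_facts(3)[OF p] .
    have ug: "u \<cdot> g \<in> Hom C (Dom C f) (Dom C q)" using u pf dg C by (simp add: Hom_iff)
    have vh: "v \<cdot> h \<in> Hom C (Cod C f) (Cod C q)" using v pf C by (simp add: Hom_iff)
    have "q \<cdot> (u \<cdot> g) = (v \<cdot> h) \<cdot> f"
      using comp_reassoc[OF eq C, of g] u v pf qm C by (simp add: Hom_iff)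
    then obtain l where l: "l \<in> Hom C (Cod C f) (Dom C q)" "l \<cdot> f = u \<cdot> g" "q \<cdot> l = v \<cdot> h"
      using has_liftE[of C f q, OF _ ug vh] f q unfolding llp_def by blast
    have u': "u \<in> Hom C (Cod C g) (Dom C q)" using u pf by simp
    obtain w where w: "w \<in> Hom C (Cod C h) (Dom C q)" "w \<cdot> h = l" "w \<cdot> k = u"
      using pushout_induced[OF C p l(1) u' l(2)] by metis
    have "q \<cdot> w = v"
      by (rule pushout_unique[OF C p, of _ "Cod C q"]) (use w v l eq pf qm C in \<open>simp_all add: Hom_iff\<close>)
    then show "\<exists>h\<in>Hom C (Cod C k) (Dom C q). h \<cdot> k = u \<and> q \<cdot> h = v"
      using w pf by auto
  qed
  then show ?thesis using pf by (simp add: llp_def)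
qed

section \<open>Model categories generated by finitely presentable objects\<close>

locale omega_model = lfp_category U C for U :: "'u itself" and C :: "('o, 'm) cat" (structure) +
  fixes W Fib Cof :: "'m set" and dbl cyl :: "'o \<Rightarrow> 'o" and k0 k1 ci cp :: "'o \<Rightarrow> 'm"
  assumes model: "model_category U C W Fib Cof"
    and gen_cof: "fp_generated U C Cof" and gen_tcof: "fp_generated U C (Cof \<inter> W)"
    and proper: "left_proper C W Cof"
    and cylinder: "is_cylinder (fp_subcat U C) (W \<inter> Mor (fp_subcat U C)) (Cof \<inter> Mor (fp_subcat U C)) dbl k0 k1 cyl ci cp"
    and cofib: "\<And>A. finitely_presentable U C A \<Longrightarrow> cofibrant C Cof A"
begin

lemma wide: "W \<subseteq> Mor C" "Fib \<subseteq> Mor C" "Cof \<subseteq> Mor C"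
  using model by (auto simp: model_category_def wide_subcat_def)

lemma idt_in: "A \<in> Ob C \<Longrightarrow> Idt C A \<in> W \<inter> Fib \<inter> Cof"
  using model by (auto simp: model_category_def wide_subcat_def)

lemma comp_in:
  "f \<in> W \<Longrightarrow> g \<in> W \<Longrightarrow> Cod C f = Dom C g \<Longrightarrow> g \<cdot> f \<in> W"
  "f \<in> Cof \<Longrightarrow> g \<in> Cof \<Longrightarrow> Cod C f = Dom C g \<Longrightarrow> g \<cdot> f \<in> Cof"
  using model by (auto simp: model_category_def wide_subcat_def)

lemma two_of_three: "two_out_of_three C W"
  using model by (simp add: model_category_def)

lemma W_cancel:
  assumes "f \<in> Mor C" "g \<in> Mor C" "Cod C f = Dom C g" "g \<cdot> f \<in> W"
  shows "f \<in> W \<Longrightarrow> g \<in> W" "g \<in> W \<Longrightarrow> f \<in> W"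
  using two_of_three assms unfolding two_out_of_three_def by blast+

lemma retracts:
  "is_retract D f g \<Longrightarrow> g \<in> W \<Longrightarrow> f \<in> Mor C \<Longrightarrow> f \<in> W"
  "is_retract D f g \<Longrightarrow> g \<in> Fib \<Longrightarrow> f \<in> Mor C \<Longrightarrow> f \<in> Fib"
  "is_retract D f g \<Longrightarrow> g \<in> Cof \<Longrightarrow> f \<in> Mor C \<Longrightarrow> f \<in> Cof"
  using model unfolding model_category_def closed_under_retracts_def by blast+

lemma lift1: "i \<in> Cof \<Longrightarrow> i \<in> W \<Longrightarrow> p \<in> Fib \<Longrightarrow> has_lift C i p"
  using model unfolding model_category_def by blast

lemma lift2: "i \<in> Cof \<Longrightarrow> p \<in> Fib \<Longrightarrow> p \<in> W \<Longrightarrow> has_lift C i p"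
  using model unfolding model_category_def by blast

lemma functorial_factorizationD:
  assumes "has_functorial_factorization C L R" "f \<in> Mor C"
  obtains \<alpha> \<beta> where "\<alpha> \<in> L" "\<beta> \<in> R" "\<alpha> \<in> Mor C" "\<beta> \<in> Mor C" "Dom C \<alpha> = Dom C f" "Cod C \<beta> = Cod C f" "Cod C \<alpha> = Dom C \<beta>" "\<beta> \<cdot> \<alpha> = f"
proof -
  obtain E \<alpha> \<beta> where e: "nat_trans D C (dom_fctr C) E \<alpha>" "nat_trans D C E (cod_fctr C) \<beta>"
    "\<forall>f \<in> Mor C. \<alpha> f \<in> L \<and> \<beta> f \<in> R \<and> \<beta> f \<cdot> \<alpha> f = f"
    using assms(1) unfolding has_functorial_factorization_def by blast
  have "f \<in> Ob D" using assms(2) by (simp add: arrow_cat_simps)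
  then have "\<alpha> f \<in> Hom C (Dom C f) (fob E f)" "\<beta> f \<in> Hom C (fob E f) (Cod C f)"
    using e(1,2) unfolding nat_trans_def by auto
  then show thesis using that[of "\<alpha> f" "\<beta> f"] e(3) assms(2) by (auto simp: Hom_iff)
qed

lemma factor1:
  assumes "f \<in> Mor C"
  obtains i p where "i \<in> Cof" "p \<in> Fib" "p \<in> W" "i \<in> Mor C" "p \<in> Mor C" "Dom C i = Dom C f" "Cod C p = Cod C f" "Cod C i = Dom C p" "p \<cdot> i = f"
proof -
  have "has_functorial_factorization C Cof (Fib \<inter> W)" using model by (simp add: model_category_def)
  from functorial_factorizationD[OF this assms] show thesis using that by (metis IntE)
qed

lemma factor2:
  assumes "f \<in> Mor C"
  obtains i p where "i \<in> Cof" "i \<in> W" "p \<in> Fib" "i \<in> Mor C" "p \<in> Mor C" "Dom C i = Dom C f" "Cod C p = Cod C f" "Cod C i = Dom C p" "p \<cdot> i = f"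
proof -
  have "has_functorial_factorization C (Cof \<inter> W) Fib" using model by (simp add: model_category_def)
  from functorial_factorizationD[OF this assms] show thesis using that by (metis IntE)
qed

text \<open>Lifting and factorization determine each class of a weak factorization system from the
  other, by the retract argument. This and the next three lemmas turn the axioms into such
  characterizations.\<close>

lemma rlp_Cof: "rlp C Cof = Fib \<inter> W"
proof
  show "Fib \<inter> W \<subseteq> rlp C Cof" using lift2 wide unfolding rlp_def by blast
  show "rlp C Cof \<subseteq> Fib \<inter> W"
  proof
    fix p assume p: "p \<in> rlp C Cof"
    then have pm: "p \<in> Mor C" by (simp add: rlp_def)
    obtain \<alpha> \<beta> where a: "\<alpha> \<in> Cof" "\<beta> \<in> Fib" "\<beta> \<in> W" "\<alpha> \<in> Mor C" "\<beta> \<in> Mor C" "Cod C \<alpha> = Dom C \<beta>" "\<beta> \<cdot> \<alpha> = p"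
      using factor1[OF pm] by metis
    have "has_lift C \<alpha> p" using p a(1) by (simp add: rlp_def)
    from retract_of_right[OF C a(4-7) this] show "p \<in> Fib \<inter> W" using retracts a pm by blast
  qed
qed

lemma rlp_tcof: "rlp C (Cof \<inter> W) = Fib"
proof
  show "Fib \<subseteq> rlp C (Cof \<inter> W)" using lift1 wide unfolding rlp_def by blast
  show "rlp C (Cof \<inter> W) \<subseteq> Fib"
  proof
    fix p assume p: "p \<in> rlp C (Cof \<inter> W)"
    then have pm: "p \<in> Mor C" by (simp add: rlp_def)
    obtain \<alpha> \<beta> where a: "\<alpha> \<in> Cof" "\<alpha> \<in> W" "\<beta> \<in> Fib" "\<alpha> \<in> Mor C" "\<beta> \<in> Mor C" "Cod C \<alpha> = Dom C \<beta>" "\<beta> \<cdot> \<alpha> = p"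
      using factor2[OF pm] by metis
    have "has_lift C \<alpha> p" using p a(1,2) by (simp add: rlp_def)
    from retract_of_right[OF C a(4-7) this] show "p \<in> Fib" using retracts a pm by blast
  qed
qed

lemma llp_tfib: "llp C (Fib \<inter> W) = Cof"
proof
  show "Cof \<subseteq> llp C (Fib \<inter> W)" using lift2 wide unfolding llp_def by blast
  show "llp C (Fib \<inter> W) \<subseteq> Cof"
  proof
    fix i assume i: "i \<in> llp C (Fib \<inter> W)"
    then have im: "i \<in> Mor C" by (simp add: llp_def)
    obtain \<alpha> \<beta> where a: "\<alpha> \<in> Cof" "\<beta> \<in> Fib" "\<beta> \<in> W" "\<alpha> \<in> Mor C" "\<beta> \<in> Mor C" "Cod C \<alpha> = Dom C \<beta>" "\<beta> \<cdot> \<alpha> = i"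
      using factor1[OF im] by metis
    have "has_lift C i \<beta>" using i a(2,3) by (simp add: llp_def)
    from retract_of_left[OF C a(4-7) this] show "i \<in> Cof" using retracts a im by blast
  qed
qed

lemma llp_fib: "llp C Fib = Cof \<inter> W"
proof
  show "Cof \<inter> W \<subseteq> llp C Fib" using lift1 wide unfolding llp_def by blast
  show "llp C Fib \<subseteq> Cof \<inter> W"
  proof
    fix i assume i: "i \<in> llp C Fib"
    then have im: "i \<in> Mor C" by (simp add: llp_def)
    obtain \<alpha> \<beta> where a: "\<alpha> \<in> Cof" "\<alpha> \<in> W" "\<beta> \<in> Fib" "\<alpha> \<in> Mor C" "\<beta> \<in> Mor C" "Cod C \<alpha> = Dom C \<beta>" "\<beta> \<cdot> \<alpha> = i"
      using factor2[OF im] by metis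
    have "has_lift C i \<beta>" using i a(3) by (simp add: llp_def)
    from retract_of_left[OF C a(4-7) this] show "i \<in> Cof \<inter> W" using retracts a im by blast
  qed
qed

lemma Cof_pushout: "is_pushout C f g h k \<Longrightarrow> f \<in> Cof \<Longrightarrow> k \<in> Cof"
  using llp_pushout[OF C, of f g h k "Fib \<inter> W"] wide llp_tfib by blast

lemma tcof_pushout: "is_pushout C f g h k \<Longrightarrow> f \<in> Cof \<inter> W \<Longrightarrow> k \<in> Cof \<inter> W"
  using llp_pushout[OF C, of f g h k Fib] wide llp_fib by blast

text \<open>Passing from \<open>I\<close> to \<open>llp\<close> of \<open>rlp\<close> does not
  change the right lifting class, so lifting against all of \<open>N\<close> can be tested on a
  small set of maps of \<open>M\<close>.\<close>

lemma generating:
  assumes "fp_generated U C N"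
  obtains I where "I \<subseteq> N" "I \<subseteq> Mor M" "small U I" "rlp C I = rlp C N"
proof -
  obtain I where I: "I \<subseteq> Mor C" "small U I" "\<forall>i\<in>I. fp (Dom C i) \<and> fp (Cod C i)" "N = llp C (rlp C I)"
    using assms unfolding fp_generated_def by blast
  show thesis
    by (rule that[of I]) (use I rlp_llp_rlp[OF I(1)] in \<open>auto simp: M_simps\<close>)
qed

lemma iso_in:
  assumes "is_iso C f"
  shows "f \<in> W" "f \<in> Cof"
proof -
  have f: "f \<in> Mor C" "Idt C (Dom C f) \<in> W \<inter> Fib \<inter> Cof" using assms idt_in C by (auto simp: is_iso_def)
  then show "f \<in> W" "f \<in> Cof" using retracts iso_retract_idt[OF C assms] by blast+
qed

text \<open>Cobase change along maps of \<open>M\<close> does not leave \<open>M\<close>, because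
  pushouts of finitely presentable objects are finitely presentable; the other closure properties
  come from the model structure.\<close>

sublocale cell_class U C "Cof \<inter> W \<inter> Mor (fp_subcat U C)"
proof unfold_locales
  show "Cof \<inter> W \<inter> Mor M \<subseteq> Mor M" by blast
  show "k \<in> Cof \<inter> W \<inter> Mor M" if "is_pushout C f g h k" "f \<in> Cof \<inter> W \<inter> Mor M" "g \<in> Mor M" for f g h k
    using tcof_pushout[OF that(1)] that pushout_fp[OF that(1)] pushout_facts[OF that(1)] by (simp add: M_simps)
  show "g \<cdot> f \<in> Cof \<inter> W \<inter> Mor M" if "f \<in> Cof \<inter> W \<inter> Mor M" "g \<in> Cof \<inter> W \<inter> Mor M" "Cod C f = Dom C g" for f g
    using comp_in that C by (simp add: M_simps)
  show "Idt C A \<in> Cof \<inter> W \<inter> Mor M" if "fp A" for A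
    using idt_in fp_ob[OF that] that C by (simp add: M_simps)
qed

abbreviation "TM \<equiv> Cof \<inter> W \<inter> Mor M"

text \<open>The small object argument writes \<open>i\<close> as a dense map followed by a
  fibration. A lift of \<open>i\<close> against that fibration exhibits \<open>i\<close> as a
  retract of the dense map.\<close>

lemma dense_tcof:
  assumes i: "i \<in> Cof \<inter> W"
  shows "dense TM i"
proof -
  have im: "i \<in> Mor C" using i wide by blast
  obtain J where J: "J \<subseteq> Cof \<inter> W" "J \<subseteq> Mor M" "small U J" "rlp C J = rlp C (Cof \<inter> W)"
    using generating[OF gen_tcof] by blast
  obtain i' p where p: "dense TM i'" "p \<in> rlp C J" "Cod C i' = Dom C p" "p \<cdot> i' = i"
    using small_object_argument[OF im, of J] J by blast
  have "p \<in> Fib" using p(2) J(4) rlp_tcof by simp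
  then have "has_lift C i p" using lift1 i by blast
  moreover have "p \<in> Mor C" using \<open>p \<in> Fib\<close> wide by blast
  ultimately have "is_retract D i i'"
    using retract_of_left[OF C dense_mor[OF p(1)] _ p(3,4)] by blast
  then show ?thesis by (rule factors_through_retract[OF D p(1)])
qed

lemma initial_Hom:
  assumes "is_initial C z" "A \<in> Ob C"
  obtains t where "t \<in> Hom C z A" "\<And>t'. t' \<in> Hom C z A \<Longrightarrow> t' = t"
  using assms unfolding is_initial_def by blast

text \<open>Mapping cylinder: push \<open>f\<close> out along the inclusion of one end of the cylinder.\<close>

lemma factor_M:
  assumes f: "f \<in> Mor M"
  obtains c q where "c \<in> Cof" "q \<in> W" "c \<in> Mor M" "q \<in> Mor M" "Dom C c = Dom C f" "Cod C q = Cod C f" "Cod C c = Dom C q" "q \<cdot> c = f"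
proof -
  let ?A = "Dom C f" and ?B = "Cod C f"
  have fM: "f \<in> Mor C" "fp ?A" "fp ?B" using f by (auto simp: M_simps)
  have Ao: "?A \<in> Ob C" "?B \<in> Ob C" using fM C by auto
  let ?ci = "ci ?A" and ?p = "cp ?A" and ?k0 = "k0 ?A" and ?k1 = "k1 ?A" and ?s = "dbl ?A" and ?I = "cyl ?A"
  have "?A \<in> Ob M" using fM(2) by (simp add: M_simps)
  note cyl' = bspec[OF cylinder[unfolded is_cylinder_def] this]
  have cyl: "is_coproduct M ?A ?A ?s ?k0 ?k1" "?ci \<in> Hom M ?s ?I" "?ci \<in> Cof" "?p \<in> Hom M ?I ?A" "?p \<in> W"
    "is_fold_map M ?A ?s ?k0 ?k1 (?p \<cdot>\<^bsub>M\<^esub> ?ci)"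
    using cyl' by simp_all
  have iH: "?ci \<in> Mor C" "Dom C ?ci = ?s" "Cod C ?ci = ?I" and pH: "?p \<in> Mor C" "Dom C ?p = ?I" "Cod C ?p = ?A"
    and fps: "fp ?s" "fp ?I"
    using cyl(2,4) unfolding Hom_M by (auto simp: Hom_iff)
  have kH: "?k0 \<in> Mor C" "Dom C ?k0 = ?A" "Cod C ?k0 = ?s" "?k1 \<in> Mor C" "Dom C ?k1 = ?A" "Cod C ?k1 = ?s"
    using cyl(1) unfolding is_coproduct_def Hom_M by (auto simp: Hom_iff)
  have fold: "(?p \<cdot> ?ci) \<cdot> ?k0 = Idt C ?A" "(?p \<cdot> ?ci) \<cdot> ?k1 = Idt C ?A"
    using cyl(6) unfolding is_fold_map_def M_simps by auto
  obtain z where z: "is_initial C z" "fp z" by (rule initial_ex)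
  obtain t where t: "t \<in> Hom C z ?A" by (rule initial_Hom[OF z(1) Ao(1)])
  have tH: "t \<in> Mor C" "Dom C t = z" "Cod C t = ?A" using t by (auto simp: Hom_iff)
  have zuniq: "x = y" if "x \<in> Hom C z B" "y \<in> Hom C z B" for x y B
    using initial_Hom[OF z(1), of B] Hom_ob[OF C that(1)] that by metis
  have tCof: "t \<in> Cof" using cofib[OF fM(2)] z(1) t unfolding cofibrant_def by blast
  \<comment> \<open>The double of the source is a pushout over the initial object. Seen this way,
    cofibrancy makes \<open>?k0\<close> a cofibration, and the coproduct, given only in
    \<open>M\<close>, is transferred to \<open>C\<close>.\<close>
  have "is_pushout M t t ?k0 ?k1"
    unfolding is_pushout_def
  proof (intro conjI ballI impI)
    show "?k0 \<cdot>\<^bsub>M\<^esub> t = ?k1 \<cdot>\<^bsub>M\<^esub> t"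
      unfolding M_simps using zuniq[of "?k0 \<cdot> t" ?s "?k1 \<cdot> t"] tH kH C by (simp add: Hom_iff)
    fix Q h' k' assume Q: "Q \<in> Ob M" "h' \<in> Hom M (Cod M t) Q" "k' \<in> Hom M (Cod M t) Q"
    have e: "Cod M t = ?A" "Cod M ?k0 = ?s" unfolding M_simps using tH kH by auto
    show "\<exists>!w. w \<in> Hom M (Cod M ?k0) Q \<and> w \<cdot>\<^bsub>M\<^esub> ?k0 = h' \<and> w \<cdot>\<^bsub>M\<^esub> ?k1 = k'"
      using cyl(1) Q unfolding is_coproduct_def e by blast
  qed (use tH kH z fM fps in \<open>auto simp: M_simps Hom_M Hom_iff\<close>)
  then have po: "is_pushout C t t ?k0 ?k1" by (rule pushout_M)
  have kCof: "?k0 \<in> Cof" using Cof_pushout[OF pushout_swap[OF po] tCof] .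
  let ?i0 = "?ci \<cdot> ?k0" and ?i1 = "?ci \<cdot> ?k1"
  have i0H: "?i0 \<in> Mor C" "Dom C ?i0 = ?A" "Cod C ?i0 = ?I" "?i1 \<in> Mor C" "Dom C ?i1 = ?A" "Cod C ?i1 = ?I"
    using iH kH C by auto
  have pi: "?p \<cdot> ?i0 = Idt C ?A" "?p \<cdot> ?i1 = Idt C ?A" using fold iH kH pH C by auto
  have i0: "?i0 \<in> Cof \<inter> W"
    using comp_in(2)[OF kCof cyl(3)] W_cancel(2)[of ?i0 ?p] i0H pH pi idt_in[OF Ao(1)] kH iH cyl(5) by simp
  \<comment> \<open>\<open>?i0\<close> is a trivial cofibration: \<open>?p\<close> is a weak
    equivalence and \<open>?p \<cdot> ?i0\<close> is an identity. So is its cobase change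
    \<open>h\<close>, and as \<open>q \<cdot> h\<close> will be an identity, the collapse
    \<open>q\<close> is a weak equivalence.\<close>
  obtain k h where po': "is_pushout C ?i0 f k h" "fp (Cod C k)"
    using pushout_ex[of ?i0 f] i0H fM fps by metis
  note pf = pushout_facts(4-9)[OF po'(1)]
  have kh: "k \<in> Mor C" "Dom C k = ?I" "h \<in> Mor C" "Dom C h = ?B" "Cod C h = Cod C k" "k \<cdot> ?i0 = h \<cdot> f"
    using pf i0H by auto
  let ?Y = "Cod C k"
  have hT: "h \<in> Cof \<inter> W" using tcof_pushout[OF po'(1) i0] .
  have "f \<cdot> ?p \<in> Hom C (Cod C ?i0) ?B" "Idt C ?B \<in> Hom C (Cod C f) ?B" "(f \<cdot> ?p) \<cdot> ?i0 = Idt C ?B \<cdot> f"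
    using fM(1) pH pi i0H Ao C by (simp_all add: Hom_iff del: comp_assoc) (simp add: comp_assoc[OF C] i0H)
  then obtain q where q: "q \<in> Hom C ?Y ?B" "q \<cdot> k = f \<cdot> ?p" "q \<cdot> h = Idt C ?B"
    using pushout_induced[OF C po'(1)] by metis
  have qH: "q \<in> Mor C" "Dom C q = ?Y" "Cod C q = ?B" using q(1) by (auto simp: Hom_iff)
  have qW: "q \<in> W" using W_cancel(1)[of h q] kh qH q(3) hT idt_in[OF Ao(2)] by simp
  let ?c = "k \<cdot> ?i1"
  have cH: "?c \<in> Mor C" "Dom C ?c = ?A" "Cod C ?c = ?Y" using kh i0H C by simp_all
  have qc: "q \<cdot> ?c = f"
    using comp_reassoc[OF q(2) C, of ?i1] kh(1,2) i0H qH pi fM pH C by simp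
  \<comment> \<open>The inclusion of the other end is a cofibration. A lift is built in three steps:
    over \<open>?B\<close> by its cofibrancy, over the double to match the prescribed
    \<open>u\<close> on one end, and over the cylinder against \<open>?ci\<close>.\<close>
  have "has_lift C ?c g" if g: "g \<in> Fib \<inter> W" for g
    unfolding has_lift_def
  proof (intro ballI impI)
    fix u v assume u: "u \<in> Hom C (Dom C ?c) (Dom C g)" and v: "v \<in> Hom C (Cod C ?c) (Cod C g)" and eq: "g \<cdot> u = v \<cdot> ?c"
    have gm: "g \<in> Mor C" using g wide by blast
    have uH: "u \<in> Mor C" "Dom C u = ?A" "Cod C u = Dom C g" "v \<in> Mor C" "Dom C v = ?Y" "Cod C v = Cod C g"
      using u v cH by (auto simp: Hom_iff)
    obtain tB where tB: "tB \<in> Hom C z ?B" by (rule initial_Hom[OF z(1) Ao(2)])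
    obtain tE where tE: "tE \<in> Hom C z (Dom C g)" using initial_Hom[OF z(1)] gm C by (metis dom_ob)
    have tBC: "tB \<in> Cof" using cofib[OF fM(3)] z(1) tB unfolding cofibrant_def by blast
    have "g \<cdot> tE = (v \<cdot> h) \<cdot> tB"
      by (rule zuniq[of _ "Cod C g"]) (use tE tB gm uH kh C in \<open>simp_all add: Hom_iff\<close>)
    moreover have tBH: "Cod C tB = ?B" "Dom C tB = z" using tB by (auto simp: Hom_iff)
    moreover have "tE \<in> Hom C (Dom C tB) (Dom C g)" "v \<cdot> h \<in> Hom C (Cod C tB) (Cod C g)"
      using tE tBH uH kh C by (simp_all add: Hom_iff)
    moreover have "has_lift C tB g" using lift2[OF tBC] g by blast
    ultimately obtain b where b: "b \<in> Hom C ?B (Dom C g)" "g \<cdot> b = v \<cdot> h"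
      using has_liftE by metis
    have bf: "b \<cdot> f \<in> Hom C (Cod C t) (Dom C g)" "u \<in> Hom C (Cod C t) (Dom C g)"
      using b fM tH uH C by (simp_all add: Hom_iff)
    have "(b \<cdot> f) \<cdot> t = u \<cdot> t"
      by (rule zuniq[of _ "Dom C g"]) (use bf tH b(1) fM C in \<open>simp_all add: Hom_iff\<close>)
    then obtain e where e: "e \<in> Hom C ?s (Dom C g)" "e \<cdot> ?k0 = b \<cdot> f" "e \<cdot> ?k1 = u"
      using pushout_induced[OF C po bf] kH by metis
    have "g \<cdot> e = (v \<cdot> k) \<cdot> ?ci"
    proof (rule pushout_unique[OF C po, of _ "Cod C g"])
      show "g \<cdot> e \<in> Hom C (Cod C ?k0) (Cod C g)" "(v \<cdot> k) \<cdot> ?ci \<in> Hom C (Cod C ?k0) (Cod C g)"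
        using e gm uH kh iH kH C by (simp_all add: Hom_iff)
      have "(g \<cdot> e) \<cdot> ?k0 = (v \<cdot> h) \<cdot> f"
        using e(1,2) gm kH comp_reassoc[OF b(2) C, of f] b(1) fM C by (simp add: Hom_iff)
      also have "\<dots> = ((v \<cdot> k) \<cdot> ?ci) \<cdot> ?k0" using kh uH iH kH fM C by simp
      finally show "(g \<cdot> e) \<cdot> ?k0 = ((v \<cdot> k) \<cdot> ?ci) \<cdot> ?k0" .
      show "(g \<cdot> e) \<cdot> ?k1 = ((v \<cdot> k) \<cdot> ?ci) \<cdot> ?k1"
        using e(1,3) gm kH eq uH kh(1-5) iH C by (simp add: Hom_iff)
    qed
    moreover have "e \<in> Hom C (Dom C ?ci) (Dom C g)" "v \<cdot> k \<in> Hom C (Cod C ?ci) (Cod C g)"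
      using e(1) uH kh(1-5) iH C by (simp_all add: Hom_iff)
    moreover have "has_lift C ?ci g" using lift2[OF cyl(3)] g by blast
    ultimately obtain d where d: "d \<in> Hom C ?I (Dom C g)" "d \<cdot> ?ci = e" "g \<cdot> d = v \<cdot> k"
      using has_liftE iH(3) by metis
    have dk: "d \<cdot> ?i0 = b \<cdot> f" "d \<cdot> ?i1 = u"
      using comp_reassoc[OF d(2) C, of ?k0] comp_reassoc[OF d(2) C, of ?k1] e d(1) iH kH by (simp_all add: Hom_iff)
    have dH: "d \<in> Hom C (Cod C ?i0) (Dom C g)" using d(1) i0H by simp
    obtain w where w: "w \<in> Hom C ?Y (Dom C g)" "w \<cdot> k = d" "w \<cdot> h = b"
      using pushout_induced[OF C po'(1) dH b(1) dk(1)] by metis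
    have "w \<cdot> ?c = u"
      using comp_reassoc[OF w(2) C, of ?i1] w(1) kh(1,2) i0H dk(2) by (simp add: Hom_iff)
    moreover have "g \<cdot> w = v"
      by (rule pushout_unique[OF C po'(1), of _ "Cod C g"])
        (use w d(3) b(2) gm uH kh(1-5) C in \<open>simp_all add: Hom_iff\<close>)
    ultimately show "\<exists>l\<in>Hom C (Cod C ?c) (Dom C g). l \<cdot> ?c = u \<and> g \<cdot> l = v"
      using w(1) cH by auto
  qed
  then have "?c \<in> Cof" using cH llp_tfib by (auto simp: llp_def)
  then show thesis
    using that[of ?c q] qW cH qH qc fM po'(2) by (simp add: M_simps)
qed

end

section \<open>Weak equivalences are the dense morphisms\<close>

context omega_model
begin

abbreviation "WM \<equiv> W \<inter> Mor M"

text \<open>A weak equivalence is a trivial fibration after a trivial cofibration. Left properness allows the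
  approximations of the two factors to be composed.\<close>

lemma W_dense:
  assumes f: "f \<in> W"
  shows "dense WM f"
proof (rule denseI)
  show fm: "f \<in> Mor C" using f wide by blast
  obtain i p where ip: "i \<in> Cof" "p \<in> Fib" "p \<in> W" "i \<in> Mor C" "p \<in> Mor C" "Dom C i = Dom C f" "Cod C p = Cod C f"
    "Cod C i = Dom C p" "p \<cdot> i = f" by (rule factor1[OF fm])
  have "i \<in> W" using W_cancel(2)[OF ip(4,5,8)] ip(3,9) f by simp
  then have di: "dense TM i" using dense_tcof ip(1) by blast
  fix c u v assume c: "c \<in> Mor M" and u: "u \<in> Hom C (Dom C c) (Dom C f)" and v: "v \<in> Hom C (Cod C c) (Cod C f)"
    and eq: "f \<cdot> u = v \<cdot> c"
  have cM: "c \<in> Mor C" "fp (Dom C c)" "fp (Cod C c)" using c by (auto simp: M_simps)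
  have uH: "u \<in> Mor C" "Dom C u = Dom C c" "Cod C u = Dom C f" and vH: "v \<in> Mor C" "Dom C v = Cod C c" "Cod C v = Cod C f"
    using u v by (auto simp: Hom_iff)
  \<comment> \<open>A trivial fibration lifts only against cofibrations, so \<open>c\<close> is
    replaced by the cofibration \<open>z\<close>. The price is that \<open>Dom C q\<close> stands in
    for \<open>Cod C c\<close>; this is corrected in the end by pushing \<open>q\<close>
    out.\<close>
  obtain z q where zq: "z \<in> Cof" "q \<in> W" "z \<in> Mor M" "q \<in> Mor M" "Dom C z = Dom C c" "Cod C q = Cod C c" "Cod C z = Dom C q" "q \<cdot> z = c"
    by (rule factor_M[OF c])
  have zm: "z \<in> Mor C" "q \<in> Mor C" "fp (Dom C q)" using zq by (auto simp: M_simps)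
  have "i \<cdot> u \<in> Hom C (Dom C z) (Dom C p)" "v \<cdot> q \<in> Hom C (Cod C z) (Cod C p)"
    using uH vH ip zq(5-7) zm C by (simp_all add: Hom_iff)
  moreover have "p \<cdot> (i \<cdot> u) = (v \<cdot> q) \<cdot> z"
    using comp_reassoc[OF ip(9) C, of u] uH vH ip(4-8) zq(5-8) zm eq C by simp
  ultimately obtain d where d: "d \<in> Hom C (Cod C z) (Dom C p)" "d \<cdot> z = i \<cdot> u" "p \<cdot> d = v \<cdot> q"
    using has_liftE[OF lift2[OF zq(1) ip(2,3)]] by metis
  have u1: "u \<in> Hom C (Dom C z) (Dom C i)" and d1: "d \<in> Hom C (Cod C z) (Cod C i)"
    using u d(1) zq(5) ip(6,8) by simp_all
  obtain t a b u2 v2 where t: "t \<in> TM" "t \<in> Mor C" "a \<in> Hom C (Dom C z) (Dom C t)" "b \<in> Hom C (Cod C z) (Cod C t)"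
    "t \<cdot> a = b \<cdot> z" "u2 \<in> Hom C (Dom C t) (Dom C i)" "v2 \<in> Hom C (Cod C t) (Cod C i)" "i \<cdot> u2 = v2 \<cdot> t"
    "u2 \<cdot> a = u" "v2 \<cdot> b = d"
    using denseE[OF di zq(3) u1 d1] d(2) by metis
  have aH: "a \<in> Mor C" "Dom C a = Dom C c" "Cod C a = Dom C t" and bH: "b \<in> Mor C" "Dom C b = Dom C q" "Cod C b = Cod C t"
    and u2H: "u2 \<in> Mor C" "Dom C u2 = Dom C t" "Cod C u2 = Dom C f" and v2H: "v2 \<in> Mor C" "Dom C v2 = Cod C t" "Cod C v2 = Dom C p"
    and tp: "fp (Dom C t)" "fp (Cod C t)" "t \<in> W"
    using t zq(5,7) ip(6,8) by (auto simp: Hom_iff M_simps)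
  have aM: "a \<in> Mor M" using aH cM tp by (simp add: M_simps)
  \<comment> \<open>Replacing \<open>a\<close> by a cofibration \<open>a'\<close>, up to the weak
    equivalence \<open>e\<close>, makes its cobase change \<open>l\<close> along \<open>z\<close> a
    cofibration, as left properness will require.\<close>
  obtain a' e where ae: "a' \<in> Cof" "e \<in> W" "a' \<in> Mor M" "e \<in> Mor M" "Dom C a' = Dom C a" "Cod C e = Cod C a" "Cod C a' = Dom C e" "e \<cdot> a' = a"
    by (rule factor_M[OF aM])
  have am: "a' \<in> Mor C" "e \<in> Mor C" "fp (Dom C e)" "Dom C a' = Dom C c" "Cod C e = Dom C t" using ae aH by (auto simp: M_simps)
  obtain l m where po: "is_pushout C z a' l m" "fp (Cod C l)" using pushout_ex[of z a'] zm am zq cM ae(7) by metis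
  note pf = pushout_facts(4-9)[OF po(1)]
  let ?O = "Cod C l"
  have lm: "l \<in> Mor C" "Dom C l = Dom C q" "m \<in> Mor C" "Dom C m = Dom C e" "Cod C m = ?O" "l \<cdot> z = m \<cdot> a'"
    using pf zq(7) ae(7) by auto
  have lC: "l \<in> Cof" using Cof_pushout[OF pushout_swap[OF po(1)] ae(1)] .
  have "b \<in> Hom C (Cod C z) (Cod C t)" "t \<cdot> e \<in> Hom C (Cod C a') (Cod C t)" "b \<cdot> z = (t \<cdot> e) \<cdot> a'"
    using t(2,4,5) am ae(7,8) C by (simp_all add: Hom_iff)
  then obtain w where w: "w \<in> Hom C ?O (Cod C t)" "w \<cdot> l = b" "w \<cdot> m = t \<cdot> e"
    using pushout_induced[OF C po(1)] by metis
  have wH: "w \<in> Mor C" "Dom C w = ?O" "Cod C w = Cod C t" using w(1) by (auto simp: Hom_iff)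
  have wM: "w \<in> Mor M" using wH po(2) tp by (simp add: M_simps)
  \<comment> \<open>The comparison \<open>w\<close> of the pushout with the target of
    \<open>t\<close> is again replaced by a cofibration \<open>o'\<close>. Two out of three in
    \<open>e' \<cdot> (o' \<cdot> m) = t \<cdot> e\<close> then shows that
    \<open>o' \<cdot> m\<close> is a weak equivalence, although \<open>m\<close> need not be
    one.\<close>
  obtain o' e' where oe: "o' \<in> Cof" "e' \<in> W" "o' \<in> Mor M" "e' \<in> Mor M" "Dom C o' = Dom C w" "Cod C e' = Cod C w" "Cod C o' = Dom C e'" "e' \<cdot> o' = w"
    by (rule factor_M[OF wM])
  have om: "o' \<in> Mor C" "e' \<in> Mor C" "Dom C o' = ?O" "Cod C e' = Cod C t" "fp (Dom C e')" using oe wH by (auto simp: M_simps)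
  have olC: "o' \<cdot> l \<in> Cof" using comp_in(2)[OF lC oe(1)] om by simp
  have omm: "o' \<cdot> m \<in> Mor C" "Dom C (o' \<cdot> m) = Dom C e" "Cod C (o' \<cdot> m) = Dom C e'"
    and oll: "o' \<cdot> l \<in> Mor C" "Dom C (o' \<cdot> l) = Dom C q" "Cod C (o' \<cdot> l) = Dom C e'"
    using om lm oe(7) C by simp_all
  have e'om: "e' \<cdot> (o' \<cdot> m) = t \<cdot> e" "e' \<cdot> (o' \<cdot> l) = b"
    using comp_reassoc[OF oe(8) C, of m] comp_reassoc[OF oe(8) C, of l] w(2,3) om oe(7) lm by simp_all
  have "t \<cdot> e \<in> W" using comp_in(1)[OF ae(2) tp(3)] am by simp
  then have omW: "o' \<cdot> m \<in> W" using W_cancel(2)[of "o' \<cdot> m" e'] omm om(2) e'om(1) oe(2) by simp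
  \<comment> \<open>Pushing the weak equivalence \<open>q\<close> out along the cofibration
    \<open>o' \<cdot> l\<close> gives a weak equivalence \<open>\<rho>\<close> and restores
    \<open>Cod C c\<close> as source of the lower side \<open>\<beta>\<close>. The approximation of
    \<open>f\<close> is \<open>\<rho> \<cdot> (o' \<cdot> m)\<close>.\<close>
  obtain \<beta> \<rho> where pr: "is_pushout C q (o' \<cdot> l) \<beta> \<rho>" "fp (Cod C \<beta>)"
    using pushout_ex[of q "o' \<cdot> l"] zm oll zq cM om(5) by metis
  note pg = pushout_facts(4-9)[OF pr(1)]
  have br: "\<beta> \<in> Mor C" "Dom C \<beta> = Cod C c" "\<rho> \<in> Mor C" "Dom C \<rho> = Dom C e'" "Cod C \<rho> = Cod C \<beta>" "\<beta> \<cdot> q = \<rho> \<cdot> (o' \<cdot> l)"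
    using pg zq(6) oll by auto
  have rW: "\<rho> \<in> W" using proper pr(1) zq(2) olC unfolding left_proper_def by blast
  let ?n = "\<rho> \<cdot> (o' \<cdot> m)"
  have nH: "?n \<in> Mor C" "Dom C ?n = Dom C e" "Cod C ?n = Cod C \<beta>" using br omm C by simp_all
  have nW: "?n \<in> WM" using comp_in(1)[OF omW rW] omm br nH am(3) pr(2) by (simp add: M_simps)
  let ?g = "p \<cdot> (v2 \<cdot> e')"
  have gH: "?g \<in> Mor C" "Dom C ?g = Dom C e'" "Cod C ?g = Cod C f" using ip(5,7) v2H om C by simp_all
  have pv2b: "p \<cdot> (v2 \<cdot> b) = v \<cdot> q" using t(10) d(3) by simp
  have "?g \<cdot> (o' \<cdot> l) = v \<cdot> q"
    using pv2b e'om(2) oll om(2,4) v2H ip(5) C by simp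
  moreover have "v \<in> Hom C (Cod C q) (Cod C f)" "?g \<in> Hom C (Cod C (o' \<cdot> l)) (Cod C f)"
    using vH zq(6) gH oll by (simp_all add: Hom_iff)
  ultimately obtain y where y: "y \<in> Hom C (Cod C \<beta>) (Cod C f)" "y \<cdot> \<beta> = v" "y \<cdot> \<rho> = ?g"
    using pushout_induced[OF C pr(1)] by metis
  have yH: "y \<in> Mor C" "Dom C y = Cod C \<beta>" "Cod C y = Cod C f" using y(1) by (auto simp: Hom_iff)
  have e1: "?n \<cdot> a' = \<beta> \<cdot> c"
  proof -
    have "?n \<cdot> a' = (\<rho> \<cdot> (o' \<cdot> l)) \<cdot> z" using br(3,4) omm oll om(1-3) lm oe(7) am(1) ae(7) zm zq(7) C by simp
    also have "\<dots> = \<beta> \<cdot> c" unfolding br(6)[symmetric] using br(1,2) zm zq(6-8) C by simp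
    finally show ?thesis .
  qed
  have u2e: "u2 \<cdot> e \<in> Hom C (Dom C ?n) (Dom C f)" using u2H am nH C by (simp add: Hom_iff)
  have e2: "f \<cdot> (u2 \<cdot> e) = y \<cdot> ?n"
  proof -
    have "f \<cdot> (u2 \<cdot> e) = p \<cdot> ((i \<cdot> u2) \<cdot> e)"
      unfolding ip(9)[symmetric] using ip(4-8) u2H am C by simp
    also have "\<dots> = p \<cdot> (v2 \<cdot> (t \<cdot> e))" unfolding t(8) using v2H t(2) am C by simp
    also have "\<dots> = ?g \<cdot> (o' \<cdot> m)" unfolding e'om(1)[symmetric] using omm om v2H ip(5) C by simp
    also have "\<dots> = y \<cdot> ?n" unfolding y(3)[symmetric] using yH br omm C by simp
    finally show ?thesis .
  qed
  have e3: "(u2 \<cdot> e) \<cdot> a' = u" using u2H am ae(7,8) t(9) C by simp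
  show "\<exists>n a b x y. n \<in> WM \<and> n \<in> Mor C \<and> a \<in> Hom C (Dom C c) (Dom C n) \<and> b \<in> Hom C (Cod C c) (Cod C n) \<and> n \<cdot> a = b \<cdot> c \<and>
        x \<in> Hom C (Dom C n) (Dom C f) \<and> y \<in> Hom C (Cod C n) (Cod C f) \<and> f \<cdot> x = y \<cdot> n \<and> x \<cdot> a = u \<and> y \<cdot> b = v"
    by (rule exI[of _ ?n], rule exI[of _ a'], rule exI[of _ \<beta>], rule exI[of _ "u2 \<cdot> e"], rule exI[of _ y],
        intro conjI nW nH(1) e1 e2 e3 u2e y(2))
      (use am ae(7) nH br(1,2) yH in \<open>simp_all add: Hom_iff\<close>)
qed

text \<open>Conversely, factor \<open>f\<close> as a trivial cofibration \<open>i\<close> followed by a fibration \<open>p\<close>. To lift a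
  generating cofibration against \<open>p\<close>, one passes to a map \<open>x\<close> between finitely presentable objects
  approximating \<open>p\<close> relative to \<open>i\<close>; it is a weak equivalence, and its factorization in \<open>C\<close> into a trivial
  cofibration and a trivial fibration provides the lift.\<close>

lemma dense_W:
  assumes f: "dense WM f"
  shows "f \<in> W"
proof -
  have fm: "f \<in> Mor C" by (rule dense_mor[OF f])
  obtain i p where ip: "i \<in> Cof" "i \<in> W" "p \<in> Fib" "i \<in> Mor C" "p \<in> Mor C" "Dom C i = Dom C f" "Cod C p = Cod C f"
    "Cod C i = Dom C p" "p \<cdot> i = f" by (rule factor2[OF fm])
  have di: "dense TM i" using dense_tcof ip(1,2) by blast
  obtain I where I: "I \<subseteq> Cof" "I \<subseteq> Mor M" "rlp C I = rlp C Cof"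
    by (rule generating[OF gen_cof])
  obtain z0 where z0: "is_initial C z0" "fp z0" by (rule initial_ex)
  have zuniq: "x = y" if "x \<in> Hom C z0 B" "y \<in> Hom C z0 B" for x y B
    using initial_Hom[OF z0(1), of B] Hom_ob[OF C that(1)] that by metis
  have "has_lift C c p" if c: "c \<in> I" for c
    unfolding has_lift_def
  proof (intro ballI impI)
    fix u v assume u: "u \<in> Hom C (Dom C c) (Dom C p)" and v: "v \<in> Hom C (Cod C c) (Cod C p)" and eq: "p \<cdot> u = v \<cdot> c"
    have cM: "c \<in> Mor C" "fp (Dom C c)" "fp (Cod C c)" "c \<in> Cof" using c I by (auto simp: M_simps)
    have co: "Dom C c \<in> Ob C" "Dom C f \<in> Ob C" using cM fm C by auto
    have uH: "u \<in> Mor C" "Dom C u = Dom C c" "Cod C u = Dom C p" and vH: "v \<in> Mor C" "Dom C v = Cod C c" "Cod C v = Cod C f"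
      using u v ip(7) by (auto simp: Hom_iff)
    \<comment> \<open>Density of \<open>i\<close> is tested on the map from the initial object to
      \<open>Dom C c\<close>. Such a square carries no more than the map \<open>u\<close>, so the
      outcome is a factorization of \<open>u\<close> through the target of some \<open>t\<close> in
      \<open>TM\<close> lying over \<open>i\<close>.\<close>
    obtain s0 where s0: "s0 \<in> Hom C z0 (Dom C c)" by (rule initial_Hom[OF z0(1) co(1)])
    obtain x0 where x0: "x0 \<in> Hom C z0 (Dom C f)" by (rule initial_Hom[OF z0(1) co(2)])
    have sH: "s0 \<in> Mor C" "Dom C s0 = z0" "Cod C s0 = Dom C c" using s0 by (auto simp: Hom_iff)
    have sM: "s0 \<in> Mor M" using sH z0 cM by (simp add: M_simps)
    have "i \<cdot> x0 = u \<cdot> s0"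
      by (rule zuniq[of _ "Dom C p"]) (use x0 sH uH ip C in \<open>simp_all add: Hom_iff\<close>)
    moreover have "x0 \<in> Hom C (Dom C s0) (Dom C i)" "u \<in> Hom C (Cod C s0) (Cod C i)"
      using x0 u sH ip by simp_all
    ultimately obtain t a1 u2 v2 where t: "t \<in> TM" "t \<in> Mor C" "a1 \<in> Hom C (Cod C s0) (Cod C t)"
      "u2 \<in> Hom C (Dom C t) (Dom C i)" "v2 \<in> Hom C (Cod C t) (Cod C i)" "i \<cdot> u2 = v2 \<cdot> t" "v2 \<cdot> a1 = u"
      using denseE[OF di sM] by metis
    have a1H: "a1 \<in> Mor C" "Dom C a1 = Dom C c" "Cod C a1 = Cod C t" and u2H: "u2 \<in> Mor C" "Dom C u2 = Dom C t" "Cod C u2 = Dom C f"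
      and v2H: "v2 \<in> Mor C" "Dom C v2 = Cod C t" "Cod C v2 = Dom C p"
      and tp: "fp (Dom C t)" "fp (Cod C t)" "t \<in> Cof \<inter> W"
      using t sH ip(6,8) by (auto simp: Hom_iff M_simps)
    \<comment> \<open>Pushing \<open>c\<close> out along \<open>a1\<close> encodes the lifting
      problem in a single map \<open>m \<cdot> t\<close> of \<open>M\<close> over \<open>f\<close>,
      to which density of \<open>f\<close> applies.\<close>
    obtain m l where po: "is_pushout C a1 c m l" "fp (Cod C m)" using pushout_ex[of a1 c] a1H cM tp by metis
    note pf = pushout_facts(4-9)[OF po(1)]
    have ml: "m \<in> Mor C" "Dom C m = Cod C t" "l \<in> Mor C" "Dom C l = Cod C c" "Cod C l = Cod C m" "m \<cdot> a1 = l \<cdot> c"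
      using pf a1H by auto
    have "p \<cdot> v2 \<in> Hom C (Cod C a1) (Cod C f)" "v \<in> Hom C (Cod C c) (Cod C f)" "(p \<cdot> v2) \<cdot> a1 = v \<cdot> c"
      using v2H a1H ip(5,7) vH t(7) eq C by (simp_all add: Hom_iff)
    then obtain y where y: "y \<in> Hom C (Cod C m) (Cod C f)" "y \<cdot> m = p \<cdot> v2" "y \<cdot> l = v"
      using pushout_induced[OF C po(1)] by metis
    have yH: "y \<in> Mor C" "Dom C y = Cod C m" "Cod C y = Cod C f" using y(1) by (auto simp: Hom_iff)
    let ?mt = "m \<cdot> t"
    have mtH: "?mt \<in> Mor C" "Dom C ?mt = Dom C t" "Cod C ?mt = Cod C m" using ml t(2) C by simp_all
    have mtM: "?mt \<in> Mor M" using mtH tp po(2) by (simp add: M_simps)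
    have "f \<cdot> u2 = y \<cdot> ?mt"
    proof -
      have "f \<cdot> u2 = p \<cdot> (i \<cdot> u2)" unfolding ip(9)[symmetric] using ip(4-8) u2H C by simp
      also have "\<dots> = (p \<cdot> v2) \<cdot> t" unfolding t(6) using ip(5) v2H t(2) C by simp
      also have "\<dots> = y \<cdot> ?mt" unfolding y(2)[symmetric] using yH ml t(2) C by simp
      finally show ?thesis .
    qed
    moreover have "u2 \<in> Hom C (Dom C ?mt) (Dom C f)" "y \<in> Hom C (Cod C ?mt) (Cod C f)"
      using u2H yH mtH by (simp_all add: Hom_iff)
    ultimately obtain s \<alpha> \<beta> u3 y3 where s: "s \<in> WM" "s \<in> Mor C" "\<alpha> \<in> Hom C (Dom C ?mt) (Dom C s)" "\<beta> \<in> Hom C (Cod C ?mt) (Cod C s)"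
      "s \<cdot> \<alpha> = \<beta> \<cdot> ?mt" "u3 \<in> Hom C (Dom C s) (Dom C f)" "y3 \<in> Hom C (Cod C s) (Cod C f)" "f \<cdot> u3 = y3 \<cdot> s"
      "u3 \<cdot> \<alpha> = u2" "y3 \<cdot> \<beta> = y"
      using denseE[OF f mtM] by metis
    have \<alpha>H: "\<alpha> \<in> Mor C" "Dom C \<alpha> = Dom C t" "Cod C \<alpha> = Dom C s" and \<beta>H: "\<beta> \<in> Mor C" "Dom C \<beta> = Cod C m" "Cod C \<beta> = Cod C s"
      and u3H: "u3 \<in> Mor C" "Dom C u3 = Dom C s" "Cod C u3 = Dom C f" and y3H: "y3 \<in> Mor C" "Dom C y3 = Cod C s" "Cod C y3 = Cod C f"
      using s mtH by (auto simp: Hom_iff)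
    \<comment> \<open>The weak equivalence \<open>s\<close> lies over \<open>f\<close>, while a map
      over \<open>p\<close> is wanted. Pushing the trivial cofibration \<open>t\<close> out along
      \<open>\<alpha>\<close> factors \<open>s\<close> as \<open>x \<cdot> m'\<close>; two out of
      three makes \<open>x\<close> a weak equivalence, and \<open>e\<close> and \<open>y3\<close>
      place it over \<open>p\<close>.\<close>
    obtain l' m' where po': "is_pushout C t \<alpha> l' m'" using pushout_ex[of t \<alpha>] t(2) \<alpha>H by metis
    note pg = pushout_facts(4-9)[OF po']
    have lm': "l' \<in> Mor C" "Dom C l' = Cod C t" "m' \<in> Mor C" "Dom C m' = Dom C s" "Cod C m' = Cod C l'" "l' \<cdot> t = m' \<cdot> \<alpha>"
      using pg \<alpha>H by auto
    have m'W: "m' \<in> W" using tcof_pushout[OF po' tp(3)] by blast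
    have "\<beta> \<cdot> m \<in> Hom C (Cod C t) (Cod C s)" "s \<in> Hom C (Cod C \<alpha>) (Cod C s)" "(\<beta> \<cdot> m) \<cdot> t = s \<cdot> \<alpha>"
      using \<beta>H ml s(2,5) \<alpha>H t(2) C by (simp_all add: Hom_iff)
    then obtain x where x: "x \<in> Hom C (Cod C l') (Cod C s)" "x \<cdot> l' = \<beta> \<cdot> m" "x \<cdot> m' = s"
      using pushout_induced[OF C po'] by metis
    have xH: "x \<in> Mor C" "Dom C x = Cod C l'" "Cod C x = Cod C s" using x(1) by (auto simp: Hom_iff)
    have xW: "x \<in> W" using W_cancel(1)[of m' x] lm' xH x(3) s(1) m'W by simp
    have iu3: "i \<cdot> u3 \<in> Mor C" "Dom C (i \<cdot> u3) = Dom C s" "Cod C (i \<cdot> u3) = Dom C p"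
      using ip u3H C by simp_all
    have "v2 \<in> Hom C (Cod C t) (Dom C p)" "i \<cdot> u3 \<in> Hom C (Cod C \<alpha>) (Dom C p)" "v2 \<cdot> t = (i \<cdot> u3) \<cdot> \<alpha>"
      using v2H iu3 \<alpha>H u3H ip(4,6) s(9) t(6) C by (simp_all add: Hom_iff)
    then obtain e where e: "e \<in> Hom C (Cod C l') (Dom C p)" "e \<cdot> l' = v2" "e \<cdot> m' = i \<cdot> u3"
      using pushout_induced[OF C po'] by metis
    have eH: "e \<in> Mor C" "Dom C e = Cod C l'" "Cod C e = Dom C p" using e(1) by (auto simp: Hom_iff)
    have pe: "p \<cdot> e = y3 \<cdot> x"
    proof (rule pushout_unique[OF C po', of _ "Cod C f"])
      show "p \<cdot> e \<in> Hom C (Cod C l') (Cod C f)" "y3 \<cdot> x \<in> Hom C (Cod C l') (Cod C f)"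
        using eH xH y3H ip(5,7) C by (simp_all add: Hom_iff)
      have "(p \<cdot> e) \<cdot> l' = y \<cdot> m" using eH lm'(1,2) ip(5) e(2) y(2) C by simp
      also have "\<dots> = y3 \<cdot> (\<beta> \<cdot> m)" unfolding s(10)[symmetric] using y3H \<beta>H ml C by simp
      also have "\<dots> = (y3 \<cdot> x) \<cdot> l'" unfolding x(2)[symmetric] using y3H xH lm' C by simp
      finally show "(p \<cdot> e) \<cdot> l' = (y3 \<cdot> x) \<cdot> l'" .
      have "(p \<cdot> e) \<cdot> m' = (p \<cdot> i) \<cdot> u3" using eH lm'(3-5) ip(4-8) u3H e(3) C by simp
      also have "\<dots> = y3 \<cdot> s" unfolding ip(9) by (rule s(8))
      also have "\<dots> = (y3 \<cdot> x) \<cdot> m'" unfolding x(3)[symmetric] using y3H xH lm'(3-5) C by simp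
      finally show "(p \<cdot> e) \<cdot> m' = (y3 \<cdot> x) \<cdot> m'" .
    qed
    \<comment> \<open>The lift is composed of two: the generating cofibration \<open>c\<close> lifts
      against the trivial fibration \<open>\<tau>\<close>, and the trivial cofibration
      \<open>\<sigma>\<close> lifts against the fibration \<open>p\<close>.\<close>
    obtain \<sigma> \<tau> where st: "\<sigma> \<in> Cof" "\<tau> \<in> Fib" "\<tau> \<in> W" "\<sigma> \<in> Mor C" "\<tau> \<in> Mor C" "Dom C \<sigma> = Dom C x" "Cod C \<tau> = Cod C x"
      "Cod C \<sigma> = Dom C \<tau>" "\<tau> \<cdot> \<sigma> = x" by (rule factor1[OF xH(1)])
    have \<sigma>W: "\<sigma> \<in> W" using W_cancel(2)[OF st(4,5,8)] st(3,9) xW by simp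
    have "e \<in> Hom C (Dom C \<sigma>) (Dom C p)" "y3 \<cdot> \<tau> \<in> Hom C (Cod C \<sigma>) (Cod C p)" "p \<cdot> e = (y3 \<cdot> \<tau>) \<cdot> \<sigma>"
      using eH st(4-9) xH y3H ip(7) pe C by (simp_all add: Hom_iff)
    then obtain g where g: "g \<in> Hom C (Cod C \<sigma>) (Dom C p)" "g \<cdot> \<sigma> = e" "p \<cdot> g = y3 \<cdot> \<tau>"
      using has_liftE[OF lift1[OF st(1) \<sigma>W ip(3)]] by metis
    have gH: "g \<in> Mor C" "Dom C g = Dom C \<tau>" "Cod C g = Dom C p" using g(1) st(8) by (auto simp: Hom_iff)
    let ?top = "\<sigma> \<cdot> (l' \<cdot> a1)"
    have topH: "?top \<in> Hom C (Dom C c) (Dom C \<tau>)" "\<beta> \<cdot> l \<in> Hom C (Cod C c) (Cod C \<tau>)"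
      using st(4-8) xH lm'(1,2) a1H \<beta>H ml C by (simp_all add: Hom_iff)
    have "\<tau> \<cdot> ?top = (\<beta> \<cdot> l) \<cdot> c"
    proof -
      have "\<tau> \<cdot> ?top = (\<tau> \<cdot> \<sigma>) \<cdot> (l' \<cdot> a1)" using st(4-8) xH lm'(1,2) a1H C by simp
      also have "\<dots> = (x \<cdot> l') \<cdot> a1" unfolding st(9) using xH lm'(1,2) a1H C by simp
      also have "\<dots> = \<beta> \<cdot> (m \<cdot> a1)" unfolding x(2) using \<beta>H ml(1,2) a1H C by simp
      also have "\<dots> = (\<beta> \<cdot> l) \<cdot> c" unfolding ml(6) using \<beta>H ml(3-5) cM C by simp
      finally show ?thesis .
    qed
    then obtain d where d: "d \<in> Hom C (Cod C c) (Dom C \<tau>)" "d \<cdot> c = ?top" "\<tau> \<cdot> d = \<beta> \<cdot> l"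
      using has_liftE[OF lift2[OF cM(4) st(2,3)] topH] by metis
    have dH: "d \<in> Mor C" "Dom C d = Cod C c" "Cod C d = Dom C \<tau>" using d(1) by (auto simp: Hom_iff)
    have "(g \<cdot> d) \<cdot> c = u"
    proof -
      have "(g \<cdot> d) \<cdot> c = (g \<cdot> \<sigma>) \<cdot> (l' \<cdot> a1)"
        using gH dH cM(1) d(2) st(4-8) xH lm'(1,2) a1H C by simp
      also have "\<dots> = (e \<cdot> l') \<cdot> a1" unfolding g(2) using eH lm'(1,2) a1H C by simp
      also have "\<dots> = u" unfolding e(2) by (rule t(7))
      finally show ?thesis .
    qed
    moreover have "p \<cdot> (g \<cdot> d) = v"
    proof -
      have "p \<cdot> (g \<cdot> d) = (p \<cdot> g) \<cdot> d" using gH dH ip(5) C by simp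
      also have "\<dots> = y3 \<cdot> (\<tau> \<cdot> d)" unfolding g(3) using y3H st(5,7) xH dH C by simp
      also have "\<dots> = (y3 \<cdot> \<beta>) \<cdot> l" unfolding d(3) using y3H \<beta>H ml(3-5) C by simp
      also have "\<dots> = v" unfolding s(10) by (rule y(3))
      finally show ?thesis .
    qed
    moreover have "g \<cdot> d \<in> Hom C (Cod C c) (Dom C p)" using gH dH C by (simp add: Hom_iff)
    ultimately show "\<exists>h\<in>Hom C (Cod C c) (Dom C p). h \<cdot> c = u \<and> p \<cdot> h = v" by blast
  qed
  then have "p \<in> rlp C I" using ip(5) by (simp add: rlp_def)
  then have "p \<in> W" unfolding I(3) rlp_Cof by blast
  then show ?thesis using comp_in(1)[OF ip(2) _ ip(8)] ip(9) by simp
qed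

lemma W_iff_dense: "f \<in> W \<longleftrightarrow> dense WM f"
  using W_dense dense_W by blast

lemma weak_cofibration: "weak_cofibration_category M WM (Cof \<inter> Mor M)"
  unfolding weak_cofibration_category_def
proof (intro conjI)
  show "category M" by (rule category_M)
  show "wide_subcat M WM" "wide_subcat M (Cof \<inter> Mor M)"
    unfolding wide_subcat_def using idt_in comp_in fp_ob C by (auto simp: M_simps)
  show "{f. is_iso M f} \<subseteq> WM \<inter> (Cof \<inter> Mor M)"
  proof
    fix f assume "f \<in> {f. is_iso M f}"
    then have "is_iso M f" by simp
    then have "is_iso C f" "f \<in> Mor M" unfolding is_iso_def M_simps Bex_def Hom_M by blast+
    then show "f \<in> WM \<inter> (Cof \<inter> Mor M)" using iso_in by blast
  qed
  show "has_finite_colimits M" by (rule finite_colimits_M)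
  show "two_out_of_three M WM"
    unfolding two_out_of_three_def
  proof (intro ballI impI)
    fix f g assume "f \<in> Mor M" "g \<in> Mor M" "Cod M f = Dom M g"
    moreover from this have "g \<cdot>\<^bsub>M\<^esub> f \<in> Mor M" using category_M by simp
    ultimately show "(f \<in> WM \<and> g \<in> WM \<longrightarrow> g \<cdot>\<^bsub>M\<^esub> f \<in> WM) \<and> (f \<in> WM \<and> g \<cdot>\<^bsub>M\<^esub> f \<in> WM \<longrightarrow> g \<in> WM) \<and>
        (g \<in> WM \<and> g \<cdot>\<^bsub>M\<^esub> f \<in> WM \<longrightarrow> f \<in> WM)"
      using comp_in(1)[of f g] W_cancel[of f g] by (auto simp: M_simps)
  qed
  show "closed_under_cobase_change M (Cof \<inter> Mor M)"
    unfolding closed_under_cobase_change_def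
  proof (intro allI impI; elim conjE)
    fix f g h k assume "is_pushout M f g h k" "f \<in> Cof \<inter> Mor M"
    then show "k \<in> Cof \<inter> Mor M" using Cof_pushout[OF pushout_M, of f g h k] pushout_facts(5)[of M f g h k] by simp
  qed
  show "closed_under_cobase_change M (Cof \<inter> Mor M \<inter> WM)"
    unfolding closed_under_cobase_change_def
  proof (intro allI impI; elim conjE)
    fix f g h k assume "is_pushout M f g h k" "f \<in> Cof \<inter> Mor M \<inter> WM"
    then show "k \<in> Cof \<inter> Mor M \<inter> WM" using tcof_pushout[OF pushout_M, of f g h k] pushout_facts(5)[of M f g h k] by simp
  qed
  show "\<forall>f\<in>Mor M. \<exists>c\<in>Cof \<inter> Mor M. \<exists>w\<in>WM. Cod M c = Dom M w \<and> w \<cdot>\<^bsub>M\<^esub> c = f"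
  proof
    fix f assume "f \<in> Mor M"
    from factor_M[OF this] show "\<exists>c\<in>Cof \<inter> Mor M. \<exists>w\<in>WM. Cod M c = Dom M w \<and> w \<cdot>\<^bsub>M\<^esub> c = f"
      unfolding M_simps(3-6) by (metis IntI)
  qed
qed

end

section \<open>Fully faithful and essentially surjective functors\<close>

text \<open>Fullness, faithfulness and essential surjectivity are all that the transport of lifting
  properties and of isomorphisms between morphisms requires.\<close>

locale ff_functor =
  fixes A :: "('a, 'b) cat" and B :: "('c, 'd) cat" and T
  assumes T: "is_functor A B T"
    and inj: "\<And>a b f g. f \<in> Hom A a b \<Longrightarrow> g \<in> Hom A a b \<Longrightarrow> fmor T f = fmor T g \<Longrightarrow> f = g"
    and surj: "\<And>a b h. a \<in> Ob A \<Longrightarrow> b \<in> Ob A \<Longrightarrow> h \<in> Hom B (fob T a) (fob T b) \<Longrightarrow> \<exists>f\<in>Hom A a b. fmor T f = h"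
    and ess: "\<And>b. b \<in> Ob B \<Longrightarrow> \<exists>a\<in>Ob A. \<exists>e\<in>Hom B (fob T a) b. \<exists>e'\<in>Hom B b (fob T a).
      e' \<cdot>\<^bsub>B\<^esub> e = Idt B (fob T a) \<and> e \<cdot>\<^bsub>B\<^esub> e' = Idt B b"
begin

lemma A: "category A" and B: "category B"
  using is_functor_cat[OF T] by auto

lemma T_Hom: "f \<in> Hom A a b \<Longrightarrow> fmor T f \<in> Hom B (fob T a) (fob T b)"
  using T by (auto simp: Hom_iff)

lemma T_comp: "f \<in> Hom A a b \<Longrightarrow> g \<in> Hom A b c \<Longrightarrow> fmor T (g \<cdot>\<^bsub>A\<^esub> f) = fmor T g \<cdot>\<^bsub>B\<^esub> fmor T f"
  using T by (auto simp: Hom_iff)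

lemma T_idt: "a \<in> Ob A \<Longrightarrow> fmor T (Idt A a) = Idt B (fob T a)"
  using T by simp

lemma equivalence: "is_equivalence A B T"
proof -
  have "\<forall>b. \<exists>a e e'. b \<in> Ob B \<longrightarrow> a \<in> Ob A \<and> e \<in> Hom B (fob T a) b \<and> e' \<in> Hom B b (fob T a) \<and>
      e' \<cdot>\<^bsub>B\<^esub> e = Idt B (fob T a) \<and> e \<cdot>\<^bsub>B\<^esub> e' = Idt B b"
    using ess by blast
  then obtain S0 \<epsilon> \<epsilon>' where S0: "\<And>b. b \<in> Ob B \<Longrightarrow> S0 b \<in> Ob A"
    and \<epsilon>: "\<And>b. b \<in> Ob B \<Longrightarrow> \<epsilon> b \<in> Hom B (fob T (S0 b)) b" "\<And>b. b \<in> Ob B \<Longrightarrow> \<epsilon>' b \<in> Hom B b (fob T (S0 b))"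
      "\<And>b. b \<in> Ob B \<Longrightarrow> \<epsilon>' b \<cdot>\<^bsub>B\<^esub> \<epsilon> b = Idt B (fob T (S0 b))" "\<And>b. b \<in> Ob B \<Longrightarrow> \<epsilon> b \<cdot>\<^bsub>B\<^esub> \<epsilon>' b = Idt B b"
    by metis
  \<comment> \<open>On morphisms the inverse is conjugation by the chosen isomorphisms, lifted by
    fullness; faithfulness then yields functoriality and naturality.\<close>
  have "\<forall>g. \<exists>f. g \<in> Mor B \<longrightarrow> f \<in> Hom A (S0 (Dom B g)) (S0 (Cod B g)) \<and> fmor T f = \<epsilon>' (Cod B g) \<cdot>\<^bsub>B\<^esub> (g \<cdot>\<^bsub>B\<^esub> \<epsilon> (Dom B g))"
  proof (intro allI)
    fix g
    show "\<exists>f. g \<in> Mor B \<longrightarrow> f \<in> Hom A (S0 (Dom B g)) (S0 (Cod B g)) \<and> fmor T f = \<epsilon>' (Cod B g) \<cdot>\<^bsub>B\<^esub> (g \<cdot>\<^bsub>B\<^esub> \<epsilon> (Dom B g))"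
    proof (cases "g \<in> Mor B")
      case True
      then have o: "Dom B g \<in> Ob B" "Cod B g \<in> Ob B" using B by auto
      have "\<epsilon>' (Cod B g) \<cdot>\<^bsub>B\<^esub> (g \<cdot>\<^bsub>B\<^esub> \<epsilon> (Dom B g)) \<in> Hom B (fob T (S0 (Dom B g))) (fob T (S0 (Cod B g)))"
        using \<epsilon>(1)[OF o(1)] \<epsilon>(2)[OF o(2)] True B by (simp add: Hom_iff)
      from surj[OF S0[OF o(1)] S0[OF o(2)] this] show ?thesis by blast
    qed simp
  qed
  then obtain S1 where S1: "\<And>g. g \<in> Mor B \<Longrightarrow> S1 g \<in> Hom A (S0 (Dom B g)) (S0 (Cod B g))"
    "\<And>g. g \<in> Mor B \<Longrightarrow> fmor T (S1 g) = \<epsilon>' (Cod B g) \<cdot>\<^bsub>B\<^esub> (g \<cdot>\<^bsub>B\<^esub> \<epsilon> (Dom B g))" by metis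
  define S where "S = \<lparr>fob = S0, fmor = S1\<rparr>"
  have Ss: "fob S = S0" "fmor S = S1" by (simp_all add: S_def)
  have S: "is_functor B A S"
    unfolding is_functor_def Ss
  proof (intro conjI ballI impI A B S0 S1(1))
    show "S1 (Idt B b) = Idt A (S0 b)" if b: "b \<in> Ob B" for b
    proof (rule inj)
      show "S1 (Idt B b) \<in> Hom A (S0 b) (S0 b)" using S1(1)[of "Idt B b"] b B by simp
      show "Idt A (S0 b) \<in> Hom A (S0 b) (S0 b)" using S0[OF b] A by (simp add: Hom_iff)
      show "fmor T (S1 (Idt B b)) = fmor T (Idt A (S0 b))"
        using S1(2)[of "Idt B b"] b B \<epsilon>(1,3)[OF b] T_idt[OF S0[OF b]] by (simp add: Hom_iff)
    qed
    fix f g assume f: "f \<in> Mor B" and g: "g \<in> Mor B" and fg: "Cod B f = Dom B g"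
    have o: "Dom B f \<in> Ob B" "Dom B g \<in> Ob B" "Cod B g \<in> Ob B" using f g B by auto
    have fH: "S1 f \<in> Hom A (S0 (Dom B f)) (S0 (Dom B g))" using S1(1)[OF f] fg by simp
    show "S1 (g \<cdot>\<^bsub>B\<^esub> f) = S1 g \<cdot>\<^bsub>A\<^esub> S1 f"
    proof (rule inj)
      show "S1 (g \<cdot>\<^bsub>B\<^esub> f) \<in> Hom A (S0 (Dom B f)) (S0 (Cod B g))" using S1(1)[of "g \<cdot>\<^bsub>B\<^esub> f"] f g fg B by simp
      show "S1 g \<cdot>\<^bsub>A\<^esub> S1 f \<in> Hom A (S0 (Dom B f)) (S0 (Cod B g))" using comp_Hom[OF A fH S1(1)[OF g]] .
      have "fmor T (S1 g \<cdot>\<^bsub>A\<^esub> S1 f) = (\<epsilon>' (Cod B g) \<cdot>\<^bsub>B\<^esub> (g \<cdot>\<^bsub>B\<^esub> \<epsilon> (Dom B g))) \<cdot>\<^bsub>B\<^esub> (\<epsilon>' (Dom B g) \<cdot>\<^bsub>B\<^esub> (f \<cdot>\<^bsub>B\<^esub> \<epsilon> (Dom B f)))"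
        using T_comp[OF fH S1(1)[OF g]] S1(2)[OF f] S1(2)[OF g] fg by simp
      also have "\<dots> = \<epsilon>' (Cod B g) \<cdot>\<^bsub>B\<^esub> ((g \<cdot>\<^bsub>B\<^esub> f) \<cdot>\<^bsub>B\<^esub> \<epsilon> (Dom B f))"
        using \<epsilon>(1)[OF o(1)] \<epsilon>(1,2)[OF o(2)] \<epsilon>(2)[OF o(3)] f g fg B
          comp_reassoc[OF \<epsilon>(4)[OF o(2)] B, of "f \<cdot>\<^bsub>B\<^esub> \<epsilon> (Dom B f)"] by (simp add: Hom_iff)
      finally show "fmor T (S1 (g \<cdot>\<^bsub>B\<^esub> f)) = fmor T (S1 g \<cdot>\<^bsub>A\<^esub> S1 f)"
        using S1(2)[of "g \<cdot>\<^bsub>B\<^esub> f"] f g fg B by simp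
    qed
  qed
  have idA: "is_functor A A id_fctr" and idB: "is_functor B B id_fctr"
    unfolding is_functor_def id_fctr_def using A B by (simp_all add: Hom_iff)
  have ids: "fob id_fctr = (\<lambda>x. x)" "fmor id_fctr = (\<lambda>x. x)" by (auto simp: id_fctr_def)
  have "\<forall>a. \<exists>f g. a \<in> Ob A \<longrightarrow> f \<in> Hom A a (S0 (fob T a)) \<and> fmor T f = \<epsilon>' (fob T a) \<and>
      g \<in> Hom A (S0 (fob T a)) a \<and> fmor T g = \<epsilon> (fob T a)"
  proof (intro allI)
    fix a
    show "\<exists>f g. a \<in> Ob A \<longrightarrow> f \<in> Hom A a (S0 (fob T a)) \<and> fmor T f = \<epsilon>' (fob T a) \<and>
      g \<in> Hom A (S0 (fob T a)) a \<and> fmor T g = \<epsilon> (fob T a)"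
    proof (cases "a \<in> Ob A")
      case True
      then have o: "fob T a \<in> Ob B" using T by simp
      show ?thesis
        using surj[OF True S0[OF o] \<epsilon>(2)[OF o]] surj[OF S0[OF o] True \<epsilon>(1)[OF o]] by blast
    qed simp
  qed
  then obtain \<eta> \<eta>' where \<eta>: "\<And>a. a \<in> Ob A \<Longrightarrow> \<eta> a \<in> Hom A a (S0 (fob T a))" "\<And>a. a \<in> Ob A \<Longrightarrow> fmor T (\<eta> a) = \<epsilon>' (fob T a)"
    "\<And>a. a \<in> Ob A \<Longrightarrow> \<eta>' a \<in> Hom A (S0 (fob T a)) a" "\<And>a. a \<in> Ob A \<Longrightarrow> fmor T (\<eta>' a) = \<epsilon> (fob T a)" by metis
  have To: "fob T a \<in> Ob B" if "a \<in> Ob A" for a using T that by simp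
  have \<eta>iso: "is_iso A (\<eta> a)" if a: "a \<in> Ob A" for a
  proof (rule is_isoI[OF \<eta>(1)[OF a] \<eta>(3)[OF a]])
    have s: "S0 (fob T a) \<in> Ob A" using S0[OF To[OF a]] .
    show "\<eta>' a \<cdot>\<^bsub>A\<^esub> \<eta> a = Idt A a"
      by (rule inj[OF comp_Hom[OF A \<eta>(1)[OF a] \<eta>(3)[OF a]]])
        (use a A T_comp[OF \<eta>(1)[OF a] \<eta>(3)[OF a]] \<eta>(2,4)[OF a] \<epsilon>(4)[OF To[OF a]] T_idt[OF a] in \<open>simp_all add: Hom_iff\<close>)
    show "\<eta> a \<cdot>\<^bsub>A\<^esub> \<eta>' a = Idt A (S0 (fob T a))"
      by (rule inj[OF comp_Hom[OF A \<eta>(3)[OF a] \<eta>(1)[OF a]]])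
        (use s A T_comp[OF \<eta>(3)[OF a] \<eta>(1)[OF a]] \<eta>(2,4)[OF a] \<epsilon>(3)[OF To[OF a]] T_idt[OF s] in \<open>simp_all add: Hom_iff\<close>)
  qed
  have "nat_trans A A id_fctr (comp_fctr S T) \<eta>"
    unfolding nat_trans_def comp_fctr_simps Ss ids
  proof (intro conjI ballI idA functor_comp[OF T S] \<eta>(1))
    fix f assume f: "f \<in> Mor A"
    let ?a = "Dom A f" and ?b = "Cod A f"
    have o: "?a \<in> Ob A" "?b \<in> Ob A" using f A by auto
    have fH: "f \<in> Hom A ?a ?b" using f by (simp add: Hom_iff)
    note Tf = T_Hom[OF fH]
    have sf: "S1 (fmor T f) \<in> Hom A (S0 (fob T ?a)) (S0 (fob T ?b))" "fmor T (S1 (fmor T f)) = \<epsilon>' (fob T ?b) \<cdot>\<^bsub>B\<^esub> (fmor T f \<cdot>\<^bsub>B\<^esub> \<epsilon> (fob T ?a))"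
      using S1[of "fmor T f"] Tf by (simp_all add: Hom_iff)
    show "\<eta> ?b \<cdot>\<^bsub>A\<^esub> f = S1 (fmor T f) \<cdot>\<^bsub>A\<^esub> \<eta> ?a"
    proof (rule inj[OF comp_Hom[OF A fH \<eta>(1)[OF o(2)]] comp_Hom[OF A \<eta>(1)[OF o(1)] sf(1)]])
      show "fmor T (\<eta> ?b \<cdot>\<^bsub>A\<^esub> f) = fmor T (S1 (fmor T f) \<cdot>\<^bsub>A\<^esub> \<eta> ?a)"
        unfolding T_comp[OF fH \<eta>(1)[OF o(2)]] T_comp[OF \<eta>(1)[OF o(1)] sf(1)] sf(2) \<eta>(2)[OF o(1)] \<eta>(2)[OF o(2)]
        using Tf \<epsilon>(1,2,4)[OF To[OF o(1)]] \<epsilon>(2)[OF To[OF o(2)]] B by (simp add: Hom_iff)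
    qed
  qed
  then have n1: "naturally_isomorphic A A id_fctr (comp_fctr S T)"
    unfolding naturally_isomorphic_def using \<eta>iso by blast
  have "nat_trans B B (comp_fctr T S) id_fctr \<epsilon>"
    unfolding nat_trans_def comp_fctr_simps Ss ids
  proof (intro conjI ballI idB functor_comp[OF S T] \<epsilon>(1))
    fix g assume g: "g \<in> Mor B"
    have o: "Dom B g \<in> Ob B" "Cod B g \<in> Ob B" using g B by auto
    show "\<epsilon> (Cod B g) \<cdot>\<^bsub>B\<^esub> fmor T (S1 g) = g \<cdot>\<^bsub>B\<^esub> \<epsilon> (Dom B g)"
      unfolding S1(2)[OF g] using comp_reassoc[OF \<epsilon>(4)[OF o(2)] B, of "g \<cdot>\<^bsub>B\<^esub> \<epsilon> (Dom B g)"]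
        \<epsilon>(1)[OF o(1)] \<epsilon>(1,2)[OF o(2)] g B by (simp add: Hom_iff)
  qed
  moreover have "is_iso B (\<epsilon> b)" if "b \<in> Ob B" for b
    using is_isoI[OF \<epsilon>(1)[OF that] \<epsilon>(2)[OF that] \<epsilon>(3)[OF that] \<epsilon>(4)[OF that]] .
  ultimately have n2: "naturally_isomorphic B B (comp_fctr T S) id_fctr"
    unfolding naturally_isomorphic_def by blast
  show ?thesis unfolding is_equivalence_def using T S n1 n2 by blast
qed

text \<open>Fullness supplies preimages of the sides of a square and of its lifts, and faithfulness
  reflects the equations between them.\<close>

lemma has_lift_iff:
  assumes i: "i \<in> Mor A" and p: "p \<in> Mor A"
  shows "has_lift A i p \<longleftrightarrow> has_lift B (fmor T i) (fmor T p)"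
proof -
  have o: "Dom A i \<in> Ob A" "Cod A i \<in> Ob A" "Dom A p \<in> Ob A" "Cod A p \<in> Ob A" using i p A by auto
  have iH: "i \<in> Hom A (Dom A i) (Cod A i)" and pH: "p \<in> Hom A (Dom A p) (Cod A p)" using i p by (auto simp: Hom_iff)
  have d: "Dom B (fmor T i) = fob T (Dom A i)" "Cod B (fmor T i) = fob T (Cod A i)"
    "Dom B (fmor T p) = fob T (Dom A p)" "Cod B (fmor T p) = fob T (Cod A p)" using i p T by auto
  show ?thesis
  proof
    assume l: "has_lift A i p"
    show "has_lift B (fmor T i) (fmor T p)"
      unfolding has_lift_def d
    proof (intro ballI impI)
      fix u v assume uv: "u \<in> Hom B (fob T (Dom A i)) (fob T (Dom A p))" "v \<in> Hom B (fob T (Cod A i)) (fob T (Cod A p))"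
        "fmor T p \<cdot>\<^bsub>B\<^esub> u = v \<cdot>\<^bsub>B\<^esub> fmor T i"
      obtain u' where u': "u' \<in> Hom A (Dom A i) (Dom A p)" "fmor T u' = u" using surj[OF o(1,3) uv(1)] by blast
      obtain v' where v': "v' \<in> Hom A (Cod A i) (Cod A p)" "fmor T v' = v" using surj[OF o(2,4) uv(2)] by blast
      have "p \<cdot>\<^bsub>A\<^esub> u' = v' \<cdot>\<^bsub>A\<^esub> i"
        by (rule inj[OF comp_Hom[OF A u'(1) pH] comp_Hom[OF A iH v'(1)]])
          (simp add: T_comp[OF u'(1) pH] T_comp[OF iH v'(1)] u'(2) v'(2) uv(3))
      then obtain h where h: "h \<in> Hom A (Cod A i) (Dom A p)" "h \<cdot>\<^bsub>A\<^esub> i = u'" "p \<cdot>\<^bsub>A\<^esub> h = v'"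
        by (rule has_liftE[OF l u'(1) v'(1)])
      have "fmor T h \<cdot>\<^bsub>B\<^esub> fmor T i = u" "fmor T p \<cdot>\<^bsub>B\<^esub> fmor T h = v"
        using T_comp[OF iH h(1)] T_comp[OF h(1) pH] h(2,3) u'(2) v'(2) by simp_all
      then show "\<exists>h\<in>Hom B (fob T (Cod A i)) (fob T (Dom A p)). h \<cdot>\<^bsub>B\<^esub> fmor T i = u \<and> fmor T p \<cdot>\<^bsub>B\<^esub> h = v"
        using T_Hom[OF h(1)] by blast
    qed
  next
    assume l: "has_lift B (fmor T i) (fmor T p)"
    show "has_lift A i p"
      unfolding has_lift_def
    proof (intro ballI impI)
      fix u v assume uv: "u \<in> Hom A (Dom A i) (Dom A p)" "v \<in> Hom A (Cod A i) (Cod A p)" "p \<cdot>\<^bsub>A\<^esub> u = v \<cdot>\<^bsub>A\<^esub> i"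
      have "fmor T p \<cdot>\<^bsub>B\<^esub> fmor T u = fmor T v \<cdot>\<^bsub>B\<^esub> fmor T i"
        using T_comp[OF uv(1) pH] T_comp[OF iH uv(2)] uv(3) by simp
      moreover have "fmor T u \<in> Hom B (Dom B (fmor T i)) (Dom B (fmor T p))" "fmor T v \<in> Hom B (Cod B (fmor T i)) (Cod B (fmor T p))"
        unfolding d using T_Hom uv by auto
      ultimately obtain k where k: "k \<in> Hom B (fob T (Cod A i)) (fob T (Dom A p))" "k \<cdot>\<^bsub>B\<^esub> fmor T i = fmor T u" "fmor T p \<cdot>\<^bsub>B\<^esub> k = fmor T v"
        using has_liftE[OF l] unfolding d by metis
      obtain h where h: "h \<in> Hom A (Cod A i) (Dom A p)" "fmor T h = k" using surj[OF o(2,3) k(1)] by blast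
      have "h \<cdot>\<^bsub>A\<^esub> i = u"
        by (rule inj[OF comp_Hom[OF A iH h(1)] uv(1)]) (simp add: T_comp[OF iH h(1)] h(2) k(2))
      moreover have "p \<cdot>\<^bsub>A\<^esub> h = v"
        by (rule inj[OF comp_Hom[OF A h(1) pH] uv(2)]) (simp add: T_comp[OF h(1) pH] h(2) k(3))
      ultimately show "\<exists>h\<in>Hom A (Cod A i) (Dom A p). h \<cdot>\<^bsub>A\<^esub> i = u \<and> p \<cdot>\<^bsub>A\<^esub> h = v" using h(1) by blast
    qed
  qed
qed

lemma arrow_full:
  assumes "f \<in> Mor A" "g \<in> Mor A" "t \<in> Hom (arrow_cat B) (fmor T f) (fmor T g)"
  obtains s where "s \<in> Hom (arrow_cat A) f g" "(fmor T f, fmor T g, fmor T (top_side s), fmor T (bot_side s)) = t"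
proof -
  have o: "Dom A f \<in> Ob A" "Cod A f \<in> Ob A" "Dom A g \<in> Ob A" "Cod A g \<in> Ob A" using assms(1,2) A by auto
  have fH: "f \<in> Hom A (Dom A f) (Cod A f)" and gH: "g \<in> Hom A (Dom A g) (Cod A g)" using assms(1,2) by (auto simp: Hom_iff)
  obtain u v where t: "t = (fmor T f, fmor T g, u, v)" "u \<in> Hom B (fob T (Dom A f)) (fob T (Dom A g))"
    "v \<in> Hom B (fob T (Cod A f)) (fob T (Cod A g))" "fmor T g \<cdot>\<^bsub>B\<^esub> u = v \<cdot>\<^bsub>B\<^esub> fmor T f"
    using assms(3) dom_fmor[OF T] cod_fmor[OF T] assms(1,2) by (auto simp: Hom_arrow)
  obtain u' where u': "u' \<in> Hom A (Dom A f) (Dom A g)" "fmor T u' = u" using surj[OF o(1,3) t(2)] by blast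
  obtain v' where v': "v' \<in> Hom A (Cod A f) (Cod A g)" "fmor T v' = v" using surj[OF o(2,4) t(3)] by blast
  have "g \<cdot>\<^bsub>A\<^esub> u' = v' \<cdot>\<^bsub>A\<^esub> f"
    by (rule inj[OF comp_Hom[OF A u'(1) gH] comp_Hom[OF A fH v'(1)]])
      (simp add: T_comp[OF u'(1) gH] T_comp[OF fH v'(1)] u'(2) v'(2) t(4))
  then have "(f, g, u', v') \<in> Hom (arrow_cat A) f g" unfolding Hom_arrow_iff using assms u' v' by simp
  then show thesis using that[of "(f, g, u', v')"] t(1) u'(2) v'(2) by simp
qed

lemma arrow_iso_iff:
  assumes f: "f \<in> Mor A" and g: "g \<in> Mor A"
  shows "isomorphic (arrow_cat A) f g \<longleftrightarrow> isomorphic (arrow_cat B) (fmor T f) (fmor T g)"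
proof
  have Tm: "fmor T f \<in> Mor B" "fmor T g \<in> Mor B" using f g T by auto
  have img: "(fmor T f, fmor T g, fmor T u, fmor T v) \<in> Hom (arrow_cat B) (fmor T f) (fmor T g)"
    if "(f, g, u, v) \<in> Hom (arrow_cat A) f g" for f g u v
  proof -
    have d: "f \<in> Mor A" "g \<in> Mor A" "u \<in> Hom A (Dom A f) (Dom A g)" "v \<in> Hom A (Cod A f) (Cod A g)" "g \<cdot>\<^bsub>A\<^esub> u = v \<cdot>\<^bsub>A\<^esub> f"
      using that unfolding Hom_arrow_iff by auto
    have h: "f \<in> Hom A (Dom A f) (Cod A f)" "g \<in> Hom A (Dom A g) (Cod A g)" using d by (auto simp: Hom_iff)
    show ?thesis
      unfolding Hom_arrow_iff using d T T_Hom[OF d(3)] T_Hom[OF d(4)] T_comp[OF d(3) h(2)] T_comp[OF h(1) d(4)] by simp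
  qed
  {
    assume "isomorphic (arrow_cat A) f g"
    then obtain s where s: "s \<in> Hom (arrow_cat A) f g" "is_iso (arrow_cat A) s" by (auto simp: isomorphic_def)
    obtain s' where s': "s' \<in> Hom (arrow_cat A) g f" "s' \<cdot>\<^bsub>arrow_cat A\<^esub> s = Idt (arrow_cat A) f" "s \<cdot>\<^bsub>arrow_cat A\<^esub> s' = Idt (arrow_cat A) g"
      using is_isoE[OF s(2)] s(1) by (metis Hom_iff)
    obtain u v where u: "s = (f, g, u, v)" "u \<in> Hom A (Dom A f) (Dom A g)" "v \<in> Hom A (Cod A f) (Cod A g)"
      using s(1) by (auto simp: Hom_arrow)
    obtain u' v' where u': "s' = (g, f, u', v')" "u' \<in> Hom A (Dom A g) (Dom A f)" "v' \<in> Hom A (Cod A g) (Cod A f)"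
      using s'(1) by (auto simp: Hom_arrow)
    have e: "u' \<cdot>\<^bsub>A\<^esub> u = Idt A (Dom A f)" "v' \<cdot>\<^bsub>A\<^esub> v = Idt A (Cod A f)" "u \<cdot>\<^bsub>A\<^esub> u' = Idt A (Dom A g)" "v \<cdot>\<^bsub>A\<^esub> v' = Idt A (Cod A g)"
      using s'(2,3) unfolding u(1) u'(1) arrow_cat_simps by auto
    have o: "Dom A f \<in> Ob A" "Cod A f \<in> Ob A" "Dom A g \<in> Ob A" "Cod A g \<in> Ob A" using f g A by auto
    have Te: "fmor T u' \<cdot>\<^bsub>B\<^esub> fmor T u = Idt B (fob T (Dom A f))" "fmor T v' \<cdot>\<^bsub>B\<^esub> fmor T v = Idt B (fob T (Cod A f))"
      "fmor T u \<cdot>\<^bsub>B\<^esub> fmor T u' = Idt B (fob T (Dom A g))" "fmor T v \<cdot>\<^bsub>B\<^esub> fmor T v' = Idt B (fob T (Cod A g))"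
      using T_comp[OF u(2) u'(2)] T_comp[OF u'(2) u(2)] T_comp[OF u(3) u'(3)] T_comp[OF u'(3) u(3)] e T_idt o by auto
    have "is_iso (arrow_cat B) (fmor T f, fmor T g, fmor T u, fmor T v)"
      by (rule is_isoI[OF img img, of _ _ _ _ u' v'])
        (use s(1) s'(1) u(1) u'(1) Te f g T in \<open>simp_all add: arrow_cat_simps\<close>)
    then show "isomorphic (arrow_cat B) (fmor T f) (fmor T g)"
      unfolding isomorphic_def using img s(1) u(1) by blast
  next
    assume "isomorphic (arrow_cat B) (fmor T f) (fmor T g)"
    then obtain t where t: "t \<in> Hom (arrow_cat B) (fmor T f) (fmor T g)" "is_iso (arrow_cat B) t" by (auto simp: isomorphic_def)
    obtain t' where t': "t' \<in> Hom (arrow_cat B) (fmor T g) (fmor T f)" "t' \<cdot>\<^bsub>arrow_cat B\<^esub> t = Idt (arrow_cat B) (fmor T f)"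
      "t \<cdot>\<^bsub>arrow_cat B\<^esub> t' = Idt (arrow_cat B) (fmor T g)"
      using is_isoE[OF t(2)] t(1) by (metis Hom_iff)
    obtain s where s: "s \<in> Hom (arrow_cat A) f g" "(fmor T f, fmor T g, fmor T (top_side s), fmor T (bot_side s)) = t"
      by (rule arrow_full[OF f g t(1)])
    obtain s' where s': "s' \<in> Hom (arrow_cat A) g f" "(fmor T g, fmor T f, fmor T (top_side s'), fmor T (bot_side s')) = t'"
      by (rule arrow_full[OF g f t'(1)])
    obtain u v where u: "s = (f, g, u, v)" "u \<in> Hom A (Dom A f) (Dom A g)" "v \<in> Hom A (Cod A f) (Cod A g)"
      using s(1) by (auto simp: Hom_arrow)
    obtain u' v' where u': "s' = (g, f, u', v')" "u' \<in> Hom A (Dom A g) (Dom A f)" "v' \<in> Hom A (Cod A g) (Cod A f)"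
      using s'(1) by (auto simp: Hom_arrow)
    have o: "Dom A f \<in> Ob A" "Cod A f \<in> Ob A" "Dom A g \<in> Ob A" "Cod A g \<in> Ob A" using f g A by auto
    have Te: "fmor T u' \<cdot>\<^bsub>B\<^esub> fmor T u = Idt B (fob T (Dom A f))" "fmor T v' \<cdot>\<^bsub>B\<^esub> fmor T v = Idt B (fob T (Cod A f))"
      "fmor T u \<cdot>\<^bsub>B\<^esub> fmor T u' = Idt B (fob T (Dom A g))" "fmor T v \<cdot>\<^bsub>B\<^esub> fmor T v' = Idt B (fob T (Cod A g))"
      using t'(2,3) f g T unfolding s(2)[symmetric] s'(2)[symmetric] u(1) u'(1) side_simps arrow_cat_simps by auto
    have idH: "Idt A a \<in> Hom A a a" if "a \<in> Ob A" for a using that A by (simp add: Hom_iff)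
    have e: "u' \<cdot>\<^bsub>A\<^esub> u = Idt A (Dom A f)" "v' \<cdot>\<^bsub>A\<^esub> v = Idt A (Cod A f)" "u \<cdot>\<^bsub>A\<^esub> u' = Idt A (Dom A g)" "v \<cdot>\<^bsub>A\<^esub> v' = Idt A (Cod A g)"
      using inj[OF comp_Hom[OF A u(2) u'(2)] idH] inj[OF comp_Hom[OF A u(3) u'(3)] idH]
        inj[OF comp_Hom[OF A u'(2) u(2)] idH] inj[OF comp_Hom[OF A u'(3) u(3)] idH]
        T_comp[OF u(2) u'(2)] T_comp[OF u'(2) u(2)] T_comp[OF u(3) u'(3)] T_comp[OF u'(3) u(3)] T_idt o Te by auto
    have "is_iso (arrow_cat A) s"
      by (rule is_isoI[OF s(1) s'(1)]) (use e in \<open>simp_all add: u(1) u'(1) arrow_cat_simps\<close>)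
    then show "isomorphic (arrow_cat A) f g" unfolding isomorphic_def using s(1) by blast
  }
qed

text \<open>Conjugation by isomorphisms of both endpoints with objects in the image gives a morphism
  that fullness can lift.\<close>

lemma arrow_ess:
  assumes q: "q \<in> Mor B"
  obtains f where "f \<in> Mor A" "isomorphic (arrow_cat B) q (fmor T f)"
proof -
  have o: "Dom B q \<in> Ob B" "Cod B q \<in> Ob B" using q B by auto
  obtain a e e' where a: "a \<in> Ob A" "e \<in> Hom B (fob T a) (Dom B q)" "e' \<in> Hom B (Dom B q) (fob T a)"
    "e' \<cdot>\<^bsub>B\<^esub> e = Idt B (fob T a)" "e \<cdot>\<^bsub>B\<^esub> e' = Idt B (Dom B q)" using ess[OF o(1)] by blast
  obtain b d d' where b: "b \<in> Ob A" "d \<in> Hom B (fob T b) (Cod B q)" "d' \<in> Hom B (Cod B q) (fob T b)"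
    "d' \<cdot>\<^bsub>B\<^esub> d = Idt B (fob T b)" "d \<cdot>\<^bsub>B\<^esub> d' = Idt B (Cod B q)" using ess[OF o(2)] by blast
  have "d' \<cdot>\<^bsub>B\<^esub> (q \<cdot>\<^bsub>B\<^esub> e) \<in> Hom B (fob T a) (fob T b)" using q a b B by (simp add: Hom_iff)
  then obtain f where f: "f \<in> Hom A a b" "fmor T f = d' \<cdot>\<^bsub>B\<^esub> (q \<cdot>\<^bsub>B\<^esub> e)" using surj[OF a(1) b(1)] by blast
  have fm: "f \<in> Mor A" "Dom A f = a" "Cod A f = b" using f(1) by (auto simp: Hom_iff)
  have Tm: "fmor T f \<in> Mor B" "Dom B (fmor T f) = fob T a" "Cod B (fmor T f) = fob T b" using fm T by auto
  have 1: "(q, fmor T f, e', d') \<in> Hom (arrow_cat B) q (fmor T f)"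
    unfolding Hom_arrow_iff Tm(2,3) using Tm(1) q a b B f(2) by (simp add: Hom_iff)
  have 2: "(fmor T f, q, e, d) \<in> Hom (arrow_cat B) (fmor T f) q"
    unfolding Hom_arrow_iff Tm(2,3) using Tm(1) q a b B f(2) comp_reassoc[OF b(5) B, of "q \<cdot>\<^bsub>B\<^esub> e"]
    by (simp add: Hom_iff)
  have "is_iso (arrow_cat B) (q, fmor T f, e', d')"
    by (rule is_isoI[OF 1 2]) (use a b Tm in \<open>simp_all add: arrow_cat_simps\<close>)
  then show thesis using that fm(1) 1 unfolding isomorphic_def by blast
qed

end

lemma isomorphicE:
  fixes C (structure)
  assumes "isomorphic C a b"
  obtains f g where "f \<in> Hom C a b" "g \<in> Hom C b a" "g \<cdot> f = Idt C a" "f \<cdot> g = Idt C b"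
proof -
  obtain f where f: "f \<in> Hom C a b" "is_iso C f" using assms by (auto simp: isomorphic_def)
  from f(2) obtain g where "g \<in> Hom C (Cod C f) (Dom C f)" "g \<cdot> f = Idt C (Dom C f)" "f \<cdot> g = Idt C (Cod C f)"
    by (rule is_isoE)
  then show thesis using that f(1) by (simp add: Hom_iff)
qed

lemma isomorphic_retract:
  assumes "isomorphic C a b"
  shows "is_retract C a b" "is_retract C b a"
  using isomorphicE[OF assms] unfolding is_retract_def by metis+

lemma has_lift_retract_left:
  fixes C (structure)
  assumes C: "category C" and r: "is_retract (arrow_cat C) i i'" and l: "has_lift C i' p" and p: "p \<in> Mor C"
  shows "has_lift C i p"
  unfolding has_lift_def
proof (intro ballI impI)
  fix u v assume u: "u \<in> Hom C (Dom C i) (Dom C p)" and v: "v \<in> Hom C (Cod C i) (Cod C p)" and eq: "p \<cdot> u = v \<cdot> i"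
  obtain s t where st: "s \<in> Hom (arrow_cat C) i i'" "t \<in> Hom (arrow_cat C) i' i" "t \<cdot>\<^bsub>arrow_cat C\<^esub> s = Idt (arrow_cat C) i"
    using r by (auto simp: is_retract_def)
  obtain a b where s: "s = (i, i', a, b)" "i \<in> Mor C" "i' \<in> Mor C" "a \<in> Hom C (Dom C i) (Dom C i')" "b \<in> Hom C (Cod C i) (Cod C i')" "i' \<cdot> a = b \<cdot> i"
    using st(1) by (rule Hom_arrowE)
  obtain a' b' where t: "t = (i', i, a', b')" "a' \<in> Hom C (Dom C i') (Dom C i)" "b' \<in> Hom C (Cod C i') (Cod C i)" "i \<cdot> a' = b' \<cdot> i'"
    using st(2) by (rule Hom_arrowE)
  have e: "a' \<cdot> a = Idt C (Dom C i)" "b' \<cdot> b = Idt C (Cod C i)" using st(3) unfolding s(1) t(1) arrow_cat_simps by auto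
  have "p \<cdot> (u \<cdot> a') = (v \<cdot> b') \<cdot> i'"
    using comp_reassoc[OF eq C, of a'] u v t s(2,3) p C by (simp add: Hom_iff)
  then obtain h where h: "h \<in> Hom C (Cod C i') (Dom C p)" "h \<cdot> i' = u \<cdot> a'" "p \<cdot> h = v \<cdot> b'"
    by (rule has_liftE[OF l comp_Hom[OF C t(2) u] comp_Hom[OF C t(3) v]])
  have "(h \<cdot> b) \<cdot> i = h \<cdot> (i' \<cdot> a)" using h(1) s C by (simp add: Hom_iff)
  also have "\<dots> = (u \<cdot> a') \<cdot> a" by (rule comp_reassoc[OF h(2) C]) (use h(1) s in \<open>simp_all add: Hom_iff\<close>)
  also have "\<dots> = u" using u t(2) s(4) e(1) C by (simp add: Hom_iff)
  finally have "(h \<cdot> b) \<cdot> i = u" .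
  moreover have "p \<cdot> (h \<cdot> b) = v"
    using comp_reassoc[OF h(3) C, of b] h(1) s(5) p v t(3) e(2) C by (simp add: Hom_iff)
  ultimately show "\<exists>h\<in>Hom C (Cod C i) (Dom C p). h \<cdot> i = u \<and> p \<cdot> h = v"
    using comp_Hom[OF C s(5) h(1)] by blast
qed

lemma has_lift_retract_right:
  fixes C (structure)
  assumes C: "category C" and r: "is_retract (arrow_cat C) p p'" and l: "has_lift C i p'" and i: "i \<in> Mor C"
  shows "has_lift C i p"
  unfolding has_lift_def
proof (intro ballI impI)
  fix u v assume u: "u \<in> Hom C (Dom C i) (Dom C p)" and v: "v \<in> Hom C (Cod C i) (Cod C p)" and eq: "p \<cdot> u = v \<cdot> i"
  obtain s t where st: "s \<in> Hom (arrow_cat C) p p'" "t \<in> Hom (arrow_cat C) p' p" "t \<cdot>\<^bsub>arrow_cat C\<^esub> s = Idt (arrow_cat C) p"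
    using r by (auto simp: is_retract_def)
  obtain a b where s: "s = (p, p', a, b)" "p \<in> Mor C" "p' \<in> Mor C" "a \<in> Hom C (Dom C p) (Dom C p')" "b \<in> Hom C (Cod C p) (Cod C p')" "p' \<cdot> a = b \<cdot> p"
    using st(1) by (rule Hom_arrowE)
  obtain a' b' where t: "t = (p', p, a', b')" "a' \<in> Hom C (Dom C p') (Dom C p)" "b' \<in> Hom C (Cod C p') (Cod C p)" "p \<cdot> a' = b' \<cdot> p'"
    using st(2) by (rule Hom_arrowE)
  have e: "a' \<cdot> a = Idt C (Dom C p)" "b' \<cdot> b = Idt C (Cod C p)" using st(3) unfolding s(1) t(1) arrow_cat_simps by auto
  have "p' \<cdot> (a \<cdot> u) = (b \<cdot> v) \<cdot> i"
    using comp_reassoc[OF s(6) C, of u] eq u v s i C by (simp add: Hom_iff)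
  then obtain h where h: "h \<in> Hom C (Cod C i) (Dom C p')" "h \<cdot> i = a \<cdot> u" "p' \<cdot> h = b \<cdot> v"
    by (rule has_liftE[OF l comp_Hom[OF C u s(4)] comp_Hom[OF C v s(5)]])
  have "(a' \<cdot> h) \<cdot> i = u"
    using comp_reassoc[OF e(1) C, of u] h(1,2) t(2) i u s(4) C by (simp add: Hom_iff)
  moreover have "p \<cdot> (a' \<cdot> h) = v"
    using comp_reassoc[OF t(4) C, of h] comp_reassoc[OF e(2) C, of v] h(1,3) t(2,3) s(2-5) v C by (simp add: Hom_iff)
  ultimately show "\<exists>h\<in>Hom C (Cod C i) (Dom C p). h \<cdot> i = u \<and> p \<cdot> h = v"
    using comp_Hom[OF C h(1) t(2)] by blast
qed

section \<open>The ind-category\<close>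

context lfp_category
begin

text \<open>The class in \<open>hom_colim J M Y a\<close> of the maps \<open>a \<rightarrow> Y t\<close> that induce a given map \<open>f\<close> to the colimit.\<close>

definition cls :: "('u, 'u) cat \<Rightarrow> ('u, 'u, 'o, 'm) fctr \<Rightarrow> ('u \<Rightarrow> 'm) \<Rightarrow> 'o \<Rightarrow> 'm \<Rightarrow> ('u \<times> 'm) set" where
  "cls J Y \<iota> a f = {(t, g). t \<in> Ob J \<and> g \<in> Hom C a (fob Y t) \<and> \<iota> t \<cdot> g = f}"

lemma ind_obs_iff:
  "((J :: ('u, 'u) cat), Y) \<in> ind_obs M \<longleftrightarrow> small_index U J \<and> is_functor J C Y \<and> (\<forall>j\<in>Ob J. fp (fob Y j))"
  unfolding ind_obs_def small_filtered_iff[of _ U] functor_M by simp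

text \<open>The ind-category is built from \<open>M\<close>, while finite presentability speaks
  about \<open>C\<close>. As \<open>M\<close> is full, both see the same hom-sets.\<close>

lemma hom_diag_M:
  assumes "is_functor J M Y" "fp a"
  shows "hom_diag J M Y a = hom_diag J C Y a"
  using assms unfolding hom_diag_def functor_M by (auto simp: Hom_M)

lemma hom_eqv_M:
  assumes Y: "is_functor J M Y" and a: "fp a"
  shows "hom_eqv J M Y a = hom_eqv J C Y a"
proof -
  have J: "category J" using is_functor_cat[OF Y] by simp
  have "f \<in> Hom M a (fob Y (Dom J u)) \<longleftrightarrow> f \<in> Hom C a (fob Y (Dom J u))" if "u \<in> Mor J" for f u
    using Y a that J unfolding functor_M Hom_M by simp
  then have "{((Dom J u, f), (Cod J u, fmor Y u \<cdot>\<^bsub>M\<^esub> f)) | u f. u \<in> Mor J \<and> f \<in> Hom M a (fob Y (Dom J u))} =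
    {((Dom J u, f), (Cod J u, fmor Y u \<cdot> f)) | u f. u \<in> Mor J \<and> f \<in> Hom C a (fob Y (Dom J u))}"
    unfolding M_simps(6) by blast
  then show ?thesis unfolding hom_eqv_def by simp
qed

context
  fixes J :: "('u, 'u) cat" and Y L \<iota> a
  assumes JY: "(J, Y) \<in> ind_obs M" and L: "is_colimit J C Y L \<iota>" and a: "fp a"
begin

lemma Y_functors: "is_functor J M Y" "is_functor J C Y" "small_index U J"
  using JY unfolding ind_obs_iff functor_M by auto

text \<open>Finite presentability of \<open>a\<close> makes an equivalence class the full set of
  representatives of one map into the colimit. Computations with quotients thereby become
  computations with maps of \<open>C\<close>.\<close>

lemma eqv_cls:
  assumes "t \<in> Ob J" "g \<in> Hom C a (fob Y t)"
  shows "hom_eqv J M Y a `` {(t, g)} = cls J Y \<iota> a (\<iota> t \<cdot> g)"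
  unfolding hom_eqv_M[OF Y_functors(1) a] cls_def
  by (rule finitely_presentable_class[OF a _ Y_functors(2) L assms])
    (use Y_functors(3) in \<open>simp only: small_filtered_iff[of J U]\<close>)

lemma cls_nonempty:
  assumes "f \<in> Hom C a L"
  obtains t g where "(t, g) \<in> cls J Y \<iota> a f"
  by (rule finitely_presentable_factor[OF a Y_functors(3,2) L assms]) (rule that, simp add: cls_def)

lemma hom_colim_iff: "c \<in> hom_colim J M Y a \<longleftrightarrow> (\<exists>f\<in>Hom C a L. c = cls J Y \<iota> a f)"
proof
  assume "c \<in> hom_colim J M Y a"
  then obtain t g where tg: "(t, g) \<in> hom_diag J C Y a" "c = hom_eqv J M Y a `` {(t, g)}"
    unfolding hom_colim_def hom_diag_M[OF Y_functors(1) a] by (metis quotientE surj_pair)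
  have d: "t \<in> Ob J" "g \<in> Hom C a (fob Y t)" using tg(1) by (auto simp: hom_diag_iff)
  have "\<iota> t \<cdot> g \<in> Hom C a L" using d cocone_facts[OF colimit_cocone[OF L]] C by (simp add: Hom_iff)
  then show "\<exists>f\<in>Hom C a L. c = cls J Y \<iota> a f" unfolding tg(2) eqv_cls[OF d] by blast
next
  assume "\<exists>f\<in>Hom C a L. c = cls J Y \<iota> a f"
  then obtain f where f: "f \<in> Hom C a L" "c = cls J Y \<iota> a f" by blast
  obtain t g where tg: "(t, g) \<in> cls J Y \<iota> a f" by (rule cls_nonempty[OF f(1)])
  then have d: "t \<in> Ob J" "g \<in> Hom C a (fob Y t)" "\<iota> t \<cdot> g = f" by (auto simp: cls_def)
  have "(t, g) \<in> hom_diag J M Y a" unfolding hom_diag_M[OF Y_functors(1) a] using d by (simp add: hom_diag_iff)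
  then show "c \<in> hom_colim J M Y a"
    unfolding f(2) d(3)[symmetric] eqv_cls[OF d(1,2), symmetric] hom_colim_def by (rule quotientI)
qed

end

end

section \<open>Morphisms of the ind-category as maps between colimits\<close>

lemma Ind_simps:
  "Ob (Ind U D) = ind_obs D"
  "(P, Q, \<phi>) \<in> Mor (Ind U D) \<longleftrightarrow> P \<in> ind_obs D \<and> Q \<in> ind_obs D \<and> \<phi> \<in> ind_hom D P Q"
  "Dom (Ind U D) (P, Q, \<phi>) = P" "Cod (Ind U D) (P, Q, \<phi>) = Q"
  "Idt (Ind U D) (I, X) = ((I, X), (I, X), \<lambda>s. if s \<in> Ob I then hom_eqv I D X (fob X s) `` {(s, Idt D (fob X s))} else {})"
  "(Q, (K, Z), \<psi>) \<cdot>\<^bsub>Ind U D\<^esub> ((I, X), Q', \<phi>) = ((I, X), (K, Z), \<lambda>s. if s \<in> Ob I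
     then (\<Union>(t, f) \<in> \<phi> s. \<Union>(r, g) \<in> \<psi> t. hom_eqv K D Z (fob X s) `` {(r, g \<cdot>\<^bsub>D\<^esub> f)}) else {})"
  by (simp_all add: Ind_def)

text \<open>A choice of colimit for each ind-object, made without reference to a functor: it serves
  both to construct the natural functor and to analyse a given one.\<close>

locale ind_colimits = lfp_category U C for U :: "'u itself" and C :: "('o, 'm) cat" (structure) +
  fixes L :: "('u, 'o, 'm) ind_ob \<Rightarrow> 'o" and \<iota> :: "('u, 'o, 'm) ind_ob \<Rightarrow> 'u \<Rightarrow> 'm"
  assumes colim: "\<And>J X. (J, X) \<in> ind_obs (fp_subcat U C) \<Longrightarrow> is_colimit J C X (L (J, X)) (\<iota> (J, X))"
begin

abbreviation "IM \<equiv> Ind U M"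

text \<open>The compatible family of classes that represents a map \<open>h\<close> between the
  colimits; it is empty off the index category, as the encoding of morphisms demands.\<close>

definition hmap :: "('u, 'o, 'm) ind_ob \<Rightarrow> ('u, 'o, 'm) ind_ob \<Rightarrow> 'm \<Rightarrow> 'u \<Rightarrow> ('u \<times> 'm) set" where
  "hmap P Q h = (\<lambda>s. if s \<in> Ob (fst P) then cls (fst Q) (snd Q) (\<iota> Q) (fob (snd P) s) (h \<cdot> \<iota> P s) else {})"

lemma \<iota>_facts:
  assumes "(J, X) \<in> ind_obs M"
  shows "L (J, X) \<in> Ob C" "\<And>j. j \<in> Ob J \<Longrightarrow> \<iota> (J, X) j \<in> Mor C" "\<And>j. j \<in> Ob J \<Longrightarrow> Dom C (\<iota> (J, X) j) = fob X j"
    "\<And>j. j \<in> Ob J \<Longrightarrow> Cod C (\<iota> (J, X) j) = L (J, X)"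
    "\<And>u. u \<in> Mor J \<Longrightarrow> \<iota> (J, X) (Cod J u) \<cdot> fmor X u = \<iota> (J, X) (Dom J u)"
  using cocone_facts[OF colimit_cocone[OF colim[OF assms]]] cocone_comm[OF colimit_cocone[OF colim[OF assms]]] by auto

lemma hmap_mem:
  assumes "(I, X) \<in> ind_obs M" "(J, Y) \<in> ind_obs M" "s \<in> Ob I"
  shows "(t, g) \<in> hmap (I, X) (J, Y) h s \<longleftrightarrow>
    t \<in> Ob J \<and> g \<in> Hom C (fob X s) (fob Y t) \<and> \<iota> (J, Y) t \<cdot> g = h \<cdot> \<iota> (I, X) s"
  using assms by (simp add: hmap_def cls_def)

lemma hmap_Hom:
  assumes "(I, X) \<in> ind_obs M" "h \<in> Hom C (L (I, X)) B" "s \<in> Ob I"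
  shows "h \<cdot> \<iota> (I, X) s \<in> Hom C (fob X s) B"
  using \<iota>_facts[OF assms(1)] assms(2,3) C by (simp add: Hom_iff)

lemma hmap_nonempty:
  assumes P: "(I, X) \<in> ind_obs M" and Q: "(J, Y) \<in> ind_obs M" and h: "h \<in> Hom C (L (I, X)) (L (J, Y))" and s: "s \<in> Ob I"
  obtains t g where "(t, g) \<in> hmap (I, X) (J, Y) h s" "t \<in> Ob J" "g \<in> Hom C (fob X s) (fob Y t)"
    "\<iota> (J, Y) t \<cdot> g = h \<cdot> \<iota> (I, X) s"
proof -
  have a: "fp (fob X s)" using P s by (simp add: ind_obs_iff)
  obtain t g where "(t, g) \<in> cls J Y (\<iota> (J, Y)) (fob X s) (h \<cdot> \<iota> (I, X) s)"
    by (rule cls_nonempty[OF Q colim[OF Q] a hmap_Hom[OF P h s]])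
  then have "(t, g) \<in> hmap (I, X) (J, Y) h s" using s by (simp add: hmap_def)
  then show thesis using that unfolding hmap_mem[OF P Q s] by blast
qed

lemma hmap_inj:
  assumes P: "(I, X) \<in> ind_obs M" and Q: "(J, Y) \<in> ind_obs M" and h: "h \<in> Hom C (L (I, X)) (L (J, Y))" "h' \<in> Hom C (L (I, X)) (L (J, Y))"
    and eq: "hmap (I, X) (J, Y) h = hmap (I, X) (J, Y) h'"
  shows "h = h'"
proof -
  have X: "is_functor I C X" using P by (simp add: ind_obs_iff)
  show ?thesis
  proof (rule colimit_unique[OF C X colim[OF P] h])
    fix s assume s: "s \<in> Ob I"
    obtain t g where tg: "(t, g) \<in> hmap (I, X) (J, Y) h s" "\<iota> (J, Y) t \<cdot> g = h \<cdot> \<iota> (I, X) s"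
      by (rule hmap_nonempty[OF P Q h(1) s])
    then show "h \<cdot> \<iota> (I, X) s = h' \<cdot> \<iota> (I, X) s" unfolding eq hmap_mem[OF P Q s] by simp
  qed
qed

text \<open>A family selects for each stage one map into the colimit of \<open>Y\<close>, and
  compatibility makes these maps a cocone, so the family comes from one map \<open>h\<close> of
  colimits.\<close>

lemma ind_hom_iff:
  assumes P: "(I, X) \<in> ind_obs M" and Q: "(J, Y) \<in> ind_obs M"
  shows "\<phi> \<in> ind_hom M (I, X) (J, Y) \<longleftrightarrow> (\<exists>h\<in>Hom C (L (I, X)) (L (J, Y)). \<phi> = hmap (I, X) (J, Y) h)"
proof
  have X: "is_functor I C X" and fpX: "\<And>s. s \<in> Ob I \<Longrightarrow> fp (fob X s)" using P by (auto simp: ind_obs_iff)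
  note Pi = \<iota>_facts[OF P] and Qi = \<iota>_facts[OF Q]
  have cI: "category I" using is_functor_cat[OF X] by simp
  {
    assume ph: "\<phi> \<in> ind_hom M (I, X) (J, Y)"
    have 0: "\<phi> s = {}" if "s \<notin> Ob I" for s using ph that by (simp add: ind_hom_def)
    have 1: "\<phi> s \<in> hom_colim J M Y (fob X s)" if "s \<in> Ob I" for s using ph that by (simp add: ind_hom_def)
    have 2: "(t, f \<cdot> fmor X u) \<in> \<phi> (Dom I u)" if "u \<in> Mor I" "(t, f) \<in> \<phi> (Cod I u)" for u t f
      using ph that by (fastforce simp: ind_hom_def M_simps)
    have "\<exists>f. f \<in> Hom C (fob X s) (L (J, Y)) \<and> \<phi> s = cls J Y (\<iota> (J, Y)) (fob X s) f" if s: "s \<in> Ob I" for s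
      using 1[OF s] hom_colim_iff[OF Q colim[OF Q] fpX[OF s]] by blast
    then obtain f where f: "\<And>s. s \<in> Ob I \<Longrightarrow> f s \<in> Hom C (fob X s) (L (J, Y))"
      "\<And>s. s \<in> Ob I \<Longrightarrow> \<phi> s = cls J Y (\<iota> (J, Y)) (fob X s) (f s)" by metis
    have "cocone I C X (L (J, Y)) f"
      unfolding cocone_def
    proof (intro conjI ballI Qi(1) f(1))
      fix u assume u: "u \<in> Mor I"
      have o: "Dom I u \<in> Ob I" "Cod I u \<in> Ob I" using u cI by auto
      obtain t g where tg: "(t, g) \<in> cls J Y (\<iota> (J, Y)) (fob X (Cod I u)) (f (Cod I u))"
        by (rule cls_nonempty[OF Q colim[OF Q] fpX[OF o(2)] f(1)[OF o(2)]])
      then have t: "t \<in> Ob J" "g \<in> Hom C (fob X (Cod I u)) (fob Y t)" "\<iota> (J, Y) t \<cdot> g = f (Cod I u)"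
        by (auto simp: cls_def)
      have "(t, g \<cdot> fmor X u) \<in> \<phi> (Dom I u)" using 2[OF u] tg f(2)[OF o(2)] by simp
      then have "\<iota> (J, Y) t \<cdot> (g \<cdot> fmor X u) = f (Dom I u)" unfolding f(2)[OF o(1)] by (simp add: cls_def)
      then show "f (Cod I u) \<cdot> fmor X u = f (Dom I u)"
        unfolding t(3)[symmetric] using t(1,2) Qi u X C by (simp add: Hom_iff)
    qed
    then obtain h where h: "h \<in> Hom C (L (I, X)) (L (J, Y))" "\<And>s. s \<in> Ob I \<Longrightarrow> h \<cdot> \<iota> (I, X) s = f s"
      using colimit_induced[OF colim[OF P]] by blast
    have "\<phi> = hmap (I, X) (J, Y) h"
      by (rule ext) (use 0 f(2) h(2) in \<open>simp add: hmap_def\<close>)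
    then show "\<exists>h\<in>Hom C (L (I, X)) (L (J, Y)). \<phi> = hmap (I, X) (J, Y) h" using h(1) by blast
  next
    assume "\<exists>h\<in>Hom C (L (I, X)) (L (J, Y)). \<phi> = hmap (I, X) (J, Y) h"
    then obtain h where h: "h \<in> Hom C (L (I, X)) (L (J, Y))" "\<phi> = hmap (I, X) (J, Y) h" by blast
    have "hmap (I, X) (J, Y) h s \<in> hom_colim J M Y (fob X s)" if s: "s \<in> Ob I" for s
      unfolding hom_colim_iff[OF Q colim[OF Q] fpX[OF s]] using hmap_Hom[OF P h(1) s] s by (auto simp: hmap_def)
    moreover have "(t, g \<cdot> fmor X u) \<in> hmap (I, X) (J, Y) h (Dom I u)"
      if u: "u \<in> Mor I" and tg: "(t, g) \<in> hmap (I, X) (J, Y) h (Cod I u)" for u t g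
    proof -
      have o: "Dom I u \<in> Ob I" "Cod I u \<in> Ob I" using u cI by auto
      have t: "t \<in> Ob J" "g \<in> Hom C (fob X (Cod I u)) (fob Y t)" "\<iota> (J, Y) t \<cdot> g = h \<cdot> \<iota> (I, X) (Cod I u)"
        using tg unfolding hmap_mem[OF P Q o(2)] by auto
      show ?thesis
        unfolding hmap_mem[OF P Q o(1)]
        using t(1,2) comp_reassoc[OF t(3) C, of "fmor X u"] Pi(2-4)[OF o(2)] Pi(5)[OF u] Qi(2-4)[OF t(1)] u X C h(1)
        by (simp add: Hom_iff)
    qed
    ultimately show "\<phi> \<in> ind_hom M (I, X) (J, Y)"
      unfolding h(2) ind_hom_def M_simps by (simp add: hmap_def[of "(I, X)" "(J, Y)"] split_beta)
  }
qed

lemma Ind_morE: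
  assumes "\<phi> \<in> Mor IM"
  obtains I X J Y h where "(I, X) \<in> ind_obs M" "(J, Y) \<in> ind_obs M" "h \<in> Hom C (L (I, X)) (L (J, Y))"
    "\<phi> = ((I, X), (J, Y), hmap (I, X) (J, Y) h)"
proof -
  obtain I X J Y \<psi> where p: "\<phi> = ((I, X), (J, Y), \<psi>)" by (metis prod.exhaust)
  show thesis using assms that ind_hom_iff unfolding p Ind_simps by blast
qed

lemma Ind_mor:
  assumes "(I, X) \<in> ind_obs M" "(J, Y) \<in> ind_obs M" "h \<in> Hom C (L (I, X)) (L (J, Y))"
  shows "((I, X), (J, Y), hmap (I, X) (J, Y) h) \<in> Mor IM"
  unfolding Ind_simps using assms ind_hom_iff by blast

lemma Ind_idt:
  assumes P: "(I, X) \<in> ind_obs M"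
  shows "Idt IM (I, X) = ((I, X), (I, X), hmap (I, X) (I, X) (Idt C (L (I, X))))"
proof -
  have X: "is_functor I C X" and fpX: "\<And>s. s \<in> Ob I \<Longrightarrow> fp (fob X s)" using P by (auto simp: ind_obs_iff)
  note Pi = \<iota>_facts[OF P]
  have "hom_eqv I M X (fob X s) `` {(s, Idt M (fob X s))} = cls I X (\<iota> (I, X)) (fob X s) (Idt C (L (I, X)) \<cdot> \<iota> (I, X) s)"
    if s: "s \<in> Ob I" for s
    unfolding M_simps using eqv_cls[OF P colim[OF P] fpX[OF s] s, of "Idt C (fob X s)"] Pi s fp_ob[OF fpX[OF s]] C
    by (simp add: Hom_iff)
  then show ?thesis unfolding Ind_simps hmap_def by (auto simp: fun_eq_iff)
qed

lemma Ind_comp: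
  assumes P: "(I, X) \<in> ind_obs M" and Q: "(J, Y) \<in> ind_obs M" and R: "(K, Z) \<in> ind_obs M"
    and h: "h \<in> Hom C (L (I, X)) (L (J, Y))" and h': "h' \<in> Hom C (L (J, Y)) (L (K, Z))"
  shows "((J, Y), (K, Z), hmap (J, Y) (K, Z) h') \<cdot>\<^bsub>IM\<^esub> ((I, X), (J, Y), hmap (I, X) (J, Y) h) =
    ((I, X), (K, Z), hmap (I, X) (K, Z) (h' \<cdot> h))"
proof -
  have fpX: "\<And>s. s \<in> Ob I \<Longrightarrow> fp (fob X s)" using P by (auto simp: ind_obs_iff)
  note Pi = \<iota>_facts[OF P] and Qi = \<iota>_facts[OF Q] and Ri = \<iota>_facts[OF R]
  have "(\<Union>(t, f)\<in>hmap (I, X) (J, Y) h s. \<Union>(r, g)\<in>hmap (J, Y) (K, Z) h' t. hom_eqv K M Z (fob X s) `` {(r, g \<cdot> f)}) =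
    cls K Z (\<iota> (K, Z)) (fob X s) ((h' \<cdot> h) \<cdot> \<iota> (I, X) s)" (is "?U = ?c") if s: "s \<in> Ob I" for s
  proof -
    \<comment> \<open>All pairs of representatives yield the same class, so the union that defines
      composition is that class as soon as one pair exists.\<close>
    have e: "hom_eqv K M Z (fob X s) `` {(r, g \<cdot> f)} = ?c"
      if tf: "(t, f) \<in> hmap (I, X) (J, Y) h s" and rg: "(r, g) \<in> hmap (J, Y) (K, Z) h' t" for t f r g
    proof -
      have t: "t \<in> Ob J" "f \<in> Hom C (fob X s) (fob Y t)" "\<iota> (J, Y) t \<cdot> f = h \<cdot> \<iota> (I, X) s"
        using tf unfolding hmap_mem[OF P Q s] by auto
      have r: "r \<in> Ob K" "g \<in> Hom C (fob Y t) (fob Z r)" "\<iota> (K, Z) r \<cdot> g = h' \<cdot> \<iota> (J, Y) t"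
        using rg unfolding hmap_mem[OF Q R t(1)] by auto
      have "\<iota> (K, Z) r \<cdot> (g \<cdot> f) = (h' \<cdot> h) \<cdot> \<iota> (I, X) s"
        using comp_reassoc[OF r(3) C, of f] t r(1,2) Pi(2-4)[OF s] Qi(2-4)[OF t(1)] Ri(2-4)[OF r(1)] h h' C
        by (simp add: Hom_iff)
      then show ?thesis using eqv_cls[OF R colim[OF R] fpX[OF s] r(1) comp_Hom[OF C t(2) r(2)]] by simp
    qed
    obtain t f where tf: "(t, f) \<in> hmap (I, X) (J, Y) h s" "t \<in> Ob J" by (rule hmap_nonempty[OF P Q h s])
    obtain r g where rg: "(r, g) \<in> hmap (J, Y) (K, Z) h' t" by (rule hmap_nonempty[OF Q R h' tf(2)])
    show ?thesis
    proof
      show "?U \<subseteq> ?c" using e by fast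
      show "?c \<subseteq> ?U" using e[OF tf(1) rg] tf(1) rg by fast
    qed
  qed
  then show ?thesis unfolding Ind_simps M_simps hmap_def[of "(I, X)" "(K, Z)"] by (auto simp: fun_eq_iff)
qed

text \<open>Identities and composites correspond to those of \<open>C\<close> under
  \<open>hmap\<close>, so the laws are inherited from \<open>C\<close> rather than checked on
  families.\<close>

lemma category_Ind: "category IM"
proof -
  have idH: "Idt C (L P) \<in> Hom C (L P) (L P)" if "P \<in> ind_obs M" for P
    using \<iota>_facts(1)[of "fst P" "snd P"] that C by (simp add: Hom_iff)
  show ?thesis
    unfolding category_def
  proof (intro conjI ballI impI)
    fix \<phi> assume "\<phi> \<in> Mor IM"
    then obtain I X J Y h where p: "(I, X) \<in> ind_obs M" "(J, Y) \<in> ind_obs M" "h \<in> Hom C (L (I, X)) (L (J, Y))"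
      "\<phi> = ((I, X), (J, Y), hmap (I, X) (J, Y) h)" by (rule Ind_morE)
    show "Dom IM \<phi> \<in> Ob IM" "Cod IM \<phi> \<in> Ob IM" unfolding p(4) Ind_simps by (rule p(1), rule p(2))
    have id: "h \<cdot> Idt C (L (I, X)) = h" "Idt C (L (J, Y)) \<cdot> h = h" using p(3) C by (simp_all add: Hom_iff)
    show "\<phi> \<cdot>\<^bsub>IM\<^esub> Idt IM (Dom IM \<phi>) = \<phi>"
      unfolding p(4) Ind_simps(3) Ind_idt[OF p(1)] Ind_comp[OF p(1,1,2) idH[OF p(1)] p(3)] id ..
    show "Idt IM (Cod IM \<phi>) \<cdot>\<^bsub>IM\<^esub> \<phi> = \<phi>"
      unfolding p(4) Ind_simps(4) Ind_idt[OF p(2)] Ind_comp[OF p(1,2,2) p(3) idH[OF p(2)]] id ..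
  next
    fix P assume "P \<in> Ob IM"
    then obtain I X where P: "P = (I, X)" "(I, X) \<in> ind_obs M" by (cases P) (auto simp: Ind_simps)
    show "Idt IM P \<in> Hom IM P P"
      using Ind_mor[OF P(2,2) idH[OF P(2)]] unfolding P(1) Ind_idt[OF P(2)] Hom_iff Ind_simps(3,4) by simp
  next
    fix \<phi> \<psi> assume "\<phi> \<in> Mor IM" "\<psi> \<in> Mor IM" and eq: "Cod IM \<phi> = Dom IM \<psi>"
    obtain I X J Y h where p: "(I, X) \<in> ind_obs M" "(J, Y) \<in> ind_obs M" "h \<in> Hom C (L (I, X)) (L (J, Y))"
      "\<phi> = ((I, X), (J, Y), hmap (I, X) (J, Y) h)" using \<open>\<phi> \<in> Mor IM\<close> by (rule Ind_morE)
    obtain J' Y' K Z h' where q: "(J', Y') \<in> ind_obs M" "(K, Z) \<in> ind_obs M" "h' \<in> Hom C (L (J', Y')) (L (K, Z))"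
      "\<psi> = ((J', Y'), (K, Z), hmap (J', Y') (K, Z) h')" using \<open>\<psi> \<in> Mor IM\<close> by (rule Ind_morE)
    have e: "J' = J" "Y' = Y" using eq unfolding p(4) q(4) Ind_simps by auto
    note q = q[unfolded e]
    show "\<psi> \<cdot>\<^bsub>IM\<^esub> \<phi> \<in> Hom IM (Dom IM \<phi>) (Cod IM \<psi>)"
      unfolding p(4) q(4) Ind_comp[OF p(1,2) q(2) p(3) q(3)] Hom_iff Ind_simps(3,4)
      using Ind_mor[OF p(1) q(2) comp_Hom[OF C p(3) q(3)]] by simp
  next
    fix \<phi> \<psi> \<xi> assume "\<phi> \<in> Mor IM" "\<psi> \<in> Mor IM" "\<xi> \<in> Mor IM"
      and "Cod IM \<phi> = Dom IM \<psi> \<and> Cod IM \<psi> = Dom IM \<xi>"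
    then have eq: "Cod IM \<phi> = Dom IM \<psi>" and eq': "Cod IM \<psi> = Dom IM \<xi>" by auto
    obtain I X J Y h where p: "(I, X) \<in> ind_obs M" "(J, Y) \<in> ind_obs M" "h \<in> Hom C (L (I, X)) (L (J, Y))"
      "\<phi> = ((I, X), (J, Y), hmap (I, X) (J, Y) h)" using \<open>\<phi> \<in> Mor IM\<close> by (rule Ind_morE)
    obtain J' Y' K Z h' where q: "(J', Y') \<in> ind_obs M" "(K, Z) \<in> ind_obs M" "h' \<in> Hom C (L (J', Y')) (L (K, Z))"
      "\<psi> = ((J', Y'), (K, Z), hmap (J', Y') (K, Z) h')" using \<open>\<psi> \<in> Mor IM\<close> by (rule Ind_morE)
    have e: "J' = J" "Y' = Y" using eq unfolding p(4) q(4) Ind_simps by auto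
    note q = q[unfolded e]
    obtain K' Z' N V h'' where r: "(K', Z') \<in> ind_obs M" "(N, V) \<in> ind_obs M" "h'' \<in> Hom C (L (K', Z')) (L (N, V))"
      "\<xi> = ((K', Z'), (N, V), hmap (K', Z') (N, V) h'')" using \<open>\<xi> \<in> Mor IM\<close> by (rule Ind_morE)
    have e': "K' = K" "Z' = Z" using eq' unfolding q(4) r(4) Ind_simps by auto
    note r = r[unfolded e']
    have "(h'' \<cdot> h') \<cdot> h = h'' \<cdot> (h' \<cdot> h)" using p(3) q(3) r(3) C by (simp add: Hom_iff)
    then show "(\<xi> \<cdot>\<^bsub>IM\<^esub> \<psi>) \<cdot>\<^bsub>IM\<^esub> \<phi> = \<xi> \<cdot>\<^bsub>IM\<^esub> (\<psi> \<cdot>\<^bsub>IM\<^esub> \<phi>)"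
      unfolding p(4) q(4) r(4) Ind_comp[OF p(1,2) q(2) p(3) q(3)] Ind_comp[OF q(1,2) r(2) q(3) r(3)]
        Ind_comp[OF p(1) q(1) r(2) p(3) comp_Hom[OF C q(3) r(3)]] Ind_comp[OF p(1) q(2) r(2) comp_Hom[OF C p(3) q(3)] r(3)]
      by simp
  qed
qed

lemma colimit_functor_ex: "\<exists>T. is_colimit_functor U M C T"
proof -
  \<comment> \<open>Recovers the map of colimits from a family; it is well defined because
    \<open>hmap\<close> is injective on each hom-set.\<close>
  define um where "um \<phi> = (THE h. h \<in> Hom C (L (fst \<phi>)) (L (fst (snd \<phi>))) \<and> snd (snd \<phi>) = hmap (fst \<phi>) (fst (snd \<phi>)) h)" for \<phi>
  have um: "um ((I, X), (J, Y), hmap (I, X) (J, Y) h) = h"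
    if "(I, X) \<in> ind_obs M" "(J, Y) \<in> ind_obs M" "h \<in> Hom C (L (I, X)) (L (J, Y))" for I X J Y h
    unfolding um_def by (rule the_equality) (use that hmap_inj[OF that(1,2)] in auto)
  define T where "T = \<lparr>fob = L, fmor = um\<rparr>"
  have Ts: "fob T = L" "fmor T = um" by (simp_all add: T_def)
  have idH: "Idt C (L (I, X)) \<in> Hom C (L (I, X)) (L (I, X))" if "(I, X) \<in> ind_obs M" for I X
    using \<iota>_facts(1)[OF that] C by (simp add: Hom_iff)
  have "is_functor IM C T"
    unfolding is_functor_def Ts
  proof (intro conjI ballI impI category_Ind C)
    fix P assume "P \<in> Ob IM"
    then obtain I X where P: "P = (I, X)" "(I, X) \<in> ind_obs M" by (cases P) (auto simp: Ind_simps)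
    show "L P \<in> Ob C" using \<iota>_facts(1)[OF P(2)] P(1) by simp
    show "um (Idt IM P) = Idt C (L P)" unfolding P(1) Ind_idt[OF P(2)] by (rule um[OF P(2,2) idH[OF P(2)]])
  next
    fix \<phi> assume "\<phi> \<in> Mor IM"
    then obtain I X J Y h where p: "(I, X) \<in> ind_obs M" "(J, Y) \<in> ind_obs M" "h \<in> Hom C (L (I, X)) (L (J, Y))"
      "\<phi> = ((I, X), (J, Y), hmap (I, X) (J, Y) h)" by (rule Ind_morE)
    show "um \<phi> \<in> Hom C (L (Dom IM \<phi>)) (L (Cod IM \<phi>))" unfolding p(4) um[OF p(1-3)] Ind_simps by (rule p(3))
    fix \<psi> assume "\<psi> \<in> Mor IM" and eq: "Cod IM \<phi> = Dom IM \<psi>"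
    obtain J' Y' K Z h' where q: "(J', Y') \<in> ind_obs M" "(K, Z) \<in> ind_obs M" "h' \<in> Hom C (L (J', Y')) (L (K, Z))"
      "\<psi> = ((J', Y'), (K, Z), hmap (J', Y') (K, Z) h')" using \<open>\<psi> \<in> Mor IM\<close> by (rule Ind_morE)
    have e: "J' = J" "Y' = Y" using eq unfolding p(4) q(4) Ind_simps by auto
    note q = q[unfolded e]
    show "um (\<psi> \<cdot>\<^bsub>IM\<^esub> \<phi>) = um \<psi> \<cdot> um \<phi>"
      unfolding p(4) q(4) Ind_comp[OF p(1,2) q(2) p(3) q(3)] um[OF p(1-3)] um[OF q(1-3)]
      by (rule um[OF p(1) q(2) comp_Hom[OF C p(3) q(3)]])
  qed
  moreover have "\<forall>(J, X)\<in>Ob IM. is_colimit J C X (fob T (J, X)) (\<iota> (J, X))"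
    unfolding Ind_simps Ts using colim by blast
  moreover have "\<forall>((I, X), Q, \<phi>)\<in>Mor IM. \<forall>s\<in>Ob I. \<forall>(t, f)\<in>\<phi> s. fmor T ((I, X), Q, \<phi>) \<cdot> \<iota> (I, X) s = \<iota> Q t \<cdot> f"
  proof -
    have "fmor T ((I, X), Q, \<phi>) \<cdot> \<iota> (I, X) s = \<iota> Q t \<cdot> f"
      if m: "((I, X), Q, \<phi>) \<in> Mor IM" and s: "s \<in> Ob I" and tf: "(t, f) \<in> \<phi> s" for I X Q \<phi> s t f
    proof -
      obtain J Y h where p: "(I, X) \<in> ind_obs M" "(J, Y) \<in> ind_obs M" "h \<in> Hom C (L (I, X)) (L (J, Y))"
        "Q = (J, Y)" "\<phi> = hmap (I, X) (J, Y) h" by (rule Ind_morE[OF m]) auto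
      show ?thesis using tf unfolding p(4,5) Ts um[OF p(1-3)] hmap_mem[OF p(1,2) s] by simp
    qed
    then show ?thesis by fast
  qed
  ultimately show ?thesis unfolding is_colimit_functor_def by blast
qed

end

text \<open>An arbitrary natural functor is analysed, not the constructed one, since the comparison
  is claimed for all of them.\<close>

locale colimit_functor = ind_colimits U C "fob T" \<iota> for U :: "'u itself" and C :: "('o, 'm) cat" (structure) and T \<iota> +
  assumes T: "is_functor (Ind U (fp_subcat U C)) C T"
    and T_comm: "\<And>I X Q \<phi> s t f. ((I, X), Q, \<phi>) \<in> Mor (Ind U (fp_subcat U C)) \<Longrightarrow> s \<in> Ob I \<Longrightarrow> (t, f) \<in> \<phi> s \<Longrightarrow>
      fmor T ((I, X), Q, \<phi>) \<cdot> \<iota> (I, X) s = \<iota> Q t \<cdot> f"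
begin

text \<open>Compatibility with the legs forces the value of \<open>T\<close>: both sides agree on
  every stage of the source.\<close>

lemma T_hmap:
  assumes P: "(I, X) \<in> ind_obs M" and Q: "(J, Y) \<in> ind_obs M" and h: "h \<in> Hom C (fob T (I, X)) (fob T (J, Y))"
  shows "fmor T ((I, X), (J, Y), hmap (I, X) (J, Y) h) = h"
proof -
  let ?\<phi> = "((I, X), (J, Y), hmap (I, X) (J, Y) h)"
  have X: "is_functor I C X" using P by (simp add: ind_obs_iff)
  have m: "?\<phi> \<in> Mor IM" by (rule Ind_mor[OF P Q h])
  have "fmor T ?\<phi> \<in> Hom C (fob T (I, X)) (fob T (J, Y))"
    using fmor_mor[OF T m] dom_fmor[OF T m] cod_fmor[OF T m] unfolding Ind_simps(3,4) by (simp add: Hom_iff)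
  then show ?thesis
  proof (rule colimit_unique[OF C X colim[OF P] _ h])
    fix s assume s: "s \<in> Ob I"
    obtain t g where tg: "(t, g) \<in> hmap (I, X) (J, Y) h s" "\<iota> (J, Y) t \<cdot> g = h \<cdot> \<iota> (I, X) s"
      by (rule hmap_nonempty[OF P Q h s])
    show "fmor T ?\<phi> \<cdot> \<iota> (I, X) s = h \<cdot> \<iota> (I, X) s"
      using T_comm[OF m s tg(1)] tg(2) by simp
  qed
qed

text \<open>On hom-sets \<open>T\<close> is inverse to \<open>hmap\<close>, which gives fullness and
  faithfulness; essential surjectivity is the existence of presentations by objects of
  \<open>M\<close>.\<close>

sublocale ff: ff_functor IM C T
proof unfold_locales
  show "is_functor IM C T" by (rule T)
  fix P Q \<phi> \<psi> assume f: "\<phi> \<in> Hom IM P Q" "\<psi> \<in> Hom IM P Q" and eq: "fmor T \<phi> = fmor T \<psi>"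
  have m: "\<phi> \<in> Mor IM" "\<psi> \<in> Mor IM" using f by (simp_all add: Hom_iff)
  obtain I X J Y h where p: "(I, X) \<in> ind_obs M" "(J, Y) \<in> ind_obs M" "h \<in> Hom C (fob T (I, X)) (fob T (J, Y))"
    "\<phi> = ((I, X), (J, Y), hmap (I, X) (J, Y) h)" using m(1) by (rule Ind_morE)
  obtain I' X' J' Y' h' where q: "(I', X') \<in> ind_obs M" "(J', Y') \<in> ind_obs M" "h' \<in> Hom C (fob T (I', X')) (fob T (J', Y'))"
    "\<psi> = ((I', X'), (J', Y'), hmap (I', X') (J', Y') h')" using m(2) by (rule Ind_morE)
  have "Dom IM \<phi> = Dom IM \<psi>" "Cod IM \<phi> = Cod IM \<psi>" using f by (simp_all add: Hom_iff)
  then have e: "I' = I" "X' = X" "J' = J" "Y' = Y" unfolding p(4) q(4) Ind_simps by auto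
  show "\<phi> = \<psi>" using eq T_hmap[OF p(1-3)] T_hmap[OF q(1-3)] unfolding p(4) q(4) e by simp
next
  fix P Q h assume P: "P \<in> Ob IM" "Q \<in> Ob IM" and h: "h \<in> Hom C (fob T P) (fob T Q)"
  obtain I X J Y where PQ: "P = (I, X)" "Q = (J, Y)" by (cases P; cases Q) blast
  note o = P[unfolded PQ Ind_simps] and h = h[unfolded PQ]
  have "((I, X), (J, Y), hmap (I, X) (J, Y) h) \<in> Hom IM P Q"
    unfolding PQ Hom_iff Ind_simps(3,4) using Ind_mor[OF o h] by simp
  then show "\<exists>f\<in>Hom IM P Q. fmor T f = h" using T_hmap[OF o h] by blast
next
  fix B assume "B \<in> Ob C"
  then obtain J :: "('u, 'u) cat" and X \<kappa> where J: "small_index U J" "is_functor J C X" "\<And>j. j \<in> Ob J \<Longrightarrow> fp (fob X j)" "is_colimit J C X B \<kappa>"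
    using presentation by metis
  have P: "(J, X) \<in> ind_obs M" using J by (simp add: ind_obs_iff)
  obtain \<theta> \<theta>' where t: "\<theta> \<in> Hom C (fob T (J, X)) B" "\<theta>' \<in> Hom C B (fob T (J, X))" "\<theta>' \<cdot> \<theta> = Idt C (fob T (J, X))" "\<theta> \<cdot> \<theta>' = Idt C B"
    using colimit_iso[OF C J(2) colim[OF P] J(4)] by metis
  then show "\<exists>a\<in>Ob IM. \<exists>e\<in>Hom C (fob T a) B. \<exists>e'\<in>Hom C B (fob T a). e' \<cdot> e = Idt C (fob T a) \<and> e \<cdot> e' = Idt C B"
    using P unfolding Ind_simps by blast
qed

lemma ind_map_colimit:
  assumes J: "small_filtered J" and \<tau>: "nat_trans J M X Y \<tau>"
  shows "ind_map M J X Y \<tau> \<in> Mor IM"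
    "\<And>j. j \<in> Ob J \<Longrightarrow> fmor T (ind_map M J X Y \<tau>) \<cdot> \<iota> (J, X) j = \<iota> (J, Y) j \<cdot> \<tau> j"
    "fmor T (ind_map M J X Y \<tau>) \<in> Hom C (fob T (J, X)) (fob T (J, Y))"
proof -
  have XY: "is_functor J M X" "is_functor J M Y" and tH: "\<And>j. j \<in> Ob J \<Longrightarrow> \<tau> j \<in> Hom C (fob X j) (fob Y j)"
    and nat: "\<And>u. u \<in> Mor J \<Longrightarrow> \<tau> (Cod J u) \<cdot> fmor X u = fmor Y u \<cdot> \<tau> (Dom J u)"
    using \<tau> unfolding nat_trans_def Hom_M M_simps by auto
  have P: "(J, X) \<in> ind_obs M" "(J, Y) \<in> ind_obs M" using J XY by (auto simp: ind_obs_def)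
  have XYC: "is_functor J C X" "is_functor J C Y" and fpX: "\<And>j. j \<in> Ob J \<Longrightarrow> fp (fob X j)" using XY unfolding functor_M by auto
  have cJ: "category J" using is_functor_cat[OF XYC(1)] by simp
  note Xi = \<iota>_facts[OF P(1)] and Yi = \<iota>_facts[OF P(2)]
  have "cocone J C X (fob T (J, Y)) (\<lambda>j. \<iota> (J, Y) j \<cdot> \<tau> j)"
    unfolding cocone_def
  proof (intro conjI ballI Yi(1))
    show "\<iota> (J, Y) j \<cdot> \<tau> j \<in> Hom C (fob X j) (fob T (J, Y))" if "j \<in> Ob J" for j
      using Yi(2-4)[OF that] tH[OF that] C by (simp add: Hom_iff)
    fix u assume u: "u \<in> Mor J"
    have o: "Dom J u \<in> Ob J" "Cod J u \<in> Ob J" using u cJ by auto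
    show "(\<iota> (J, Y) (Cod J u) \<cdot> \<tau> (Cod J u)) \<cdot> fmor X u = \<iota> (J, Y) (Dom J u) \<cdot> \<tau> (Dom J u)"
      using comp_reassoc[OF Yi(5)[OF u] C, of "\<tau> (Dom J u)"] nat[OF u] u o tH[OF o(1)] tH[OF o(2)] Yi(2-4)[OF o(2)] XYC C
      by (simp add: Hom_iff)
  qed
  then obtain h where h: "h \<in> Hom C (fob T (J, X)) (fob T (J, Y))" "\<And>j. j \<in> Ob J \<Longrightarrow> h \<cdot> \<iota> (J, X) j = \<iota> (J, Y) j \<cdot> \<tau> j"
    using colimit_induced[OF colim[OF P(1)]] by blast
  have e: "ind_map M J X Y \<tau> = ((J, X), (J, Y), hmap (J, X) (J, Y) h)"
    unfolding ind_map_def hmap_def using eqv_cls[OF P(2) colim[OF P(2)] fpX _ tH] h(2) by (auto simp: fun_eq_iff)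
  show "ind_map M J X Y \<tau> \<in> Mor IM" unfolding e by (rule Ind_mor[OF P h(1)])
  show "fmor T (ind_map M J X Y \<tau>) \<cdot> \<iota> (J, X) j = \<iota> (J, Y) j \<cdot> \<tau> j" if "j \<in> Ob J" for j
    unfolding e T_hmap[OF P h(1)] by (rule h(2)[OF that])
  show "fmor T (ind_map M J X Y \<tau>) \<in> Hom C (fob T (J, X)) (fob T (J, Y))" unfolding e T_hmap[OF P h(1)] by (rule h(1))
qed

text \<open>The colimit of a constant diagram on the one-morphism category is the object itself, so
  \<open>T\<close> recovers \<open>c\<close>. It does so only up to isomorphism, since the values of
  \<open>T\<close> are arbitrary colimits.\<close>

lemma ind_embed_iso:
  assumes c: "c \<in> Mor M"
  shows "ind_embed U M c \<in> Mor IM" "isomorphic D (fmor T (ind_embed U M c)) c"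
proof -
  have cat1: "category one_cat" unfolding category_def one_cat_def by (simp add: Hom_iff)
  have f1: "filtered one_cat"
    by (rule filteredI[OF cat1]) (auto simp: one_cat_def Hom_iff)
  have o1: "Ob one_cat = {undefined}" "Mor one_cat = {undefined}" by (simp_all add: one_cat_def)
  have s1: "small_filtered (one_cat :: ('u, 'u) cat)"
    unfolding small_filtered_iff[of _ U] small_index_def using f1 small_finite[of "{undefined}"] by (simp add: o1)
  have cM: "c \<in> Mor C" "fp (Dom C c)" "fp (Cod C c)" using c by (auto simp: M_simps)
  have k: "const_fctr M a = konst C a" for a by (simp add: const_fctr_def konst_def M_simps)
  let ?X = "konst C (Dom C c) :: ('u, 'u, 'o, 'm) fctr" and ?Y = "konst C (Cod C c) :: ('u, 'u, 'o, 'm) fctr"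
  have F: "is_functor one_cat C (konst C a)" if "fp a" for a using functor_konst[OF C cat1 fp_ob[OF that]] .
  have FM: "is_functor one_cat M ?X" "is_functor one_cat M ?Y" unfolding functor_M using F cM by auto
  have "nat_trans one_cat M ?X ?Y (\<lambda>_. c)"
    unfolding nat_trans_def using FM cM C by (simp add: Hom_M M_simps Hom_iff)
  note im = ind_map_colimit[OF s1 this]
  have e: "ind_embed U M c = ind_map M one_cat ?X ?Y (\<lambda>_. c)" unfolding ind_embed_def k M_simps ..
  show "ind_embed U M c \<in> Mor IM" unfolding e by (rule im(1))
  have iso: "\<exists>\<theta>'. \<theta>' \<in> Hom C (fob T (one_cat, konst C a)) a \<and> \<iota> (one_cat, konst C a) undefined \<in> Hom C a (fob T (one_cat, konst C a)) \<and>
      \<theta>' \<cdot> \<iota> (one_cat, konst C a) undefined = Idt C a \<and> \<iota> (one_cat, konst C a) undefined \<cdot> \<theta>' = Idt C (fob T (one_cat, konst C a))"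
    if a: "fp a" for a
  proof -
    let ?K = "konst C a :: ('u, 'u, 'o, 'm) fctr"
    have P: "(one_cat, ?K) \<in> ind_obs M" using s1[unfolded small_filtered_iff[of _ U]] F[OF a] a by (simp add: ind_obs_iff)
    obtain \<theta> \<theta>' where t: "\<theta> \<in> Hom C a (fob T (one_cat, ?K))" "\<theta>' \<in> Hom C (fob T (one_cat, ?K)) a"
      "\<theta>' \<cdot> \<theta> = Idt C a" "\<theta> \<cdot> \<theta>' = Idt C (fob T (one_cat, ?K))"
      "\<And>j. j \<in> Ob one_cat \<Longrightarrow> \<theta> \<cdot> Idt C a = \<iota> (one_cat, ?K) j"
      using colimit_iso[OF C F[OF a] colimit_konst[OF f1 C fp_ob[OF a]] colim[OF P]] by metis
    have "\<theta> = \<iota> (one_cat, ?K) undefined" using t(1) t(5)[of undefined] C by (simp add: o1 Hom_iff)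
    then show ?thesis using t(1-4) by blast
  qed
  let ?a = "\<iota> (one_cat, ?X) undefined" and ?b = "\<iota> (one_cat, ?Y) undefined" and ?t = "fmor T (ind_map M one_cat ?X ?Y (\<lambda>_. c))"
  obtain a' where a': "a' \<in> Hom C (fob T (one_cat, ?X)) (Dom C c)" "?a \<in> Hom C (Dom C c) (fob T (one_cat, ?X))"
    "a' \<cdot> ?a = Idt C (Dom C c)" "?a \<cdot> a' = Idt C (fob T (one_cat, ?X))" using iso[OF cM(2)] by blast
  obtain b' where b': "b' \<in> Hom C (fob T (one_cat, ?Y)) (Cod C c)" "?b \<in> Hom C (Cod C c) (fob T (one_cat, ?Y))"
    "b' \<cdot> ?b = Idt C (Cod C c)" "?b \<cdot> b' = Idt C (fob T (one_cat, ?Y))" using iso[OF cM(3)] by blast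
  have tm: "?t \<in> Mor C" "Dom C ?t = fob T (one_cat, ?X)" "Cod C ?t = fob T (one_cat, ?Y)" using im(3) by (auto simp: Hom_iff)
  have sq: "?t \<cdot> ?a = ?b \<cdot> c" using im(2)[of undefined] by (simp add: o1)
  have sq': "c \<cdot> a' = b' \<cdot> ?t"
  proof -
    have "b' \<cdot> ?t = b' \<cdot> ((?t \<cdot> ?a) \<cdot> a')" using tm a'(1,2,4) C by (simp add: Hom_iff)
    also have "\<dots> = (b' \<cdot> ?b) \<cdot> (c \<cdot> a')" unfolding sq using cM(1) a'(1) b'(1,2) C by (simp add: Hom_iff)
    also have "\<dots> = c \<cdot> a'" unfolding b'(3) using cM(1) a'(1) C by (simp add: Hom_iff)
    finally show ?thesis by simp
  qed
  have 1: "(?t, c, a', b') \<in> Hom D ?t c" "(c, ?t, ?a, ?b) \<in> Hom D c ?t"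
    unfolding Hom_arrow_iff using tm cM(1) a' b' sq sq' by simp_all
  have "is_iso D (?t, c, a', b')"
    by (rule is_isoI[OF 1]) (use a' b' tm in \<open>simp_all add: arrow_cat_simps\<close>)
  then show "isomorphic D (fmor T (ind_embed U M c)) c" unfolding isomorphic_def e using 1(1) by blast
qed

text \<open>Identifies the image of a levelwise map with the filtered colimit of its components. The
  diagram \<open>Z\<close> is a parameter because in one use it is built from \<open>\<tau>\<close>,
  while in another \<open>\<tau>\<close> is read off from it.\<close>

lemma ind_map_arrow:
  assumes J: "small_filtered J" and \<tau>: "nat_trans J M X Y \<tau>"
    and Z: "is_functor J D Z" "\<And>j. j \<in> Ob J \<Longrightarrow> fob Z j = \<tau> j"
      "\<And>u. u \<in> Mor J \<Longrightarrow> top_side (fmor Z u) = fmor X u" "\<And>u. u \<in> Mor J \<Longrightarrow> bot_side (fmor Z u) = fmor Y u"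
  shows "is_colimit J D Z (fmor T (ind_map M J X Y \<tau>)) (\<lambda>j. (fob Z j, fmor T (ind_map M J X Y \<tau>), \<iota> (J, X) j, \<iota> (J, Y) j))"
proof -
  have XY: "is_functor J M X" "is_functor J M Y" and tH: "\<And>j. j \<in> Ob J \<Longrightarrow> \<tau> j \<in> Hom C (fob X j) (fob Y j)"
    using \<tau> unfolding nat_trans_def Hom_M by auto
  have P: "(J, X) \<in> ind_obs M" "(J, Y) \<in> ind_obs M" using J XY by (auto simp: ind_obs_def)
  note im = ind_map_colimit[OF J \<tau>]
  have 1: "is_colimit J C (comp_fctr (dom_fctr C) Z) (fob T (J, X)) (\<iota> (J, X))"
    by (rule iffD1[OF colimit_fctr_cong colim[OF P(1)]]) (use Z tH in \<open>simp_all add: Hom_iff\<close>)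
  have 2: "is_colimit J C (comp_fctr (cod_fctr C) Z) (fob T (J, Y)) (\<iota> (J, Y))"
    by (rule iffD1[OF colimit_fctr_cong colim[OF P(2)]]) (use Z tH in \<open>simp_all add: Hom_iff\<close>)
  show ?thesis
    by (rule arrow_colimitI[OF C Z(1) 1 2 im(3)]) (use im(2) Z(2) in simp)
qed

end

section \<open>The induced model structure\<close>

context lfp_category
begin

lemma natural_functor_ex: "\<exists>T. is_colimit_functor U M C T"
proof -
  have "\<exists>L \<iota>. is_colimit (fst P) C (snd P) L \<iota>" if "P \<in> ind_obs M" for P :: "('u, 'o, 'm) ind_ob"
    using that filtered_colimit[OF filtered_colims] by (cases P) (auto simp: ind_obs_iff)
  then obtain L \<iota> where "\<And>P :: ('u, 'o, 'm) ind_ob. P \<in> ind_obs M \<Longrightarrow> is_colimit (fst P) C (snd P) (L P) (\<iota> P)" by metis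
  then interpret ind_colimits U C L \<iota> by unfold_locales force
  show ?thesis by (rule colimit_functor_ex)
qed

lemma colimit_functorE:
  assumes "is_colimit_functor U M C T"
  obtains \<iota> where "colimit_functor U C T \<iota>"
proof -
  obtain \<iota> where T: "is_functor (Ind U M) C T"
    and c: "\<And>J X. (J, X) \<in> ind_obs M \<Longrightarrow> is_colimit J C X (fob T (J, X)) (\<iota> (J, X))"
    and e: "\<forall>((I, X), Q, \<phi>) \<in> Mor (Ind U M). \<forall>s \<in> Ob I. \<forall>(t, f) \<in> \<phi> s.
        fmor T ((I, X), Q, \<phi>) \<cdot> \<iota> (I, X) s = \<iota> Q t \<cdot> f"
    using assms unfolding is_colimit_functor_def Ind_simps by auto
  have "colimit_functor U C T \<iota>" by unfold_locales (use T c e in fast)+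
  then show thesis by (rule that)
qed

end

section \<open>Filtered colimits of weak equivalences and accessibility\<close>

context omega_model
begin

lemma TM_eq: "Cof \<inter> Mor M \<inter> WM = TM"
  by blast

text \<open>\<open>TM\<close> lies between a generating set of trivial cofibrations and the class of
  all of them, and both ends have the fibrations as right lifting class.\<close>

lemma rlp_TM: "rlp C TM = Fib"
proof
  show "Fib \<subseteq> rlp C TM" using rlp_antimono[of TM "Cof \<inter> W" C] rlp_tcof by auto
  obtain J where "J \<subseteq> Cof \<inter> W" "J \<subseteq> Mor M" "rlp C J = rlp C (Cof \<inter> W)" by (rule generating[OF gen_tcof])
  then show "rlp C TM \<subseteq> Fib" using rlp_antimono[of J TM C] rlp_tcof by auto
qed

text \<open>\<open>WM\<close> may fail to be small, but closure of \<open>W\<close> under retracts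
  makes it closed under isomorphism within \<open>M\<close>, so small sets of representatives detect
  density equally well.\<close>

lemma W_representatives:
  obtains N where "N \<subseteq> WM" "small U N" "\<And>f. f \<in> W \<Longrightarrow> dense N f"
proof -
  have "m \<in> WM" if "n \<in> WM" "m \<in> Mor M" "isomorphic D n m" for n m
    using retracts(1)[OF isomorphic_retract(2)[OF that(3)]] that by (simp add: M_simps)
  then obtain N where "N \<subseteq> WM" "small U N" "\<And>f. dense WM f \<Longrightarrow> dense N f"
    using representatives[of WM] by (metis Int_lower2)
  then show thesis using that W_iff_dense by blast
qed

text \<open>For dense morphisms closure under filtered colimits is formal; it is imported through
  \<open>W_iff_dense\<close>.\<close>

lemma filtered_colimit_W:
  assumes J: "small_index U J" and Z: "is_functor J D Z" "\<forall>j\<in>Ob J. fob Z j \<in> W"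
  obtains f \<kappa> where "f \<in> W" "is_colimit J D Z f \<kappa>"
proof -
  obtain L \<iota> where L: "is_colimit J C (comp_fctr (dom_fctr C) Z) L \<iota>"
    using filtered_colimit[OF filtered_colims functor_comp[OF Z(1) functor_dom[OF C]] J] by blast
  obtain L' \<iota>' where L': "is_colimit J C (comp_fctr (cod_fctr C) Z) L' \<iota>'"
    using filtered_colimit[OF filtered_colims functor_comp[OF Z(1) functor_cod[OF C]] J] by blast
  obtain f where f: "is_colimit J D Z f (\<lambda>j. (fob Z j, f, \<iota> j, \<iota>' j))" by (rule arrow_colimit_ex[OF C Z(1) L L'])
  have "f \<in> W" unfolding W_iff_dense
    by (rule dense_filtered_colimit[OF J Z(1) f]) (use Z(2) W_iff_dense in blast)
  then show thesis using that f by blast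
qed

text \<open>The generators are the representatives \<open>N\<close>. They are finitely presentable
  among all morphisms, and remain so among the weak equivalences because filtered colimits there are
  computed in the category of all morphisms.\<close>

lemma finitely_accessible_W: "finitely_accessible U (full_subcat D W)"
proof -
  let ?V = "full_subcat D W"
  have DW: "Ob ?V = W" using wide(1) by (auto simp: arrow_cat_simps)
  have colimit_D: "is_colimit J D X f \<kappa>" if J: "small_index U J" and X: "is_functor J ?V X" and f: "is_colimit J ?V X f \<kappa>"
    for J :: "('u, 'u) cat" and X f \<kappa>
  proof -
    have X': "is_functor J D X" "\<forall>j\<in>Ob J. fob X j \<in> W" using X by (simp_all add: functor_full_subcat[OF D])
    obtain f' \<kappa>' where "f' \<in> W" "is_colimit J D X f' \<kappa>'" by (rule filtered_colimit_W[OF J X'])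
    then show ?thesis using colimit_full_subcatD[OF D X' _ _ f] by blast
  qed
  obtain N where N: "N \<subseteq> WM" "small U N" "\<And>f. f \<in> W \<Longrightarrow> dense N f"
    using W_representatives by metis
  have fpN: "finitely_presentable U ?V n" if n: "n \<in> N" for n
  proof (rule finitely_presentableI)
    have nW: "n \<in> W" and nfp: "finitely_presentable U D n" using n N(1) fp_arrow by auto
    show "n \<in> Ob ?V" using nW DW by simp
    fix J :: "('u, 'u) cat" and X f \<kappa> assume J: "small_index U J" and X: "is_functor J ?V X" and f: "is_colimit J ?V X f \<kappa>"
    have X': "is_functor J D X" "\<And>j. j \<in> Ob J \<Longrightarrow> fob X j \<in> W" using X by (simp_all add: functor_full_subcat[OF D])
    have fW: "f \<in> W" using cocone_ob[OF colimit_cocone[OF f]] DW by simp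
    note f' = colimit_D[OF J X f]
    {
      fix t assume "t \<in> Hom ?V n f"
      then have "t \<in> Hom D n f" using nW fW by simp
      then obtain j g where g: "j \<in> Ob J" "g \<in> Hom D n (fob X j)" "\<kappa> j \<cdot>\<^bsub>D\<^esub> g = t"
        by (rule finitely_presentable_factor[OF nfp J X'(1) f'])
      then have "g \<in> Hom ?V n (fob X j)" using nW X'(2)[OF g(1)] by simp
      then show "\<exists>j\<in>Ob J. \<exists>g\<in>Hom ?V n (fob X j). \<kappa> j \<cdot>\<^bsub>?V\<^esub> g = t" using g by auto
    next
      fix j g g' assume j: "j \<in> Ob J" and "g \<in> Hom ?V n (fob X j)" "g' \<in> Hom ?V n (fob X j)" "\<kappa> j \<cdot>\<^bsub>?V\<^esub> g = \<kappa> j \<cdot>\<^bsub>?V\<^esub> g'"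
      then have "g \<in> Hom D n (fob X j)" "g' \<in> Hom D n (fob X j)" "\<kappa> j \<cdot>\<^bsub>D\<^esub> g = \<kappa> j \<cdot>\<^bsub>D\<^esub> g'"
        using nW X'(2)[OF j] by simp_all
      then obtain k u where "u \<in> Hom J j k" "fmor X u \<cdot>\<^bsub>D\<^esub> g = fmor X u \<cdot>\<^bsub>D\<^esub> g'"
        by (rule finitely_presentable_equalize[OF nfp J X'(1) f' j])
      then show "\<exists>k. \<exists>u\<in>Hom J j k. fmor X u \<cdot>\<^bsub>?V\<^esub> g = fmor X u \<cdot>\<^bsub>?V\<^esub> g'" by auto
    }
  qed
  have pres: "\<exists>(J :: ('u, 'u) cat) X \<iota>. small_filtered J \<and> is_functor J ?V X \<and> (\<forall>j\<in>Ob J. fob X j \<in> N) \<and> is_colimit J ?V X f \<iota>"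
    if f: "f \<in> W" for f
  proof -
    obtain E :: "('u, 'u) cat" and Z \<kappa> where E: "small_index U E" "is_functor E D Z" "is_colimit E D Z f \<kappa>"
      "\<And>e. e \<in> Ob E \<Longrightarrow> fob Z e \<in> N"
      by (rule dense_colimit[OF N(3)[OF f] _ N(2)]) (use N(1) in blast)+
    have ZW: "\<forall>e\<in>Ob E. fob Z e \<in> W" using E(4) N(1) by blast
    have "small_filtered E" using E(1) by (simp only: small_filtered_iff[of E U])
    moreover have "is_functor E ?V Z" using E(2) ZW by (simp add: functor_full_subcat[OF D])
    moreover have "is_colimit E ?V Z f \<kappa>" by (rule colimit_full_subcat[OF D E(2) ZW f E(3)])
    ultimately show ?thesis using E(4) by blast
  qed
  have colims: "has_colimits (small_filtered :: ('u, 'u) cat \<Rightarrow> bool) ?V"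
    unfolding has_colimits_def
  proof (intro allI impI, elim conjE)
    fix J :: "('u, 'u) cat" and X assume "small_filtered J" and X: "is_functor J ?V X"
    then have J: "small_index U J" by (simp only: small_filtered_iff[of J U])
    have X': "is_functor J D X" "\<forall>j\<in>Ob J. fob X j \<in> W" using X by (simp_all add: functor_full_subcat[OF D])
    obtain f \<kappa> where "f \<in> W" "is_colimit J D X f \<kappa>" by (rule filtered_colimit_W[OF J X'])
    then show "\<exists>L \<iota>. is_colimit J ?V X L \<iota>" using colimit_full_subcat[OF D X'] by blast
  qed
  have "locally_small TYPE('u) ?V"
    unfolding locally_small_def small_type[of _ U] using D wide(1) small_Hom_arrow by (simp add: DW arrow_cat_simps subset_iff)
  moreover have "N \<subseteq> Ob ?V" using N(1) DW by simp
  moreover have "\<forall>n\<in>N. presentable_wrt (small_filtered :: ('u, 'u) cat \<Rightarrow> bool) ?V n"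
    using fpN unfolding finitely_presentable_def by blast
  moreover have "small TYPE('u) N" using N(2) by (simp only: small_type[of _ U])
  moreover have "\<forall>f\<in>Ob ?V. \<exists>(J :: ('u, 'u) cat) X \<iota>. small_filtered J \<and> is_functor J ?V X \<and>
      (\<forall>j\<in>Ob J. fob X j \<in> N) \<and> is_colimit J ?V X f \<iota>"
    unfolding DW by (intro ballI pres)
  ultimately show ?thesis
    unfolding finitely_accessible_def accessible_wrt_def using colims by (intro conjI exI[of _ N])
qed

end

section \<open>Comparison of the two model structures\<close>

locale induced_model = omega_model U C W Fib Cof dbl cyl k0 k1 ci cp + colimit_functor U C T \<iota>
  for U :: "'u itself" and C :: "('o, 'm) cat" (structure) and W Fib Cof :: "'m set" and dbl cyl k0 k1 ci cp T \<iota>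
begin

text \<open>A levelwise weak equivalence goes under \<open>T\<close> to a filtered colimit of
  members of \<open>WM\<close>, hence to a dense map. Conversely a weak equivalence is such a
  colimit; the sources and the targets of the diagram are ind-objects on one index, and full
  faithfulness carries the isomorphism back.\<close>

lemma Lw_iff:
  assumes \<phi>: "\<phi> \<in> Mor IM"
  shows "\<phi> \<in> Lw U M WM \<longleftrightarrow> fmor T \<phi> \<in> W"
proof
  assume "\<phi> \<in> Lw U M WM"
  then obtain J X Y \<tau> where J: "small_filtered J" and n: "nat_trans J M X Y \<tau>" and tW: "\<And>j. j \<in> Ob J \<Longrightarrow> \<tau> j \<in> WM"
    and i: "isomorphic (arrow_cat IM) \<phi> (ind_map M J X Y \<tau>)" unfolding Lw_def by blast
  have XY: "is_functor J M X" "is_functor J M Y" and tH: "\<And>j. j \<in> Ob J \<Longrightarrow> \<tau> j \<in> Hom C (fob X j) (fob Y j)"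
    and nat: "\<And>u. u \<in> Mor J \<Longrightarrow> \<tau> (Cod J u) \<cdot> fmor X u = fmor Y u \<cdot> \<tau> (Dom J u)"
    using n unfolding nat_trans_def Hom_M M_simps by auto
  have XYC: "is_functor J C X" "is_functor J C Y" using XY unfolding functor_M by auto
  have cJ: "category J" using is_functor_cat[OF XYC(1)] by simp
  define Z where "Z = \<lparr>fob = \<tau>, fmor = \<lambda>u. (\<tau> (Dom J u), \<tau> (Cod J u), fmor X u, fmor Y u)\<rparr>"
  have Zs: "fob Z = \<tau>" "\<And>u. fmor Z u = (\<tau> (Dom J u), \<tau> (Cod J u), fmor X u, fmor Y u)" by (simp_all add: Z_def)
  have tm: "\<And>j. j \<in> Ob J \<Longrightarrow> \<tau> j \<in> Mor C" "\<And>j. j \<in> Ob J \<Longrightarrow> Dom C (\<tau> j) = fob X j" "\<And>j. j \<in> Ob J \<Longrightarrow> Cod C (\<tau> j) = fob Y j"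
    using tH by (simp_all add: Hom_iff)
  have Z: "is_functor J D Z"
    unfolding is_functor_def Zs
  proof (intro conjI ballI impI cJ D)
    show "\<tau> j \<in> Ob D" if "j \<in> Ob J" for j using tm(1)[OF that] by (simp add: arrow_cat_simps)
    show "(\<tau> (Dom J u), \<tau> (Cod J u), fmor X u, fmor Y u) \<in> Hom D (\<tau> (Dom J u)) (\<tau> (Cod J u))" if "u \<in> Mor J" for u
      unfolding Hom_arrow_iff using that cJ tm XYC nat[OF that] by (simp add: Hom_iff)
    show "(\<tau> (Dom J (Idt J j)), \<tau> (Cod J (Idt J j)), fmor X (Idt J j), fmor Y (Idt J j)) = Idt D (\<tau> j)" if "j \<in> Ob J" for j
      using that cJ tm XYC by (simp add: arrow_cat_simps)
    show "(\<tau> (Dom J (v \<cdot>\<^bsub>J\<^esub> u)), \<tau> (Cod J (v \<cdot>\<^bsub>J\<^esub> u)), fmor X (v \<cdot>\<^bsub>J\<^esub> u), fmor Y (v \<cdot>\<^bsub>J\<^esub> u)) =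
      (\<tau> (Dom J v), \<tau> (Cod J v), fmor X v, fmor Y v) \<cdot>\<^bsub>D\<^esub> (\<tau> (Dom J u), \<tau> (Cod J u), fmor X u, fmor Y u)"
      if "u \<in> Mor J" "v \<in> Mor J" "Cod J u = Dom J v" for u v
      using that cJ XYC by (simp add: arrow_cat_simps)
  qed
  have L: "is_colimit J D Z (fmor T (ind_map M J X Y \<tau>))
      (\<lambda>j. (fob Z j, fmor T (ind_map M J X Y \<tau>), \<iota> (J, X) j, \<iota> (J, Y) j))"
    by (rule ind_map_arrow[OF J n Z]) (simp_all add: Zs)
  have "dense WM (fmor T (ind_map M J X Y \<tau>))"
    by (rule dense_filtered_colimit[OF _ Z L])
      (use J tW tm(1) dense_self in \<open>simp_all only: Zs small_filtered_iff[of J U]\<close>)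
  then have "fmor T (ind_map M J X Y \<tau>) \<in> W" by (simp only: W_iff_dense)
  moreover have "isomorphic D (fmor T \<phi>) (fmor T (ind_map M J X Y \<tau>))"
    using i ff.arrow_iso_iff[OF \<phi> ind_map_colimit(1)[OF J n]] by simp
  ultimately show "fmor T \<phi> \<in> W" using retracts(1)[OF isomorphic_retract(1)] fmor_mor[OF T \<phi>] by blast
next
  assume f: "fmor T \<phi> \<in> W"
  obtain N where N: "N \<subseteq> WM" "small U N" "\<And>f. f \<in> W \<Longrightarrow> dense N f"
    using W_representatives by metis
  obtain E :: "('u, 'u) cat" and Z \<kappa> where E: "small_index U E" "is_functor E D Z" "is_colimit E D Z (fmor T \<phi>) \<kappa>"
    "\<And>e. e \<in> Ob E \<Longrightarrow> fob Z e \<in> N"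
    by (rule dense_colimit[OF N(3)[OF f] _ N(2)]) (use N(1) in blast)+
  let ?X = "comp_fctr (dom_fctr C) Z" and ?Y = "comp_fctr (cod_fctr C) Z"
  have ZM: "fob Z e \<in> WM" if "e \<in> Ob E" for e using E(4)[OF that] N(1) by blast
  have sf: "small_filtered E" using E(1) by (simp only: small_filtered_iff[of E U])
  have XY: "is_functor E M ?X" "is_functor E M ?Y"
    unfolding functor_M using functor_comp[OF E(2) functor_dom[OF C]] functor_comp[OF E(2) functor_cod[OF C]] ZM
    by (auto simp: M_simps)
  have n: "nat_trans E M ?X ?Y (fob Z)"
    unfolding nat_trans_def
  proof (intro conjI ballI XY)
    show "fob Z e \<in> Hom M (fob ?X e) (fob ?Y e)" if "e \<in> Ob E" for e
      using ZM[OF that] by (simp add: Hom_iff M_simps)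
    fix u assume u: "u \<in> Mor E"
    show "fob Z (Cod E u) \<cdot>\<^bsub>M\<^esub> fmor ?X u = fmor ?Y u \<cdot>\<^bsub>M\<^esub> fob Z (Dom E u)"
      by (rule arrow_fmor[OF E(2) u]) (simp add: M_simps)
  qed
  have L: "is_colimit E D Z (fmor T (ind_map M E ?X ?Y (fob Z)))
      (\<lambda>j. (fob Z j, fmor T (ind_map M E ?X ?Y (fob Z)), \<iota> (E, ?X) j, \<iota> (E, ?Y) j))"
    by (rule ind_map_arrow[OF sf n E(2)]) simp_all
  obtain \<theta> \<theta>' where t: "\<theta> \<in> Hom D (fmor T \<phi>) (fmor T (ind_map M E ?X ?Y (fob Z)))"
      "\<theta>' \<in> Hom D (fmor T (ind_map M E ?X ?Y (fob Z))) (fmor T \<phi>)"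
      "\<theta>' \<cdot>\<^bsub>D\<^esub> \<theta> = Idt D (fmor T \<phi>)" "\<theta> \<cdot>\<^bsub>D\<^esub> \<theta>' = Idt D (fmor T (ind_map M E ?X ?Y (fob Z)))"
    by (rule colimit_iso[OF D E(2) E(3) L])
  have "isomorphic D (fmor T \<phi>) (fmor T (ind_map M E ?X ?Y (fob Z)))"
    unfolding isomorphic_def using t(1) is_isoI[OF t] by blast
  then have "isomorphic (arrow_cat IM) \<phi> (ind_map M E ?X ?Y (fob Z))"
    unfolding ff.arrow_iso_iff[OF \<phi> ind_map_colimit(1)[OF sf n]] .
  then show "\<phi> \<in> Lw U M WM" unfolding Lw_def using \<phi> sf n ZM by blast
qed

text \<open>Lifting problems are transported by \<open>T\<close>, which sends the embedded maps of
  \<open>TM\<close> to isomorphic copies of themselves, and these maps detect the fibrations by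
  \<open>rlp_TM\<close>.\<close>

lemma ind_fib_iff:
  assumes \<phi>: "\<phi> \<in> Mor IM"
  shows "\<phi> \<in> ind_fib U M WM (Cof \<inter> Mor M) \<longleftrightarrow> fmor T \<phi> \<in> Fib"
proof -
  have T\<phi>: "fmor T \<phi> \<in> Mor C" using fmor_mor[OF T \<phi>] .
  have "has_lift IM (ind_embed U M c) \<phi> \<longleftrightarrow> has_lift C c (fmor T \<phi>)" if c: "c \<in> TM" for c
    unfolding ff.has_lift_iff[OF ind_embed_iso(1)[of c] \<phi>, OF IntD2[OF c]]
    using isomorphic_retract[OF ind_embed_iso(2)[OF IntD2[OF c]]] has_lift_retract_left[OF C _ _ T\<phi>] by blast
  then have "\<phi> \<in> ind_fib U M WM (Cof \<inter> Mor M) \<longleftrightarrow> fmor T \<phi> \<in> rlp C TM"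
    unfolding ind_fib_def rlp_def TM_eq using \<phi> T\<phi> by blast
  then show ?thesis unfolding rlp_TM .
qed

lemma ind_cof_iff:
  assumes \<phi>: "\<phi> \<in> Mor IM"
  shows "\<phi> \<in> ind_cof U M WM (Cof \<inter> Mor M) \<longleftrightarrow> fmor T \<phi> \<in> Cof"
proof -
  have T\<phi>: "fmor T \<phi> \<in> Mor C" using fmor_mor[OF T \<phi>] .
  have tf: "q \<in> ind_fib U M WM (Cof \<inter> Mor M) \<inter> Lw U M WM \<longleftrightarrow> q \<in> Mor IM \<and> fmor T q \<in> Fib \<inter> W" for q
    using ind_fib_iff[of q] Lw_iff[of q] unfolding Lw_def by blast
  have "\<phi> \<in> ind_cof U M WM (Cof \<inter> Mor M) \<longleftrightarrow> (\<forall>q. q \<in> Mor IM \<and> fmor T q \<in> Fib \<inter> W \<longrightarrow> has_lift IM \<phi> q)"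
    unfolding ind_cof_def llp_def tf[symmetric] using \<phi> by blast
  also have "\<dots> \<longleftrightarrow> fmor T \<phi> \<in> llp C (Fib \<inter> W)"
  proof
    assume l: "\<forall>q. q \<in> Mor IM \<and> fmor T q \<in> Fib \<inter> W \<longrightarrow> has_lift IM \<phi> q"
    \<comment> \<open>The trivial fibration \<open>p\<close> need not lie in the image of
      \<open>T\<close>; it is replaced by an isomorphic morphism that does, which is again a trivial
      fibration.\<close>
    have "has_lift C (fmor T \<phi>) p" if p: "p \<in> Fib \<inter> W" for p
    proof -
      have pm: "p \<in> Mor C" using p wide(1) by blast
      obtain q where q: "q \<in> Mor IM" "isomorphic D p (fmor T q)" by (rule ff.arrow_ess[OF pm])
      have "fmor T q \<in> Fib \<inter> W"
        using retracts(1,2)[OF isomorphic_retract(2)[OF q(2)]] p fmor_mor[OF T q(1)] by blast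
      then have "has_lift C (fmor T \<phi>) (fmor T q)" using l q(1) ff.has_lift_iff[OF \<phi> q(1)] by blast
      then show ?thesis by (rule has_lift_retract_right[OF C isomorphic_retract(1)[OF q(2)] _ T\<phi>])
    qed
    then show "fmor T \<phi> \<in> llp C (Fib \<inter> W)" using T\<phi> by (simp add: llp_def)
  next
    assume "fmor T \<phi> \<in> llp C (Fib \<inter> W)"
    then show "\<forall>q. q \<in> Mor IM \<and> fmor T q \<in> Fib \<inter> W \<longrightarrow> has_lift IM \<phi> q"
      using ff.has_lift_iff[OF \<phi>] by (simp add: llp_def)
  qed
  finally show ?thesis unfolding llp_tfib .
qed

text \<open>Membership in \<open>Lw\<close> is membership of the image in \<open>W\<close>, so two
  out of three is pulled back along the functor \<open>T\<close>.\<close>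

lemma admissible: "ind_admissible U M WM"
  unfolding ind_admissible_def two_out_of_three_def
proof (intro ballI impI)
  fix \<phi> \<psi> assume p: "\<phi> \<in> Mor IM" "\<psi> \<in> Mor IM" "Cod IM \<phi> = Dom IM \<psi>"
  have c: "\<psi> \<cdot>\<^bsub>IM\<^esub> \<phi> \<in> Mor IM" by (rule comp_mor[OF category_Ind p])
  have "fmor T \<phi> \<in> Mor C" "fmor T \<psi> \<in> Mor C" "Cod C (fmor T \<phi>) = Dom C (fmor T \<psi>)" using p T by simp_all
  then show "(\<phi> \<in> Lw U M WM \<and> \<psi> \<in> Lw U M WM \<longrightarrow> \<psi> \<cdot>\<^bsub>IM\<^esub> \<phi> \<in> Lw U M WM) \<and>
      (\<phi> \<in> Lw U M WM \<and> \<psi> \<cdot>\<^bsub>IM\<^esub> \<phi> \<in> Lw U M WM \<longrightarrow> \<psi> \<in> Lw U M WM) \<and>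
      (\<psi> \<in> Lw U M WM \<and> \<psi> \<cdot>\<^bsub>IM\<^esub> \<phi> \<in> Lw U M WM \<longrightarrow> \<phi> \<in> Lw U M WM)"
    using two_of_three unfolding Lw_iff[OF p(1)] Lw_iff[OF p(2)] Lw_iff[OF c] fmor_comp[OF T p] two_out_of_three_def by blast
qed

end

theorem theorem4p4:
  fixes U :: "'u itself"
    and C :: "('o, 'm) cat"
    and W Fib Cof :: "'m set"
    and M :: "('o, 'm) cat"
    and WM CM :: "'m set"
    and dbl cyl :: "'o \<Rightarrow> 'o"
    and k0 k1 i p :: "'o \<Rightarrow> 'm"
  assumes univ: "inaccessible_universe U"
    and model: "omega_combinatorial U C W Fib Cof"
    and left_proper: "left_proper C W Cof"
    and M: "M = fp_subcat U C"
    and WM: "WM = W \<inter> Mor M"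
    and CM: "CM = Cof \<inter> Mor M"
    and cylinder: "is_cylinder M WM CM dbl k0 k1 cyl i p"
    and finite_limits: "has_finite_limits M"
    and all_cofibrant: "\<forall>A \<in> Ob M. cofibrant C Cof A"
    and right_proper:
      "\<forall>A \<in> Ob M. \<forall>B \<in> Ob M. \<forall>f \<in> Hom M A B. \<forall>h k q.
         is_pushout M f (i A \<cdot>\<^bsub>M\<^esub> k0 A) h k \<and>
         q \<in> Hom M (Cod M h) B \<and> q \<cdot>\<^bsub>M\<^esub> h = Idt M B \<and> q \<cdot>\<^bsub>M\<^esub> k = f \<cdot>\<^bsub>M\<^esub> p A \<longrightarrow>
         right_proper_map M WM q"
  shows "weak_cofibration_category M WM CM \<and>
    ind_admissible U M WM \<and>
    (\<exists>T. is_colimit_functor U M C T) \<and>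
    (\<forall>T. is_colimit_functor U M C T \<longrightarrow>
       is_equivalence (Ind U M) C T \<and>
       (\<forall>\<phi> \<in> Mor (Ind U M).
          (\<phi> \<in> Lw U M WM \<longleftrightarrow> fmor T \<phi> \<in> W) \<and>
          (\<phi> \<in> ind_fib U M WM CM \<longleftrightarrow> fmor T \<phi> \<in> Fib) \<and>
          (\<phi> \<in> ind_cof U M WM CM \<longleftrightarrow> fmor T \<phi> \<in> Cof))) \<and>
    finitely_accessible U (full_subcat (arrow_cat C) W)"
proof -
  have mc: "model_category U C W Fib Cof" "locally_finitely_presentable U C"
    and gen: "fp_generated U C Cof" "fp_generated U C (Cof \<inter> W)"
    using model by (simp_all add: omega_combinatorial_def combinatorial_def)
  have cat: "category C" and cocomp: "cocomplete U C" and acc: "finitely_accessible U C"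
    using mc by (simp_all add: model_category_def locally_finitely_presentable_def)
  interpret L: lfp_category U C by unfold_locales (fact univ cat cocomp acc)+
  interpret O: omega_model U C W Fib Cof dbl cyl k0 k1 i p
    by unfold_locales (use mc(1) gen left_proper cylinder all_cofibrant in \<open>simp_all add: M WM CM L.M_simps\<close>)
  have ind: "induced_model U C W Fib Cof dbl cyl k0 k1 i p T \<iota>" if "colimit_functor U C T \<iota>" for T \<iota>
    using that O.omega_model_axioms by (simp add: induced_model_def)
  \<comment> \<open>Admissibility does not mention \<open>T\<close>, yet it is obtained through one;
    the existence of a natural functor is supplied separately.\<close>
  have each: "ind_admissible U M WM \<and> is_equivalence (Ind U M) C T \<and> (\<forall>\<phi> \<in> Mor (Ind U M).
      (\<phi> \<in> Lw U M WM \<longleftrightarrow> fmor T \<phi> \<in> W) \<and> (\<phi> \<in> ind_fib U M WM CM \<longleftrightarrow> fmor T \<phi> \<in> Fib) \<and>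
      (\<phi> \<in> ind_cof U M WM CM \<longleftrightarrow> fmor T \<phi> \<in> Cof))" if T: "is_colimit_functor U M C T" for T
  proof -
    obtain \<iota> where "colimit_functor U C T \<iota>" by (rule L.colimit_functorE[OF T[unfolded M]])
    then interpret I: induced_model U C W Fib Cof dbl cyl k0 k1 i p T \<iota> by (rule ind)
    show ?thesis unfolding WM CM M
      using I.admissible I.ff.equivalence I.Lw_iff I.ind_fib_iff I.ind_cof_iff by blast
  qed
  moreover obtain T where "is_colimit_functor U M C T" using L.natural_functor_ex unfolding M by blast
  moreover have "weak_cofibration_category M WM CM" using O.weak_cofibration unfolding WM CM M .
  ultimately show ?thesis using O.finitely_accessible_W by blast
qed

end
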